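(* Define $R(1)=1\otimes 1$ and $R(w_i)=\sum_{j=1}^n w_j\otimes t_{ji}$ for $i=1,\dots,n$. Then $R$ extends uniquely to a map $R\colon W\to W\widetilde\otimes\mathcal F_R(M(n))$ such that $W$, with $R$ as its right corepresentation, is a right $\mathfrak h$-comodule algebra for $\mathcal F_R(M(n))$.
   Context: Setting. Fix $n\ge 1$ and $q\in\mathbb C^\times$ not a root of unity, with a fixed choice of $\log q$ and $q^z=\exp(z\log q)$. Identify $\mathfrak h\cong\mathfrak h^*\cong\mathbb C^n$ with unit vectors $e_i$, and put $\omega(i)=e_i$. $M_{\mathfrak h^*}$ is the field of meromorphic functions on $\mathfrak h^*$ (in $\underline\lambda=(\lambda_1,\dots,\lambda_n)$), and $(T_\alpha f)(\lambda)=f(\lambda+\alpha)$. Put $h_0(z)=\frac{q^{-1}-q}{q^{-2z}-1}$, $g(z)=\frac{(q^{-2z}-q^{-2})(q^{-2z}-q^2)}{(q^{-2z}-1)^2}$, $h(z)=q-h_0(z)=q\frac{q^{-2z}-q^{-2}}{q^{-2z}-1}$. $\mathfrak h$-algebras and bialgebroids. An $\mathfrak h$-algebra is a unital associative $\mathbb C$-algebra $\mathcal A=\bigoplus_{\alpha,\beta\in\mathfrak h^*}\mathcal A_{\alpha\beta}$ (bigraded) with algebra embeddings $\mu_l,\mu_r\colon M_{\mathfrak h^*}\to\mathcal A_{00}$ such that $\mu_l(f)a=a\mu_l(T_\alpha f)$, $\mu_r(f)a=a\mu_r(T_\beta f)$ for $a\in\mathcal A_{\alpha\beta}$. Morphisms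 preserve bigrading and moment maps. $\mathcal A\widetilde\otimes\mathcal B$ has $(\mathcal A\widetilde\otimes\mathcal B)_{\alpha\beta}=\bigoplus_\gamma\mathcal A_{\alpha\gamma}\otimes_{M_{\mathfrak h^*}}\mathcal B_{\gamma\beta}$, modulo $\mu_r(f)a\otimes b=a\otimes\mu_l(f)b$, with product $(a\otimes b)(c\otimes d)=ac\otimes bd$ and moment maps $\mu_l(f)\otimes1$, $1\otimes\mu_r(f)$. $D_{\mathfrak h^*}$ is the $\mathfrak h$-algebra of difference operators $\sum_i f_iT_{\beta_i}$ on $M_{\mathfrak h^*}$, with $fT_{-\beta}\in(D_{\mathfrak h^*})_{\beta\beta}$ and both moment maps the natural embedding; $\mathcal A\cong\mathcal A\widetilde\otimes D_{\mathfrak h^*}\cong D_{\mathfrak h^*}\widetilde\otimes\mathcal A$ via $x\cong x\otimes T_{-\beta}\cong T_{-\alpha}\otimes x$ for $x\in\mathcal A_{\alpha\beta}$. An $\mathfrak h$-bialgebroid is an $\mathfrak h$-algebra with $\mathfrak h$-algebra homomorphisms $\Delta\colon\mathcal A\to\mathcal A\widetilde\otimes\mathcal A$, $\varepsilon\colon\mathcal A\to D_{\mathfrak h^*}$, coassociative and counital. The $\mathfrak h$-bialgebroid $\mathcal F_R(M(n))$. It is generated by $t_{ij}$ ($1\le i,j\le n$) and two commuting copies of $M_{\mathfrak h^*}$, written $f(\underline\lambda)=\mu_l(f)$ and $f(\underline\mu)=\mu_r(f)$, with relations $f(\underline\lambda)t_{ij}=t_{ij}f(\underline\lambda+\omega(i))$,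 $f(\underline\mu)t_{ij}=t_{ij}f(\underline\mu+\omega(j))$ and, for all $a,b,c,d$, the RLL-relations $\sum_{x,y}R^{xy}_{ac}(\underline\lambda)t_{xb}t_{yd}=\sum_{x,y}R^{bd}_{xy}(\underline\mu)t_{cy}t_{ax}$. The nonzero $R$-entries are $R^{aa}_{aa}=q$; $R^{ab}_{ab}(\underline\lambda)=1$ if $a<b$ and $g(\lambda_a-\lambda_b)$ if $a>b$; $R^{ab}_{ba}(\underline\lambda)=h_0(\lambda_a-\lambda_b)$ if $a\ne b$. Moreover $t_{ij}$ has bidegree $(\omega(i),\omega(j))$, $f(\underline\lambda),f(\underline\mu)$ have bidegree $(0,0)$, $\Delta(t_{ij})=\sum_kt_{ik}\otimes t_{kj}$, $\varepsilon(t_{ij})=\delta_{ij}T_{-\omega(i)}$, $\Delta(f(\underline\lambda))=f(\underline\lambda)\otimes1$, $\Delta(f(\underline\mu))=1\otimes f(\underline\mu)$, $\varepsilon(f(\underline\lambda))=\varepsilon(f(\underline\mu))=f$. Corepresentations. An $\mathfrak h$-space is an $M_{\mathfrak h^*}$-vector space $V=\bigoplus_{\alpha\in\mathfrak h^*} V_\alpha$ with $M_{\mathfrak h^*}V_\alpha\subseteq V_\alpha$; write $fv=\mu_V(f)v$. Morphisms are grade preserving $M_{\mathfrak h^*}$-linear maps. $V\widetilde\otimes\mathcal A=\bigoplus_{\alpha,\beta}V_\alpha\otimes_{M_{\mathfrak h^*}}\mathcal A_{\alpha\beta}$ modulo $v\otimes\mu_l(f)a=fv\otimes a$, with $V_\alpha\otimes\mathcal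 A_{\alpha\beta}$ in degree $\beta$ and $f(v\otimes a)=v\otimes\mu_r(f)a$. A right corepresentation of $\mathcal A$ on $V$ is a morphism of $\mathfrak h$-spaces $\rho\colon V\to V\widetilde\otimes\mathcal A$ with $(\mathrm{Id}\otimes\Delta)\rho=(\rho\otimes\mathrm{Id})\rho$ and $(\mathrm{Id}\otimes\varepsilon)\rho=\mathrm{Id}$, using $V\cong V\widetilde\otimes D_{\mathfrak h^*}$, $v\otimes fT_{-\alpha}\cong fv$ for $v\in V_\alpha$. $V$ is a right $\mathfrak h$-comodule algebra for $\mathcal A$ if there is a right corepresentation $R\colon V\to V\widetilde\otimes\mathcal A$ such that (i) $V$ is an associative algebra with $\mu_V(f)vw=v\mu_V(T_\alpha f)w$ for $v\in V_\alpha$, $w\in V$, and $V_\alpha V_\beta\subset V_{\alpha+\beta}$; (ii) $R$ is an algebra homomorphism, where $(v\otimes a)(w\otimes b)=vw\otimes ab$; if $V$ is unital, $R$ is required to be unital. The algebra $W$. $W$ is the unital associative algebra generated by $w_1,\dots,w_n$ and a copy of $M_{\mathfrak h^*}$ (elements $f(\underline\lambda)$), with relations $w_i^2=0$ for all $i$, $w_jw_i=-h(\lambda_j-\lambda_i)w_iw_j$ for $i<j$, and $f(\underline\lambda)w_i=w_if(\underline\lambda+\omega(i))$. It is an $\mathfrak h$-space with $\mu_W(f)=f(\underline\lambda)$ acting by left multiplication and $w_{i_1}\cdots w_{i_r}\in W_{\omega(i_1)+\dots+\omega(i_r)}$. *)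

theory Defs
  imports "HOL-Complex_Analysis.Complex_Analysis" "HOL-Algebra.QuotRing" "HOL-Algebra.Module"
    "HOL-Algebra.Free_Abelian_Groups"
begin

section \<open>The field of meromorphic functions on \<open>\<complex>\<^sup>n\<close>\<close>

text \<open>Only used on open sets: complex differentiability is Frechet differentiability with a
  complex-linear derivative.\<close>

definition holomorphic_n :: "(complex^'n \<Rightarrow> complex) \<Rightarrow> (complex^'n) set \<Rightarrow> bool" where
  "holomorphic_n f S \<longleftrightarrow>
     (\<forall>z\<in>S. \<exists>D. (f has_derivative D) (at z) \<and> (\<forall>c v. D (c *s v) = c * D v))"

text \<open>
  A meromorphic function is locally a quotient \<open>g / h\<close> of holomorphic functions whose denominator
  vanishes identically on no nonempty open set.  It is represented by a total function with arbitrary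
  values where no local denominator is nonzero; functions agreeing on an open dense set are identified.
\<close>

definition meromorphic_n :: "(complex^'n \<Rightarrow> complex) \<Rightarrow> bool" where
  "meromorphic_n f \<longleftrightarrow>
     (\<forall>p. \<exists>N g h. open N \<and> p \<in> N \<and> holomorphic_n g N \<and> holomorphic_n h N \<and>
        (\<forall>U. open U \<and> U \<noteq> {} \<and> U \<subseteq> N \<longrightarrow> (\<exists>z\<in>U. h z \<noteq> 0)) \<and>
        (\<forall>z\<in>N. h z \<noteq> 0 \<longrightarrow> f z = g z / h z))"

definition mero_eq :: "(complex^'n \<Rightarrow> complex) \<Rightarrow> (complex^'n \<Rightarrow> complex) \<Rightarrow> bool" where
  "mero_eq f f' \<longleftrightarrow> meromorphic_n f \<and> meromorphic_n f' \<and>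
     (\<exists>U. open U \<and> closure U = UNIV \<and> (\<forall>z\<in>U. f z = f' z))"

subsection \<open>Closure properties\<close>

lemma holomorphic_n_subset: "holomorphic_n f S \<Longrightarrow> T \<subseteq> S \<Longrightarrow> holomorphic_n f T"
  unfolding holomorphic_n_def by blast

lemma holomorphic_n_const: "holomorphic_n (\<lambda>_. c) S"
  unfolding holomorphic_n_def
  by (intro ballI exI[of _ "\<lambda>_. 0"]) auto

lemma holomorphic_n_component: "holomorphic_n (\<lambda>z. z $ i) S"
  unfolding holomorphic_n_def
  by (intro ballI exI[of _ "\<lambda>v. v $ i"])
     (auto intro!: bounded_linear_imp_has_derivative bounded_linear_vec_nth)

lemma holomorphic_n_add:
  assumes "holomorphic_n f S" "holomorphic_n g S"
  shows "holomorphic_n (\<lambda>z. f z + g z) S"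
  unfolding holomorphic_n_def
proof
  fix z assume "z \<in> S"
  then obtain D E where
    "(f has_derivative D) (at z)" "\<forall>c v. D (c *s v) = c * D v"
    "(g has_derivative E) (at z)" "\<forall>c v. E (c *s v) = c * E v"
    using assms unfolding holomorphic_n_def by blast
  then show "\<exists>D. ((\<lambda>z. f z + g z) has_derivative D) (at z) \<and> (\<forall>c v. D (c *s v) = c * D v)"
    by (intro exI[of _ "\<lambda>v. D v + E v"]) (auto intro!: derivative_eq_intros simp: algebra_simps)
qed

lemma holomorphic_n_mult:
  assumes "holomorphic_n f S" "holomorphic_n g S"
  shows "holomorphic_n (\<lambda>z. f z * g z) S"
  unfolding holomorphic_n_def
proof
  fix z assume "z \<in> S"
  then obtain D E where
    "(f has_derivative D) (at z)" "\<forall>c v. D (c *s v) = c * D v"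
    "(g has_derivative E) (at z)" "\<forall>c v. E (c *s v) = c * E v"
    using assms unfolding holomorphic_n_def by blast
  then show "\<exists>D. ((\<lambda>z. f z * g z) has_derivative D) (at z) \<and> (\<forall>c v. D (c *s v) = c * D v)"
    by (intro exI[of _ "\<lambda>v. f z * E v + D v * g z"])
       (auto intro!: derivative_eq_intros simp: algebra_simps)
qed

lemma holomorphic_n_compose:
  assumes "holomorphic_n f S" "\<And>w. (g has_field_derivative g' w) (at w)"
  shows "holomorphic_n (\<lambda>z. g (f z)) S"
  unfolding holomorphic_n_def
proof
  fix z assume "z \<in> S"
  then obtain D where D: "(f has_derivative D) (at z)" "\<forall>c v. D (c *s v) = c * D v"
    using assms unfolding holomorphic_n_def by blast
  have "((\<lambda>z. g (f z)) has_derivative (\<lambda>v. g' (f z) * D v)) (at z)"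
    using has_derivative_compose[OF D(1), of g "(*) (g' (f z))"] assms(2)
    by (simp add: has_field_derivative_def)
  with D(2) show "\<exists>D. ((\<lambda>z. g (f z)) has_derivative D) (at z) \<and> (\<forall>c v. D (c *s v) = c * D v)"
    by (intro exI[of _ "\<lambda>v. g' (f z) * D v"]) (auto simp: algebra_simps)
qed

lemma holomorphic_n_translate:
  assumes "holomorphic_n f S"
  shows "holomorphic_n (\<lambda>z. f (z + a)) ((\<lambda>z. z + a) -` S)"
  unfolding holomorphic_n_def
proof
  fix z assume "z \<in> (\<lambda>z. z + a) -` S"
  then obtain D where D: "(f has_derivative D) (at (z + a))" "\<forall>c v. D (c *s v) = c * D v"
    using assms unfolding holomorphic_n_def by blast
  have "((\<lambda>z. f (z + a)) has_derivative D) (at z)"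
    by (rule has_derivative_compose[of "\<lambda>z. z + a" "\<lambda>v. v" z UNIV f D, OF _ D(1)])
       (auto intro!: derivative_eq_intros)
  with D(2) show "\<exists>D. ((\<lambda>z. f (z + a)) has_derivative D) (at z) \<and> (\<forall>c v. D (c *s v) = c * D v)"
    by blast
qed

lemma holomorphic_n_continuous: "holomorphic_n f S \<Longrightarrow> continuous_on S f"
  unfolding holomorphic_n_def
  by (rule continuous_at_imp_continuous_on) (blast intro: has_derivative_continuous)

lemma open_nonzero:
  assumes "holomorphic_n h N" "open N" "open U" "U \<subseteq> N"
  shows "open {z \<in> U. h z \<noteq> 0}"
proof -
  have "continuous_on U h"
    using assms holomorphic_n_continuous continuous_on_subset by blast
  then have "open (h -` (- {0}) \<inter> U)"
    by (intro continuous_open_preimage[OF _ \<open>open U\<close>, of h "- {0}", unfolded Int_commute[of U]])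
       auto
  moreover have "h -` (- {0}) \<inter> U = {z \<in> U. h z \<noteq> 0}" by auto
  ultimately show ?thesis by simp
qed

lemma nonvanish_mult:
  assumes "holomorphic_n h N" "open N"
    and "\<forall>U. open U \<and> U \<noteq> {} \<and> U \<subseteq> N \<longrightarrow> (\<exists>z\<in>U. h z \<noteq> 0)"
    and "\<forall>U. open U \<and> U \<noteq> {} \<and> U \<subseteq> N \<longrightarrow> (\<exists>z\<in>U. k z \<noteq> 0)"
  shows "\<forall>U. open U \<and> U \<noteq> {} \<and> U \<subseteq> N \<longrightarrow> (\<exists>z\<in>U. h z * k z \<noteq> (0::complex))"
proof (intro allI impI)
  fix U assume U: "open U \<and> U \<noteq> {} \<and> U \<subseteq> N"
  let ?V = "{z \<in> U. h z \<noteq> 0}"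
  have "open ?V" using open_nonzero[of h N U] assms(1,2) U by blast
  moreover have "?V \<noteq> {}" using assms(3) U by blast
  moreover have "?V \<subseteq> N" using U by blast
  ultimately show "\<exists>z\<in>U. h z * k z \<noteq> 0"
    using assms(4)[rule_format, of ?V] by auto
qed

lemma meromorphic_n_local:
  assumes "meromorphic_n f"
  obtains r g h where "r > 0" "holomorphic_n g (ball p r)" "holomorphic_n h (ball p r)"
    "\<forall>U. open U \<and> U \<noteq> {} \<and> U \<subseteq> ball p r \<longrightarrow> (\<exists>z\<in>U. h z \<noteq> 0)"
    "\<forall>z\<in>ball p r. h z \<noteq> 0 \<longrightarrow> f z = g z / h z"
proof -
  obtain N g h where *: "open N" "p \<in> N" "holomorphic_n g N" "holomorphic_n h N"
        "\<forall>U. open U \<and> U \<noteq> {} \<and> U \<subseteq> N \<longrightarrow> (\<exists>z\<in>U. h z \<noteq> 0)"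
        "\<forall>z\<in>N. h z \<noteq> 0 \<longrightarrow> f z = g z / h z"
    using spec[OF assms[unfolded meromorphic_n_def], of p] by (elim exE conjE) (rule that)
  obtain r where r: "r > 0" "ball p r \<subseteq> N"
    using openE[OF *(1,2)] by blast
  show ?thesis
  proof (rule that[OF r(1)])
    show "holomorphic_n g (ball p r)" "holomorphic_n h (ball p r)"
      by (rule holomorphic_n_subset[OF *(3) r(2)], rule holomorphic_n_subset[OF *(4) r(2)])
    show "\<forall>U. open U \<and> U \<noteq> {} \<and> U \<subseteq> ball p r \<longrightarrow> (\<exists>z\<in>U. h z \<noteq> 0)"
      using *(5) r(2) by (meson order_trans)
    show "\<forall>z\<in>ball p r. h z \<noteq> 0 \<longrightarrow> f z = g z / h z" using *(6) r by blast
  qed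
qed

lemma meromorphic_n_binary:
  fixes f f' :: "complex^'n \<Rightarrow> complex"
  assumes f: "meromorphic_n f" and g: "meromorphic_n f'"
    and num: "\<And>(N :: (complex^'n) set) (g :: complex^'n \<Rightarrow> complex) h g' h'. holomorphic_n g N \<Longrightarrow> holomorphic_n h N \<Longrightarrow>
        holomorphic_n g' N \<Longrightarrow> holomorphic_n h' N \<Longrightarrow>
        holomorphic_n (\<lambda>z. F (g z) (h z) (g' z) (h' z)) N"
    and val: "\<And>a b a' b'. b \<noteq> 0 \<Longrightarrow> b' \<noteq> 0 \<Longrightarrow> G (a / b) (a' / b') = F a b a' b' / (b * b')"
  shows "meromorphic_n (\<lambda>z. G (f z) (f' z))"
  unfolding meromorphic_n_def
proof
  fix p
  obtain r g h where 1: "r > 0" "holomorphic_n g (ball p r)" "holomorphic_n h (ball p r)"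
    "\<forall>U. open U \<and> U \<noteq> {} \<and> U \<subseteq> ball p r \<longrightarrow> (\<exists>z\<in>U. h z \<noteq> 0)"
    "\<forall>z\<in>ball p r. h z \<noteq> 0 \<longrightarrow> f z = g z / h z"
    using meromorphic_n_local[OF f] .
  obtain r' g' h' where 2: "r' > 0" "holomorphic_n g' (ball p r')" "holomorphic_n h' (ball p r')"
    "\<forall>U. open U \<and> U \<noteq> {} \<and> U \<subseteq> ball p r' \<longrightarrow> (\<exists>z\<in>U. h' z \<noteq> 0)"
    "\<forall>z\<in>ball p r'. h' z \<noteq> 0 \<longrightarrow> f' z = g' z / h' z"
    using meromorphic_n_local[OF g] .
  define N where "N = ball p (min r r')"
  have N: "open N" "p \<in> N" "N \<subseteq> ball p r" "N \<subseteq> ball p r'"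
    using 1(1) 2(1) by (simp_all add: N_def subset_ball)
  have h: "holomorphic_n g N" "holomorphic_n h N" "holomorphic_n g' N" "holomorphic_n h' N"
    using N(3,4) 1(2,3) 2(2,3) by (auto elim: holomorphic_n_subset)
  have nv: "\<forall>U. open U \<and> U \<noteq> {} \<and> U \<subseteq> N \<longrightarrow> (\<exists>z\<in>U. h z * h' z \<noteq> 0)"
    using 1(4) 2(4) N(3,4) by (intro nonvanish_mult[OF h(2) N(1)]) (meson order_trans)+
  have "\<forall>z\<in>N. h z * h' z \<noteq> 0 \<longrightarrow> G (f z) (f' z) = F (g z) (h z) (g' z) (h' z) / (h z * h' z)"
    using 1(5) 2(5) N(3,4) val by (auto simp: subset_iff)
  then show "\<exists>N g h. open N \<and> p \<in> N \<and> holomorphic_n g N \<and> holomorphic_n h N \<and>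
        (\<forall>U. open U \<and> U \<noteq> {} \<and> U \<subseteq> N \<longrightarrow> (\<exists>z\<in>U. h z \<noteq> 0)) \<and>
        (\<forall>z\<in>N. h z \<noteq> 0 \<longrightarrow> G (f z) (f' z) = g z / h z)"
    using N(1,2) num[OF h] holomorphic_n_mult[OF h(2,4)] nv
    by (intro exI[of _ N] exI[of _ "\<lambda>z. F (g z) (h z) (g' z) (h' z)"]
          exI[of _ "\<lambda>z. h z * h' z"] conjI)
qed

lemma meromorphic_n_holomorphic: "holomorphic_n f UNIV \<Longrightarrow> meromorphic_n f"
  unfolding meromorphic_n_def
  by (intro allI exI[of _ UNIV] exI[of _ f] exI[of _ "\<lambda>_. 1"]) (auto intro: holomorphic_n_const)

lemma meromorphic_n_const: "meromorphic_n (\<lambda>_. c)"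
  by (intro meromorphic_n_holomorphic holomorphic_n_const)

lemma meromorphic_n_add:
  "meromorphic_n f \<Longrightarrow> meromorphic_n g \<Longrightarrow> meromorphic_n (\<lambda>z. f z + g z)"
  by (rule meromorphic_n_binary[of f g "\<lambda>a b a' b'. a * b' + a' * b" "(+)"])
     (auto intro!: holomorphic_n_add holomorphic_n_mult simp: field_simps)

lemma meromorphic_n_mult:
  "meromorphic_n f \<Longrightarrow> meromorphic_n g \<Longrightarrow> meromorphic_n (\<lambda>z. f z * g z)"
  by (rule meromorphic_n_binary[of f g "\<lambda>a b a' b'. a * a'" "(*)"])
     (auto intro!: holomorphic_n_mult simp: field_simps)

lemma meromorphic_n_minus: "meromorphic_n f \<Longrightarrow> meromorphic_n (\<lambda>z. - f z)"
  by (drule meromorphic_n_mult[OF meromorphic_n_const[of "-1"]]) (simp only: mult_minus1)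

lemma meromorphic_n_diff:
  "meromorphic_n f \<Longrightarrow> meromorphic_n g \<Longrightarrow> meromorphic_n (\<lambda>z. f z - g z)"
  unfolding diff_conv_add_uminus by (rule meromorphic_n_add, assumption, erule meromorphic_n_minus)

lemma meromorphic_n_translate:
  assumes "meromorphic_n f"
  shows "meromorphic_n (\<lambda>z. f (z + a))"
  unfolding meromorphic_n_def
proof
  fix p
  obtain N g h where *: "open N" "p + a \<in> N" "holomorphic_n g N" "holomorphic_n h N"
        "\<forall>U. open U \<and> U \<noteq> {} \<and> U \<subseteq> N \<longrightarrow> (\<exists>z\<in>U. h z \<noteq> 0)"
        "\<forall>z\<in>N. h z \<noteq> 0 \<longrightarrow> f z = g z / h z"
    using spec[OF assms[unfolded meromorphic_n_def], of "p + a"] by (elim exE conjE) (rule that)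
  let ?N = "(\<lambda>z. z + a) -` N"
  have "open ?N" by (intro open_vimage *(1) continuous_intros)
  moreover have "\<exists>z\<in>U. h (z + a) \<noteq> 0" if U: "open U" "U \<noteq> {}" "U \<subseteq> ?N" for U
  proof -
    have "(\<lambda>z. z + a) ` U = (\<lambda>z. z - a) -` U" by force
    then have "open ((\<lambda>z. z + a) ` U)"
      using U(1) by (auto intro!: open_vimage continuous_intros)
    moreover have "(\<lambda>z. z + a) ` U \<noteq> {}" "(\<lambda>z. z + a) ` U \<subseteq> N" using U by auto
    ultimately show ?thesis using *(5) by blast
  qed
  ultimately show "\<exists>N g h. open N \<and> p \<in> N \<and> holomorphic_n g N \<and> holomorphic_n h N \<and>
        (\<forall>U. open U \<and> U \<noteq> {} \<and> U \<subseteq> N \<longrightarrow> (\<exists>z\<in>U. h z \<noteq> 0)) \<and>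
        (\<forall>z\<in>N. h z \<noteq> 0 \<longrightarrow> f (z + a) = g z / h z)"
    using * by (intro exI[of _ ?N] exI[of _ "\<lambda>z. g (z + a)"] exI[of _ "\<lambda>z. h (z + a)"])
      (auto intro!: holomorphic_n_translate)
qed

subsection \<open>Identity theorem\<close>

lemma holomorphic_n_identity:
  assumes g: "holomorphic_n g (ball p r)" and U: "open U" "U \<noteq> {}" "U \<subseteq> ball p r"
    and zero: "\<And>z. z \<in> U \<Longrightarrow> g z = 0" and w: "w \<in> ball p r"
  shows "g w = 0"
proof -
  obtain u where u: "u \<in> U" using U by auto
  define l where "l = (\<lambda>t::complex. u + t *s (w - u))"
  define S where "S = l -` ball p r"
  define D0 where "D0 = (\<lambda>s::complex. s *s (w - u))"
  have lin: "bounded_linear D0"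
    unfolding D0_def linear_conv_bounded_linear[symmetric]
    by (intro linearI) (auto simp: vec_eq_iff algebra_simps)
  have dl: "(l has_derivative D0) (at t)" for t
  proof -
    have "l = (\<lambda>t. u + D0 t)" by (simp add: l_def D0_def)
    then show ?thesis
      using has_derivative_add[OF has_derivative_const bounded_linear_imp_has_derivative[OF lin]]
      by simp
  qed
  have contl: "continuous_on UNIV l"
    by (intro continuous_at_imp_continuous_on ballI has_derivative_continuous[OF dl])
  have openS: "open S" unfolding S_def using contl by (intro open_vimage) auto
  have "S = D0 -` ball (p - u) r"
    by (auto simp: S_def l_def D0_def dist_norm algebra_simps)
  then have "convex S"
    using convex_linear_vimage[OF bounded_linear.linear[OF lin] convex_ball] by simp
  then have conn: "connected S" by (rule convex_connected)
  have hol: "(\<lambda>t. g (l t)) holomorphic_on S"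
    unfolding holomorphic_on_open[OF openS]
  proof
    fix t assume "t \<in> S"
    then obtain D where D: "(g has_derivative D) (at (l t))" "\<forall>c v. D (c *s v) = c * D v"
      using g unfolding holomorphic_n_def S_def by blast
    have "((\<lambda>t. g (l t)) has_derivative (\<lambda>s. D (D0 s))) (at t)"
      by (rule has_derivative_compose[OF dl D(1)])
    also have "(\<lambda>s. D (D0 s)) = (*) (D (w - u))"
    proof
      fix s show "D (D0 s) = D (w - u) * s"
        unfolding D0_def D(2)[rule_format] by (rule mult.commute)
    qed
    finally show "\<exists>f'. ((\<lambda>t. g (l t)) has_field_derivative f') (at t)"
      by (auto simp: has_field_derivative_def)
  qed
  have "g (l 1) = 0"
  proof (rule analytic_continuation_open[of "l -` U" S "\<lambda>t. g (l t)" "\<lambda>_. 0"])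
    show "open (l -` U)" using contl U(1) by (intro open_vimage) auto
    have "l 0 = u" by (simp add: l_def)
    then show "l -` U \<noteq> {}" using u by auto
    show "l -` U \<subseteq> S" using U(3) by (auto simp: S_def)
    show "1 \<in> S" using w by (simp add: S_def l_def)
  qed (use openS conn hol zero in auto)
  then show ?thesis by (simp add: l_def)
qed

lemma meromorphic_n_inverse:
  assumes "meromorphic_n f"
  shows "meromorphic_n (\<lambda>z. inverse (f z))"
  unfolding meromorphic_n_def
proof
  fix p
  obtain r g h where *: "r > 0" "holomorphic_n g (ball p r)" "holomorphic_n h (ball p r)"
    "\<forall>U. open U \<and> U \<noteq> {} \<and> U \<subseteq> ball p r \<longrightarrow> (\<exists>z\<in>U. h z \<noteq> 0)"
    "\<forall>z\<in>ball p r. h z \<noteq> 0 \<longrightarrow> f z = g z / h z"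
    using meromorphic_n_local[OF assms] .
  show "\<exists>N g h. open N \<and> p \<in> N \<and> holomorphic_n g N \<and> holomorphic_n h N \<and>
        (\<forall>U. open U \<and> U \<noteq> {} \<and> U \<subseteq> N \<longrightarrow> (\<exists>z\<in>U. h z \<noteq> 0)) \<and>
        (\<forall>z\<in>N. h z \<noteq> 0 \<longrightarrow> inverse (f z) = g z / h z)"
  proof (cases "\<exists>U. open U \<and> U \<noteq> {} \<and> U \<subseteq> ball p r \<and> (\<forall>z\<in>U. g z = 0)")
    case True
    then have "g z = 0" if "z \<in> ball p r" for z
      using holomorphic_n_identity[OF *(2)] that by blast
    then show ?thesis using *
      by (intro exI[of _ "ball p r"] exI[of _ "\<lambda>_. 0"] exI[of _ h])
         (auto intro: holomorphic_n_const)
  next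
    case False
    then have nv: "\<forall>U. open U \<and> U \<noteq> {} \<and> U \<subseteq> ball p r \<longrightarrow> (\<exists>z\<in>U. g z \<noteq> 0)" by blast
    have "\<forall>U. open U \<and> U \<noteq> {} \<and> U \<subseteq> ball p r \<longrightarrow> (\<exists>z\<in>U. h z * g z \<noteq> 0)"
      by (rule nonvanish_mult[OF *(3) open_ball *(4) nv])
    then show ?thesis using * holomorphic_n_mult[OF *(3,3)] holomorphic_n_mult[OF *(3,2)]
      by (intro exI[of _ "ball p r"] exI[of _ "\<lambda>z. h z * h z"] exI[of _ "\<lambda>z. h z * g z"]) auto
  qed
qed

lemma meromorphic_n_divide:
  "meromorphic_n f \<Longrightarrow> meromorphic_n g \<Longrightarrow> meromorphic_n (\<lambda>z. f z / g z)"
  unfolding divide_inverse by (intro meromorphic_n_mult meromorphic_n_inverse)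

lemmas meromorphic_intros = meromorphic_n_const meromorphic_n_add meromorphic_n_mult
  meromorphic_n_minus meromorphic_n_diff meromorphic_n_inverse meromorphic_n_divide

lemma dense_Int_open:
  fixes U V :: "'a::topological_space set"
  assumes "open U" "closure U = UNIV" "open V" "closure V = UNIV"
  shows "open (U \<inter> V)" "closure (U \<inter> V) = UNIV"
proof -
  show "open (U \<inter> V)" using assms by auto
  have "closure U \<subseteq> closure (U \<inter> V)"
    using open_Int_closure_subset[OF assms(1), of V] assms(4)
    by (intro closure_minimal) auto
  then show "closure (U \<inter> V) = UNIV" using assms by auto
qed

lemma dense_iff: "closure U = UNIV \<longleftrightarrow> (\<forall>V. open V \<and> V \<noteq> {} \<longrightarrow> V \<inter> U \<noteq> {})"
  for U :: "'a::topological_space set"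
proof
  assume "closure U = UNIV"
  then show "\<forall>V. open V \<and> V \<noteq> {} \<longrightarrow> V \<inter> U \<noteq> {}"
    by (metis Int_UNIV_right open_Int_closure_eq_empty)
next
  assume *: "\<forall>V. open V \<and> V \<noteq> {} \<longrightarrow> V \<inter> U \<noteq> {}"
  have "- closure U \<inter> U = {}" using closure_subset by blast
  with *[rule_format, of "- closure U"] show "closure U = UNIV" by auto
qed

text \<open>A meromorphic function that is zero on some nonempty open set is zero on an open
  dense set.\<close>

lemma meromorphic_n_zero:
  assumes f: "meromorphic_n f" and V: "open V" "V \<noteq> {}" "\<forall>z\<in>V. f z = 0"
  shows "\<exists>U. open U \<and> closure U = UNIV \<and> (\<forall>z\<in>U. f z = 0)"
proof -
  define Z where "Z = interior (closure (interior {z. f z = 0}))"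
  have cl: "x \<in> Z" if x: "x \<in> closure Z" for x
  proof -
    obtain r g h where *: "r > 0" "holomorphic_n g (ball x r)" "holomorphic_n h (ball x r)"
      "\<forall>U. open U \<and> U \<noteq> {} \<and> U \<subseteq> ball x r \<longrightarrow> (\<exists>z\<in>U. h z \<noteq> 0)"
      "\<forall>z\<in>ball x r. h z \<noteq> 0 \<longrightarrow> f z = g z / h z"
      using meromorphic_n_local[OF f] .
    have "x \<in> closure (interior {z. f z = 0})"
      using x unfolding Z_def by (metis closure_closure closure_mono interior_subset subsetD)
    then have "ball x r \<inter> interior {z. f z = 0} \<noteq> {}"
      using \<open>r > 0\<close> by (metis Int_iff centre_in_ball empty_iff open_Int_closure_eq_empty open_ball)
    moreover define O1 where "O1 = ball x r \<inter> interior {z. f z = 0}"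
    ultimately have O1: "open O1" "O1 \<noteq> {}" "O1 \<subseteq> ball x r" "\<forall>z\<in>O1. f z = 0"
      using interior_subset by auto
    define O2 where "O2 = {z \<in> O1. h z \<noteq> 0}"
    have O2: "open O2" "O2 \<noteq> {}" "O2 \<subseteq> ball x r"
      using open_nonzero[OF *(3) open_ball O1(1,3)] *(4)[rule_format, of O1] O1
      by (auto simp: O2_def)
    have "g z = 0" if "z \<in> O2" for z
      using that O1(3,4) *(5) by (force simp: O2_def)
    then have g0: "g z = 0" if "z \<in> ball x r" for z
      using holomorphic_n_identity[OF *(2) O2] that by blast
    define O3 where "O3 = {z \<in> ball x r. h z \<noteq> 0}"
    have O3: "open O3" using open_nonzero[OF *(3) open_ball open_ball order_refl] by (simp add: O3_def)
    moreover have "O3 \<subseteq> {z. f z = 0}" using *(5) g0 by (auto simp: O3_def)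
    ultimately have O3i: "O3 \<subseteq> interior {z. f z = 0}" by (rule interior_maximal[rotated])
    have "ball x r \<subseteq> closure O3"
    proof
      fix y assume y: "y \<in> ball x r"
      show "y \<in> closure O3"
      proof (rule ccontr)
        assume "y \<notin> closure O3"
        then have "open (ball x r - closure O3)" "ball x r - closure O3 \<noteq> {}"
          using y by (auto intro!: open_Diff)
        then have "\<exists>z\<in>ball x r - closure O3. h z \<noteq> 0"
          using *(4) by blast
        then show False using closure_subset[of O3] by (auto simp: O3_def)
      qed
    qed
    also have "\<dots> \<subseteq> closure (interior {z. f z = 0})" using O3i by (rule closure_mono)
    finally show "x \<in> Z"
      unfolding Z_def using \<open>r > 0\<close> by (meson centre_in_ball interiorI open_ball)
  qed
  have "closed Z" using cl closure_subset by (metis closure_eq subsetI subset_antisym)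
  moreover have "open Z" by (simp add: Z_def)
  moreover have "Z \<noteq> {}"
  proof -
    have "V \<subseteq> interior {z. f z = 0}" using V by (intro interior_maximal) auto
    then have "V \<subseteq> Z"
      unfolding Z_def using V(1) closure_subset by (intro interior_maximal) blast+
    then show ?thesis using V by auto
  qed
  ultimately have "Z = UNIV" using clopen by blast
  then have "closure (interior {z. f z = 0}) = UNIV"
    unfolding Z_def using interior_subset by blast
  then show ?thesis using interior_subset by (intro exI[of _ "interior {z. f z = 0}"]) auto
qed

lemma meromorphic_n_nonzero:
  assumes f: "meromorphic_n f" and nz: "\<not> mero_eq f (\<lambda>_. 0)"
  shows "\<exists>U. open U \<and> closure U = UNIV \<and> (\<forall>z\<in>U. f z \<noteq> 0)"
proof -
  define U where "U = interior {z. f z \<noteq> 0}"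
  have "V \<inter> U \<noteq> {}" if V: "open V" "V \<noteq> {}" for V
  proof -
    obtain p where "p \<in> V" using V by auto
    obtain r g h where *: "r > 0" "holomorphic_n g (ball p r)" "holomorphic_n h (ball p r)"
      "\<forall>U. open U \<and> U \<noteq> {} \<and> U \<subseteq> ball p r \<longrightarrow> (\<exists>z\<in>U. h z \<noteq> 0)"
      "\<forall>z\<in>ball p r. h z \<noteq> 0 \<longrightarrow> f z = g z / h z"
      using meromorphic_n_local[OF f] .
    define O1 where "O1 = {z \<in> V \<inter> ball p r. h z \<noteq> 0}"
    have "V \<inter> ball p r \<noteq> {}" using * \<open>p \<in> V\<close> by auto
    then have O1: "open O1" "O1 \<noteq> {}" "O1 \<subseteq> ball p r" "O1 \<subseteq> V"
      using open_nonzero[OF *(3) open_ball, of "V \<inter> ball p r"] V *(4)[rule_format, of "V \<inter> ball p r"]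
      by (auto simp: O1_def open_Int)
    have O1f: "f z = g z / h z" "h z \<noteq> 0" if "z \<in> O1" for z using that *(5) by (auto simp: O1_def)
    have "\<not> (\<forall>z\<in>O1. f z = 0)"
      using meromorphic_n_zero[OF f O1(1,2)] nz f meromorphic_n_const[of 0]
      unfolding mero_eq_def by blast
    then have O2: "{z \<in> O1. g z \<noteq> 0} \<noteq> {}" using O1f by force
    moreover have "open {z \<in> O1. g z \<noteq> 0}"
      by (rule open_nonzero[OF *(2) open_ball O1(1,3)])
    then have "{z \<in> O1. g z \<noteq> 0} \<subseteq> U"
      unfolding U_def using O1f by (intro interior_maximal) auto
    ultimately show ?thesis using O1(4) by blast
  qed
  then have "closure U = UNIV" unfolding dense_iff by blast
  then show ?thesis using interior_subset by (intro exI[of _ U]) (auto simp: U_def)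
qed

lemma mero_eq_binary:
  fixes f f' g g' :: "complex^'n \<Rightarrow> complex"
  assumes "mero_eq f f'" "mero_eq g g'"
    and "\<And>f g :: complex^'n \<Rightarrow> complex. meromorphic_n f \<Longrightarrow> meromorphic_n g \<Longrightarrow>
      meromorphic_n (\<lambda>z. G (f z) (g z))"
  shows "mero_eq (\<lambda>z. G (f z) (g z)) (\<lambda>z. G (f' z) (g' z))"
proof -
  obtain U V where "open U" "closure U = UNIV" "\<forall>z\<in>U. f z = f' z"
     "open V" "closure V = UNIV" "\<forall>z\<in>V. g z = g' z"
    using assms(1,2) unfolding mero_eq_def by auto
  moreover have "meromorphic_n f" "meromorphic_n f'" "meromorphic_n g" "meromorphic_n g'"
    using assms(1,2) unfolding mero_eq_def by auto
  ultimately show ?thesis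
    using dense_Int_open[of U V] assms(3)[of f g] assms(3)[of f' g'] unfolding mero_eq_def
    by (intro conjI exI[of _ "U \<inter> V"]) simp_all
qed

lemma mero_eq_unary:
  fixes f f' :: "complex^'n \<Rightarrow> complex"
  assumes "mero_eq f f'"
    and "\<And>f :: complex^'n \<Rightarrow> complex. meromorphic_n f \<Longrightarrow> meromorphic_n (\<lambda>z. G (f z))"
  shows "mero_eq (\<lambda>z. G (f z)) (\<lambda>z. G (f' z))"
  by (rule mero_eq_binary[where G = "\<lambda>a b. G a", OF assms(1,1)]) (rule assms(2))

lemma mero_eq_refl: "meromorphic_n f \<Longrightarrow> mero_eq f f"
  unfolding mero_eq_def by (intro conjI exI[of _ UNIV]) auto

lemma part_equivp_mero_eq: "part_equivp mero_eq"
proof (rule part_equivpI)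
  show "\<exists>f. mero_eq f f" using mero_eq_refl[OF meromorphic_n_const] by blast
  show "symp mero_eq" unfolding symp_def mero_eq_def by metis
  show "transp mero_eq"
  proof (rule transpI)
    fix f g h :: "complex^'n \<Rightarrow> complex"
    assume fg: "mero_eq f g" and gh: "mero_eq g h"
    then obtain U V where "open U" "closure U = UNIV" "\<forall>z\<in>U. f z = g z"
      "open V" "closure V = UNIV" "\<forall>z\<in>V. g z = h z"
      unfolding mero_eq_def by auto
    then show "mero_eq f h"
      using fg gh dense_Int_open[of U V] unfolding mero_eq_def
      by (intro conjI exI[of _ "U \<inter> V"]) auto
  qed
qed

quotient_type 'n mero = "complex^'n::finite \<Rightarrow> complex" / partial: mero_eq
  by (rule part_equivp_mero_eq)

instantiation mero :: (finite) field
begin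

lift_definition zero_mero :: "'a mero" is "\<lambda>_. 0"
  by (intro mero_eq_refl meromorphic_n_const)
lift_definition one_mero :: "'a mero" is "\<lambda>_. 1"
  by (intro mero_eq_refl meromorphic_n_const)
lift_definition plus_mero :: "'a mero \<Rightarrow> 'a mero \<Rightarrow> 'a mero" is "\<lambda>f g z. f z + g z"
  by (rule mero_eq_binary[where G = "(+)"]) (assumption | erule (1) meromorphic_n_add)+
lift_definition minus_mero :: "'a mero \<Rightarrow> 'a mero \<Rightarrow> 'a mero" is "\<lambda>f g z. f z - g z"
  by (rule mero_eq_binary[where G = "(-)"]) (assumption | erule (1) meromorphic_n_diff)+
lift_definition times_mero :: "'a mero \<Rightarrow> 'a mero \<Rightarrow> 'a mero" is "\<lambda>f g z. f z * g z"
  by (rule mero_eq_binary[where G = "(*)"]) (assumption | erule (1) meromorphic_n_mult)+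
lift_definition divide_mero :: "'a mero \<Rightarrow> 'a mero \<Rightarrow> 'a mero" is "\<lambda>f g z. f z / g z"
  by (rule mero_eq_binary[where G = "(/)"]) (assumption | erule (1) meromorphic_n_divide)+
lift_definition uminus_mero :: "'a mero \<Rightarrow> 'a mero" is "\<lambda>f z. - f z"
  by (rule mero_eq_unary[where G = uminus]) (assumption | erule meromorphic_n_minus)+
lift_definition inverse_mero :: "'a mero \<Rightarrow> 'a mero" is "\<lambda>f z. inverse (f z)"
  by (rule mero_eq_unary[where G = inverse]) (assumption | erule meromorphic_n_inverse)+

lemma mero_eqI:
  "meromorphic_n f \<Longrightarrow> meromorphic_n g \<Longrightarrow> (\<And>z. f z = g z) \<Longrightarrow> mero_eq f g"
  unfolding mero_eq_def by (intro conjI exI[of _ UNIV]) auto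

lemma mero_eqD: "mero_eq f g \<Longrightarrow> meromorphic_n f"
  by (simp add: mero_eq_def)

instance
proof
  fix a b c :: "'a mero"
  show "a * b * c = a * (b * c)"
    by (transfer, rule mero_eqI; (rule meromorphic_intros | erule mero_eqD | simp add: algebra_simps)+)
  show "a * b = b * a"
    by (transfer, rule mero_eqI; (rule meromorphic_intros | erule mero_eqD | simp add: algebra_simps)+)
  show "1 * a = a"
    by (transfer, rule mero_eqI; (rule meromorphic_intros | erule mero_eqD | simp add: algebra_simps)+)
  show "a + b + c = a + (b + c)"
    by (transfer, rule mero_eqI; (rule meromorphic_intros | erule mero_eqD | simp add: algebra_simps)+)
  show "a + b = b + a"
    by (transfer, rule mero_eqI; (rule meromorphic_intros | erule mero_eqD | simp add: algebra_simps)+)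
  show "0 + a = a"
    by (transfer, rule mero_eqI; (rule meromorphic_intros | erule mero_eqD | simp add: algebra_simps)+)
  show "(a + b) * c = a * c + b * c"
    by (transfer, rule mero_eqI; (rule meromorphic_intros | erule mero_eqD | simp add: algebra_simps)+)
  show "- a + a = 0"
    by (transfer, rule mero_eqI; (rule meromorphic_intros | erule mero_eqD | simp add: algebra_simps)+)
  show "a - b = a + - b"
    by (transfer, rule mero_eqI; (rule meromorphic_intros | erule mero_eqD | simp add: algebra_simps)+)
  show "a div b = a * inverse b"
    by (transfer, rule mero_eqI; (rule meromorphic_intros divide_inverse | erule mero_eqD)+)
  show "inverse (0 :: 'a mero) = 0"
    by (transfer, rule mero_eqI; (rule meromorphic_intros | erule mero_eqD | simp add: algebra_simps)+)
  show "(0 :: 'a mero) \<noteq> 1"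
  proof (transfer, rule notI)
    assume "mero_eq (\<lambda>_::complex^'a. 0) (\<lambda>_. 1)"
    then obtain U :: "(complex^'a) set" where "closure U = UNIV" "\<forall>z\<in>U. (0::complex) = 1"
      unfolding mero_eq_def by auto
    then have "U = {}" by auto
    with \<open>closure U = UNIV\<close> show False by auto
  qed
  show "inverse a * a = 1" if "a \<noteq> 0"
    using that
  proof transfer
    fix f :: "complex^'a \<Rightarrow> complex"
    assume f: "mero_eq f f" and nz: "\<not> mero_eq f (\<lambda>_. 0)"
    obtain U where U: "open U" "closure U = UNIV" "\<forall>z\<in>U. f z \<noteq> 0"
      using meromorphic_n_nonzero[OF mero_eqD[OF f] nz] by blast
    then show "mero_eq (\<lambda>z. inverse (f z) * f z) (\<lambda>_. 1)"
      unfolding mero_eq_def using mero_eqD[OF f]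
      by (auto intro!: meromorphic_n_mult meromorphic_n_inverse meromorphic_n_const exI[of _ U])
  qed
qed

end

lemma mero_eq_translate:
  fixes f f' :: "complex^'n \<Rightarrow> complex"
  assumes "mero_eq f f'"
  shows "mero_eq (\<lambda>z. f (z + a)) (\<lambda>z. f' (z + a))"
proof -
  obtain U where U: "open U" "closure U = UNIV" "\<forall>z\<in>U. f z = f' z"
    using assms unfolding mero_eq_def by auto
  have eq: "(\<lambda>z. z + a) -` U = (\<lambda>z. - a + z) ` U"
    by (auto simp: image_iff intro!: bexI[of _ "_ + a"])
  have "closure ((\<lambda>z. - a + z) ` U) = UNIV"
    unfolding closure_translation U(2) by (auto intro!: image_eqI[of _ _ "_ + a"])
  then have "closure ((\<lambda>z. z + a) -` U) = UNIV" by (simp only: eq)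
  moreover have "open ((\<lambda>z. z + a) -` U)"
    by (rule open_vimage[OF U(1)]) (intro continuous_intros)
  ultimately show ?thesis
    using assms U(3) unfolding mero_eq_def
    by (intro conjI meromorphic_n_translate exI[of _ "(\<lambda>z. z + a) -` U"]) auto
qed

lift_definition mero_const :: "complex \<Rightarrow> 'n::finite mero" is "\<lambda>c z. c"
  by (intro mero_eq_refl meromorphic_n_const)

lift_definition T_shift :: "complex^'n \<Rightarrow> 'n::finite mero \<Rightarrow> 'n mero" is "\<lambda>\<alpha> f z. f (z + \<alpha>)"
  by (rule mero_eq_translate)

definition \<omega> :: "'n::finite \<Rightarrow> complex^'n" where
  "\<omega> i = axis i 1"

definition mero_field :: "'n::finite mero ring" where
  "mero_field = \<lparr>carrier = UNIV, monoid.mult = (*), one = 1, ring.zero = 0, ring.add = (+)\<rparr>"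

subsection \<open>The functions of the dynamical parameter\<close>

text \<open>\<open>lq\<close> is the chosen logarithm of \<open>q\<close>, so that \<open>q = qpow lq 1\<close>.\<close>

definition qpow :: "complex \<Rightarrow> complex \<Rightarrow> complex" where
  "qpow lq z = exp (z * lq)"

definition h0 :: "complex \<Rightarrow> complex \<Rightarrow> complex" where
  "h0 lq z = (qpow lq (-1) - qpow lq 1) / (qpow lq (-2 * z) - 1)"

definition g_fun :: "complex \<Rightarrow> complex \<Rightarrow> complex" where
  "g_fun lq z = (qpow lq (-2 * z) - qpow lq (-2)) * (qpow lq (-2 * z) - qpow lq 2)
            / (qpow lq (-2 * z) - 1)^2"

definition h_fun :: "complex \<Rightarrow> complex \<Rightarrow> complex" where
  "h_fun lq z = qpow lq 1 - h0 lq z"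

lemma meromorphic_n_qpow: "meromorphic_n (\<lambda>l. qpow lq (c * (l $ a - l $ b)))"
proof (rule meromorphic_n_holomorphic)
  have "holomorphic_n (\<lambda>l. (c * lq) * (l $ a + (-1) * l $ b)) UNIV"
    by (intro holomorphic_n_mult holomorphic_n_add holomorphic_n_const holomorphic_n_component)
  then have "holomorphic_n (\<lambda>l. exp ((c * lq) * (l $ a + (-1) * l $ b))) UNIV"
    by (rule holomorphic_n_compose[where g = exp and g' = exp]) (rule DERIV_exp)
  then show "holomorphic_n (\<lambda>l. qpow lq (c * (l $ a - l $ b))) UNIV"
    by (simp add: qpow_def mult_ac)
qed

text \<open>The elements \<open>h\<^sub>0(\<lambda>\<^sub>a - \<lambda>\<^sub>b)\<close>, \<open>g(\<lambda>\<^sub>a - \<lambda>\<^sub>b)\<close> and \<open>h(\<lambda>\<^sub>a - \<lambda>\<^sub>b)\<close> of the field of meromorphic functions.\<close>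

lift_definition h0_at :: "complex \<Rightarrow> 'n \<Rightarrow> 'n \<Rightarrow> 'n::finite mero" is
  "\<lambda>lq a b (l :: complex^'n). h0 lq (l $ a - l $ b)"
  unfolding h0_def by (intro mero_eq_refl meromorphic_intros meromorphic_n_qpow)

lift_definition g_at :: "complex \<Rightarrow> 'n \<Rightarrow> 'n \<Rightarrow> 'n::finite mero" is
  "\<lambda>lq a b (l :: complex^'n). g_fun lq (l $ a - l $ b)"
  unfolding g_fun_def power2_eq_square by (intro mero_eq_refl meromorphic_intros meromorphic_n_qpow)

lift_definition h_at :: "complex \<Rightarrow> 'n \<Rightarrow> 'n \<Rightarrow> 'n::finite mero" is
  "\<lambda>lq a b (l :: complex^'n). h_fun lq (l $ a - l $ b)"
  unfolding h_fun_def h0_def by (intro mero_eq_refl meromorphic_intros meromorphic_n_qpow)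

text \<open>\<open>Rmat lq x y a c\<close> is the entry with upper indices \<open>x y\<close> and lower indices \<open>a c\<close>.\<close>

definition Rmat :: "complex \<Rightarrow> 'n \<Rightarrow> 'n \<Rightarrow> 'n \<Rightarrow> 'n \<Rightarrow> 'n::{finite,linorder} mero" where
  "Rmat lq x y a c =
     (if x = y \<and> a = x \<and> c = x then mero_const (qpow lq 1)
      else if x \<noteq> y \<and> a = x \<and> c = y then (if x < y then 1 else g_at lq x y)
      else if x \<noteq> y \<and> a = y \<and> c = x then h0_at lq x y
      else 0)"

section \<open>Algebras given by generators and relations\<close>

text \<open>The free unital \<open>\<complex>\<close>-algebra on \<open>'x\<close> is the monoid algebra of the free monoid of words over
  \<open>'x\<close>.  The wrapper around lists only serves to carry the (additively written) monoid structure.\<close>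

datatype 'x fmon = FMon (letters: "'x list")

instantiation fmon :: (type) monoid_add
begin
definition "0 = FMon []"
definition "u + v = FMon (letters u @ letters v)"
instance by standard (auto simp: zero_fmon_def plus_fmon_def)
end

type_synonym 'x falg = "'x fmon \<Rightarrow>\<^sub>0 complex"

definition fgen :: "'x \<Rightarrow> 'x falg" where
  "fgen x = Poly_Mapping.single (FMon [x]) 1"

definition fscalar :: "complex \<Rightarrow> 'x falg" where
  "fscalar c = Poly_Mapping.single 0 c"

definition free_algebra :: "'x falg ring" where
  "free_algebra = \<lparr>carrier = UNIV, monoid.mult = (*), one = 1, ring.zero = 0, ring.add = (+)\<rparr>"

definition presented :: "'x falg set \<Rightarrow> 'x falg set ring" where
  "presented S = free_algebra Quot (genideal free_algebra S)"

definition pclass :: "'x falg set \<Rightarrow> 'x falg \<Rightarrow> 'x falg set" where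
  "pclass S x = genideal free_algebra S +>\<^bsub>free_algebra\<^esub> x"

definition homogeneous :: "('x \<Rightarrow> 'd::monoid_add) \<Rightarrow> 'd \<Rightarrow> 'x falg set" where
  "homogeneous deg d = {x. \<forall>m\<in>Poly_Mapping.keys x. sum_list (map deg (letters m)) = d}"

section \<open>\<open>\<hh>\<close>-spaces and \<open>\<hh>\<close>-algebras\<close>

text \<open>The multiplication and unit of the underlying ring record are only used for \<open>\<hh>\<close>-spaces that
  are algebras.\<close>

record ('n, 'v) hspace = "('n::finite mero, 'v) module" +
  grade :: "complex^'n \<Rightarrow> 'v set"

text \<open>Scalars of an \<open>\<hh>\<close>-algebra act through the constant functions, on which the two moment maps
  agree.\<close>

record ('n, 'a) halg = "'a ring" +
  bigrade :: "complex^'n::finite \<Rightarrow> complex^'n \<Rightarrow> 'a set"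
  mu_l :: "'n mero \<Rightarrow> 'a"
  mu_r :: "'n mero \<Rightarrow> 'a"

definition direct_sum :: "('v, 'r) ring_scheme \<Rightarrow> ('d \<Rightarrow> 'v set) \<Rightarrow> bool" where
  "direct_sum V G \<longleftrightarrow>
     (\<forall>v\<in>carrier V. \<exists>!x. (\<forall>d. x d \<in> G d) \<and> finite {d. x d \<noteq> \<zero>\<^bsub>V\<^esub>} \<and>
        v = (\<Oplus>\<^bsub>V\<^esub>d\<in>{d. x d \<noteq> \<zero>\<^bsub>V\<^esub>}. x d))"

definition h_space :: "('n::finite, 'v) hspace \<Rightarrow> bool" where
  "h_space V \<longleftrightarrow> Module.module mero_field V \<and>
     (\<forall>\<alpha>. submodule (grade V \<alpha>) mero_field V) \<and> direct_sum V (grade V)"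

definition hspace_hom :: "('n::finite, 'v) hspace \<Rightarrow> ('n, 'w) hspace \<Rightarrow> ('v \<Rightarrow> 'w) set" where
  "hspace_hom V W = {\<phi>. \<phi> \<in> carrier V \<rightarrow> carrier W \<and>
     (\<forall>v\<in>carrier V. \<forall>w\<in>carrier V. \<phi> (v \<oplus>\<^bsub>V\<^esub> w) = \<phi> v \<oplus>\<^bsub>W\<^esub> \<phi> w) \<and>
     (\<forall>f. \<forall>v\<in>carrier V. \<phi> (f \<odot>\<^bsub>V\<^esub> v) = f \<odot>\<^bsub>W\<^esub> \<phi> v) \<and>
     (\<forall>\<alpha>. \<phi> ` grade V \<alpha> \<subseteq> grade W \<alpha>)}"

definition l_module :: "('n::finite, 'a) halg \<Rightarrow> ('n mero, 'a) module" where
  "l_module A = \<lparr>carrier = carrier A, monoid.mult = monoid.mult A, one = one A,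
     ring.zero = ring.zero A, ring.add = ring.add A, smult = (\<lambda>f a. mu_l A f \<otimes>\<^bsub>A\<^esub> a)\<rparr>"

definition r_module :: "('n::finite, 'a) halg \<Rightarrow> ('n mero, 'a) module" where
  "r_module A = \<lparr>carrier = carrier A, monoid.mult = monoid.mult A, one = one A,
     ring.zero = ring.zero A, ring.add = ring.add A, smult = (\<lambda>f a. mu_r A f \<otimes>\<^bsub>A\<^esub> a)\<rparr>"

section \<open>Tensor products\<close>

text \<open>
  For a family \<open>Cs\<close> of pairs \<open>(X, Y)\<close> of homogeneous components \<open>X\<close> of \<open>V\<close> and \<open>Y\<close> of \<open>W\<close>, the
  direct sum of the tensor products \<open>X \<otimes> Y\<close> over the scalars is the free abelian group on the union
  of the sets \<open>X \<times> Y\<close> modulo the bilinearity and balancing relations inside each of these sets.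
  A pair lying in several of the sets \<open>X \<times> Y\<close> has a zero entry, hence is zero in the quotient
  anyway, so there is no need to label the generators by components.
\<close>

definition tpairs :: "('v set \<times> 'w set) set \<Rightarrow> ('v \<times> 'w) set" where
  "tpairs Cs = (\<Union>(X, Y)\<in>Cs. X \<times> Y)"

definition trels :: "('m, 'v, 'r) module_scheme \<Rightarrow> ('m, 'w, 's) module_scheme \<Rightarrow>
    ('v set \<times> 'w set) set \<Rightarrow> (('v \<times> 'w) \<Rightarrow>\<^sub>0 int) set" where
  "trels V W Cs =
     {frag_of (v \<oplus>\<^bsub>V\<^esub> v', w) - frag_of (v, w) - frag_of (v', w) | X Y v v' w.
        (X, Y) \<in> Cs \<and> v \<in> X \<and> v' \<in> X \<and> w \<in> Y} \<union>
     {frag_of (v, w \<oplus>\<^bsub>W\<^esub> w') - frag_of (v, w) - frag_of (v, w') | X Y v w w'.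
        (X, Y) \<in> Cs \<and> v \<in> X \<and> w \<in> Y \<and> w' \<in> Y} \<union>
     {frag_of (f \<odot>\<^bsub>V\<^esub> v, w) - frag_of (v, f \<odot>\<^bsub>W\<^esub> w) | X Y f v w.
        (X, Y) \<in> Cs \<and> v \<in> X \<and> w \<in> Y}"

definition tnull :: "('m, 'v, 'r) module_scheme \<Rightarrow> ('m, 'w, 's) module_scheme \<Rightarrow>
    ('v set \<times> 'w set) set \<Rightarrow> (('v \<times> 'w) \<Rightarrow>\<^sub>0 int) set" where
  "tnull V W Cs = generate (free_Abelian_group (tpairs Cs)) (trels V W Cs)"

definition tclass :: "('m, 'v, 'r) module_scheme \<Rightarrow> ('m, 'w, 's) module_scheme \<Rightarrow>
    ('v set \<times> 'w set) set \<Rightarrow> (('v \<times> 'w) \<Rightarrow>\<^sub>0 int) \<Rightarrow> (('v \<times> 'w) \<Rightarrow>\<^sub>0 int) set" where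
  "tclass V W Cs x = tnull V W Cs #>\<^bsub>free_Abelian_group (tpairs Cs)\<^esub> x"

text \<open>Pure tensors; a pair of homogeneous elements whose degrees do not match yields zero.\<close>

definition tpure :: "('m, 'v, 'r) module_scheme \<Rightarrow> ('m, 'w, 's) module_scheme \<Rightarrow>
    ('v set \<times> 'w set) set \<Rightarrow> 'v \<Rightarrow> 'w \<Rightarrow> (('v \<times> 'w) \<Rightarrow>\<^sub>0 int) set" where
  "tpure V W Cs v w =
     (if (v, w) \<in> tpairs Cs then tclass V W Cs (frag_of (v, w)) else tclass V W Cs 0)"

text \<open>The ring structure with \<open>(v \<otimes> a) (w \<otimes> b) = vw \<otimes> ab\<close>, defined on cosets by representatives
  in the same way as \<^const>\<open>rcoset_mult\<close>.\<close>

definition tring :: "('m, 'v, 'r) module_scheme \<Rightarrow> ('m, 'w, 's) module_scheme \<Rightarrow>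
    ('v set \<times> 'w set) set \<Rightarrow> (('v \<times> 'w) \<Rightarrow>\<^sub>0 int) set ring" where
  "tring V W Cs = (let Q = free_Abelian_group (tpairs Cs) Mod tnull V W Cs in
     \<lparr>carrier = carrier Q,
      monoid.mult = (\<lambda>X Y. \<Union>x\<in>X. \<Union>y\<in>Y. tclass V W Cs
        (frag_extend (\<lambda>(v, a). frag_extend (\<lambda>(w, b). frag_of (v \<otimes>\<^bsub>V\<^esub> w, a \<otimes>\<^bsub>W\<^esub> b)) y) x)),
      one = tpure V W Cs \<one>\<^bsub>V\<^esub> \<one>\<^bsub>W\<^esub>,
      ring.zero = one Q,
      ring.add = monoid.mult Q\<rparr>)"

text \<open>The additive map on a tensor product with prescribed (balanced, biadditive) values on pure tensors:
  the additive extension to the free abelian group is constant on cosets.\<close>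

definition tlift :: "('c, 'r) ring_scheme \<Rightarrow> ('v \<Rightarrow> 'w \<Rightarrow> 'c) \<Rightarrow> (('v \<times> 'w) \<Rightarrow>\<^sub>0 int) set \<Rightarrow> 'c" where
  "tlift G \<phi> X = the_elem ((\<lambda>x. \<Oplus>\<^bsub>G\<^esub>p\<in>Poly_Mapping.keys x.
      [Poly_Mapping.lookup x p] \<cdot>\<^bsub>G\<^esub> \<phi> (fst p) (snd p)) ` X)"

type_synonym ('v, 'w) ten = "(('v \<times> 'w) \<Rightarrow>\<^sub>0 int) set"

subsection \<open>An \<open>\<hh>\<close>-space with an \<open>\<hh>\<close>-algebra\<close>

definition hcomps :: "('n::finite, 'v) hspace \<Rightarrow> ('n, 'a) halg \<Rightarrow> ('v set \<times> 'a set) set" where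
  "hcomps V A = {(grade V \<alpha>, bigrade A \<alpha> \<beta>) | \<alpha> \<beta>. True}"

definition hpure :: "('n::finite, 'v) hspace \<Rightarrow> ('n, 'a) halg \<Rightarrow> 'v \<Rightarrow> 'a \<Rightarrow> ('v, 'a) ten" where
  "hpure V A = tpure V (l_module A) (hcomps V A)"

definition hten :: "('n::finite, 'v) hspace \<Rightarrow> ('n, 'a) halg \<Rightarrow> ('n, ('v, 'a) ten) hspace" where
  "hten V A = (let T = tring V (l_module A) (hcomps V A);
                   cl = tclass V (l_module A) (hcomps V A) in
     \<lparr>carrier = carrier T, monoid.mult = monoid.mult T, one = one T, ring.zero = ring.zero T, ring.add = ring.add T,
      smult = (\<lambda>f X. \<Union>x\<in>X. cl (frag_extend (\<lambda>(v, a). frag_of (v, mu_r A f \<otimes>\<^bsub>A\<^esub> a)) x)),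
      grade = (\<lambda>\<beta>. cl ` {x. Poly_Mapping.keys x \<subseteq> (\<Union>\<alpha>. grade V \<alpha> \<times> bigrade A \<alpha> \<beta>)})\<rparr>)"

subsection \<open>Two \<open>\<hh>\<close>-algebras\<close>

definition acomps :: "('n::finite, 'a) halg \<Rightarrow> ('n, 'b) halg \<Rightarrow> ('a set \<times> 'b set) set" where
  "acomps A B = {(bigrade A \<alpha> \<gamma>, bigrade B \<gamma> \<beta>) | \<alpha> \<beta> \<gamma>. True}"

definition apure :: "('n::finite, 'a) halg \<Rightarrow> ('n, 'b) halg \<Rightarrow> 'a \<Rightarrow> 'b \<Rightarrow> ('a, 'b) ten" where
  "apure A B = tpure (r_module A) (l_module B) (acomps A B)"

definition aten :: "('n::finite, 'a) halg \<Rightarrow> ('n, 'b) halg \<Rightarrow> ('n, ('a, 'b) ten) halg" where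
  "aten A B = (let T = tring (r_module A) (l_module B) (acomps A B);
                   cl = tclass (r_module A) (l_module B) (acomps A B) in
     \<lparr>carrier = carrier T, monoid.mult = monoid.mult T, one = one T, ring.zero = ring.zero T, ring.add = ring.add T,
      bigrade = (\<lambda>\<alpha> \<beta>. cl ` {x. Poly_Mapping.keys x \<subseteq> (\<Union>\<gamma>. bigrade A \<alpha> \<gamma> \<times> bigrade B \<gamma> \<beta>)}),
      mu_l = (\<lambda>f. apure A B (mu_l A f) \<one>\<^bsub>B\<^esub>),
      mu_r = (\<lambda>f. apure A B \<one>\<^bsub>A\<^esub> (mu_r B f))\<rparr>)"

subsection \<open>Difference operators\<close>

definition D_alg :: "('n::finite, 'n mero \<Rightarrow> 'n mero) halg" where
  "D_alg =
     \<lparr>carrier = {d. \<exists>B f. finite B \<and> d = (\<lambda>u. \<Sum>\<beta>\<in>B. f \<beta> * T_shift \<beta> u)},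
      monoid.mult = (\<circ>), one = id, ring.zero = (\<lambda>u. 0), ring.add = (\<lambda>d e u. d u + e u),
      bigrade = (\<lambda>\<alpha> \<beta>. if \<alpha> = \<beta> then {\<lambda>u. f * T_shift (- \<beta>) u | f. True} else {\<lambda>u. 0}),
      mu_l = (\<lambda>f u. f * u), mu_r = (\<lambda>f u. f * u)\<rparr>"

section \<open>Corepresentations and comodule algebras\<close>

text \<open>\<open>(V \<otimes> A) \<otimes> A \<cong> V \<otimes> (A \<otimes> A)\<close>\<close>

definition hassoc :: "('n::finite, 'v) hspace \<Rightarrow> ('n, 'a) halg \<Rightarrow>
    (('v, 'a) ten, 'a) ten \<Rightarrow> ('v, ('a, 'a) ten) ten" where
  "hassoc V A = (let U = hten V (aten A A) in
     tlift U (\<lambda>X b. tlift U (\<lambda>v a. hpure V (aten A A) v (apure A A a b)) X))"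

text \<open>\<open>V \<otimes> D \<cong> V\<close>, given by \<open>v \<otimes> f T\<^sub>-\<^sub>\<alpha> \<mapsto> f v\<close> for \<open>v\<close> of degree \<open>\<alpha>\<close>; the coefficient \<open>f\<close> of the operator
  \<open>d = f T\<^sub>-\<^sub>\<alpha>\<close> is \<open>d 1\<close>.\<close>

definition hunit :: "('n::finite, 'v) hspace \<Rightarrow> ('v, 'n mero \<Rightarrow> 'n mero) ten \<Rightarrow> 'v" where
  "hunit V = tlift V (\<lambda>v d. d 1 \<odot>\<^bsub>V\<^esub> v)"

text \<open>\<open>A\<close> with \<open>\<Delta>\<close> and \<open>\<epsilon>\<close> is the bialgebroid; the two sides of the coaction identity are compared
  in \<open>V \<otimes> (A \<otimes> A)\<close>.\<close>

definition right_corepresentation :: "('n::finite, 'a) halg \<Rightarrow> ('a \<Rightarrow> ('a, 'a) ten) \<Rightarrow>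
    ('a \<Rightarrow> 'n mero \<Rightarrow> 'n mero) \<Rightarrow> ('n, 'v) hspace \<Rightarrow> ('v \<Rightarrow> ('v, 'a) ten) \<Rightarrow> bool" where
  "right_corepresentation A \<Delta> \<epsilon> V \<rho> \<longleftrightarrow>
     h_space V \<and> \<rho> \<in> hspace_hom V (hten V A) \<and>
     (\<forall>v\<in>carrier V.
        tlift (hten V (aten A A)) (\<lambda>w a. hpure V (aten A A) w (\<Delta> a)) (\<rho> v) =
        hassoc V A (tlift (hten (hten V A) A) (\<lambda>w a. hpure (hten V A) A (\<rho> w) a) (\<rho> v))) \<and>
     (\<forall>v\<in>carrier V. hunit V (tlift (hten V D_alg) (\<lambda>w a. hpure V D_alg w (\<epsilon> a)) (\<rho> v)) = v)"

text \<open>Only unital comodule algebras are considered.  The product \<open>f v w\<close> is unambiguous, so both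
  bracketings occur in the compatibility condition.\<close>

definition right_comodule_algebra :: "('n::finite, 'a) halg \<Rightarrow> ('a \<Rightarrow> ('a, 'a) ten) \<Rightarrow>
    ('a \<Rightarrow> 'n mero \<Rightarrow> 'n mero) \<Rightarrow> ('n, 'v) hspace \<Rightarrow> ('v \<Rightarrow> ('v, 'a) ten) \<Rightarrow> bool" where
  "right_comodule_algebra A \<Delta> \<epsilon> V \<rho> \<longleftrightarrow>
     right_corepresentation A \<Delta> \<epsilon> V \<rho> \<and>
     ring V \<and>
     (\<forall>f \<alpha>. \<forall>v\<in>grade V \<alpha>. \<forall>w\<in>carrier V.
        f \<odot>\<^bsub>V\<^esub> (v \<otimes>\<^bsub>V\<^esub> w) = (f \<odot>\<^bsub>V\<^esub> v) \<otimes>\<^bsub>V\<^esub> w \<and>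
        (f \<odot>\<^bsub>V\<^esub> v) \<otimes>\<^bsub>V\<^esub> w = v \<otimes>\<^bsub>V\<^esub> (T_shift \<alpha> f \<odot>\<^bsub>V\<^esub> w)) \<and>
     (\<forall>\<alpha> \<beta>. \<forall>v\<in>grade V \<alpha>. \<forall>w\<in>grade V \<beta>. v \<otimes>\<^bsub>V\<^esub> w \<in> grade V (\<alpha> + \<beta>)) \<and>
     \<rho> \<in> ring_hom V (hten V A)"

section \<open>The \<open>\<hh>\<close>-bialgebroid \<open>F\<^sub>R(M(n))\<close>\<close>

datatype 'n Fgen = Tgen 'n 'n | Lgen "'n::finite mero" | Rgen "'n mero"

definition F_rels :: "complex \<Rightarrow> 'n::{finite,linorder} Fgen falg set" where
  "F_rels lq =
     (\<Union>M\<in>{Lgen, Rgen}.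
        {fgen (M (f + f')) - (fgen (M f) + fgen (M f')) | f f'. True} \<union>
        {fgen (M (f * f')) - fgen (M f) * fgen (M f') | f f'. True} \<union>
        {fgen (M (mero_const c)) - fscalar c | c. True}) \<union>
     {fgen (Lgen f) * fgen (Rgen f') - fgen (Rgen f') * fgen (Lgen f) | f f'. True} \<union>
     {fgen (Lgen f) * fgen (Tgen i j) - fgen (Tgen i j) * fgen (Lgen (T_shift (\<omega> i) f)) | f i j. True} \<union>
     {fgen (Rgen f) * fgen (Tgen i j) - fgen (Tgen i j) * fgen (Rgen (T_shift (\<omega> j) f)) | f i j. True} \<union>
     {(\<Sum>x\<in>UNIV. \<Sum>y\<in>UNIV. fgen (Lgen (Rmat lq x y a c)) * fgen (Tgen x b) * fgen (Tgen y d)) -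
      (\<Sum>x\<in>UNIV. \<Sum>y\<in>UNIV. fgen (Rgen (Rmat lq b d x y)) * fgen (Tgen c y) * fgen (Tgen a x))
      | a b c d. True}"

fun F_deg :: "'n::finite Fgen \<Rightarrow> (complex^'n) \<times> (complex^'n)" where
  "F_deg (Tgen i j) = (\<omega> i, \<omega> j)"
| "F_deg (Lgen f) = 0"
| "F_deg (Rgen f) = 0"

definition F_gen :: "complex \<Rightarrow> 'n::{finite,linorder} Fgen \<Rightarrow> 'n Fgen falg set" where
  "F_gen lq x = pclass (F_rels lq) (fgen x)"

definition F_alg :: "complex \<Rightarrow> ('n::{finite,linorder}, 'n Fgen falg set) halg" where
  "F_alg lq = (let Q = presented (F_rels lq) in
     \<lparr>carrier = carrier Q, monoid.mult = monoid.mult Q, one = one Q, ring.zero = ring.zero Q, ring.add = ring.add Q,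
      bigrade = (\<lambda>\<alpha> \<beta>. pclass (F_rels lq) ` homogeneous F_deg (\<alpha>, \<beta>)),
      mu_l = (\<lambda>f. F_gen lq (Lgen f)),
      mu_r = (\<lambda>f. F_gen lq (Rgen f))\<rparr>)"

definition t_elt :: "complex \<Rightarrow> 'n \<Rightarrow> 'n \<Rightarrow> 'n::{finite,linorder} Fgen falg set" where
  "t_elt lq i j = F_gen lq (Tgen i j)"

text \<open>The algebra homomorphism into the \<open>\<hh>\<close>-algebra \<open>B\<close> with prescribed values on generators, on the
  free algebra and on a quotient of it (if the relations are respected, it is constant on cosets).\<close>

definition free_lift :: "('n::finite, 'b) halg \<Rightarrow> ('x \<Rightarrow> 'b) \<Rightarrow> 'x falg \<Rightarrow> 'b" where
  "free_lift B \<phi> x = (\<Oplus>\<^bsub>B\<^esub>m\<in>Poly_Mapping.keys x.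
     mu_l B (mero_const (Poly_Mapping.lookup x m)) \<otimes>\<^bsub>B\<^esub>
     foldr (\<lambda>y b. \<phi> y \<otimes>\<^bsub>B\<^esub> b) (letters m) \<one>\<^bsub>B\<^esub>)"

definition presented_lift :: "('n::finite, 'b) halg \<Rightarrow> ('x \<Rightarrow> 'b) \<Rightarrow> 'x falg set \<Rightarrow> 'b" where
  "presented_lift B \<phi> X = the_elem (free_lift B \<phi> ` X)"

definition F_comult :: "complex \<Rightarrow> 'n Fgen falg set \<Rightarrow>
    ('n::{finite,linorder} Fgen falg set, 'n Fgen falg set) ten" where
  "F_comult lq = (let F = F_alg lq; FF = aten F F in
     presented_lift FF (\<lambda>y. case y of
         Tgen i j \<Rightarrow> (\<Oplus>\<^bsub>FF\<^esub>k\<in>UNIV. apure F F (t_elt lq i k) (t_elt lq k j))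
       | Lgen f \<Rightarrow> apure F F (mu_l F f) \<one>\<^bsub>F\<^esub>
       | Rgen f \<Rightarrow> apure F F \<one>\<^bsub>F\<^esub> (mu_r F f)))"

definition F_counit :: "'n Fgen falg set \<Rightarrow> 'n::{finite,linorder} mero \<Rightarrow> 'n mero" where
  "F_counit = presented_lift D_alg (\<lambda>y. case y of
       Tgen i j \<Rightarrow> (if i = j then T_shift (- \<omega> i) else (\<lambda>u. 0))
     | Lgen f \<Rightarrow> (\<lambda>u. f * u)
     | Rgen f \<Rightarrow> (\<lambda>u. f * u))"

section \<open>The algebra \<open>W\<close>\<close>

datatype 'n Wgen = Vgen 'n | Mgen "'n::finite mero"

definition W_rels :: "complex \<Rightarrow> 'n::{finite,linorder} Wgen falg set" where
  "W_rels lq =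
     {fgen (Mgen (f + f')) - (fgen (Mgen f) + fgen (Mgen f')) | f f'. True} \<union>
     {fgen (Mgen (f * f')) - fgen (Mgen f) * fgen (Mgen f') | f f'. True} \<union>
     {fgen (Mgen (mero_const c)) - fscalar c | c. True} \<union>
     {fgen (Vgen i) * fgen (Vgen i) | i. True} \<union>
     {fgen (Vgen j) * fgen (Vgen i) - (- (fgen (Mgen (h_at lq j i)) * fgen (Vgen i) * fgen (Vgen j)))
      | i j. i < j} \<union>
     {fgen (Mgen f) * fgen (Vgen i) - fgen (Vgen i) * fgen (Mgen (T_shift (\<omega> i) f)) | f i. True}"

fun W_deg :: "'n::finite Wgen \<Rightarrow> complex^'n" where
  "W_deg (Vgen i) = \<omega> i"
| "W_deg (Mgen f) = 0"

definition W_gen :: "complex \<Rightarrow> 'n::{finite,linorder} Wgen \<Rightarrow> 'n Wgen falg set" where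
  "W_gen lq x = pclass (W_rels lq) (fgen x)"

definition W_alg :: "complex \<Rightarrow> ('n::{finite,linorder}, 'n Wgen falg set) hspace" where
  "W_alg lq = (let Q = presented (W_rels lq) in
     \<lparr>carrier = carrier Q, monoid.mult = monoid.mult Q, one = one Q, ring.zero = ring.zero Q, ring.add = ring.add Q,
      smult = (\<lambda>f X. W_gen lq (Mgen f) \<otimes>\<^bsub>Q\<^esub> X),
      grade = (\<lambda>\<alpha>. pclass (W_rels lq) ` homogeneous W_deg \<alpha>)\<rparr>)"

definition w_elt :: "complex \<Rightarrow> 'n \<Rightarrow> 'n::{finite,linorder} Wgen falg set" where
  "w_elt lq i = W_gen lq (Vgen i)"

end

theory Submission
  imports Defs
begin

text \<open>
  Reading off the \<open>RLL\<close> relations with \<open>a < c\<close>, the coefficient of \<open>w\<^sub>k w\<^sub>l\<close> (\<open>k < l\<close>) in the product of the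
  prospective images of \<open>w\<^sub>i\<close> and \<open>w\<^sub>j\<close> is the \<open>2 \<times> 2\<close> minor
  \<open>t\<^sub>k\<^sub>i t\<^sub>l\<^sub>j - h(\<lambda>\<^sub>l - \<lambda>\<^sub>k) t\<^sub>l\<^sub>i t\<^sub>k\<^sub>j\<close>.  It vanishes for \<open>i = j\<close>, and exchanging \<open>i < j\<close> multiplies it by
  \<open>-h(\<mu>\<^sub>j - \<mu>\<^sub>i)\<close>, because \<open>h = q - h\<^sub>0\<close> and \<open>g(z) = h(z) h(-z)\<close>; hence the relations of \<open>W\<close> are respected.
  Both coaction identities are additive, so they only have to be compared on the additive generators
  \<open>f w\<^sub>I\<close>, where \<open>R(f w\<^sub>I) = \<Sum>\<^sub>J w\<^sub>J \<otimes> f(\<mu>) t\<^sub>J\<^sub>I\<close>, \<open>\<Delta>(t\<^sub>J\<^sub>I) = \<Sum>\<^sub>K t\<^sub>J\<^sub>K \<otimes> t\<^sub>K\<^sub>I\<close> and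
  \<open>\<epsilon>(t\<^sub>J\<^sub>I) = \<delta>\<^sub>J\<^sub>I T\<close> for words \<open>I, J, K\<close> of equal length.  The same generators give uniqueness.
\<close>

section \<open>Meromorphic functions\<close>

text \<open>No basis of W or of F is used: every step works with spanning sets, so independence of
  words never has to be known. The price is that all maps must come from presentations or from
  universal properties. \<open>presented_lift\<close> and \<open>tlift\<close> take the unique
  element of an image set, so they carry information only after constancy on cosets is proved. This
  includes \<open>F_comult\<close> and \<open>F_counit\<close>, whose compatibility with the RLL
  relations is therefore part of the proof. A second obstacle is that functions are not central. A
  tensor product over them has a well defined product only because the two entries of a pair have
  matching degrees, so that a function crossing either of them is shifted by the same vector; the
  ring structures on tensor products rest on this. Finally, sums can be moved through the tensor
  sign only inside one homogeneous component. This is why the gradings, and the weight condition on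
  the R-matrix, reappear at the uses of RLL.\<close>

lemma T_shift_add: "T_shift \<alpha> (f + g) = T_shift \<alpha> f + T_shift \<alpha> g"
  by (transfer, rule mero_eqI; (rule meromorphic_intros meromorphic_n_translate | erule mero_eqD | simp)+)

lemma T_shift_mult: "T_shift \<alpha> (f * g) = T_shift \<alpha> f * T_shift \<alpha> g"
  by (transfer, rule mero_eqI; (rule meromorphic_intros meromorphic_n_translate | erule mero_eqD | simp)+)

lemma T_shift_const [simp]: "T_shift \<alpha> (mero_const c) = mero_const c"
  by (transfer, rule mero_eqI; (rule meromorphic_intros | simp)+)

lemma T_shift_T_shift [simp]: "T_shift \<alpha> (T_shift \<beta> f) = T_shift (\<alpha> + \<beta>) f"
proof transfer
  fix \<alpha> \<beta> and f :: "complex^'a \<Rightarrow> complex"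
  assume f: "mero_eq f f"
  show "mero_eq (\<lambda>z. f (z + \<alpha> + \<beta>)) (\<lambda>z. f (z + (\<alpha> + \<beta>)))"
    using mero_eq_refl[OF meromorphic_n_translate[OF mero_eqD[OF f], of "\<alpha> + \<beta>"]]
    by (simp add: add.assoc)
qed

lemma T_shift_0 [simp]: "T_shift 0 f = f"
  by (transfer, rule mero_eqI; (erule mero_eqD | simp)+)

lemma mero_const_add: "mero_const (c + d) = mero_const c + mero_const d"
  by (transfer, rule mero_eqI; (rule meromorphic_intros | simp)+)

lemma mero_const_mult: "mero_const (c * d) = mero_const c * mero_const d"
  by (transfer, rule mero_eqI; (rule meromorphic_intros | simp)+)

lemma mero_const_0 [simp]: "mero_const 0 = 0"
  by (transfer, rule mero_eqI; (rule meromorphic_intros | simp)+)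

lemma mero_const_1 [simp]: "mero_const 1 = 1"
  by (transfer, rule mero_eqI; (rule meromorphic_intros | simp)+)

lemma T_shift_zero [simp]: "T_shift \<alpha> 0 = 0"
  using T_shift_const[of \<alpha> 0] by simp

lemma T_shift_one [simp]: "T_shift \<alpha> 1 = 1"
  using T_shift_const[of \<alpha> 1] by simp

lemma h_at_eq: "h_at lq a b = mero_const (qpow lq 1) - h0_at lq a b"
proof transfer
  fix lq and a b :: 'a
  show "mero_eq (\<lambda>l. h_fun lq (l $ a - l $ b)) (\<lambda>l. qpow lq 1 - h0 lq (l $ a - l $ b))"
    unfolding h_fun_def h0_def by (intro mero_eq_refl meromorphic_intros meromorphic_n_qpow)
qed

text \<open>With \<open>p\<close> standing for q, \<open>r\<close> for its inverse and
  \<open>X\<close> for q^(-2z), h(z) = (pX - r)/(X - 1) and h(-z) = (rX - p)/(X - 1). Since pr = 1,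
  the product of the numerators is (X - r^2)(X - p^2), the numerator of g. The assumption keeps z
  away from the common pole.\<close>

lemma h_fun_mult_reflect:
  assumes "qpow lq (-2 * z) \<noteq> 1"
  shows "g_fun lq z = h_fun lq z * h_fun lq (- z)"
proof -
  define p where "p = exp lq"
  define X where "X = exp (-2 * z * lq)"
  have p0: "p \<noteq> 0" and X0: "X \<noteq> 0" by (simp_all add: p_def X_def)
  have X1: "X \<noteq> 1" using assms by (simp add: X_def qpow_def)
  have q: "qpow lq (-1) = 1 / p" "qpow lq 1 = p" "qpow lq 2 = p\<^sup>2" "qpow lq (-2) = 1 / p\<^sup>2"
    "qpow lq (-2 * z) = X" "qpow lq (-2 * (- z)) = 1 / X"
    using exp_double[of lq] by (simp_all add: qpow_def p_def X_def exp_minus field_simps)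
  define r where "r = 1 / p"
  have pr: "p * r = 1" "r\<^sup>2 = 1 / p\<^sup>2" using p0 by (simp_all add: r_def power_divide)
  have h1: "h_fun lq z = (p * X - r) / (X - 1)"
    unfolding h_fun_def h0_def q using X1 by (simp add: r_def field_simps)
  have "(1 / p - p) / (1 / X - 1) = - ((r - p) * X / (X - 1))"
    using X0 X1 by (simp add: r_def divide_simps) (simp add: algebra_simps)
  then have h2: "h_fun lq (- z) = (r * X - p) / (X - 1)"
    unfolding h_fun_def h0_def q using X1 by (simp add: field_simps)
  have "(X - r\<^sup>2) * (X - p\<^sup>2) = X * X - p\<^sup>2 * X - r\<^sup>2 * X + (p * r) * (p * r)"
    by (simp add: algebra_simps power2_eq_square)
  also have "\<dots> = (p * X - r) * (r * X - p)"
    using pr(1) by (simp add: algebra_simps power2_eq_square)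
  finally show ?thesis
    unfolding h1 h2 unfolding g_fun_def q by (simp add: pr(2)[symmetric]) (simp add: power2_eq_square)
qed

text \<open>Equality in the field of meromorphic functions only has to hold on an open dense set, so
  the pointwise identity is enough where \<open>E\<close>, the expression X - 1 of the denominators,
  is nonzero. This happens on an open dense set unless \<open>E\<close> is the zero function, which
  \<open>lq \<noteq> 0\<close> excludes.\<close>

lemma g_at_factor:
  fixes a b :: "'n::finite"
  assumes ab: "a \<noteq> b" and lq: "lq \<noteq> 0"
  shows "g_at lq a b = h_at lq a b * h_at lq b a"
proof -
  define E :: "complex^'n \<Rightarrow> complex" where "E = (\<lambda>l. qpow lq (-2 * (l $ a - l $ b)) - 1)"
  have E: "meromorphic_n E"
    unfolding E_def by (intro meromorphic_intros meromorphic_n_qpow)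
  have contE: "continuous_on UNIV E"
    unfolding E_def qpow_def by (intro continuous_intros)
  have "\<not> mero_eq E (\<lambda>_. 0)"
  proof
    assume "mero_eq E (\<lambda>_. 0)"
    then obtain U where U: "closure U = UNIV" "\<forall>z\<in>U. E z = 0"
      unfolding mero_eq_def by blast
    \<comment> \<open>The zeros of a continuous function form a closed set, so vanishing on a dense
      set means vanishing everywhere.\<close>
    have "closed {z. E z = 0}"
      using continuous_closed_preimage_constant[OF contE closed_UNIV, of 0] by simp
    with U have z: "E z = 0" for z
      using closure_minimal[of U "{z. E z = 0}"] by auto
    \<comment> \<open>Solves -2 t lq = i pi, so that the exponential in \<open>E\<close> is -1 at
      the point whose only nonzero coordinate, in position \<open>a\<close>, is
      \<open>t\<close>.\<close>
    define t where "t = - (\<i> * pi) / (2 * lq)"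
    have "E (axis a t) = exp (\<i> * pi) - 1"
      using ab lq by (simp add: E_def qpow_def t_def axis_def field_simps)
    also have "\<dots> = -2" by simp
    finally show False using z by simp
  qed
  then obtain U where U: "open U" "closure U = UNIV" "\<forall>z\<in>U. E z \<noteq> 0"
    using meromorphic_n_nonzero[OF E] by blast
  have *: "mero_eq (\<lambda>l. g_fun lq (l $ a - l $ b)) (\<lambda>l. h_fun lq (l $ a - l $ b) * h_fun lq (l $ b - l $ a))"
    unfolding mero_eq_def
  proof (intro conjI exI[of _ U] ballI)
    show "meromorphic_n (\<lambda>l. g_fun lq (l $ a - l $ b))"
      unfolding g_fun_def power2_eq_square by (intro meromorphic_intros meromorphic_n_qpow)
    show "meromorphic_n (\<lambda>l. h_fun lq (l $ a - l $ b) * h_fun lq (l $ b - l $ a))"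
      unfolding h_fun_def h0_def by (intro meromorphic_intros meromorphic_n_qpow)
    fix z assume "z \<in> U"
    then have "qpow lq (-2 * (z $ a - z $ b)) \<noteq> 1" using U(3) by (auto simp: E_def)
    from h_fun_mult_reflect[OF this]
    show "g_fun lq (z $ a - z $ b) = h_fun lq (z $ a - z $ b) * h_fun lq (z $ b - z $ a)" by simp
  qed (use U in auto)
  then show ?thesis
    by (transfer fixing: lq a b)
qed

section \<open>Algebras given by generators and relations\<close>

lemma free_algebra_simps [simp]:
  "carrier free_algebra = UNIV" "monoid.mult free_algebra = (*)" "one free_algebra = 1"
  "ring.zero free_algebra = 0" "ring.add free_algebra = (+)"
  by (simp_all add: free_algebra_def)

lemma ring_free_algebra: "ring (free_algebra :: 'x falg ring)"
  by (rule ringI, rule abelian_groupI, simp_all)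
     (auto intro!: exI[of _ "- _"] monoid.intro simp: algebra_simps)

interpretation free_algebra: ring "free_algebra :: 'x falg ring"
  by (rule ring_free_algebra)

lemma a_inv_free_algebra [simp]: "\<ominus>\<^bsub>free_algebra\<^esub> x = - x"
  by (rule free_algebra.minus_equality) simp_all

lemma a_minus_free_algebra [simp]: "x \<ominus>\<^bsub>free_algebra\<^esub> y = x - y"
  by (simp add: a_minus_def)

lemma falg_induct [case_names zero single_add]:
  assumes "P 0" and "\<And>x m c. P x \<Longrightarrow> P (x + Poly_Mapping.single m c)"
  shows "P (x :: 'x falg)"
proof (induction x rule: update_induct)
  case const
  then show ?case by (rule assms(1))
next
  case (update f a b)
  then have "Poly_Mapping.lookup f a = 0" by (simp add: in_keys_iff)
  then have "Poly_Mapping.update a b f = f + Poly_Mapping.single a b"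
    by (intro poly_mapping_eqI) (auto simp: lookup_update lookup_add lookup_single)
  then show ?case using assms(2)[OF update(3)] by simp
qed

text \<open>\<open>A\<close> is any record that agrees with the quotient ring on the five ring
  fields. One development thus serves the h-space record of W, the h-algebra record of F and the two
  module records of F, which differ in their further fields.\<close>

locale presented_algebra =
  fixes S :: "'x falg set" and A :: "('x falg set, 'e) ring_scheme" (structure)
  assumes fields: "carrier A = carrier (presented S)" "monoid.mult A = monoid.mult (presented S)"
    "one A = one (presented S)" "ring.zero A = ring.zero (presented S)"
    "ring.add A = ring.add (presented S)"
begin

abbreviation I where "I \<equiv> genideal free_algebra S"
abbreviation cls where "cls \<equiv> pclass S"

lemma ideal_I: "ideal I free_algebra"
  by (rule free_algebra.genideal_ideal) simp

lemma I_0: "0 \<in> I"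
  using additive_subgroup.zero_closed[OF ideal.axioms(1)[OF ideal_I]] by simp

lemma I_add: "x \<in> I \<Longrightarrow> y \<in> I \<Longrightarrow> x + y \<in> I"
  using additive_subgroup.a_closed[OF ideal.axioms(1)[OF ideal_I]] by simp

lemma I_minus: "x \<in> I \<Longrightarrow> - x \<in> I"
  using additive_subgroup.a_inv_closed[OF ideal.axioms(1)[OF ideal_I]] by simp

lemma I_diff: "x \<in> I \<Longrightarrow> y \<in> I \<Longrightarrow> x - y \<in> I"
  using I_add[of x "- y"] I_minus by simp

lemma I_mult: "x \<in> I \<Longrightarrow> y * x \<in> I" "x \<in> I \<Longrightarrow> x * y \<in> I"
  using ideal.I_l_closed[OF ideal_I] ideal.I_r_closed[OF ideal_I] by simp_all

text \<open>Monomials span the free algebra additively, so closure under multiplication by single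
  monomials on either side already makes \<open>J\<close> an ideal. This form suits kernels of
  lifted maps and sets described by homogeneous components.\<close>

lemma I_minimal:
  assumes "S \<subseteq> J" "0 \<in> J" "\<And>x y. x \<in> J \<Longrightarrow> y \<in> J \<Longrightarrow> x - y \<in> J"
    and "\<And>x m c. x \<in> J \<Longrightarrow> Poly_Mapping.single m c * x \<in> J"
    and "\<And>x m c. x \<in> J \<Longrightarrow> x * Poly_Mapping.single m c \<in> J"
  shows "I \<subseteq> J"
proof -
  have minus: "- x \<in> J" if "x \<in> J" for x using assms(2,3) that by fastforce
  have plus: "x + y \<in> J" if "x \<in> J" "y \<in> J" for x y
    using assms(3)[OF that(1) minus[OF that(2)]] by simp
  have "y * x \<in> J" if "x \<in> J" for x y
    by (induction y rule: falg_induct) (simp_all add: assms(2,4) plus algebra_simps that)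
  moreover have "x * y \<in> J" if "x \<in> J" for x y
    by (induction y rule: falg_induct) (simp_all add: assms(2,5) plus algebra_simps that)
  moreover have "subgroup J (add_monoid free_algebra)"
    using assms(2) minus plus
    by (intro free_algebra.add.subgroupI) (auto simp: a_inv_free_algebra[unfolded a_inv_def])
  ultimately have "ideal J free_algebra"
    by (intro idealI ring_free_algebra) simp_all
  then show ?thesis by (rule free_algebra.genideal_minimal) (rule assms(1))
qed

lemma S_subset_I: "S \<subseteq> I"
  by (rule free_algebra.genideal_self) simp

lemma cls_eq_iff: "cls x = cls y \<longleftrightarrow> x - y \<in> I"
  using free_algebra.quotient_eq_iff_same_a_r_cos[OF ideal_I, of x y] by (simp add: pclass_def)

lemma carrier_A: "carrier A = Set.range cls"
  by (auto simp: fields presented_def FactRing_def A_RCOSETS_def' pclass_def)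

lemma cls_hom: "cls \<in> ring_hom free_algebra A"
  using ideal.rcos_ring_hom[OF ideal_I]
  by (auto simp: ring_hom_def fields presented_def pclass_def[abs_def])

lemma cls_closed [simp]: "cls x \<in> carrier A"
  by (simp add: carrier_A)

lemma cls_add: "cls x \<oplus> cls y = cls (x + y)"
  using ring_hom_add[OF cls_hom, of x y] by simp

lemma cls_mult: "cls x \<otimes> cls y = cls (x * y)"
  using ring_hom_mult[OF cls_hom, of x y] by simp

lemma cls_one: "\<one> = cls 1"
  using ring_hom_one[OF cls_hom] by simp

lemma ring_A: "ring A"
proof -
  have eq: "\<exists>x. a = cls x" if "a \<in> carrier A" for a using that by (auto simp: carrier_A)
  have z: "\<zero> = cls 0"
    using ideal.quotient_is_ring[OF ideal_I]
    by (simp add: fields presented_def FactRing_def pclass_def free_algebra.a_rcos_zero[OF ideal_I I_0])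
  show ?thesis
  proof (rule ringI, rule abelian_groupI)
    show "monoid A"
      by (rule monoid.intro) (auto simp: carrier_A cls_mult cls_one mult.assoc)
    fix x assume "x \<in> carrier A"
    then obtain x' where "x = cls x'" using eq by blast
    then show "\<exists>y\<in>carrier A. y \<oplus> x = \<zero>"
      by (intro bexI[of _ "cls (- x')"]) (simp_all add: cls_add z)
  qed (auto simp: carrier_A cls_mult cls_add z algebra_simps)
qed

sublocale ring A by (rule ring_A)

lemma cls_zero: "\<zero> = cls 0"
  by (metis add.r_cancel_one' cls_add cls_closed add_0)

lemma cls_eq_zero: "cls x = \<zero> \<longleftrightarrow> x \<in> I"
  by (simp add: cls_zero cls_eq_iff)

lemma cls_minus: "\<ominus> cls x = cls (- x)"
  by (rule minus_equality) (simp_all add: cls_add cls_zero)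

lemma cls_sum: "finite J \<Longrightarrow> (\<Oplus>i\<in>J. cls (f i)) = cls (sum f J)"
  by (induction J rule: finite_induct) (simp_all add: cls_zero cls_add Pi_def)

lemma cls_rel: "s \<in> S \<Longrightarrow> cls s = \<zero>"
  using S_subset_I by (auto simp: cls_eq_zero)

lemma cls_rel_eq: "x - y \<in> S \<Longrightarrow> cls x = cls y"
  using S_subset_I by (auto simp: cls_eq_iff)

end

section \<open>Words, degrees and homogeneous components in the free algebra\<close>

lemma fscalar_1 [simp]: "fscalar 1 = 1"
  by (simp add: fscalar_def)

lemma fscalar_commute: "fscalar c * x = x * (fscalar c :: 'x falg)"
  by (induction x rule: falg_induct) (simp_all add: fscalar_def mult_single algebra_simps)

lemma single_Cons: "Poly_Mapping.single (FMon (y # ys)) c = fgen y * Poly_Mapping.single (FMon ys) c"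
  by (simp add: fgen_def mult_single plus_fmon_def)

lemma single_Nil: "Poly_Mapping.single (FMon []) c = fscalar c"
  by (simp add: fscalar_def zero_fmon_def)

definition mdeg :: "('x \<Rightarrow> 'd::monoid_add) \<Rightarrow> 'x fmon \<Rightarrow> 'd" where
  "mdeg deg m = sum_list (map deg (letters m))"

lemma mdeg_add: "mdeg deg (m + m') = mdeg deg m + mdeg deg m'"
  by (simp add: mdeg_def plus_fmon_def)

lemma homogeneous_iff: "x \<in> homogeneous deg d \<longleftrightarrow> (\<forall>m\<in>Poly_Mapping.keys x. mdeg deg m = d)"
  by (simp add: homogeneous_def mdeg_def)

lemma homogeneous_0: "0 \<in> homogeneous deg d"
  by (simp add: homogeneous_iff)

lemma homogeneous_add: "x \<in> homogeneous deg d \<Longrightarrow> y \<in> homogeneous deg d \<Longrightarrow> x + y \<in> homogeneous deg d"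
  using keys_add[of x y] unfolding homogeneous_iff by blast

lemma homogeneous_minus: "x \<in> homogeneous deg d \<Longrightarrow> - x \<in> homogeneous deg d"
  by (simp add: homogeneous_iff in_keys_iff)

lemma homogeneous_diff: "x \<in> homogeneous deg d \<Longrightarrow> y \<in> homogeneous deg d \<Longrightarrow> x - y \<in> homogeneous deg d"
  using homogeneous_add[OF _ homogeneous_minus, of x deg d y] by simp

lemma homogeneous_mult:
  "x \<in> homogeneous deg d \<Longrightarrow> y \<in> homogeneous deg e \<Longrightarrow> x * y \<in> homogeneous deg (d + e)"
  using keys_mult[of x y] unfolding homogeneous_iff by (fastforce simp: mdeg_add)

lemma homogeneous_fgen: "fgen x \<in> homogeneous deg (deg x)"
  by (simp add: homogeneous_iff fgen_def mdeg_def)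

lemma homogeneous_fscalar: "fscalar c \<in> homogeneous deg 0"
  by (simp add: homogeneous_iff fscalar_def mdeg_def zero_fmon_def)

lemma homogeneous_1: "1 \<in> homogeneous deg 0"
  using homogeneous_fscalar[of 1] by simp

text \<open>The projection of the free algebra onto its part of degree \<open>d\<close>.\<close>

definition hcomp :: "('x \<Rightarrow> 'd::monoid_add) \<Rightarrow> 'd \<Rightarrow> 'x falg \<Rightarrow> 'x falg" where
  "hcomp deg d x = Poly_Mapping.mapp (\<lambda>m c. c when mdeg deg m = d) x"

lemma lookup_hcomp: "Poly_Mapping.lookup (hcomp deg d x) m = (Poly_Mapping.lookup x m when mdeg deg m = d)"
  by (auto simp: hcomp_def Poly_Mapping.lookup_mapp when_def in_keys_iff)

lemma hcomp_0 [simp]: "hcomp deg d 0 = 0"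
  by (rule poly_mapping_eqI) (simp add: lookup_hcomp)

lemma hcomp_add: "hcomp deg d (x + y) = hcomp deg d x + hcomp deg d y"
  by (rule poly_mapping_eqI) (simp add: lookup_hcomp lookup_add when_def)

lemma hcomp_diff: "hcomp deg d (x - y) = hcomp deg d x - hcomp deg d y"
  by (rule poly_mapping_eqI) (simp add: lookup_hcomp lookup_minus when_def)

lemma hcomp_sum: "hcomp deg d (sum f J) = (\<Sum>j\<in>J. hcomp deg d (f j))"
  by (induction J rule: infinite_finite_induct) (simp_all add: hcomp_add)

lemma hcomp_homogeneous: "x \<in> homogeneous deg d \<Longrightarrow> hcomp deg e x = (if e = d then x else 0)"
  by (rule poly_mapping_eqI) (auto simp: lookup_hcomp homogeneous_iff when_def in_keys_iff)

lemma hcomp_in_homogeneous: "hcomp deg d x \<in> homogeneous deg d"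
  by (auto simp: homogeneous_iff in_keys_iff lookup_hcomp)

lemma hcomp_single: "hcomp deg d (Poly_Mapping.single m c) = (Poly_Mapping.single m c when mdeg deg m = d)"
  by (rule poly_mapping_eqI) (auto simp: lookup_hcomp lookup_single when_def)

text \<open>Every monomial of the product has its degree raised by that of \<open>m\<close>, so
  degree \<open>d\<close> in the product means degree \<open>d - mdeg deg m\<close> in the other
  factor; hence degrees in an abelian group. Such multiplications are what leads from the relations
  to the ideal they generate.\<close>

lemma hcomp_single_mult:
  fixes deg :: "'x \<Rightarrow> 'd::ab_group_add"
  shows "hcomp deg d (Poly_Mapping.single m c * x) = Poly_Mapping.single m c * hcomp deg (d - mdeg deg m) x"
  by (induction x rule: falg_induct)
     (auto simp: hcomp_add hcomp_single mult_single mdeg_add algebra_simps when_def)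

lemma hcomp_mult_single:
  fixes deg :: "'x \<Rightarrow> 'd::ab_group_add"
  shows "hcomp deg d (x * Poly_Mapping.single m c) = hcomp deg (d - mdeg deg m) x * Poly_Mapping.single m c"
  by (induction x rule: falg_induct)
     (auto simp: hcomp_add hcomp_single mult_single mdeg_add algebra_simps when_def)

lemma sum_hcomp:
  assumes "finite D" "mdeg deg ` Poly_Mapping.keys x \<subseteq> D"
  shows "(\<Sum>d\<in>D. hcomp deg d x) = x"
proof (rule poly_mapping_eqI)
  fix m
  have "Poly_Mapping.lookup (\<Sum>d\<in>D. hcomp deg d x) m = (\<Sum>d\<in>D. if mdeg deg m = d then Poly_Mapping.lookup x m else 0)"
    by (simp add: lookup_sum lookup_hcomp when_def)
  also have "\<dots> = (if mdeg deg m \<in> D then Poly_Mapping.lookup x m else 0)"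
    using assms(1) by simp
  also have "\<dots> = Poly_Mapping.lookup x m"
    using assms(2) by (auto simp flip: not_in_keys_iff_lookup_eq_zero)
  finally show "Poly_Mapping.lookup (\<Sum>d\<in>D. hcomp deg d x) m = Poly_Mapping.lookup x m" .
qed

lemma homogeneous_induct [consumes 1, case_names zero add_single]:
  assumes "x \<in> homogeneous deg d" and "Q 0"
    and "\<And>x m c. mdeg deg m = d \<Longrightarrow> Q x \<Longrightarrow> Q (x + Poly_Mapping.single m c)"
  shows "Q x"
proof -
  \<comment> \<open>Induction over the whole free algebra, followed by projection: a monomial of
    another degree is erased, so only monomials of degree \<open>d\<close> call on the
    hypothesis.\<close>
  have "Q (hcomp deg d y)" for y
    by (induction y rule: falg_induct)
       (auto simp: assms(2) hcomp_add hcomp_single when_def intro: assms(3))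
  then show ?thesis using hcomp_homogeneous[OF assms(1), of d] by metis
qed

text \<open>Homogeneity of the relations modulo the ideal is all that can be asked for: the generator
  \<open>f(\<lambda>)\<close> with \<open>f = 0\<close> is a nonzero element of the free algebra, so the \<open>RLL\<close> relations contain monomials
  of other degrees.\<close>

locale graded_presentation = presented_algebra S A
  for S :: "'x falg set" and A :: "('x falg set, 'e) ring_scheme" (structure) +
  fixes deg :: "'x \<Rightarrow> 'd::ab_group_add"
  assumes hcomp_S: "s \<in> S \<Longrightarrow> hcomp deg d s \<in> genideal free_algebra S"
begin

definition part :: "'d \<Rightarrow> 'x falg set set" where
  "part d = cls ` homogeneous deg d"

text \<open>The elements all of whose components lie in the ideal form an ideal themselves, and it
  contains the relations by \<open>hcomp_S\<close>. All degrees are treated at once, because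
  multiplying by a monomial changes the degree that is asked for.\<close>

lemma hcomp_I: "x \<in> I \<Longrightarrow> hcomp deg d x \<in> I"
proof -
  have "I \<subseteq> {x. \<forall>d. hcomp deg d x \<in> I}"
  proof (rule I_minimal)
    show "S \<subseteq> {x. \<forall>d. hcomp deg d x \<in> I}" using hcomp_S by blast
  qed (auto simp: I_0 hcomp_diff I_diff hcomp_single_mult hcomp_mult_single I_mult)
  then show "x \<in> I \<Longrightarrow> hcomp deg d x \<in> I" by blast
qed

lemma part_subset: "part d \<subseteq> carrier A"
  by (auto simp: part_def)

lemma part_closed: "a \<in> part d \<Longrightarrow> a \<in> carrier A"
  using part_subset by blast

lemma cls_in_part: "x \<in> homogeneous deg d \<Longrightarrow> cls x \<in> part d"
  by (simp add: part_def)

lemma part_zero: "\<zero> \<in> part d"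
  unfolding cls_zero by (intro cls_in_part homogeneous_0)

lemma part_one: "\<one> \<in> part 0"
  unfolding cls_one by (intro cls_in_part homogeneous_1)

lemma part_add: "a \<in> part d \<Longrightarrow> b \<in> part d \<Longrightarrow> a \<oplus> b \<in> part d"
  by (auto simp: part_def cls_add intro!: imageI homogeneous_add)

lemma part_minus: "a \<in> part d \<Longrightarrow> \<ominus> a \<in> part d"
  by (auto simp: part_def cls_minus intro!: imageI homogeneous_minus)

lemma part_mult: "a \<in> part d \<Longrightarrow> b \<in> part e \<Longrightarrow> a \<otimes> b \<in> part (d + e)"
  by (auto simp: part_def cls_mult intro!: imageI homogeneous_mult)

text \<open>Two homogeneous representatives of different degrees differ by an element of the ideal.
  Its component of degree \<open>d\<close> is the first representative, which is therefore in the
  ideal.\<close>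

lemma part_disjoint:
  assumes "a \<in> part d" "a \<in> part e" "d \<noteq> e"
  shows "a = \<zero>"
proof -
  obtain x y where *: "a = cls x" "x \<in> homogeneous deg d" "a = cls y" "y \<in> homogeneous deg e"
    using assms unfolding part_def by blast
  then have "x - y \<in> I" using cls_eq_iff by metis
  from hcomp_I[OF this, of d] have "x \<in> I"
    using assms(3) * by (simp add: hcomp_diff hcomp_homogeneous)
  then show ?thesis using * by (simp add: cls_eq_zero)
qed

lemma part_induct [consumes 1, case_names zero add single]:
  assumes "a \<in> part d" and "Q \<zero>"
    and "\<And>a b. a \<in> part d \<Longrightarrow> b \<in> part d \<Longrightarrow> Q a \<Longrightarrow> Q b \<Longrightarrow> Q (a \<oplus> b)"
    and "\<And>ys c. sum_list (map deg ys) = d \<Longrightarrow> Q (cls (Poly_Mapping.single (FMon ys) c))"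
  shows "Q a"
proof -
  obtain x where x: "a = cls x" "x \<in> homogeneous deg d" using assms(1) unfolding part_def by blast
  from x(2) have "x \<in> homogeneous deg d \<and> Q (cls x)"
  proof (induction rule: homogeneous_induct)
    case zero
    then show ?case using assms(2) by (simp add: cls_zero homogeneous_0)
  next
    case (add_single x m c)
    have "Poly_Mapping.single m c \<in> homogeneous deg d"
      using add_single by (auto simp: homogeneous_iff)
    moreover have "Q (cls (Poly_Mapping.single m c))"
      using assms(4)[of "letters m" c] add_single by (simp add: mdeg_def)
    ultimately show ?case
      using add_single assms(3)[of "cls x" "cls (Poly_Mapping.single m c)"]
      by (auto simp: cls_add intro: cls_in_part homogeneous_add)
  qed
  then show ?thesis by (simp add: x)
qed

lemma scalar_commute: "a \<in> carrier A \<Longrightarrow> cls (fscalar c) \<otimes> a = a \<otimes> cls (fscalar c)"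
  by (auto simp: carrier_A cls_mult fscalar_commute)

text \<open>The relations only say how a function passes a generator; along a word the shifts add
  up. The additive map \<open>\<pi>\<close> reads the shift off the degree, so that this covers the
  moment map of W (identity) and the left and right moment maps of F (first and second
  component).\<close>

lemma shift_commute:
  fixes u :: "'n::finite mero \<Rightarrow> 'x falg set" and \<pi> :: "'d \<Rightarrow> complex^'n"
  assumes "\<And>f. u f \<in> carrier A" "\<pi> 0 = 0" "\<And>d e. \<pi> (d + e) = \<pi> d + \<pi> e"
    and gen: "\<And>f y. u f \<otimes> cls (fgen y) = cls (fgen y) \<otimes> u (T_shift (\<pi> (deg y)) f)"
    and a: "a \<in> part d"
  shows "u f \<otimes> a = a \<otimes> u (T_shift (\<pi> d) f)"
  using a
proof (induction rule: part_induct)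
  case (add a b)
  then show ?case using part_closed by (simp add: assms(1) r_distr l_distr)
next
  case (single ys c)
  have "u f \<otimes> cls (Poly_Mapping.single (FMon ys) c) =
      cls (Poly_Mapping.single (FMon ys) c) \<otimes> u (T_shift (\<pi> (sum_list (map deg ys))) f)" for f
  proof (induction ys arbitrary: f)
    case Nil
    then show ?case by (simp add: single_Nil assms(1,2) scalar_commute)
  next
    case (Cons y ys)
    have "u f \<otimes> cls (Poly_Mapping.single (FMon (y # ys)) c) =
        (u f \<otimes> cls (fgen y)) \<otimes> cls (Poly_Mapping.single (FMon ys) c)"
      by (simp add: single_Cons m_assoc assms(1) flip: cls_mult)
    also have "\<dots> = cls (fgen y) \<otimes> (u (T_shift (\<pi> (deg y)) f) \<otimes> cls (Poly_Mapping.single (FMon ys) c))"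
      by (simp add: gen m_assoc assms(1))
    also have "\<dots> = cls (Poly_Mapping.single (FMon (y # ys)) c) \<otimes> u (T_shift (\<pi> (sum_list (map deg (y # ys)))) f)"
      by (simp add: Cons.IH single_Cons m_assoc assms(1,3) add.commute flip: cls_mult)
    finally show ?case .
  qed
  then show ?case using single by simp
qed (simp add: assms(1))

text \<open>Existence takes the classes of the homogeneous components of a representative.
  Uniqueness compares two decompositions degree by degree, which is legitimate because the ideal is
  closed under taking components.\<close>

lemma direct_sum_part: "direct_sum A part"
  unfolding direct_sum_def
proof
  fix v assume "v \<in> carrier A"
  then obtain x where x: "v = cls x" by (auto simp: carrier_A)
  define f where "f d = cls (hcomp deg d x)" for d
  have fin: "finite {d. f d \<noteq> \<zero>}"
  proof (rule finite_subset)
    show "finite (mdeg deg ` Poly_Mapping.keys x)" by simp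
    have "hcomp deg d x = 0" if "d \<notin> mdeg deg ` Poly_Mapping.keys x" for d
      using that by (intro poly_mapping_eqI) (auto simp: lookup_hcomp when_def in_keys_iff)
    then show "{d. f d \<noteq> \<zero>} \<subseteq> mdeg deg ` Poly_Mapping.keys x"
      by (auto simp: f_def cls_zero)
  qed
  \<comment> \<open>Nonzero components of \<open>x\<close> may still have class zero, so the sum is
    first taken over all degrees that occur in \<open>x\<close> and then cut down to the nonzero
    classes.\<close>
  have "v = (\<Oplus>d\<in>mdeg deg ` Poly_Mapping.keys x \<union> {d. f d \<noteq> \<zero>}. f d)"
    using fin by (simp add: f_def cls_sum sum_hcomp x)
  also have "\<dots> = (\<Oplus>d\<in>{d. f d \<noteq> \<zero>}. f d)"
    using fin by (intro add.finprod_mono_neutral_cong_right) (auto simp: f_def)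
  finally have sum: "v = (\<Oplus>d\<in>{d. f d \<noteq> \<zero>}. f d)" .
  show "\<exists>!y. (\<forall>d. y d \<in> part d) \<and> finite {d. y d \<noteq> \<zero>} \<and> v = (\<Oplus>d\<in>{d. y d \<noteq> \<zero>}. y d)"
  proof (rule ex1I[of _ f])
    show "(\<forall>d. f d \<in> part d) \<and> finite {d. f d \<noteq> \<zero>} \<and> v = (\<Oplus>d\<in>{d. f d \<noteq> \<zero>}. f d)"
      using fin sum by (auto simp: f_def intro: cls_in_part hcomp_in_homogeneous)
  next
    fix y assume y: "(\<forall>d. y d \<in> part d) \<and> finite {d. y d \<noteq> \<zero>} \<and> v = (\<Oplus>d\<in>{d. y d \<noteq> \<zero>}. y d)"
    have "\<forall>d. \<exists>z. z \<in> homogeneous deg d \<and> y d = cls z" using y by (auto simp: part_def)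
    then obtain z where z: "\<And>d. z d \<in> homogeneous deg d" "y = (\<lambda>d. cls (z d))" by metis
    let ?D = "{d. y d \<noteq> \<zero>}"
    have "finite ?D" using y by blast
    then have "v = cls (\<Sum>d\<in>?D. z d)" using y cls_sum z(2) by auto
    then have I: "(\<Sum>d\<in>?D. z d) - x \<in> I" using x cls_eq_iff by metis
    show "y = f"
    proof
      fix d
      have "hcomp deg d (\<Sum>e\<in>?D. z e) = (\<Sum>e\<in>?D. if e = d then z e else 0)"
        unfolding hcomp_sum by (intro sum.cong) (auto simp: hcomp_homogeneous[OF z(1)])
      also have "\<dots> = (if d \<in> ?D then z d else 0)"
        using \<open>finite ?D\<close> by (simp add: sum.delta)
      finally have "(if d \<in> ?D then z d else 0) - hcomp deg d x \<in> I"
        using hcomp_I[OF I, of d] by (simp add: hcomp_diff)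
      then have "cls (if d \<in> ?D then z d else 0) = f d" by (simp only: f_def cls_eq_iff)
      then show "y d = f d" using z(2) cls_zero by (auto split: if_splits)
    qed
  qed
qed

end

lemma (in presented_algebra) pclass_image: "cls x = (\<lambda>z. z + x) ` I"
  unfolding pclass_def a_r_coset_def' by auto

section \<open>Lifting maps to presented algebras\<close>

text \<open>The complex coefficients of the free algebra enter \<open>B\<close> through its left
  moment map on constants. The assumptions on scalars say that this is a unital ring homomorphism
  into the centre, which is what multiplicativity of \<open>free_lift\<close> rests on.\<close>

locale free_lift_hom =
  fixes B :: "('n::finite, 'b) halg" (structure) and \<phi> :: "'x \<Rightarrow> 'b"
  assumes ring_B: "ring B"
    and \<phi>_closed: "\<phi> y \<in> carrier B"
    and scalar_closed: "mu_l B (mero_const c) \<in> carrier B"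
    and scalar_add: "mu_l B (mero_const (c + d)) = mu_l B (mero_const c) \<oplus> mu_l B (mero_const d)"
    and scalar_mult: "mu_l B (mero_const (c * d)) = mu_l B (mero_const c) \<otimes> mu_l B (mero_const d)"
    and scalar_one: "mu_l B 1 = \<one>"
    and scalar_central: "b \<in> carrier B \<Longrightarrow> mu_l B (mero_const c) \<otimes> b = b \<otimes> mu_l B (mero_const c)"
begin

sublocale ring B by (rule ring_B)

abbreviation word :: "'x list \<Rightarrow> 'b" where
  "word ys \<equiv> foldr (\<lambda>y b. \<phi> y \<otimes> b) ys \<one>"

abbreviation lift where "lift \<equiv> free_lift B \<phi>"

lemma word_closed [simp]: "word ys \<in> carrier B"
  by (induction ys) (simp_all add: \<phi>_closed)

lemma word_append: "word (ys @ zs) = word ys \<otimes> word zs"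
  by (induction ys) (simp_all add: \<phi>_closed m_assoc)

lemma scalar_zero: "mu_l B (mero_const 0) = \<zero>"
  using scalar_add[of 0 0] by (metis add.l_cancel_one' add_0 scalar_closed)

lemma lift_superset:
  assumes "finite K" "Poly_Mapping.keys x \<subseteq> K"
  shows "lift x = (\<Oplus>m\<in>K. mu_l B (mero_const (Poly_Mapping.lookup x m)) \<otimes> word (letters m))"
  unfolding free_lift_def using assms scalar_zero
  by (intro add.finprod_mono_neutral_cong_left)
     (auto simp: scalar_closed in_keys_iff simp del: mero_const_0)

lemma lift_closed [simp]: "lift x \<in> carrier B"
  unfolding free_lift_def by (intro finsum_closed) (auto simp: scalar_closed)

lemma lift_add: "lift (x + y) = lift x \<oplus> lift y"
proof -
  let ?K = "Poly_Mapping.keys x \<union> Poly_Mapping.keys y"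
  have "lift (x + y) = (\<Oplus>m\<in>?K. mu_l B (mero_const (Poly_Mapping.lookup x m)) \<otimes> word (letters m) \<oplus>
     mu_l B (mero_const (Poly_Mapping.lookup y m)) \<otimes> word (letters m))"
    using keys_add[of x y]
    by (subst lift_superset[of ?K])
       (auto simp: lookup_add scalar_add l_distr scalar_closed intro!: finsum_cong')
  also have "\<dots> = lift x \<oplus> lift y"
    by (subst finsum_addf)
       (auto simp: lift_superset[of ?K x] lift_superset[of ?K y] scalar_closed)
  finally show ?thesis .
qed

lemma lift_0 [simp]: "lift 0 = \<zero>"
  by (simp add: free_lift_def)

lemma lift_single: "lift (Poly_Mapping.single m c) = mu_l B (mero_const c) \<otimes> word (letters m)"
  by (subst lift_superset[of "{m}"]) (auto simp: scalar_closed)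

lemma lift_minus: "lift (- x) = \<ominus> lift x"
  by (rule minus_equality[symmetric]) (simp_all flip: lift_add)

lemma lift_diff: "lift (x - y) = lift x \<ominus> lift y"
  using lift_add[of x "- y"] by (simp add: lift_minus a_minus_def)

lemma lift_mult: "lift (x * y) = lift x \<otimes> lift y"
proof (induction x rule: falg_induct)
  case (single_add x m c)
  have "lift (Poly_Mapping.single m c * y) = lift (Poly_Mapping.single m c) \<otimes> lift y"
  proof (induction y rule: falg_induct)
    case (single_add y m' c')
    have "lift (Poly_Mapping.single m c * Poly_Mapping.single m' c') =
       (mu_l B (mero_const c) \<otimes> mu_l B (mero_const c')) \<otimes> (word (letters m) \<otimes> word (letters m'))"
      using word_append by (simp add: mult_single lift_single plus_fmon_def scalar_mult del: foldr_append)
    also have "\<dots> = (mu_l B (mero_const c) \<otimes> (mu_l B (mero_const c') \<otimes> word (letters m))) \<otimes> word (letters m')"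
      by (simp add: m_assoc scalar_closed)
    \<comment> \<open>Centrality takes the scalar of the right factor past the word of the left
      factor.\<close>
    also have "\<dots> = lift (Poly_Mapping.single m c) \<otimes> lift (Poly_Mapping.single m' c')"
      by (subst scalar_central) (simp_all add: m_assoc scalar_closed lift_single)
    finally show ?case using single_add by (simp add: distrib_left lift_add r_distr)
  qed simp
  then show ?case using single_add by (simp add: distrib_right lift_add l_distr)
qed simp

lemma lift_fgen: "lift (fgen y) = \<phi> y"
  by (simp add: fgen_def lift_single scalar_one \<phi>_closed)

lemma lift_fscalar: "lift (fscalar c) = mu_l B (mero_const c)"
  by (simp add: fscalar_def lift_single zero_fmon_def scalar_closed)

lemma lift_one: "lift 1 = \<one>"
  using lift_fscalar[of 1] by (simp add: scalar_one)

lemma lift_sum: "finite J \<Longrightarrow> lift (sum f J) = (\<Oplus>j\<in>J. lift (f j))"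
  by (induction J rule: finite_induct) (simp_all add: lift_add Pi_def)

text \<open>The grading \<open>G\<close> is a parameter and not the field \<open>bigrade\<close> of
  \<open>B\<close>, since one of the targets is an auxiliary record with a dummy bigrading, while
  the grading that matters there is indexed by single degrees.\<close>

lemma lift_homogeneous:
  assumes "x \<in> homogeneous deg d"
    and "\<And>d. \<zero> \<in> G d"
    and "\<And>d a b. a \<in> G d \<Longrightarrow> b \<in> G d \<Longrightarrow> a \<oplus> b \<in> G d"
    and "\<And>d e a b. a \<in> G d \<Longrightarrow> b \<in> G e \<Longrightarrow> a \<otimes> b \<in> G (d + e)"
    and "\<one> \<in> G 0" "\<And>c. mu_l B (mero_const c) \<in> G 0" "\<And>y. \<phi> y \<in> G (deg y)"
  shows "lift x \<in> G d"
  using assms(1)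
proof (induction rule: homogeneous_induct)
  case (add_single x m c)
  have "word ys \<in> G (sum_list (map deg ys))" for ys
    by (induction ys) (simp_all add: assms(4,5,7))
  from assms(4)[OF assms(6) this, of c "letters m"] show ?case
    using add_single assms(3)[of "lift x" d] by (simp add: lift_add lift_single mdeg_def)
qed (simp add: assms(2))

text \<open>The kernel of the lift is an ideal. Once it contains the relations it contains the ideal
  they generate, so the lift is constant on each coset and \<open>the_elem\<close> is applied to a
  singleton.\<close>

lemma presented_lift_class:
  assumes "\<And>s. s \<in> S \<Longrightarrow> lift s = \<zero>"
  shows "presented_lift B \<phi> (pclass S x) = lift x"
proof -
  interpret Q: presented_algebra S "presented S" by (rule presented_algebra.intro) (rule refl)+
  have sub: "Q.I \<subseteq> {x. lift x = \<zero>}"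
  proof (rule Q.I_minimal)
    show "S \<subseteq> {x. lift x = \<zero>}" using assms by blast
  qed (simp_all add: lift_mult lift_diff a_minus_def)
  have "lift y = lift x" if y: "y \<in> pclass S x" for y
  proof -
    obtain z where z: "z \<in> Q.I" "y = z + x" using y unfolding Q.pclass_image by blast
    then have "lift z = \<zero>" using sub by blast
    then show ?thesis by (simp add: z(2) lift_add)
  qed
  moreover have "x \<in> pclass S x"
    unfolding Q.pclass_image by (rule image_eqI[OF _ Q.I_0]) simp
  ultimately have "lift ` pclass S x = {lift x}" by blast
  then show ?thesis by (simp add: presented_lift_def)
qed

end

section \<open>Tensor products\<close>

lemma frag_extend_diff_fun: "frag_extend (\<lambda>p. f p - g p) x = frag_extend f x - frag_extend g x"
  using subset_UNIV[of "Poly_Mapping.keys x"]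
  by (induction x rule: frag_induction) (simp_all add: frag_extend_diff)

lemma frag_add_induct [consumes 1, case_names zero one minus add]:
  assumes "Poly_Mapping.keys c \<subseteq> S" "P 0" "\<And>x. x \<in> S \<Longrightarrow> P (frag_of x)"
    and "\<And>a. P a \<Longrightarrow> P (- a)" "\<And>a b. P a \<Longrightarrow> P b \<Longrightarrow> P (a + b)"
  shows "P c"
  using assms(1)
proof (induction c rule: frag_induction)
  case (diff a b)
  then show ?case using assms(4,5)[of b] assms(5)[of a "- b"] by simp
qed (use assms in auto)

text \<open>The expression inside \<open>tlift\<close>, kept for arbitrary elements of the free
  abelian group so that additivity can be proved before passing to cosets.\<close>

definition frag_eval :: "('c, 'r) ring_scheme \<Rightarrow> ('p \<Rightarrow> 'c) \<Rightarrow> ('p \<Rightarrow>\<^sub>0 int) \<Rightarrow> 'c" where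
  "frag_eval G \<phi> x = (\<Oplus>\<^bsub>G\<^esub>p\<in>Poly_Mapping.keys x. [Poly_Mapping.lookup x p] \<cdot>\<^bsub>G\<^esub> \<phi> p)"

context abelian_group
begin

lemma add_pow_int_closed [simp]: "a \<in> carrier G \<Longrightarrow> [(k :: int)] \<cdot> a \<in> carrier G"
  using add.int_pow_closed[of a k] by (simp add: add_pow_def)

lemma add_pow_int_add: "a \<in> carrier G \<Longrightarrow> [(k + l :: int)] \<cdot> a = [k] \<cdot> a \<oplus> [l] \<cdot> a"
  using add.int_pow_mult[of a k l] by (simp add: add_pow_def)

lemma add_pow_int_0 [simp]: "[(0 :: int)] \<cdot> a = \<zero>"
  by (simp add: add_pow_def int_pow_def nat_pow_def)

lemma add_pow_int_1 [simp]: "a \<in> carrier G \<Longrightarrow> [(1 :: int)] \<cdot> a = a"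
  using add.int_pow_1[of a] by (simp add: add_pow_def)

lemma frag_eval_superset:
  assumes "finite K" "Poly_Mapping.keys x \<subseteq> K" "\<phi> \<in> K \<rightarrow> carrier G"
  shows "frag_eval G \<phi> x = (\<Oplus>p\<in>K. [Poly_Mapping.lookup x p] \<cdot> \<phi> p)"
  unfolding frag_eval_def using assms
  by (intro add.finprod_mono_neutral_cong_left) (auto simp: in_keys_iff Pi_def)

lemma frag_eval_closed: "Poly_Mapping.keys x \<subseteq> S \<Longrightarrow> \<phi> \<in> S \<rightarrow> carrier G \<Longrightarrow> frag_eval G \<phi> x \<in> carrier G"
  unfolding frag_eval_def by (intro finsum_closed) auto

lemma frag_eval_add:
  assumes "Poly_Mapping.keys x \<subseteq> S" "Poly_Mapping.keys y \<subseteq> S" "\<phi> \<in> S \<rightarrow> carrier G"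
  shows "frag_eval G \<phi> (x + y) = frag_eval G \<phi> x \<oplus> frag_eval G \<phi> y"
proof -
  let ?K = "Poly_Mapping.keys x \<union> Poly_Mapping.keys y"
  have K: "\<phi> \<in> ?K \<rightarrow> carrier G" using assms by auto
  have "frag_eval G \<phi> (x + y) =
      (\<Oplus>p\<in>?K. [Poly_Mapping.lookup x p] \<cdot> \<phi> p \<oplus> [Poly_Mapping.lookup y p] \<cdot> \<phi> p)"
  proof (subst frag_eval_superset[of ?K])
    show "(\<Oplus>p\<in>?K. [Poly_Mapping.lookup (x + y) p] \<cdot> \<phi> p) =
        (\<Oplus>p\<in>?K. [Poly_Mapping.lookup x p] \<cdot> \<phi> p \<oplus> [Poly_Mapping.lookup y p] \<cdot> \<phi> p)"
      using K by (intro finsum_cong') (auto simp: lookup_add add_pow_int_add Pi_def)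
  qed (use K keys_add[of x y] in auto)
  also have "\<dots> = frag_eval G \<phi> x \<oplus> frag_eval G \<phi> y"
    using K by (subst finsum_addf) (auto simp: frag_eval_superset[of ?K x] frag_eval_superset[of ?K y] Pi_def)
  finally show ?thesis .
qed

lemma frag_eval_0 [simp]: "frag_eval G \<phi> 0 = \<zero>"
  by (simp add: frag_eval_def)

lemma frag_eval_of: "\<phi> p \<in> carrier G \<Longrightarrow> frag_eval G \<phi> (frag_of p) = \<phi> p"
  by (simp add: frag_eval_def)

lemma frag_eval_diff:
  assumes "Poly_Mapping.keys x \<subseteq> S" "Poly_Mapping.keys y \<subseteq> S" "\<phi> \<in> S \<rightarrow> carrier G"
  shows "frag_eval G \<phi> (x - y) = frag_eval G \<phi> x \<ominus> frag_eval G \<phi> y"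
proof -
  have "Poly_Mapping.keys (x - y) \<subseteq> S" using keys_diff[of x y] assms by blast
  from frag_eval_add[OF this assms(2,3)]
  have "frag_eval G \<phi> x = frag_eval G \<phi> (x - y) \<oplus> frag_eval G \<phi> y" by simp
  moreover have "frag_eval G \<phi> (x - y) \<in> carrier G" "frag_eval G \<phi> y \<in> carrier G"
    using frag_eval_closed assms \<open>Poly_Mapping.keys (x - y) \<subseteq> S\<close> by blast+
  ultimately show ?thesis by (simp add: a_minus_def a_assoc r_neg)
qed

lemma add_minus_minus: "a \<in> carrier G \<Longrightarrow> b \<in> carrier G \<Longrightarrow> a \<oplus> b \<ominus> a \<ominus> b = \<zero>"
  by (simp add: a_minus_def a_assoc r_neg minus_add[symmetric] a_comm[of "\<ominus> a"]) (metis a_assoc a_inv_closed minus_add add.m_closed r_neg)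

end

text \<open>Closure of the components under addition and scalars is all that the quotient group
  needs. It is easy to check for iterated tensor products, whose factors are themselves
  quotients.\<close>

locale tensor_product =
  fixes V :: "('m, 'v, 'r) module_scheme" and W :: "('m, 'w, 's) module_scheme"
    and Cs :: "('v set \<times> 'w set) set" and T :: "(('v, 'w) ten, 't) ring_scheme" (structure)
  assumes T_fields: "carrier T = carrier (tring V W Cs)" "ring.add T = ring.add (tring V W Cs)"
      "ring.zero T = ring.zero (tring V W Cs)"
    and closed: "(X, Y) \<in> Cs \<Longrightarrow> v \<in> X \<Longrightarrow> v' \<in> X \<Longrightarrow> v \<oplus>\<^bsub>V\<^esub> v' \<in> X"
      "(X, Y) \<in> Cs \<Longrightarrow> w \<in> Y \<Longrightarrow> w' \<in> Y \<Longrightarrow> w \<oplus>\<^bsub>W\<^esub> w' \<in> Y"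
      "(X, Y) \<in> Cs \<Longrightarrow> v \<in> X \<Longrightarrow> f \<odot>\<^bsub>V\<^esub> v \<in> X"
      "(X, Y) \<in> Cs \<Longrightarrow> w \<in> Y \<Longrightarrow> f \<odot>\<^bsub>W\<^esub> w \<in> Y"
begin

abbreviation pairs where "pairs \<equiv> tpairs Cs"
abbreviation null where "null \<equiv> tnull V W Cs"
abbreviation cl where "cl \<equiv> tclass V W Cs"
abbreviation pure where "pure \<equiv> tpure V W Cs"

lemma pairsI: "(X, Y) \<in> Cs \<Longrightarrow> v \<in> X \<Longrightarrow> w \<in> Y \<Longrightarrow> (v, w) \<in> pairs"
  by (auto simp: tpairs_def)

lemma pairsE:
  assumes "(v, w) \<in> pairs"
  obtains X Y where "(X, Y) \<in> Cs" "v \<in> X" "w \<in> Y"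
  using assms by (auto simp: tpairs_def)

lemma trels_cases [consumes 1, case_names left right balanced]:
  assumes "r \<in> trels V W Cs"
    and "\<And>X Y v v' w. (X, Y) \<in> Cs \<Longrightarrow> v \<in> X \<Longrightarrow> v' \<in> X \<Longrightarrow> w \<in> Y \<Longrightarrow>
      Q (frag_of (v \<oplus>\<^bsub>V\<^esub> v', w) - frag_of (v, w) - frag_of (v', w))"
    and "\<And>X Y v w w'. (X, Y) \<in> Cs \<Longrightarrow> v \<in> X \<Longrightarrow> w \<in> Y \<Longrightarrow> w' \<in> Y \<Longrightarrow>
      Q (frag_of (v, w \<oplus>\<^bsub>W\<^esub> w') - frag_of (v, w) - frag_of (v, w'))"
    and "\<And>X Y f v w. (X, Y) \<in> Cs \<Longrightarrow> v \<in> X \<Longrightarrow> w \<in> Y \<Longrightarrow>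
      Q (frag_of (f \<odot>\<^bsub>V\<^esub> v, w) - frag_of (v, f \<odot>\<^bsub>W\<^esub> w))"
  shows "Q r"
  using assms unfolding trels_def by blast

lemma trels_left:
  "(X, Y) \<in> Cs \<Longrightarrow> v \<in> X \<Longrightarrow> v' \<in> X \<Longrightarrow> w \<in> Y \<Longrightarrow>
    frag_of (v \<oplus>\<^bsub>V\<^esub> v', w) - frag_of (v, w) - frag_of (v', w) \<in> trels V W Cs"
  unfolding trels_def by blast

lemma trels_right:
  "(X, Y) \<in> Cs \<Longrightarrow> v \<in> X \<Longrightarrow> w \<in> Y \<Longrightarrow> w' \<in> Y \<Longrightarrow>
    frag_of (v, w \<oplus>\<^bsub>W\<^esub> w') - frag_of (v, w) - frag_of (v, w') \<in> trels V W Cs"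
  unfolding trels_def by blast

lemma trels_balanced:
  "(X, Y) \<in> Cs \<Longrightarrow> v \<in> X \<Longrightarrow> w \<in> Y \<Longrightarrow>
    frag_of (f \<odot>\<^bsub>V\<^esub> v, w) - frag_of (v, f \<odot>\<^bsub>W\<^esub> w) \<in> trels V W Cs"
  unfolding trels_def by blast

lemma keys_diff_subset:
  "Poly_Mapping.keys x \<subseteq> D \<Longrightarrow> Poly_Mapping.keys y \<subseteq> D \<Longrightarrow> Poly_Mapping.keys (x - y :: 'p \<Rightarrow>\<^sub>0 int) \<subseteq> D"
  using keys_diff[of x y] by blast

lemma trels_keys: "r \<in> trels V W Cs \<Longrightarrow> Poly_Mapping.keys r \<subseteq> pairs"
proof (induction rule: trels_cases)
  case (left X Y v v' w)
  then show ?case using pairsI[OF left(1)] closed(1)[OF left(1)] by (simp add: keys_diff_subset)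
next
  case (right X Y v w w')
  then show ?case using pairsI[OF right(1)] closed(2)[OF right(1)] by (simp add: keys_diff_subset)
next
  case (balanced X Y f v w)
  then show ?case using pairsI[OF balanced(1)] closed(3,4)[OF balanced(1)] by (simp add: keys_diff_subset)
qed

lemma subgroup_null: "subgroup null (free_Abelian_group pairs)"
  unfolding tnull_def using trels_keys by (intro group.generate_is_subgroup) auto

lemma null_keys: "x \<in> null \<Longrightarrow> Poly_Mapping.keys x \<subseteq> pairs"
  using subgroup.mem_carrier[OF subgroup_null, of x] by simp

lemma null_0: "0 \<in> null"
  using subgroup.one_closed[OF subgroup_null] by simp

lemma null_add: "x \<in> null \<Longrightarrow> y \<in> null \<Longrightarrow> x + y \<in> null"
  using subgroup.m_closed[OF subgroup_null] by simp

lemma null_minus: "x \<in> null \<Longrightarrow> - x \<in> null"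
  using subgroup.m_inv_closed[OF subgroup_null, of x] null_keys by simp

lemma null_diff: "x \<in> null \<Longrightarrow> y \<in> null \<Longrightarrow> x - y \<in> null"
  using null_add[of x "- y"] null_minus by simp

lemma null_rel: "r \<in> trels V W Cs \<Longrightarrow> r \<in> null"
  unfolding tnull_def by (rule generate.incl)

lemma null_induct [consumes 1, case_names zero rel minus add]:
  assumes "x \<in> null" "Q 0" "\<And>r. r \<in> trels V W Cs \<Longrightarrow> Q r"
    "\<And>x. x \<in> null \<Longrightarrow> Q x \<Longrightarrow> Q (- x)"
    "\<And>x y. x \<in> null \<Longrightarrow> y \<in> null \<Longrightarrow> Q x \<Longrightarrow> Q y \<Longrightarrow> Q (x + y)"
  shows "Q x"
  using assms(1) unfolding tnull_def
proof (induction rule: generate.induct)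
  case (inv h)
  then show ?case using assms(3,4) trels_keys null_rel by simp
next
  case (eng h1 h2)
  then show ?case using assms(5) by (simp add: tnull_def)
qed (use assms in auto)

lemma cl_image: "cl x = (\<lambda>z. z + x) ` null"
  by (auto simp: tclass_def r_coset_def)

lemma in_cl_iff: "y \<in> cl x \<longleftrightarrow> y - x \<in> null"
  by (auto simp: cl_image image_iff algebra_simps) (metis add_diff_cancel_left' diff_add_cancel)

lemma self_in_cl: "x \<in> cl x"
  using null_0 by (simp add: in_cl_iff)

lemma cl_eq_iff: "cl x = cl y \<longleftrightarrow> x - y \<in> null"
proof
  assume "cl x = cl y"
  then show "x - y \<in> null" using self_in_cl[of x] by (simp add: in_cl_iff)
next
  assume *: "x - y \<in> null"
  have "z - x \<in> null \<longleftrightarrow> z - y \<in> null" for z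
    using null_add[OF _ *, of "z - x"] null_diff[OF _ *, of "z - y"] by auto
  then show "cl x = cl y" by (auto simp: in_cl_iff)
qed

lemma carrier_T: "carrier T = cl ` {x. Poly_Mapping.keys x \<subseteq> pairs}"
  by (auto simp: T_fields tring_def Let_def FactGroup_def RCOSETS_def tclass_def)

lemma carrierE:
  assumes "X \<in> carrier T"
  obtains x where "X = cl x" "Poly_Mapping.keys x \<subseteq> pairs"
  using assms by (auto simp: carrier_T)

lemma cl_closed: "Poly_Mapping.keys x \<subseteq> pairs \<Longrightarrow> cl x \<in> carrier T"
  by (simp add: carrier_T)

lemma cl_add: "cl x \<oplus> cl y = cl (x + y)"
proof -
  have "cl x \<oplus> cl y = (\<Union>a\<in>cl x. \<Union>b\<in>cl y. {a + b})"
    by (simp add: T_fields tring_def Let_def FactGroup_def set_mult_def)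
  also have "\<dots> = cl (x + y)"
  proof
    show "(\<Union>a\<in>cl x. \<Union>b\<in>cl y. {a + b}) \<subseteq> cl (x + y)"
      using null_add by (fastforce simp: in_cl_iff add_diff_add)
    show "cl (x + y) \<subseteq> (\<Union>a\<in>cl x. \<Union>b\<in>cl y. {a + b})"
    proof
      fix z assume "z \<in> cl (x + y)"
      then have "z - y \<in> cl x" by (simp add: in_cl_iff algebra_simps)
      then show "z \<in> (\<Union>a\<in>cl x. \<Union>b\<in>cl y. {a + b})"
        using self_in_cl[of y] by (intro UN_I[of "z - y"] UN_I[of y]) auto
    qed
  qed
  finally show ?thesis .
qed

lemma zero_T: "\<zero> = cl 0"
  by (auto simp: T_fields tring_def Let_def FactGroup_def cl_image)

lemma abelian_group_T: "abelian_group T"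
proof (rule abelian_groupI)
  fix x y z assume "x \<in> carrier T" "y \<in> carrier T" "z \<in> carrier T"
  then obtain x' y' z' where *: "x = cl x'" "Poly_Mapping.keys x' \<subseteq> pairs"
      "y = cl y'" "Poly_Mapping.keys y' \<subseteq> pairs" "z = cl z'" by (elim carrierE)
  have "Poly_Mapping.keys (x' + y') \<subseteq> pairs" using * keys_add[of x' y'] by blast
  then show "x \<oplus> y \<in> carrier T" by (simp add: * cl_add cl_closed)
  show "x \<oplus> y \<oplus> z = x \<oplus> (y \<oplus> z)" "x \<oplus> y = y \<oplus> x" "\<zero> \<oplus> x = x"
    by (simp_all add: * cl_add zero_T add_ac)
  show "\<exists>y\<in>carrier T. y \<oplus> x = \<zero>"
    using * by (intro bexI[of _ "cl (- x')"]) (simp_all add: cl_add zero_T cl_closed)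
qed (simp add: zero_T cl_closed)

sublocale abelian_group T by (rule abelian_group_T)

lemma cl_minus: "Poly_Mapping.keys x \<subseteq> pairs \<Longrightarrow> \<ominus> cl x = cl (- x)"
  by (rule minus_equality) (simp_all add: cl_add zero_T cl_closed)

lemma pure_pairs: "(v, w) \<in> pairs \<Longrightarrow> pure v w = cl (frag_of (v, w))"
  by (simp add: tpure_def)

lemma pure_closed [simp]: "pure v w \<in> carrier T"
  by (simp add: tpure_def cl_closed)

lemma pure_unmatched: "(v, w) \<notin> pairs \<Longrightarrow> pure v w = \<zero>"
  by (simp add: tpure_def zero_T)

lemma pure_add_left:
  assumes "(X, Y) \<in> Cs" "v \<in> X" "v' \<in> X" "w \<in> Y"
  shows "pure (v \<oplus>\<^bsub>V\<^esub> v') w = pure v w \<oplus> pure v' w"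
proof -
  have "frag_of (v \<oplus>\<^bsub>V\<^esub> v', w) - frag_of (v, w) - frag_of (v', w) \<in> null"
    using assms by (intro null_rel trels_left trels_right trels_balanced)
  then show ?thesis
    using assms closed(1)[OF assms(1)] by (simp add: pure_pairs pairsI cl_add cl_eq_iff diff_diff_add)
qed

lemma pure_add_right:
  assumes "(X, Y) \<in> Cs" "v \<in> X" "w \<in> Y" "w' \<in> Y"
  shows "pure v (w \<oplus>\<^bsub>W\<^esub> w') = pure v w \<oplus> pure v w'"
proof -
  have "frag_of (v, w \<oplus>\<^bsub>W\<^esub> w') - frag_of (v, w) - frag_of (v, w') \<in> null"
    using assms by (intro null_rel trels_left trels_right trels_balanced)
  then show ?thesis
    using assms closed(2)[OF assms(1)] by (simp add: pure_pairs pairsI cl_add cl_eq_iff diff_diff_add)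
qed

lemma pure_balanced:
  assumes "(X, Y) \<in> Cs" "v \<in> X" "w \<in> Y"
  shows "pure (f \<odot>\<^bsub>V\<^esub> v) w = pure v (f \<odot>\<^bsub>W\<^esub> w)"
proof -
  have "frag_of (f \<odot>\<^bsub>V\<^esub> v, w) - frag_of (v, f \<odot>\<^bsub>W\<^esub> w) \<in> null"
    using assms by (intro null_rel trels_left trels_right trels_balanced)
  then show ?thesis
    using assms closed(3,4)[OF assms(1)] by (simp add: pure_pairs pairsI cl_eq_iff)
qed

text \<open>Biadditivity makes the tensor equal to its own double, hence zero in the group
  \<open>T\<close>; a pair of mismatched degrees is zero by the convention in \<open>tpure\<close>.
  The assumption stands in for group axioms on \<open>V\<close>.\<close>

lemma pure_zero_left:
  assumes "\<zero>\<^bsub>V\<^esub> \<oplus>\<^bsub>V\<^esub> \<zero>\<^bsub>V\<^esub> = \<zero>\<^bsub>V\<^esub>"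
  shows "pure \<zero>\<^bsub>V\<^esub> w = \<zero>"
proof (cases "(\<zero>\<^bsub>V\<^esub>, w) \<in> pairs")
  case True
  then obtain X Y where "(X, Y) \<in> Cs" "\<zero>\<^bsub>V\<^esub> \<in> X" "w \<in> Y" by (rule pairsE)
  from pure_add_left[OF this(1,2,2,3)] show ?thesis
    using assms by (metis add.l_cancel_one' pure_closed)
qed (rule pure_unmatched)

lemma pure_zero_right:
  assumes "\<zero>\<^bsub>W\<^esub> \<oplus>\<^bsub>W\<^esub> \<zero>\<^bsub>W\<^esub> = \<zero>\<^bsub>W\<^esub>"
  shows "pure v \<zero>\<^bsub>W\<^esub> = \<zero>"
proof (cases "(v, \<zero>\<^bsub>W\<^esub>) \<in> pairs")
  case True
  then obtain X Y where "(X, Y) \<in> Cs" "v \<in> X" "\<zero>\<^bsub>W\<^esub> \<in> Y" by (rule pairsE)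
  from pure_add_right[OF this(1,2,3,3)] show ?thesis
    using assms by (metis add.l_cancel_one' pure_closed)
qed (rule pure_unmatched)

text \<open>For \<open>D\<close> consisting of matching pairs, the additive subgroup generated by
  the pure tensors from \<open>D\<close>. The homogeneous components of \<open>hten\<close> and
  \<open>aten\<close> have this form.\<close>

definition tspan :: "('v \<times> 'w) set \<Rightarrow> ('v, 'w) ten set" where
  "tspan D = cl ` {x. Poly_Mapping.keys x \<subseteq> D}"

lemma tspan_pairs: "tspan pairs = carrier T"
  by (simp add: tspan_def carrier_T)

lemma tspan_closed: "D \<subseteq> pairs \<Longrightarrow> X \<in> tspan D \<Longrightarrow> X \<in> carrier T"
  by (auto simp: tspan_def intro!: cl_closed)

lemma tspan_zero: "\<zero> \<in> tspan D"
  by (auto simp: tspan_def zero_T)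

lemma tspan_add: "X \<in> tspan D \<Longrightarrow> Y \<in> tspan D \<Longrightarrow> X \<oplus> Y \<in> tspan D"
  unfolding tspan_def using keys_add by (fastforce simp: cl_add)

lemma tspan_minus: "D \<subseteq> pairs \<Longrightarrow> X \<in> tspan D \<Longrightarrow> \<ominus> X \<in> tspan D"
  unfolding tspan_def by (auto simp: cl_minus)

lemma pure_in_tspan: "(v, w) \<in> D \<Longrightarrow> D \<subseteq> pairs \<Longrightarrow> pure v w \<in> tspan D"
  by (auto simp: tspan_def pure_pairs subset_iff)

lemma tspan_induct [consumes 2, case_names zero pure minus add]:
  assumes "X \<in> tspan D" "D \<subseteq> pairs" "Q \<zero>" "\<And>v w. (v, w) \<in> D \<Longrightarrow> Q (pure v w)"
    and "\<And>X. X \<in> tspan D \<Longrightarrow> Q X \<Longrightarrow> Q (\<ominus> X)"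
    and "\<And>X Y. X \<in> tspan D \<Longrightarrow> Y \<in> tspan D \<Longrightarrow> Q X \<Longrightarrow> Q Y \<Longrightarrow> Q (X \<oplus> Y)"
  shows "Q X"
proof -
  obtain x where x: "X = cl x" "Poly_Mapping.keys x \<subseteq> D" using assms(1) by (auto simp: tspan_def)
  from x(2) have "Poly_Mapping.keys x \<subseteq> D \<and> Q (cl x)"
  proof (induction x rule: frag_add_induct)
    case zero
    then show ?case using assms(3) by (simp add: zero_T)
  next
    case (one p)
    then show ?case using assms(2) assms(4)[of "fst p" "snd p"] pure_pairs[of "fst p" "snd p"] by auto
  next
    case (minus a)
    then show ?case using assms(2) assms(5)[of "cl a"] by (auto simp: cl_minus tspan_def)
  next
    case (add a b)
    then show ?case using keys_add[of a b] assms(6)[of "cl a" "cl b"] by (auto simp: cl_add tspan_def)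
  qed
  then show ?thesis by (simp add: x)
qed

end

text \<open>The universal property of the tensor product, with additivity and balancing of
  \<open>\<phi>\<close> stated on each matching pair of components: the pairs inside these are the
  generators.\<close>

locale tensor_lift = tensor_product V W Cs T + G: abelian_group G
  for V :: "('m, 'v, 'r) module_scheme" and W :: "('m, 'w, 's) module_scheme"
    and Cs and T :: "(('v, 'w) ten, 't) ring_scheme" (structure) and G :: "('c, 'g) ring_scheme" +
  fixes \<phi> :: "'v \<Rightarrow> 'w \<Rightarrow> 'c"
  assumes \<phi>_closed: "(X, Y) \<in> Cs \<Longrightarrow> v \<in> X \<Longrightarrow> w \<in> Y \<Longrightarrow> \<phi> v w \<in> carrier G"
    and \<phi>_add_left: "(X, Y) \<in> Cs \<Longrightarrow> v \<in> X \<Longrightarrow> v' \<in> X \<Longrightarrow> w \<in> Y \<Longrightarrow>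
      \<phi> (v \<oplus>\<^bsub>V\<^esub> v') w = \<phi> v w \<oplus>\<^bsub>G\<^esub> \<phi> v' w"
    and \<phi>_add_right: "(X, Y) \<in> Cs \<Longrightarrow> v \<in> X \<Longrightarrow> w \<in> Y \<Longrightarrow> w' \<in> Y \<Longrightarrow>
      \<phi> v (w \<oplus>\<^bsub>W\<^esub> w') = \<phi> v w \<oplus>\<^bsub>G\<^esub> \<phi> v w'"
    and \<phi>_balanced: "(X, Y) \<in> Cs \<Longrightarrow> v \<in> X \<Longrightarrow> w \<in> Y \<Longrightarrow> \<phi> (f \<odot>\<^bsub>V\<^esub> v) w = \<phi> v (f \<odot>\<^bsub>W\<^esub> w)"
begin

abbreviation ev where "ev \<equiv> frag_eval G (\<lambda>p. \<phi> (fst p) (snd p))"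

lemma ev_Pi: "(\<lambda>p. \<phi> (fst p) (snd p)) \<in> pairs \<rightarrow> carrier G"
  by (auto elim!: pairsE intro: \<phi>_closed)

lemmas ev_diff = G.frag_eval_diff[OF _ _ ev_Pi]
lemmas ev_add = G.frag_eval_add[OF _ _ ev_Pi]
lemmas ev_closed = G.frag_eval_closed[OF _ ev_Pi]

lemma ev_of: "(v, w) \<in> pairs \<Longrightarrow> ev (frag_of (v, w)) = \<phi> v w"
  using funcset_mem[OF ev_Pi, of "(v, w)"] by (simp add: G.frag_eval_of)

lemma ev_rel: "r \<in> trels V W Cs \<Longrightarrow> ev r = \<zero>\<^bsub>G\<^esub>"
proof (induction rule: trels_cases)
  case (left X Y v v' w)
  note * = pairsI[OF left(1)] left closed(1)[OF left(1)]
  show ?case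
    by (simp add: ev_diff keys_diff_subset * ev_of \<phi>_add_left[OF left] \<phi>_closed[OF left(1)] G.add_minus_minus)
next
  case (right X Y v w w')
  note * = pairsI[OF right(1)] right closed(2)[OF right(1)]
  show ?case
    by (simp add: ev_diff keys_diff_subset * ev_of \<phi>_add_right[OF right] \<phi>_closed[OF right(1)] G.add_minus_minus)
next
  case (balanced X Y f v w)
  note * = pairsI[OF balanced(1)] balanced closed(3,4)[OF balanced(1)]
  show ?case
    by (simp add: ev_diff * ev_of \<phi>_balanced[OF balanced] \<phi>_closed[OF balanced(1)] G.r_neg a_minus_def)
qed

lemma ev_null: "x \<in> null \<Longrightarrow> ev x = \<zero>\<^bsub>G\<^esub>"
proof (induction rule: null_induct)
  case (minus x)
  then show ?case using ev_diff[of 0 x] null_keys by (simp add: a_minus_def)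
next
  case (add x y)
  then show ?case using ev_add[of x y] null_keys by simp
qed (simp_all add: ev_rel)

lemma tlift_cl:
  assumes "Poly_Mapping.keys x \<subseteq> pairs"
  shows "tlift G \<phi> (cl x) = ev x"
proof -
  have "ev y = ev x" if y: "y \<in> cl x" for y
  proof -
    obtain z where z: "z \<in> null" "y = z + x" using y unfolding cl_image by blast
    then show ?thesis using ev_add[OF null_keys[OF z(1)] assms] ev_null[OF z(1)] ev_closed[OF assms] by simp
  qed
  then have "ev ` cl x = {ev x}" using self_in_cl by blast
  then show ?thesis unfolding tlift_def frag_eval_def by simp
qed

lemma tlift_closed: "X \<in> carrier T \<Longrightarrow> tlift G \<phi> X \<in> carrier G"
  by (elim carrierE) (simp add: tlift_cl ev_closed)

lemma tlift_add: "X \<in> carrier T \<Longrightarrow> Y \<in> carrier T \<Longrightarrow> tlift G \<phi> (X \<oplus> Y) = tlift G \<phi> X \<oplus>\<^bsub>G\<^esub> tlift G \<phi> Y"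
proof (elim carrierE, hypsubst)
  fix x y :: "'v \<times> 'w \<Rightarrow>\<^sub>0 int"
  assume *: "Poly_Mapping.keys x \<subseteq> pairs" "Poly_Mapping.keys y \<subseteq> pairs"
  then have "Poly_Mapping.keys (x + y) \<subseteq> pairs" using keys_add[of x y] by blast
  then show "tlift G \<phi> (cl x \<oplus> cl y) = tlift G \<phi> (cl x) \<oplus>\<^bsub>G\<^esub> tlift G \<phi> (cl y)"
    using * by (simp add: cl_add tlift_cl ev_add)
qed

lemma tlift_zero: "tlift G \<phi> \<zero> = \<zero>\<^bsub>G\<^esub>"
  by (simp add: zero_T tlift_cl)

lemma tlift_minus: "X \<in> carrier T \<Longrightarrow> tlift G \<phi> (\<ominus> X) = \<ominus>\<^bsub>G\<^esub> tlift G \<phi> X"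
  using tlift_add[of X "\<ominus> X"] tlift_closed
  by (intro G.minus_equality[symmetric]) (simp_all add: r_neg tlift_zero G.a_comm)

lemma tlift_pure: "(v, w) \<in> pairs \<Longrightarrow> tlift G \<phi> (pure v w) = \<phi> v w"
  by (simp add: pure_pairs tlift_cl ev_of)

lemma tlift_finsum:
  "finite J \<Longrightarrow> (\<And>j. j \<in> J \<Longrightarrow> f j \<in> carrier T) \<Longrightarrow> tlift G \<phi> (\<Oplus>j\<in>J. f j) = (\<Oplus>\<^bsub>G\<^esub>j\<in>J. tlift G \<phi> (f j))"
  by (induction J rule: finite_induct) (simp_all add: tlift_zero tlift_add tlift_closed Pi_def)

end

text \<open>Scalars do not commute with the products of \<open>V\<close> and \<open>W\<close>. The
  product of tensors is still well defined, because by \<open>mult_smult\<close> a scalar can be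
  pulled out of a right-hand factor, in \<open>V\<close> and in \<open>W\<close> alike, at the cost
  of the same replacement \<open>f'\<close>. For h-algebras \<open>f'\<close> is \<open>f\<close>
  shifted by the negative of the degree that the two entries of the left-hand tensor share.\<close>

locale tensor_ring = tensor_product V W Cs T + V: ring V + W: ring W
  for V :: "('m, 'v, 'r) module_scheme" and W :: "('m, 'w, 's) module_scheme"
    and Cs and T :: "(('v, 'w) ten, 't) ring_scheme" (structure) +
  assumes T_mult: "monoid.mult T = monoid.mult (tring V W Cs)" and T_one: "one T = one (tring V W Cs)"
    and components: "(X, Y) \<in> Cs \<Longrightarrow> X \<subseteq> carrier V" "(X, Y) \<in> Cs \<Longrightarrow> Y \<subseteq> carrier W"
    and mult_component: "(X, Y) \<in> Cs \<Longrightarrow> (X', Y') \<in> Cs \<Longrightarrow> \<exists>X'' Y''. (X'', Y'') \<in> Cs \<and>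
      (\<forall>v\<in>X. \<forall>v'\<in>X'. v \<otimes>\<^bsub>V\<^esub> v' \<in> X'') \<and> (\<forall>w\<in>Y. \<forall>w'\<in>Y'. w \<otimes>\<^bsub>W\<^esub> w' \<in> Y'')"
    and one_pairs: "(\<one>\<^bsub>V\<^esub>, \<one>\<^bsub>W\<^esub>) \<in> tpairs Cs"
    and smult_mult: "v \<in> carrier V \<Longrightarrow> v' \<in> carrier V \<Longrightarrow> (f \<odot>\<^bsub>V\<^esub> v) \<otimes>\<^bsub>V\<^esub> v' = f \<odot>\<^bsub>V\<^esub> (v \<otimes>\<^bsub>V\<^esub> v')"
      "w \<in> carrier W \<Longrightarrow> w' \<in> carrier W \<Longrightarrow> (f \<odot>\<^bsub>W\<^esub> w) \<otimes>\<^bsub>W\<^esub> w' = f \<odot>\<^bsub>W\<^esub> (w \<otimes>\<^bsub>W\<^esub> w')"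
    and mult_smult: "(X, Y) \<in> Cs \<Longrightarrow> \<exists>f'.
      (\<forall>v\<in>X. \<forall>v'\<in>carrier V. v \<otimes>\<^bsub>V\<^esub> (f \<odot>\<^bsub>V\<^esub> v') = f' \<odot>\<^bsub>V\<^esub> (v \<otimes>\<^bsub>V\<^esub> v')) \<and>
      (\<forall>w\<in>Y. \<forall>w'\<in>carrier W. w \<otimes>\<^bsub>W\<^esub> (f \<odot>\<^bsub>W\<^esub> w') = f' \<odot>\<^bsub>W\<^esub> (w \<otimes>\<^bsub>W\<^esub> w'))"
begin

definition tmul :: "('v \<times> 'w \<Rightarrow>\<^sub>0 int) \<Rightarrow> ('v \<times> 'w \<Rightarrow>\<^sub>0 int) \<Rightarrow> ('v \<times> 'w \<Rightarrow>\<^sub>0 int)" where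
  "tmul x y = frag_extend (\<lambda>(v, a). frag_extend (\<lambda>(w, b). frag_of (v \<otimes>\<^bsub>V\<^esub> w, a \<otimes>\<^bsub>W\<^esub> b)) y) x"

lemma tmul_0 [simp]: "tmul 0 y = 0" "tmul x 0 = 0"
  by (simp_all add: tmul_def case_prod_unfold frag_extend_eq_0)

lemma tmul_diff_left: "tmul (x - x') y = tmul x y - tmul x' y"
  by (simp add: tmul_def frag_extend_diff)

lemma tmul_diff_right: "tmul x (y - y') = tmul x y - tmul x y'"
  by (simp add: tmul_def frag_extend_diff case_prod_unfold frag_extend_diff_fun)

lemma tmul_minus: "tmul (- x) y = - tmul x y" "tmul x (- y) = - tmul x y"
  using tmul_diff_left[of 0 x y] tmul_diff_right[of x 0 y] by simp_all

lemma tmul_add: "tmul (x + x') y = tmul x y + tmul x' y" "tmul x (y + y') = tmul x y + tmul x y'"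
  using tmul_diff_left[of x "- x'" y] tmul_diff_right[of x y "- y'"] by (simp_all add: tmul_minus)

lemma tmul_of: "tmul (frag_of (v, a)) (frag_of (w, b)) = frag_of (v \<otimes>\<^bsub>V\<^esub> w, a \<otimes>\<^bsub>W\<^esub> b)"
  by (simp add: tmul_def)

lemma pairs_carrier: "(v, w) \<in> pairs \<Longrightarrow> v \<in> carrier V" "(v, w) \<in> pairs \<Longrightarrow> w \<in> carrier W"
  by (erule pairsE, use components in blast)+

lemma pairs_carrier': "p \<in> pairs \<Longrightarrow> fst p \<in> carrier V" "p \<in> pairs \<Longrightarrow> snd p \<in> carrier W"
  using pairs_carrier[of "fst p" "snd p"] by simp_all

lemma pairs_mult: "(v, w) \<in> pairs \<Longrightarrow> (v', w') \<in> pairs \<Longrightarrow> (v \<otimes>\<^bsub>V\<^esub> v', w \<otimes>\<^bsub>W\<^esub> w') \<in> pairs"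
  by (elim pairsE) (metis mult_component pairsI)

lemma tmul_keys:
  assumes "Poly_Mapping.keys x \<subseteq> pairs" "Poly_Mapping.keys y \<subseteq> pairs"
  shows "Poly_Mapping.keys (tmul x y) \<subseteq> pairs"
  using assms(1)
proof (induction x rule: frag_induction)
  case (one p)
  from assms(2) show ?case
  proof (induction y rule: frag_induction)
    case (one p')
    then show ?case using \<open>p \<in> pairs\<close> pairs_mult by (cases p, cases p') (simp add: tmul_of)
  qed (simp_all add: tmul_diff_right keys_diff_subset)
qed (simp_all add: tmul_diff_left keys_diff_subset)

lemma null_tmul_of_right:
  assumes "x \<in> null" "(w, b) \<in> pairs"
  shows "tmul x (frag_of (w, b)) \<in> null"
  using assms(1)
proof (induction rule: null_induct)
  case (rel r)
  obtain X' Y' where wb: "(X', Y') \<in> Cs" "w \<in> X'" "b \<in> Y'" using assms(2) by (rule pairsE)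
  have c: "w \<in> carrier V" "b \<in> carrier W" using assms(2) pairs_carrier by auto
  from rel show ?case
  proof (induction rule: trels_cases)
    case (left X Y v v' a)
    obtain X'' Y'' where XY: "(X'', Y'') \<in> Cs" "v \<otimes>\<^bsub>V\<^esub> w \<in> X''" "v' \<otimes>\<^bsub>V\<^esub> w \<in> X''" "a \<otimes>\<^bsub>W\<^esub> b \<in> Y''"
      using mult_component[OF left(1) wb(1)] left wb by metis
    show ?case
      using null_rel[OF trels_left[OF XY]] left c components[OF left(1)]
      by (simp add: tmul_diff_left tmul_of V.l_distr subset_iff)
  next
    case (right X Y v a a')
    obtain X'' Y'' where XY: "(X'', Y'') \<in> Cs" "v \<otimes>\<^bsub>V\<^esub> w \<in> X''" "a \<otimes>\<^bsub>W\<^esub> b \<in> Y''" "a' \<otimes>\<^bsub>W\<^esub> b \<in> Y''"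
      using mult_component[OF right(1) wb(1)] right wb by metis
    show ?case
      using null_rel[OF trels_right[OF XY]] right c components[OF right(1)]
      by (simp add: tmul_diff_left tmul_of W.l_distr subset_iff)
  next
    case (balanced X Y f v a)
    obtain X'' Y'' where XY: "(X'', Y'') \<in> Cs" "v \<otimes>\<^bsub>V\<^esub> w \<in> X''" "a \<otimes>\<^bsub>W\<^esub> b \<in> Y''"
      using mult_component[OF balanced(1) wb(1)] balanced wb by metis
    show ?case
      using null_rel[OF trels_balanced[OF XY, of f]] balanced c components[OF balanced(1)]
      by (simp add: tmul_diff_left tmul_of smult_mult subset_iff)
  qed
qed (simp_all add: null_0 null_minus null_add tmul_minus tmul_add)

lemma null_tmul_of_left:
  assumes "x \<in> null" "(w, b) \<in> pairs"
  shows "tmul (frag_of (w, b)) x \<in> null"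
  using assms(1)
proof (induction rule: null_induct)
  case (rel r)
  obtain X' Y' where wb: "(X', Y') \<in> Cs" "w \<in> X'" "b \<in> Y'" using assms(2) by (rule pairsE)
  have c: "w \<in> carrier V" "b \<in> carrier W" using assms(2) pairs_carrier by auto
  from rel show ?case
  proof (induction rule: trels_cases)
    case (left X Y v v' a)
    obtain X'' Y'' where XY: "(X'', Y'') \<in> Cs" "w \<otimes>\<^bsub>V\<^esub> v \<in> X''" "w \<otimes>\<^bsub>V\<^esub> v' \<in> X''" "b \<otimes>\<^bsub>W\<^esub> a \<in> Y''"
      using mult_component[OF wb(1) left(1)] left wb by metis
    show ?case
      using null_rel[OF trels_left[OF XY]] left c components[OF left(1)]
      by (simp add: tmul_diff_right tmul_of V.r_distr subset_iff)
  next
    case (right X Y v a a')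
    obtain X'' Y'' where XY: "(X'', Y'') \<in> Cs" "w \<otimes>\<^bsub>V\<^esub> v \<in> X''" "b \<otimes>\<^bsub>W\<^esub> a \<in> Y''" "b \<otimes>\<^bsub>W\<^esub> a' \<in> Y''"
      using mult_component[OF wb(1) right(1)] right wb by metis
    show ?case
      using null_rel[OF trels_right[OF XY]] right c components[OF right(1)]
      by (simp add: tmul_diff_right tmul_of W.r_distr subset_iff)
  next
    case (balanced X Y f v a)
    obtain X'' Y'' where XY: "(X'', Y'') \<in> Cs" "w \<otimes>\<^bsub>V\<^esub> v \<in> X''" "b \<otimes>\<^bsub>W\<^esub> a \<in> Y''"
      using mult_component[OF wb(1) balanced(1)] balanced wb by metis
    \<comment> \<open>One \<open>f'\<close> serves both entries of the left factor, so the product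
      with a balancing relation is a balancing relation again.\<close>
    obtain f' where f': "\<And>v'. v' \<in> carrier V \<Longrightarrow> w \<otimes>\<^bsub>V\<^esub> (f \<odot>\<^bsub>V\<^esub> v') = f' \<odot>\<^bsub>V\<^esub> (w \<otimes>\<^bsub>V\<^esub> v')"
        "\<And>w'. w' \<in> carrier W \<Longrightarrow> b \<otimes>\<^bsub>W\<^esub> (f \<odot>\<^bsub>W\<^esub> w') = f' \<odot>\<^bsub>W\<^esub> (b \<otimes>\<^bsub>W\<^esub> w')"
      using mult_smult[OF wb(1), of f] wb by metis
    show ?case
      using null_rel[OF trels_balanced[OF XY, of f']] balanced c components[OF balanced(1)]
      by (simp add: tmul_diff_right tmul_of f' subset_iff)
  qed
qed (simp_all add: null_0 null_minus null_add tmul_minus tmul_add)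

lemma null_tmul_right:
  assumes "x \<in> null" "Poly_Mapping.keys y \<subseteq> pairs"
  shows "tmul x y \<in> null"
  using assms(2)
proof (induction y rule: frag_induction)
  case (one p)
  then show ?case using null_tmul_of_right[OF assms(1)] by (cases p) simp
qed (simp_all add: null_0 null_diff tmul_diff_right)

lemma null_tmul_left:
  assumes "x \<in> null" "Poly_Mapping.keys y \<subseteq> pairs"
  shows "tmul y x \<in> null"
  using assms(2)
proof (induction y rule: frag_induction)
  case (one p)
  then show ?case using null_tmul_of_left[OF assms(1)] by (cases p) simp
qed (simp_all add: null_0 null_diff tmul_diff_left)

lemma keys_cl: "y \<in> cl x \<Longrightarrow> Poly_Mapping.keys x \<subseteq> pairs \<Longrightarrow> Poly_Mapping.keys y \<subseteq> pairs"
  using null_keys[of "y - x"] keys_add[of "y - x" x] by (auto simp: in_cl_iff)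

lemma cl_mult:
  assumes "Poly_Mapping.keys x \<subseteq> pairs" "Poly_Mapping.keys y \<subseteq> pairs"
  shows "cl x \<otimes> cl y = cl (tmul x y)"
proof -
  have "cl (tmul x' y') = cl (tmul x y)" if "x' \<in> cl x" "y' \<in> cl y" for x' y'
  proof -
    \<comment> \<open>The usual splitting x'y' - xy = (x' - x)y' + x(y' - y).\<close>
    have "tmul (x' - x) y' + tmul x (y' - y) \<in> null"
      using that assms keys_cl by (intro null_add null_tmul_left null_tmul_right) (auto simp: in_cl_iff)
    then show ?thesis by (simp add: cl_eq_iff tmul_diff_left tmul_diff_right)
  qed
  then have "(\<Union>x'\<in>cl x. \<Union>y'\<in>cl y. cl (tmul x' y')) = cl (tmul x y)"
    using self_in_cl by blast
  then show ?thesis by (simp add: T_mult tring_def Let_def tmul_def)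
qed

lemma pure_mult: "(v, w) \<in> pairs \<Longrightarrow> (v', w') \<in> pairs \<Longrightarrow>
    pure v w \<otimes> pure v' w' = pure (v \<otimes>\<^bsub>V\<^esub> v') (w \<otimes>\<^bsub>W\<^esub> w')"
  by (simp add: pure_pairs pairs_mult cl_mult tmul_of)

lemma one_T: "\<one> = cl (frag_of (\<one>\<^bsub>V\<^esub>, \<one>\<^bsub>W\<^esub>))"
  using one_pairs by (simp add: T_one tring_def Let_def pure_pairs)

lemma one_pure: "\<one> = pure \<one>\<^bsub>V\<^esub> \<one>\<^bsub>W\<^esub>"
  using one_pairs by (simp add: one_T pure_pairs)

lemma tmul_one:
  assumes "Poly_Mapping.keys x \<subseteq> pairs"
  shows "tmul (frag_of (\<one>\<^bsub>V\<^esub>, \<one>\<^bsub>W\<^esub>)) x = x" "tmul x (frag_of (\<one>\<^bsub>V\<^esub>, \<one>\<^bsub>W\<^esub>)) = x"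
  using assms
proof (induction x rule: frag_induction)
  case (one p)
  { case 1 then show ?case using pairs_carrier[of "fst p" "snd p"] one by (cases p) (simp add: tmul_of) }
  { case 2 then show ?case using pairs_carrier[of "fst p" "snd p"] one by (cases p) (simp add: tmul_of) }
qed (simp_all add: tmul_diff_left tmul_diff_right)

lemma tmul_assoc:
  assumes "Poly_Mapping.keys x \<subseteq> pairs" "Poly_Mapping.keys y \<subseteq> pairs" "Poly_Mapping.keys z \<subseteq> pairs"
  shows "tmul (tmul x y) z = tmul x (tmul y z)"
  using assms(1)
proof (induction x rule: frag_induction)
  case x: (one p)
  from assms(2) show ?case
  proof (induction y rule: frag_induction)
    case y: (one p')
    from assms(3) show ?case
    proof (induction z rule: frag_induction)
      case z: (one p'')
      show ?case
        using pairs_carrier'[OF x] pairs_carrier'[OF y] pairs_carrier'[OF z]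
        by (cases p, cases p', cases p'') (simp add: tmul_of V.m_assoc W.m_assoc)
    qed (simp_all add: tmul_diff_right)
  qed (simp_all add: tmul_diff_left tmul_diff_right)
qed (simp_all add: tmul_diff_left)

lemma ring_T: "ring T"
proof (rule ringI[OF abelian_group_T])
  have one: "Poly_Mapping.keys (frag_of (\<one>\<^bsub>V\<^esub>, \<one>\<^bsub>W\<^esub>)) \<subseteq> pairs" using one_pairs by simp
  show "monoid T"
  proof (rule monoidI)
    fix x y z assume "x \<in> carrier T" "y \<in> carrier T" "z \<in> carrier T"
    then obtain x' y' z' where *: "x = cl x'" "Poly_Mapping.keys x' \<subseteq> pairs"
      "y = cl y'" "Poly_Mapping.keys y' \<subseteq> pairs" "z = cl z'" "Poly_Mapping.keys z' \<subseteq> pairs"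
      by (elim carrierE)
    show "x \<otimes> y \<in> carrier T" using * by (simp add: cl_mult cl_closed tmul_keys)
    show "x \<otimes> y \<otimes> z = x \<otimes> (y \<otimes> z)" using * by (simp add: cl_mult tmul_keys tmul_assoc)
    show "\<one> \<otimes> x = x" "x \<otimes> \<one> = x" using * one by (simp_all add: cl_mult one_T tmul_one)
  qed (use one in \<open>simp add: one_T cl_closed\<close>)
  fix x y z assume "x \<in> carrier T" "y \<in> carrier T" "z \<in> carrier T"
  then obtain x' y' z' where *: "x = cl x'" "Poly_Mapping.keys x' \<subseteq> pairs"
    "y = cl y'" "Poly_Mapping.keys y' \<subseteq> pairs" "z = cl z'" "Poly_Mapping.keys z' \<subseteq> pairs"
    by (elim carrierE)
  have "Poly_Mapping.keys (x' + y') \<subseteq> pairs" using * keys_add[of x' y'] by blast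
  then show "(x \<oplus> y) \<otimes> z = x \<otimes> z \<oplus> y \<otimes> z" "z \<otimes> (x \<oplus> y) = z \<otimes> x \<oplus> z \<otimes> y"
    using * by (simp_all add: cl_mult cl_add tmul_add)
qed

sublocale ring T by (rule ring_T)

lemma tspan_mult:
  assumes D: "D \<subseteq> pairs" "D' \<subseteq> pairs" "D'' \<subseteq> pairs"
    and D_mult: "\<And>v a w b. (v, a) \<in> D \<Longrightarrow> (w, b) \<in> D' \<Longrightarrow> (v \<otimes>\<^bsub>V\<^esub> w, a \<otimes>\<^bsub>W\<^esub> b) \<in> D''"
    and X: "X \<in> tspan D" and Y: "Y \<in> tspan D'"
  shows "X \<otimes> Y \<in> tspan D''"
  using X D(1)
proof (induction X rule: tspan_induct)
  case (pure v a)
  from Y D(2) show ?case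
  proof (induction Y rule: tspan_induct)
    case (pure w b)
    have "(v, a) \<in> pairs" "(w, b) \<in> pairs" using \<open>(v, a) \<in> D\<close> pure D by blast+
    then show ?case using D_mult[OF \<open>(v, a) \<in> D\<close> pure] by (simp add: pure_mult pure_in_tspan D(3))
  next
    case (minus Y)
    then show ?case using tspan_closed[OF D(2) minus(1)] by (simp add: r_minus tspan_minus D(3))
  next
    case (add Y Z)
    then show ?case using tspan_closed[OF D(2) add(1)] tspan_closed[OF D(2) add(2)] by (simp add: r_distr tspan_add)
  qed (simp add: tspan_zero)
next
  case zero
  show ?case using tspan_closed[OF D(2) Y] by (simp add: tspan_zero)
next
  case (minus X)
  then show ?case using tspan_closed[OF D(1) minus(1)] tspan_closed[OF D(2) Y] by (simp add: l_minus tspan_minus D(3))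
next
  case (add X Z)
  then show ?case using tspan_closed[OF D(1) add(1)] tspan_closed[OF D(1) add(2)] tspan_closed[OF D(2) Y]
    by (simp add: l_distr tspan_add)
qed

lemma pure_central:
  assumes mn: "(m, n) \<in> pairs"
    and comm: "\<And>v. v \<in> carrier V \<Longrightarrow> m \<otimes>\<^bsub>V\<^esub> v = v \<otimes>\<^bsub>V\<^esub> m" "\<And>a. a \<in> carrier W \<Longrightarrow> n \<otimes>\<^bsub>W\<^esub> a = a \<otimes>\<^bsub>W\<^esub> n"
    and X: "X \<in> carrier T"
  shows "pure m n \<otimes> X = X \<otimes> pure m n"
  using X[folded tspan_pairs] order_refl
proof (induction X rule: tspan_induct)
  case (pure v a)
  then show ?case using pairs_carrier[OF pure] by (simp add: pure_mult mn comm)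
qed (simp_all add: tspan_pairs l_minus r_minus l_distr r_distr)

text \<open>The left side is the coset-wise formula that \<open>hten\<close> uses for its scalar
  action, with \<open>m\<close> a value of the right moment map. Written as a ring product, it makes
  linearity over functions a case of multiplicativity.\<close>

lemma mult_right_factor:
  assumes "(\<one>\<^bsub>V\<^esub>, m) \<in> pairs" "X \<in> carrier T"
  shows "(\<Union>x\<in>X. cl (frag_extend (\<lambda>(v, a). frag_of (v, m \<otimes>\<^bsub>W\<^esub> a)) x)) = pure \<one>\<^bsub>V\<^esub> m \<otimes> X"
proof -
  obtain x where x: "X = cl x" "Poly_Mapping.keys x \<subseteq> pairs" using assms(2) by (rule carrierE)
  have m: "Poly_Mapping.keys (frag_of (\<one>\<^bsub>V\<^esub>, m)) \<subseteq> pairs" using assms by simp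
  have *: "cl (frag_extend (\<lambda>(v, a). frag_of (v, m \<otimes>\<^bsub>W\<^esub> a)) y) = pure \<one>\<^bsub>V\<^esub> m \<otimes> X" if y: "y \<in> X" for y
  proof -
    have k: "Poly_Mapping.keys y \<subseteq> pairs" using y x keys_cl by blast
    have "frag_extend (\<lambda>(v, a). frag_of (v, m \<otimes>\<^bsub>W\<^esub> a)) y = tmul (frag_of (\<one>\<^bsub>V\<^esub>, m)) y"
      unfolding tmul_def using k pairs_carrier'(1) by (simp, intro frag_extend_eq) (fastforce simp: subset_iff)
    moreover have "X = cl y" using y x by (simp add: in_cl_iff cl_eq_iff) (metis null_minus minus_diff_eq)
    ultimately show ?thesis using k m assms(1) by (simp add: cl_mult pure_pairs)
  qed
  then show ?thesis using * self_in_cl[of x] unfolding x(1) by blast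
qed

end

section \<open>The algebras \<open>W\<close> and \<open>F\<^sub>R(M(n))\<close>\<close>

abbreviation F_cls :: "complex \<Rightarrow> 'n Fgen falg \<Rightarrow> 'n::{finite,linorder} Fgen falg set" where
  "F_cls lq \<equiv> pclass (F_rels lq)"

abbreviation W_cls :: "complex \<Rightarrow> 'n Wgen falg \<Rightarrow> 'n::{finite,linorder} Wgen falg set" where
  "W_cls lq \<equiv> pclass (W_rels lq)"

abbreviation F_ideal :: "complex \<Rightarrow> 'n::{finite,linorder} Fgen falg set" where
  "F_ideal lq \<equiv> genideal free_algebra (F_rels lq)"

abbreviation mul :: "complex \<Rightarrow> 'n mero \<Rightarrow> 'n::{finite,linorder} Fgen falg set" where
  "mul lq \<equiv> mu_l (F_alg lq)"

abbreviation mur :: "complex \<Rightarrow> 'n mero \<Rightarrow> 'n::{finite,linorder} Fgen falg set" where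
  "mur lq \<equiv> mu_r (F_alg lq)"

abbreviation WF_ten :: "complex \<Rightarrow>
    ('n::{finite,linorder}, ('n Wgen falg set, 'n Fgen falg set) ten) hspace" where
  "WF_ten lq \<equiv> hten (W_alg lq) (F_alg lq)"

abbreviation hpure_W :: "complex \<Rightarrow> 'n Wgen falg set \<Rightarrow> 'n Fgen falg set \<Rightarrow>
    ('n::{finite,linorder} Wgen falg set, 'n Fgen falg set) ten" where
  "hpure_W lq \<equiv> hpure (W_alg lq) (F_alg lq)"

abbreviation FF_ten :: "complex \<Rightarrow>
    ('n::{finite,linorder}, ('n Fgen falg set, 'n Fgen falg set) ten) halg" where
  "FF_ten lq \<equiv> aten (F_alg lq) (F_alg lq)"

abbreviation apure_F :: "complex \<Rightarrow> 'n Fgen falg set \<Rightarrow> 'n Fgen falg set \<Rightarrow>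
    ('n::{finite,linorder} Fgen falg set, 'n Fgen falg set) ten" where
  "apure_F lq \<equiv> apure (F_alg lq) (F_alg lq)"

abbreviation W_FF_ten :: "complex \<Rightarrow>
    ('n::{finite,linorder}, ('n Wgen falg set, ('n Fgen falg set, 'n Fgen falg set) ten) ten) hspace" where
  "W_FF_ten lq \<equiv> hten (W_alg lq) (FF_ten lq)"

abbreviation hpure_W_FF :: "complex \<Rightarrow> 'n Wgen falg set \<Rightarrow> ('n Fgen falg set, 'n Fgen falg set) ten \<Rightarrow>
    ('n::{finite,linorder} Wgen falg set, ('n Fgen falg set, 'n Fgen falg set) ten) ten" where
  "hpure_W_FF lq \<equiv> hpure (W_alg lq) (FF_ten lq)"

abbreviation WF_F_ten :: "complex \<Rightarrow>
    ('n::{finite,linorder}, (('n Wgen falg set, 'n Fgen falg set) ten, 'n Fgen falg set) ten) hspace" where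
  "WF_F_ten lq \<equiv> hten (WF_ten lq) (F_alg lq)"

section \<open>Homogeneity of the relations of W and F\<close>

lemma homogeneous_mult_eq:
  "x \<in> homogeneous deg d \<Longrightarrow> y \<in> homogeneous deg e \<Longrightarrow> k = d + e \<Longrightarrow> x * y \<in> homogeneous deg k"
  using homogeneous_mult by blast

lemma l_module_simps [simp]:
  "carrier (l_module A) = carrier A" "monoid.mult (l_module A) = monoid.mult A"
  "one (l_module A) = one A" "ring.zero (l_module A) = ring.zero A"
  "ring.add (l_module A) = ring.add A" "smult (l_module A) f a = mu_l A f \<otimes>\<^bsub>A\<^esub> a"
  by (simp_all add: l_module_def)

lemma r_module_simps [simp]:
  "carrier (r_module A) = carrier A" "monoid.mult (r_module A) = monoid.mult A"
  "one (r_module A) = one A" "ring.zero (r_module A) = ring.zero A"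
  "ring.add (r_module A) = ring.add A" "smult (r_module A) f a = mu_r A f \<otimes>\<^bsub>A\<^esub> a"
  by (simp_all add: r_module_def)

lemma W_alg_fields:
  "carrier (W_alg lq) = carrier (presented (W_rels lq))"
  "monoid.mult (W_alg lq) = monoid.mult (presented (W_rels lq))"
  "one (W_alg lq) = one (presented (W_rels lq))"
  "ring.zero (W_alg lq) = ring.zero (presented (W_rels lq))"
  "ring.add (W_alg lq) = ring.add (presented (W_rels lq))"
  by (simp_all add: W_alg_def Let_def)

lemma F_alg_fields:
  "carrier (F_alg lq) = carrier (presented (F_rels lq))"
  "monoid.mult (F_alg lq) = monoid.mult (presented (F_rels lq))"
  "one (F_alg lq) = one (presented (F_rels lq))"
  "ring.zero (F_alg lq) = ring.zero (presented (F_rels lq))"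
  "ring.add (F_alg lq) = ring.add (presented (F_rels lq))"
  by (simp_all add: F_alg_def Let_def)

interpretation W_pres: presented_algebra "W_rels lq" "W_alg lq" for lq
  by unfold_locales (rule W_alg_fields)+

interpretation F_pres: presented_algebra "F_rels lq" "F_alg lq" for lq
  by unfold_locales (rule F_alg_fields)+

lemma W_rels_cases [consumes 1, case_names add mult const square anticommute moment]:
  assumes "s \<in> W_rels lq"
    and "\<And>f f'. Q (fgen (Mgen (f + f')) - (fgen (Mgen f) + fgen (Mgen f')))"
    and "\<And>f f'. Q (fgen (Mgen (f * f')) - fgen (Mgen f) * fgen (Mgen f'))"
    and "\<And>c. Q (fgen (Mgen (mero_const c)) - fscalar c)"
    and "\<And>i. Q (fgen (Vgen i) * fgen (Vgen i))"
    and "\<And>i j. i < j \<Longrightarrow>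
      Q (fgen (Vgen j) * fgen (Vgen i) - (- (fgen (Mgen (h_at lq j i)) * fgen (Vgen i) * fgen (Vgen j))))"
    and "\<And>f i. Q (fgen (Mgen f) * fgen (Vgen i) - fgen (Vgen i) * fgen (Mgen (T_shift (\<omega> i) f)))"
  shows "Q s"
  using assms(1) unfolding W_rels_def by (elim UnE CollectE exE conjE) (use assms(2-) in simp_all)

lemma W_gens_homogeneous:
  "fgen (Vgen i) \<in> homogeneous W_deg (\<omega> i)" "fgen (Mgen f) \<in> homogeneous W_deg 0"
  using homogeneous_fgen[of "Vgen i" W_deg] homogeneous_fgen[of "Mgen f" W_deg] by simp_all

lemma F_gens_homogeneous:
  "fgen (Tgen i j) \<in> homogeneous F_deg (\<omega> i, \<omega> j)" "fgen (Lgen f) \<in> homogeneous F_deg 0"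
  "fgen (Rgen f) \<in> homogeneous F_deg 0"
  using homogeneous_fgen[of "Tgen i j" F_deg] homogeneous_fgen[of "Lgen f" F_deg]
    homogeneous_fgen[of "Rgen f" F_deg] by simp_all

lemmas homogeneous_intros = homogeneous_mult_eq W_gens_homogeneous F_gens_homogeneous
  homogeneous_fscalar homogeneous_diff homogeneous_add homogeneous_minus

text \<open>Each relation of W is a homogeneous element of the free algebra, so its components are
  zero or the relation itself.\<close>

lemma graded_presentation_W: "graded_presentation (W_rels lq) (W_alg lq) W_deg"
proof unfold_locales
  fix s :: "'a Wgen falg" and d assume s: "s \<in> W_rels lq"
  then have "\<exists>e. s \<in> homogeneous W_deg e"
  proof (induction rule: W_rels_cases)
    case (square i)
    show ?case by (rule exI[of _ "\<omega> i + \<omega> i"]) ((rule homogeneous_intros | simp)+)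
  next
    case (anticommute i j)
    show ?case by (rule exI[of _ "\<omega> i + \<omega> j"]) ((rule homogeneous_intros | simp add: add.commute)+)
  next
    case (moment f i)
    show ?case by (rule exI[of _ "\<omega> i"]) ((rule homogeneous_intros | simp)+)
  qed (rule exI[of _ 0], (rule homogeneous_intros | simp)+)+
  then show "hcomp W_deg d s \<in> genideal free_algebra (W_rels lq)"
    using s W_pres.S_subset_I[of lq] W_pres.I_0[of lq] by (auto simp: hcomp_homogeneous)
qed

interpretation W: graded_presentation "W_rels lq" "W_alg lq" W_deg for lq
  by (rule graded_presentation_W)

text \<open>Weight conservation of the dynamical R-matrix: a nonzero entry has the same pair of
  indices, up to order, above and below.\<close>

lemma Rmat_zero:
  fixes x y a c :: "'n::{finite,linorder}"
  assumes "\<omega> x + \<omega> y \<noteq> \<omega> a + \<omega> c"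
  shows "Rmat lq x y a c = 0"
  using assms by (auto simp: Rmat_def add.commute)

lemma F_rels_moment:
  assumes "M \<in> {Lgen, Rgen}"
  shows "fgen (M (f + f')) - (fgen (M f) + fgen (M f')) \<in> F_rels lq"
    "fgen (M (f * f')) - fgen (M f) * fgen (M f') \<in> F_rels lq"
    "fgen (M (mero_const c)) - fscalar c \<in> F_rels lq"
  unfolding F_rels_def
  by (rule UnI1, rule UnI1, rule UnI1, rule UnI1, rule UN_I[OF assms], blast)+

lemma F_rels_cases [consumes 1, case_names add mult const commute left right RLL]:
  fixes lq :: complex
  assumes "s \<in> F_rels lq"
    and "\<And>M f f'. M \<in> {Lgen, Rgen} \<Longrightarrow> Q (fgen (M (f + f')) - (fgen (M f) + fgen (M f')))"
    and "\<And>M f f'. M \<in> {Lgen, Rgen} \<Longrightarrow> Q (fgen (M (f * f')) - fgen (M f) * fgen (M f'))"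
    and "\<And>M c. M \<in> {Lgen, Rgen} \<Longrightarrow> Q (fgen (M (mero_const c)) - fscalar c)"
    and "\<And>f f'. Q (fgen (Lgen f) * fgen (Rgen f') - fgen (Rgen f') * fgen (Lgen f))"
    and "\<And>f i j. Q (fgen (Lgen f) * fgen (Tgen i j) - fgen (Tgen i j) * fgen (Lgen (T_shift (\<omega> i) f)))"
    and "\<And>f i j. Q (fgen (Rgen f) * fgen (Tgen i j) - fgen (Tgen i j) * fgen (Rgen (T_shift (\<omega> j) f)))"
    and "\<And>a b c d. Q
     ((\<Sum>x\<in>UNIV. \<Sum>y\<in>UNIV. fgen (Lgen (Rmat lq x y a c)) * fgen (Tgen x b) * fgen (Tgen y d)) -
      (\<Sum>x\<in>UNIV. \<Sum>y\<in>UNIV. fgen (Rgen (Rmat lq b d x y)) * fgen (Tgen c y) * fgen (Tgen a x)))"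
  shows "Q s"
  using assms(1) unfolding F_rels_def
  by (elim UnE UN_E CollectE exE conjE) (use assms(2-) in simp_all)

text \<open>The generator belonging to the zero function is a nonzero element of the free algebra.
  The relation for the constant 0 puts it into the ideal, and with it every term of RLL whose
  R-entry vanishes.\<close>

lemma F_moment_0:
  assumes "M \<in> {Lgen, Rgen :: 'n::{finite,linorder} mero \<Rightarrow> 'n Fgen}"
  shows "fgen (M 0) \<in> F_ideal lq"
proof -
  have "fgen (M 0) - fscalar 0 \<in> F_rels lq"
    using F_rels_moment(3)[OF assms, of 0 lq] by simp
  then show ?thesis using F_pres.S_subset_I by (auto simp: fscalar_def)
qed

text \<open>Terms of degree other than \<open>D\<close> are negligible modulo \<open>I\<close>, so
  modulo \<open>I\<close> the sum behaves like a homogeneous element of degree \<open>D\<close>.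
  Each side of RLL is a sum of this kind.\<close>

lemma hcomp_sum_zero:
  assumes "finite J" "\<And>j. j \<in> J \<Longrightarrow> f j \<in> homogeneous deg (e j)" "\<And>j. j \<in> J \<Longrightarrow> e j \<noteq> D \<Longrightarrow> f j \<in> I"
    and I: "0 \<in> I" "\<And>x y. x \<in> I \<Longrightarrow> y \<in> I \<Longrightarrow> x + y \<in> I" "\<And>x. x \<in> I \<Longrightarrow> - x \<in> I"
  shows "hcomp deg d (sum f J) - (if d = D then sum f J else 0) \<in> I"
  using assms(1-3)
proof (induction J rule: finite_induct)
  case (insert j J)
  have "hcomp deg d (f j) - (if d = D then f j else 0) \<in> I"
    using insert.prems[of j] I by (auto simp: hcomp_homogeneous)
  with insert I(2) have "(hcomp deg d (f j) - (if d = D then f j else 0)) +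
     (hcomp deg d (sum f J) - (if d = D then sum f J else 0)) \<in> I" by blast
  then show ?case using insert by (auto simp: hcomp_add algebra_simps)
qed (use I in simp)

lemma graded_presentation_F:
  "graded_presentation (F_rels lq) (F_alg lq :: ('n::{finite,linorder}, _) halg) F_deg"
proof unfold_locales
  fix s :: "'n Fgen falg" and d assume s: "s \<in> F_rels lq"
  let ?I = "F_ideal lq :: 'n Fgen falg set"
  have hom: "hcomp F_deg d s \<in> ?I" if "s \<in> homogeneous F_deg e" for e
    using s F_pres.S_subset_I[of lq] F_pres.I_0[of lq] that by (auto simp: hcomp_homogeneous)
  from s have "(\<exists>e. s \<in> homogeneous F_deg e) \<or> hcomp F_deg d s \<in> ?I"
  proof (induction rule: F_rels_cases)
    case (RLL a b c e)
    define l where "l p = fgen (Lgen (Rmat lq (fst p) (snd p) a c)) * fgen (Tgen (fst p) b) * fgen (Tgen (snd p) e)" for p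
    define r where "r p = fgen (Rgen (Rmat lq b e (fst p) (snd p))) * fgen (Tgen c (snd p)) * fgen (Tgen a (fst p))" for p
    let ?s = "sum l (UNIV \<times> UNIV) - sum r (UNIV \<times> UNIV)"
    have s': "(\<Sum>x\<in>UNIV. \<Sum>y\<in>UNIV. fgen (Lgen (Rmat lq x y a c)) * fgen (Tgen x b) * fgen (Tgen y e)) -
      (\<Sum>x\<in>UNIV. \<Sum>y\<in>UNIV. fgen (Rgen (Rmat lq b e x y)) * fgen (Tgen c y) * fgen (Tgen a x)) = ?s"
      unfolding l_def r_def by (simp only: sum.cartesian_product case_prod_unfold)
    have sI: "?s \<in> ?I" unfolding s'[symmetric]
      by (rule subsetD[OF F_pres.S_subset_I[of lq]], unfold F_rels_def, rule UnI2, blast)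
    \<comment> \<open>By weight conservation this is the bidegree of all terms with a nonzero
      R-entry: on the left of RLL the entry fixes the first component, on the right the
      second.\<close>
    define D where "D = (\<omega> a + \<omega> c, \<omega> b + \<omega> e)"
    have L: "hcomp F_deg d (sum l (UNIV \<times> UNIV)) - (if d = D then sum l (UNIV \<times> UNIV) else 0) \<in> ?I"
    proof (rule hcomp_sum_zero[where e = "\<lambda>p. (\<omega> (fst p) + \<omega> (snd p), \<omega> b + \<omega> e)"])
      fix p :: "'n \<times> 'n"
      show "l p \<in> homogeneous F_deg (\<omega> (fst p) + \<omega> (snd p), \<omega> b + \<omega> e)"
        unfolding l_def by ((rule homogeneous_intros | simp add: zero_prod_def)+)
      assume "(\<omega> (fst p) + \<omega> (snd p), \<omega> b + \<omega> e) \<noteq> D"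
      then have "Rmat lq (fst p) (snd p) a c = 0" by (intro Rmat_zero) (simp add: D_def)
      then show "l p \<in> ?I" unfolding l_def using F_moment_0[OF insertI1, of lq] by (simp only:) (intro F_pres.I_mult(2))
    qed (auto intro: F_pres.I_0 F_pres.I_add F_pres.I_minus)
    have R: "hcomp F_deg d (sum r (UNIV \<times> UNIV)) - (if d = D then sum r (UNIV \<times> UNIV) else 0) \<in> ?I"
    proof (rule hcomp_sum_zero[where e = "\<lambda>p. (\<omega> c + \<omega> a, \<omega> (snd p) + \<omega> (fst p))"])
      fix p :: "'n \<times> 'n"
      show "r p \<in> homogeneous F_deg (\<omega> c + \<omega> a, \<omega> (snd p) + \<omega> (fst p))"
        unfolding r_def by ((rule homogeneous_intros | simp add: zero_prod_def)+)
      assume "(\<omega> c + \<omega> a, \<omega> (snd p) + \<omega> (fst p)) \<noteq> D"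
      then have "Rmat lq b e (fst p) (snd p) = 0" by (intro Rmat_zero) (auto simp: D_def add.commute)
      then show "r p \<in> ?I" unfolding r_def using F_moment_0[OF insertI2[OF singletonI], of lq] by (simp only:) (intro F_pres.I_mult(2))
    qed (auto intro: F_pres.I_0 F_pres.I_add F_pres.I_minus)
    have "(if d = D then ?s else 0) \<in> ?I" using sI by (auto intro: F_pres.I_0)
    from F_pres.I_add[OF F_pres.I_diff[OF L R] this]
    show ?case unfolding s' by (auto simp: hcomp_diff algebra_simps split: if_splits)
  next
    case (left f i j)
    show ?case by (rule disjI1, rule exI[of _ "(\<omega> i, \<omega> j)"]) ((rule homogeneous_intros | simp add: zero_prod_def)+)
  next
    case (right f i j)
    show ?case by (rule disjI1, rule exI[of _ "(\<omega> i, \<omega> j)"]) ((rule homogeneous_intros | simp add: zero_prod_def)+)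
  next
    case (commute f f')
    show ?case by (rule disjI1, rule exI[of _ 0]) ((rule homogeneous_intros | simp)+)
  next
    case (add M f f')
    then have M: "fgen (M x) \<in> homogeneous F_deg 0" for x using F_gens_homogeneous by auto
    show ?case by (rule disjI1, rule exI[of _ 0]) (intro homogeneous_diff homogeneous_add M)
  next
    case (mult M f f')
    then have M: "fgen (M x) \<in> homogeneous F_deg 0" for x using F_gens_homogeneous by auto
    show ?case by (rule disjI1, rule exI[of _ 0]) (intro homogeneous_diff homogeneous_mult[where d = 0 and e = 0, simplified] M)
  next
    case (const M c)
    then have M: "fgen (M x) \<in> homogeneous F_deg 0" for x using F_gens_homogeneous by auto
    show ?case by (rule disjI1, rule exI[of _ 0]) (intro homogeneous_diff homogeneous_fscalar M)
  qed
  then show "hcomp F_deg d s \<in> ?I" using hom by blast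
qed

interpretation F: graded_presentation "F_rels lq" "F_alg lq" F_deg for lq
  by (rule graded_presentation_F)

section \<open>Moment maps and homogeneous components of F\<close>

lemma grade_W: "grade (W_alg lq) \<alpha> = W.part lq \<alpha>"
  by (simp add: W_alg_def Let_def W.part_def)

lemma bigrade_F: "bigrade (F_alg lq) \<alpha> \<beta> = F.part lq (\<alpha>, \<beta>)"
  by (simp add: F_alg_def Let_def F.part_def)

lemma mu_l_F: "mul lq f = F_cls lq (fgen (Lgen f))"
  by (simp add: F_alg_def Let_def F_gen_def)

lemma mu_r_F: "mur lq f = F_cls lq (fgen (Rgen f))"
  by (simp add: F_alg_def Let_def F_gen_def)

lemma t_elt_class: "t_elt lq i j = F_cls lq (fgen (Tgen i j))"
  by (simp add: t_elt_def F_gen_def)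

lemma w_elt_class: "w_elt lq i = W_cls lq (fgen (Vgen i))"
  by (simp add: w_elt_def W_gen_def)

lemma smult_W: "f \<odot>\<^bsub>W_alg lq\<^esub> X = W_gen lq (Mgen f) \<otimes>\<^bsub>W_alg lq\<^esub> X"
  by (simp add: W_alg_def Let_def)

lemma W_gen_closed [simp]: "W_gen lq x \<in> carrier (W_alg lq)"
  by (simp add: W_gen_def)

lemma F_gen_closed [simp]: "F_gen lq x \<in> carrier (F_alg lq)"
  by (simp add: F_gen_def)

lemma mu_F_closed [simp]: "mul lq f \<in> carrier (F_alg lq)" "mur lq f \<in> carrier (F_alg lq)"
  by (simp_all add: mu_l_F mu_r_F)

lemma elt_closed [simp]: "t_elt lq i j \<in> carrier (F_alg lq)" "w_elt lq i \<in> carrier (W_alg lq)"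
  by (simp_all add: t_elt_class w_elt_class)

lemma F_rel_eq: "x - y \<in> F_rels lq \<Longrightarrow> F_cls lq x = F_cls lq y"
  by (rule F_pres.cls_rel_eq)

lemma W_rel_eq: "x - y \<in> W_rels lq \<Longrightarrow> W_cls lq x = W_cls lq y"
  by (rule W_pres.cls_rel_eq)

lemma mu_F_add:
  "mul lq (f + f') = mul lq f \<oplus>\<^bsub>F_alg lq\<^esub> mul lq f'"
  "mur lq (f + f') = mur lq f \<oplus>\<^bsub>F_alg lq\<^esub> mur lq f'"
  unfolding mu_l_F mu_r_F F_pres.cls_add by (rule F_rel_eq, rule F_rels_moment, simp)+

lemma mu_F_mult:
  "mul lq (f * f') = mul lq f \<otimes>\<^bsub>F_alg lq\<^esub> mul lq f'"
  "mur lq (f * f') = mur lq f \<otimes>\<^bsub>F_alg lq\<^esub> mur lq f'"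
  unfolding mu_l_F mu_r_F F_pres.cls_mult by (rule F_rel_eq, rule F_rels_moment, simp)+

lemma mu_F_const:
  "mul lq (mero_const c) = F_cls lq (fscalar c)"
  "mur lq (mero_const c) = F_cls lq (fscalar c)"
  unfolding mu_l_F mu_r_F by (rule F_rel_eq, rule F_rels_moment, simp)+

lemma mu_F_one: "mul lq 1 = \<one>\<^bsub>F_alg lq\<^esub>" "mur lq 1 = \<one>\<^bsub>F_alg lq\<^esub>"
  using mu_F_const[of lq 1] by (simp_all add: F_pres.cls_one)

lemma mu_F_zero: "mul lq 0 = \<zero>\<^bsub>F_alg lq\<^esub>" "mur lq 0 = \<zero>\<^bsub>F_alg lq\<^esub>"
  using mu_F_const[of lq 0] by (simp_all add: F_pres.cls_zero fscalar_def)

lemma F_rels_commute: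
  "fgen (Lgen f) * fgen (Rgen f') - fgen (Rgen f') * fgen (Lgen f) \<in> F_rels lq"
  "fgen (Lgen f) * fgen (Tgen i j) - fgen (Tgen i j) * fgen (Lgen (T_shift (\<omega> i) f)) \<in> F_rels lq"
  "fgen (Rgen f) * fgen (Tgen i j) - fgen (Tgen i j) * fgen (Rgen (T_shift (\<omega> j) f)) \<in> F_rels lq"
  unfolding F_rels_def
  by (rule UnI1, rule UnI1, rule UnI1, rule UnI2, blast)
     (rule UnI1, rule UnI1, rule UnI2, blast, rule UnI1, rule UnI2, blast)

lemma F_rels_RLL:
  "(\<Sum>x\<in>UNIV. \<Sum>y\<in>UNIV. fgen (Lgen (Rmat lq x y a c)) * fgen (Tgen x b) * fgen (Tgen y d)) -
      (\<Sum>x\<in>UNIV. \<Sum>y\<in>UNIV. fgen (Rgen (Rmat lq b d x y)) * fgen (Tgen c y) * fgen (Tgen a x)) \<in> F_rels lq"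
  unfolding F_rels_def by (rule UnI2, blast)

lemma mu_F_commute:
  "mul lq f \<otimes>\<^bsub>F_alg lq\<^esub> mur lq f' = mur lq f' \<otimes>\<^bsub>F_alg lq\<^esub> mul lq f"
  unfolding mu_l_F mu_r_F F_pres.cls_mult by (rule F_rel_eq, rule F_rels_commute)

lemma mu_l_F_shift:
  assumes "a \<in> bigrade (F_alg lq) \<alpha> \<beta>"
  shows "mul lq f \<otimes>\<^bsub>F_alg lq\<^esub> a = a \<otimes>\<^bsub>F_alg lq\<^esub> mul lq (T_shift \<alpha> f)"
proof -
  have "mul lq f \<otimes>\<^bsub>F_alg lq\<^esub> a = a \<otimes>\<^bsub>F_alg lq\<^esub> mul lq (T_shift (fst (\<alpha>, \<beta>)) f)"
  proof (rule F.shift_commute[where \<pi> = fst])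
    fix f and y
    show "mul lq f \<otimes>\<^bsub>F_alg lq\<^esub> F_cls lq (fgen y) =
        F_cls lq (fgen y) \<otimes>\<^bsub>F_alg lq\<^esub> mul lq (T_shift (fst (F_deg y)) f)"
    proof (cases y)
      case (Tgen i j)
      then show ?thesis unfolding mu_l_F F_pres.cls_mult by simp (rule F_rel_eq, rule F_rels_commute)
    next
      case (Lgen f')
      then show ?thesis by (simp flip: mu_l_F mu_F_mult add: mult.commute)
    next
      case (Rgen f')
      then show ?thesis by (simp flip: mu_r_F add: mu_F_commute)
    qed
  qed (use assms in \<open>simp_all add: bigrade_F\<close>)
  then show ?thesis by simp
qed

lemma mu_r_F_shift:
  assumes "a \<in> bigrade (F_alg lq) \<alpha> \<beta>"
  shows "mur lq f \<otimes>\<^bsub>F_alg lq\<^esub> a = a \<otimes>\<^bsub>F_alg lq\<^esub> mur lq (T_shift \<beta> f)"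
proof -
  have "mur lq f \<otimes>\<^bsub>F_alg lq\<^esub> a = a \<otimes>\<^bsub>F_alg lq\<^esub> mur lq (T_shift (snd (\<alpha>, \<beta>)) f)"
  proof (rule F.shift_commute[where \<pi> = snd])
    fix f and y
    show "mur lq f \<otimes>\<^bsub>F_alg lq\<^esub> F_cls lq (fgen y) =
        F_cls lq (fgen y) \<otimes>\<^bsub>F_alg lq\<^esub> mur lq (T_shift (snd (F_deg y)) f)"
    proof (cases y)
      case (Tgen i j)
      then show ?thesis unfolding mu_r_F F_pres.cls_mult by simp (rule F_rel_eq, rule F_rels_commute)
    next
      case (Lgen f')
      then show ?thesis by (simp flip: mu_l_F add: mu_F_commute)
    next
      case (Rgen f')
      then show ?thesis by (simp flip: mu_r_F mu_F_mult add: mult.commute)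
    qed
  qed (use assms in \<open>simp_all add: bigrade_F\<close>)
  then show ?thesis by simp
qed

lemma bigrade_F_props:
  "bigrade (F_alg lq) \<alpha> \<beta> \<subseteq> carrier (F_alg lq)"
  "\<zero>\<^bsub>F_alg lq\<^esub> \<in> bigrade (F_alg lq) \<alpha> \<beta>"
  "a \<in> bigrade (F_alg lq) \<alpha> \<beta> \<Longrightarrow> b \<in> bigrade (F_alg lq) \<alpha> \<beta> \<Longrightarrow> a \<oplus>\<^bsub>F_alg lq\<^esub> b \<in> bigrade (F_alg lq) \<alpha> \<beta>"
  "a \<in> bigrade (F_alg lq) \<alpha> \<beta> \<Longrightarrow> b \<in> bigrade (F_alg lq) \<gamma> \<delta> \<Longrightarrow>
     a \<otimes>\<^bsub>F_alg lq\<^esub> b \<in> bigrade (F_alg lq) (\<alpha> + \<gamma>) (\<beta> + \<delta>)"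
  using F.part_mult[of a lq "(\<alpha>, \<beta>)" b "(\<gamma>, \<delta>)"]
  by (auto simp: bigrade_F F.part_zero F.part_add F.part_closed)

lemma bigrade_F_closed: "a \<in> bigrade (F_alg lq) \<alpha> \<beta> \<Longrightarrow> a \<in> carrier (F_alg lq)"
  by (rule subsetD[OF bigrade_F_props(1)])

lemma bigrade_F_elems:
  "mul lq f \<in> bigrade (F_alg lq) 0 0" "mur lq f \<in> bigrade (F_alg lq) 0 0"
  "\<one>\<^bsub>F_alg lq\<^esub> \<in> bigrade (F_alg lq) 0 0" "t_elt lq i j \<in> bigrade (F_alg lq) (\<omega> i) (\<omega> j)"
  using F.cls_in_part[OF F_gens_homogeneous(1)] F.cls_in_part[OF F_gens_homogeneous(2)]
    F.cls_in_part[OF F_gens_homogeneous(3)] F.part_one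
  by (simp_all add: bigrade_F mu_l_F mu_r_F t_elt_class zero_prod_def)

lemma bigrade_F_mu_mult:
  assumes "a \<in> bigrade (F_alg lq) \<alpha> \<beta>"
  shows "mul lq f \<otimes>\<^bsub>F_alg lq\<^esub> a \<in> bigrade (F_alg lq) \<alpha> \<beta>"
    "mur lq f \<otimes>\<^bsub>F_alg lq\<^esub> a \<in> bigrade (F_alg lq) \<alpha> \<beta>"
  using bigrade_F_props(4)[OF bigrade_F_elems(1) assms] bigrade_F_props(4)[OF bigrade_F_elems(2) assms]
  by simp_all

lemma bigrade_F_disjoint:
  "a \<in> bigrade (F_alg lq) \<alpha> \<beta> \<Longrightarrow> a \<in> bigrade (F_alg lq) \<gamma> \<delta> \<Longrightarrow> (\<alpha>, \<beta>) \<noteq> (\<gamma>, \<delta>) \<Longrightarrow> a = \<zero>\<^bsub>F_alg lq\<^esub>"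
  unfolding bigrade_F by (rule F.part_disjoint)

section \<open>Relations, moment map and grading of W\<close>

lemma W_rels_mem:
  "fgen (Mgen (f + f')) - (fgen (Mgen f) + fgen (Mgen f')) \<in> W_rels lq"
  "fgen (Mgen (f * f')) - fgen (Mgen f) * fgen (Mgen f') \<in> W_rels lq"
  "fgen (Mgen (mero_const c)) - fscalar c \<in> W_rels lq"
  "fgen (Vgen i) * fgen (Vgen i) \<in> W_rels lq"
  "i < j \<Longrightarrow> fgen (Vgen j) * fgen (Vgen i) - (- (fgen (Mgen (h_at lq j i)) * fgen (Vgen i) * fgen (Vgen j))) \<in> W_rels lq"
  "fgen (Mgen f) * fgen (Vgen i) - fgen (Vgen i) * fgen (Mgen (T_shift (\<omega> i) f)) \<in> W_rels lq"
proof -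
  show "fgen (Mgen (f + f')) - (fgen (Mgen f) + fgen (Mgen f')) \<in> W_rels lq"
    unfolding W_rels_def by (rule UnI1, rule UnI1, rule UnI1, rule UnI1, rule UnI1, blast)
  show "fgen (Mgen (f * f')) - fgen (Mgen f) * fgen (Mgen f') \<in> W_rels lq"
    unfolding W_rels_def by (rule UnI1, rule UnI1, rule UnI1, rule UnI1, rule UnI2, blast)
  show "fgen (Mgen (mero_const c)) - fscalar c \<in> W_rels lq"
    unfolding W_rels_def by (rule UnI1, rule UnI1, rule UnI1, rule UnI2, blast)
  show "fgen (Vgen i) * fgen (Vgen i) \<in> W_rels lq"
    unfolding W_rels_def by (rule UnI1, rule UnI1, rule UnI2, blast)
  show "fgen (Vgen j) * fgen (Vgen i) - (- (fgen (Mgen (h_at lq j i)) * fgen (Vgen i) * fgen (Vgen j))) \<in> W_rels lq"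
    if "i < j" unfolding W_rels_def by (rule UnI1, rule UnI2, use that in blast)
  show "fgen (Mgen f) * fgen (Vgen i) - fgen (Vgen i) * fgen (Mgen (T_shift (\<omega> i) f)) \<in> W_rels lq"
    unfolding W_rels_def by (rule UnI2, blast)
qed

lemma W_moment_add: "W_gen lq (Mgen (f + f')) = W_gen lq (Mgen f) \<oplus>\<^bsub>W_alg lq\<^esub> W_gen lq (Mgen f')"
  unfolding W_gen_def W_pres.cls_add by (rule W_rel_eq, rule W_rels_mem)

lemma W_moment_mult: "W_gen lq (Mgen (f * f')) = W_gen lq (Mgen f) \<otimes>\<^bsub>W_alg lq\<^esub> W_gen lq (Mgen f')"
  unfolding W_gen_def W_pres.cls_mult by (rule W_rel_eq, rule W_rels_mem)

lemma W_moment_const: "W_gen lq (Mgen (mero_const c)) = W_cls lq (fscalar c)"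
  unfolding W_gen_def by (rule W_rel_eq, rule W_rels_mem)

lemma W_moment_one: "W_gen lq (Mgen 1) = \<one>\<^bsub>W_alg lq\<^esub>"
  using W_moment_const[of lq 1] by (simp add: W_pres.cls_one)

lemma w_elt_square: "w_elt lq i \<otimes>\<^bsub>W_alg lq\<^esub> w_elt lq i = \<zero>\<^bsub>W_alg lq\<^esub>"
  unfolding w_elt_class W_pres.cls_mult by (rule W_pres.cls_rel, rule W_rels_mem)

lemma w_elt_anticommute:
  assumes "i < j"
  shows "w_elt lq j \<otimes>\<^bsub>W_alg lq\<^esub> w_elt lq i =
    \<ominus>\<^bsub>W_alg lq\<^esub> (h_at lq j i \<odot>\<^bsub>W_alg lq\<^esub> (w_elt lq i \<otimes>\<^bsub>W_alg lq\<^esub> w_elt lq j))"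
  unfolding smult_W w_elt_class W_gen_def W_pres.cls_mult W_pres.cls_minus
  by (rule W_rel_eq) (use W_rels_mem(5)[OF assms] in \<open>simp add: mult.assoc\<close>)

lemma W_moment_shift:
  assumes "v \<in> grade (W_alg lq) \<alpha>"
  shows "W_gen lq (Mgen f) \<otimes>\<^bsub>W_alg lq\<^esub> v = v \<otimes>\<^bsub>W_alg lq\<^esub> W_gen lq (Mgen (T_shift \<alpha> f))"
proof (rule W.shift_commute[where \<pi> = "\<lambda>x. x"])
  fix f and y
  show "W_gen lq (Mgen f) \<otimes>\<^bsub>W_alg lq\<^esub> W_cls lq (fgen y) =
      W_cls lq (fgen y) \<otimes>\<^bsub>W_alg lq\<^esub> W_gen lq (Mgen (T_shift (W_deg y) f))"
  proof (cases y)
    case (Vgen i)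
    then show ?thesis unfolding W_gen_def W_pres.cls_mult by simp (rule W_rel_eq, rule W_rels_mem)
  next
    case (Mgen f')
    then show ?thesis by (simp flip: W_gen_def W_moment_mult add: mult.commute)
  qed
qed (use assms in \<open>simp_all add: grade_W\<close>)

lemma grade_W_props:
  "grade (W_alg lq) \<alpha> \<subseteq> carrier (W_alg lq)"
  "\<zero>\<^bsub>W_alg lq\<^esub> \<in> grade (W_alg lq) \<alpha>"
  "v \<in> grade (W_alg lq) \<alpha> \<Longrightarrow> w \<in> grade (W_alg lq) \<alpha> \<Longrightarrow> v \<oplus>\<^bsub>W_alg lq\<^esub> w \<in> grade (W_alg lq) \<alpha>"
  "v \<in> grade (W_alg lq) \<alpha> \<Longrightarrow> w \<in> grade (W_alg lq) \<beta> \<Longrightarrow> v \<otimes>\<^bsub>W_alg lq\<^esub> w \<in> grade (W_alg lq) (\<alpha> + \<beta>)"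
  by (auto simp: grade_W W.part_zero W.part_add W.part_closed W.part_mult)

lemma grade_W_closed: "v \<in> grade (W_alg lq) \<alpha> \<Longrightarrow> v \<in> carrier (W_alg lq)"
  by (rule subsetD[OF grade_W_props(1)])

lemma grade_W_elems:
  "W_gen lq (Mgen f) \<in> grade (W_alg lq) 0" "\<one>\<^bsub>W_alg lq\<^esub> \<in> grade (W_alg lq) 0"
  "w_elt lq i \<in> grade (W_alg lq) (\<omega> i)"
  using W.cls_in_part[OF W_gens_homogeneous(1)] W.cls_in_part[OF W_gens_homogeneous(2)] W.part_one
  by (simp_all add: grade_W W_gen_def w_elt_class)

lemma grade_W_smult: "v \<in> grade (W_alg lq) \<alpha> \<Longrightarrow> f \<odot>\<^bsub>W_alg lq\<^esub> v \<in> grade (W_alg lq) \<alpha>"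
  using grade_W_props(4)[OF grade_W_elems(1)] by (fastforce simp: smult_W)

lemma smult_W_closed [simp]: "v \<in> carrier (W_alg lq) \<Longrightarrow> f \<odot>\<^bsub>W_alg lq\<^esub> v \<in> carrier (W_alg lq)"
  by (simp add: smult_W)

lemma cring_mero_field: "cring (mero_field :: 'n::finite mero ring)"
proof (rule cringI)
  show "abelian_group (mero_field :: 'n mero ring)"
  proof (rule abelian_groupI)
    fix x :: "'n mero" assume "x \<in> carrier mero_field"
    show "\<exists>y\<in>carrier mero_field. y \<oplus>\<^bsub>mero_field\<^esub> x = \<zero>\<^bsub>mero_field\<^esub>"
      by (rule bexI[of _ "- x"]) (simp_all add: mero_field_def)
  qed (simp_all add: mero_field_def add_ac)
qed (auto intro!: comm_monoidI simp: mero_field_def algebra_simps)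

lemma h_space_W: "h_space (W_alg lq :: ('n::{finite,linorder}, _) hspace)"
  unfolding h_space_def
proof (intro conjI allI)
  show mod: "Module.module mero_field (W_alg lq)"
  proof (rule module.intro[OF cring_mero_field W_pres.abelian_group_axioms], unfold_locales)
  qed (auto simp: smult_W mero_field_def W_moment_add W_moment_mult W_moment_one W_pres.l_distr W_pres.r_distr W_pres.m_assoc)
  show "direct_sum (W_alg lq) (grade (W_alg lq))"
    using W.direct_sum_part[of lq] by (simp add: grade_W[abs_def])
  fix \<alpha> :: "(complex, 'n) vec"
  show "submodule (grade (W_alg lq) \<alpha>) mero_field (W_alg lq)"
    unfolding grade_W
    by (rule module.submoduleI[OF mod])
       (auto intro: W.part_closed W.part_minus W.part_zero W.part_add grade_W_smult[unfolded grade_W])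
qed

section \<open>The tensor products\<close>

lemma hten_fields:
  "carrier (hten V A) = carrier (tring V (l_module A) (hcomps V A))"
  "ring.add (hten V A) = ring.add (tring V (l_module A) (hcomps V A))"
  "ring.zero (hten V A) = ring.zero (tring V (l_module A) (hcomps V A))"
  "monoid.mult (hten V A) = monoid.mult (tring V (l_module A) (hcomps V A))"
  "one (hten V A) = one (tring V (l_module A) (hcomps V A))"
  by (simp_all add: hten_def Let_def)

lemma aten_fields:
  "carrier (aten A B) = carrier (tring (r_module A) (l_module B) (acomps A B))"
  "ring.add (aten A B) = ring.add (tring (r_module A) (l_module B) (acomps A B))"
  "ring.zero (aten A B) = ring.zero (tring (r_module A) (l_module B) (acomps A B))"
  "monoid.mult (aten A B) = monoid.mult (tring (r_module A) (l_module B) (acomps A B))"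
  "one (aten A B) = one (tring (r_module A) (l_module B) (acomps A B))"
  by (simp_all add: aten_def Let_def)

lemma hcompsI: "(grade V \<alpha>, bigrade A \<alpha> \<beta>) \<in> hcomps V A"
  by (auto simp: hcomps_def)

lemma hcompsE:
  assumes "(X, Y) \<in> hcomps V A"
  obtains \<alpha> \<beta> where "X = grade V \<alpha>" "Y = bigrade A \<alpha> \<beta>"
  using assms by (auto simp: hcomps_def)

lemma acompsI: "(bigrade A \<alpha> \<gamma>, bigrade B \<gamma> \<beta>) \<in> acomps A B"
  by (auto simp: acomps_def)

lemma acompsE:
  assumes "(X, Y) \<in> acomps A B"
  obtains \<alpha> \<beta> \<gamma> where "X = bigrade A \<alpha> \<gamma>" "Y = bigrade B \<gamma> \<beta>"
  using assms by (auto simp: acomps_def)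

lemma tensor_product_hten:
  assumes "\<And>\<alpha> v w. v \<in> grade V \<alpha> \<Longrightarrow> w \<in> grade V \<alpha> \<Longrightarrow> v \<oplus>\<^bsub>V\<^esub> w \<in> grade V \<alpha>"
    and "\<And>\<alpha> f v. v \<in> grade V \<alpha> \<Longrightarrow> f \<odot>\<^bsub>V\<^esub> v \<in> grade V \<alpha>"
    and "\<And>\<alpha> \<beta> a b. a \<in> bigrade A \<alpha> \<beta> \<Longrightarrow> b \<in> bigrade A \<alpha> \<beta> \<Longrightarrow> a \<oplus>\<^bsub>A\<^esub> b \<in> bigrade A \<alpha> \<beta>"
    and "\<And>\<alpha> \<beta> f a. a \<in> bigrade A \<alpha> \<beta> \<Longrightarrow> mu_l A f \<otimes>\<^bsub>A\<^esub> a \<in> bigrade A \<alpha> \<beta>"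
  shows "tensor_product V (l_module A) (hcomps V A) (hten V A)"
  by unfold_locales (auto simp: hten_fields assms elim!: hcompsE)

lemma tensor_product_aten:
  assumes "\<And>\<alpha> \<beta> a b. a \<in> bigrade A \<alpha> \<beta> \<Longrightarrow> b \<in> bigrade A \<alpha> \<beta> \<Longrightarrow> a \<oplus>\<^bsub>A\<^esub> b \<in> bigrade A \<alpha> \<beta>"
    and "\<And>\<alpha> \<beta> f a. a \<in> bigrade A \<alpha> \<beta> \<Longrightarrow> mu_r A f \<otimes>\<^bsub>A\<^esub> a \<in> bigrade A \<alpha> \<beta>"
    and "\<And>\<alpha> \<beta> a b. a \<in> bigrade B \<alpha> \<beta> \<Longrightarrow> b \<in> bigrade B \<alpha> \<beta> \<Longrightarrow> a \<oplus>\<^bsub>B\<^esub> b \<in> bigrade B \<alpha> \<beta>"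
    and "\<And>\<alpha> \<beta> f a. a \<in> bigrade B \<alpha> \<beta> \<Longrightarrow> mu_l B f \<otimes>\<^bsub>B\<^esub> a \<in> bigrade B \<alpha> \<beta>"
  shows "tensor_product (r_module A) (l_module B) (acomps A B) (aten A B)"
  by unfold_locales (auto simp: aten_fields assms elim!: acompsE)

lemma ring_l_module_F: "ring (l_module (F_alg lq))"
  by (rule presented_algebra.ring_A[of "F_rels lq"]) (unfold_locales, simp_all add: F_alg_fields)

lemma ring_r_module_F: "ring (r_module (F_alg lq))"
  by (rule presented_algebra.ring_A[of "F_rels lq"]) (unfold_locales, simp_all add: F_alg_fields)

text \<open>The moment relation shifts a function by \<open>\<alpha>\<close> when it moves to the
  right past \<open>a\<close>; moving it to the left therefore shifts it by
  \<open>- \<alpha>\<close>.\<close>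

lemma F_mult_mu_l:
  assumes a: "a \<in> bigrade (F_alg lq) \<alpha> \<beta>" and b: "b \<in> carrier (F_alg lq)"
  shows "a \<otimes>\<^bsub>F_alg lq\<^esub> (mul lq f \<otimes>\<^bsub>F_alg lq\<^esub> b) =
    mul lq (T_shift (- \<alpha>) f) \<otimes>\<^bsub>F_alg lq\<^esub> (a \<otimes>\<^bsub>F_alg lq\<^esub> b)"
proof -
  have "a \<in> carrier (F_alg lq)" using a by (rule bigrade_F_closed)
  then show ?thesis
    using mu_l_F_shift[OF a, of "T_shift (- \<alpha>) f"] b by (simp flip: F_pres.m_assoc)
qed

lemma F_mult_mu_r:
  assumes a: "a \<in> bigrade (F_alg lq) \<alpha> \<beta>" and b: "b \<in> carrier (F_alg lq)"
  shows "a \<otimes>\<^bsub>F_alg lq\<^esub> (mur lq f \<otimes>\<^bsub>F_alg lq\<^esub> b) =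
    mur lq (T_shift (- \<beta>) f) \<otimes>\<^bsub>F_alg lq\<^esub> (a \<otimes>\<^bsub>F_alg lq\<^esub> b)"
proof -
  have "a \<in> carrier (F_alg lq)" using a by (rule bigrade_F_closed)
  then show ?thesis
    using mu_r_F_shift[OF a, of "T_shift (- \<beta>) f"] b by (simp flip: F_pres.m_assoc)
qed

lemma W_mult_smult:
  assumes v: "v \<in> grade (W_alg lq) \<alpha>" and w: "w \<in> carrier (W_alg lq)"
  shows "v \<otimes>\<^bsub>W_alg lq\<^esub> (f \<odot>\<^bsub>W_alg lq\<^esub> w) = T_shift (- \<alpha>) f \<odot>\<^bsub>W_alg lq\<^esub> (v \<otimes>\<^bsub>W_alg lq\<^esub> w)"
proof -
  have "v \<in> carrier (W_alg lq)" using v by (rule grade_W_closed)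
  then show ?thesis
    using W_moment_shift[OF v, of "T_shift (- \<alpha>) f"] w by (simp add: smult_W flip: W_pres.m_assoc)
qed

lemma tensor_ring_WF:
  "tensor_ring (W_alg lq :: ('n::{finite,linorder}, _) hspace) (l_module (F_alg lq))
    (hcomps (W_alg lq) (F_alg lq)) (WF_ten lq)"
proof (intro tensor_ring.intro tensor_ring_axioms.intro)
  show "tensor_product (W_alg lq) (l_module (F_alg lq)) (hcomps (W_alg lq) (F_alg lq)) (WF_ten lq)"
    by (rule tensor_product_hten) (auto intro: grade_W_props grade_W_smult bigrade_F_props bigrade_F_mu_mult)
  show "ring (W_alg lq)" by (rule W_pres.ring_A)
  show "ring (l_module (F_alg lq))" by (rule ring_l_module_F)
  show "(\<one>\<^bsub>W_alg lq\<^esub>, \<one>\<^bsub>l_module (F_alg lq)\<^esub>) \<in> tpairs (hcomps (W_alg lq) (F_alg lq))"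
    unfolding tpairs_def l_module_simps
    by (rule UN_I[OF hcompsI[of _ 0 _ 0]]) (simp add: grade_W_elems bigrade_F_elems)
next
  fix X X' :: "'n Wgen falg set set" and Y Y' :: "'n Fgen falg set set"
  assume "(X, Y) \<in> hcomps (W_alg lq) (F_alg lq)" "(X', Y') \<in> hcomps (W_alg lq) (F_alg lq)"
  then obtain \<alpha> \<beta> \<alpha>' \<beta>' where "X = grade (W_alg lq) \<alpha>" "Y = bigrade (F_alg lq) \<alpha> \<beta>"
     "X' = grade (W_alg lq) \<alpha>'" "Y' = bigrade (F_alg lq) \<alpha>' \<beta>'" by (elim hcompsE)
  then show "\<exists>X'' Y''. (X'', Y'') \<in> hcomps (W_alg lq) (F_alg lq) \<and>
      (\<forall>v\<in>X. \<forall>v'\<in>X'. v \<otimes>\<^bsub>W_alg lq\<^esub> v' \<in> X'') \<and>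
      (\<forall>w\<in>Y. \<forall>w'\<in>Y'. w \<otimes>\<^bsub>l_module (F_alg lq)\<^esub> w' \<in> Y'')"
    by (intro exI[of _ "grade (W_alg lq) (\<alpha> + \<alpha>')"] exI[of _ "bigrade (F_alg lq) (\<alpha> + \<alpha>') (\<beta> + \<beta>')"])
       (auto intro: hcompsI grade_W_props(4) bigrade_F_props(4))
next
  fix X :: "'n Wgen falg set set" and Y :: "'n Fgen falg set set" and f
  assume "(X, Y) \<in> hcomps (W_alg lq) (F_alg lq)"
  then obtain \<alpha> \<beta> where "X = grade (W_alg lq) \<alpha>" "Y = bigrade (F_alg lq) \<alpha> \<beta>" by (rule hcompsE)
  then show "\<exists>f'. (\<forall>v\<in>X. \<forall>v'\<in>carrier (W_alg lq).
         v \<otimes>\<^bsub>W_alg lq\<^esub> (f \<odot>\<^bsub>W_alg lq\<^esub> v') = f' \<odot>\<^bsub>W_alg lq\<^esub> (v \<otimes>\<^bsub>W_alg lq\<^esub> v')) \<and>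
       (\<forall>w\<in>Y. \<forall>w'\<in>carrier (l_module (F_alg lq)). w \<otimes>\<^bsub>l_module (F_alg lq)\<^esub>
          (f \<odot>\<^bsub>l_module (F_alg lq)\<^esub> w') = f' \<odot>\<^bsub>l_module (F_alg lq)\<^esub> (w \<otimes>\<^bsub>l_module (F_alg lq)\<^esub> w'))"
    \<comment> \<open>Both entries of a matching pair carry the degree \<open>\<alpha>\<close>, as
      grade in W and as left degree in F, so the same shift works for both.\<close>
    by (intro exI[of _ "T_shift (- \<alpha>) f"]) (simp add: W_mult_smult F_mult_mu_l)
qed (auto simp: hten_fields smult_W W_pres.m_assoc F_pres.m_assoc elim!: hcompsE
      intro: grade_W_closed bigrade_F_closed)

lemma tensor_ring_FF:
  "tensor_ring (r_module (F_alg lq :: ('n::{finite,linorder}, _) halg)) (l_module (F_alg lq))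
    (acomps (F_alg lq) (F_alg lq)) (FF_ten lq)"
proof (intro tensor_ring.intro tensor_ring_axioms.intro)
  show "tensor_product (r_module (F_alg lq)) (l_module (F_alg lq)) (acomps (F_alg lq) (F_alg lq))
      (FF_ten lq)"
    by (rule tensor_product_aten) (auto intro: bigrade_F_props bigrade_F_mu_mult)
  show "ring (r_module (F_alg lq))" by (rule ring_r_module_F)
  show "ring (l_module (F_alg lq))" by (rule ring_l_module_F)
  show "(\<one>\<^bsub>r_module (F_alg lq)\<^esub>, \<one>\<^bsub>l_module (F_alg lq)\<^esub>) \<in> tpairs (acomps (F_alg lq) (F_alg lq))"
    unfolding tpairs_def l_module_simps r_module_simps
    by (rule UN_I[OF acompsI[of _ 0 0 _ 0]]) (simp add: bigrade_F_elems)
next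
  fix X X' Y Y' :: "'n Fgen falg set set"
  assume "(X, Y) \<in> acomps (F_alg lq) (F_alg lq)" "(X', Y') \<in> acomps (F_alg lq) (F_alg lq)"
  then obtain \<alpha> \<beta> \<gamma> \<alpha>' \<beta>' \<gamma>' where "X = bigrade (F_alg lq) \<alpha> \<gamma>" "Y = bigrade (F_alg lq) \<gamma> \<beta>"
     "X' = bigrade (F_alg lq) \<alpha>' \<gamma>'" "Y' = bigrade (F_alg lq) \<gamma>' \<beta>'" by (elim acompsE)
  then show "\<exists>X'' Y''. (X'', Y'') \<in> acomps (F_alg lq) (F_alg lq) \<and>
      (\<forall>v\<in>X. \<forall>v'\<in>X'. v \<otimes>\<^bsub>r_module (F_alg lq)\<^esub> v' \<in> X'') \<and>
      (\<forall>w\<in>Y. \<forall>w'\<in>Y'. w \<otimes>\<^bsub>l_module (F_alg lq)\<^esub> w' \<in> Y'')"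
    by (intro exI[of _ "bigrade (F_alg lq) (\<alpha> + \<alpha>') (\<gamma> + \<gamma>')"]
          exI[of _ "bigrade (F_alg lq) (\<gamma> + \<gamma>') (\<beta> + \<beta>')"])
       (auto intro: acompsI bigrade_F_props(4))
next
  fix X Y :: "'n Fgen falg set set" and f
  assume "(X, Y) \<in> acomps (F_alg lq) (F_alg lq)"
  then obtain \<alpha> \<beta> \<gamma> where "X = bigrade (F_alg lq) \<alpha> \<gamma>" "Y = bigrade (F_alg lq) \<gamma> \<beta>" by (rule acompsE)
  then show "\<exists>f'. (\<forall>v\<in>X. \<forall>v'\<in>carrier (r_module (F_alg lq)). v \<otimes>\<^bsub>r_module (F_alg lq)\<^esub>
         (f \<odot>\<^bsub>r_module (F_alg lq)\<^esub> v') = f' \<odot>\<^bsub>r_module (F_alg lq)\<^esub> (v \<otimes>\<^bsub>r_module (F_alg lq)\<^esub> v')) \<and>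
       (\<forall>w\<in>Y. \<forall>w'\<in>carrier (l_module (F_alg lq)). w \<otimes>\<^bsub>l_module (F_alg lq)\<^esub>
          (f \<odot>\<^bsub>l_module (F_alg lq)\<^esub> w') = f' \<odot>\<^bsub>l_module (F_alg lq)\<^esub> (w \<otimes>\<^bsub>l_module (F_alg lq)\<^esub> w'))"
    \<comment> \<open>\<open>\<gamma>\<close> is the middle degree: the right degree of the first
      entry and the left degree of the second.\<close>
    by (intro exI[of _ "T_shift (- \<gamma>) f"]) (simp add: F_mult_mu_l F_mult_mu_r)
qed (auto simp: aten_fields F_pres.m_assoc elim!: acompsE intro: bigrade_F_closed)

interpretation WF: tensor_ring "W_alg lq" "l_module (F_alg lq)" "hcomps (W_alg lq) (F_alg lq)"
    "WF_ten lq" for lq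
  by (rule tensor_ring_WF)

interpretation FF: tensor_ring "r_module (F_alg lq)" "l_module (F_alg lq)" "acomps (F_alg lq) (F_alg lq)"
    "FF_ten lq" for lq
  by (rule tensor_ring_FF)

section \<open>Difference operators and the counit\<close>

lemma T_shift_sum: "T_shift \<alpha> (sum f J) = (\<Sum>j\<in>J. T_shift \<alpha> (f j))"
  by (induction J rule: infinite_finite_induct) (simp_all add: T_shift_add)

lemma D_alg_simps [simp]:
  "monoid.mult D_alg = (\<circ>)" "one D_alg = id" "ring.zero D_alg = (\<lambda>u. 0)"
  "ring.add D_alg = (\<lambda>d e u. d u + e u)" "mu_l D_alg f = (\<lambda>u. f * u)" "mu_r D_alg f = (\<lambda>u. f * u)"
  by (simp_all add: D_alg_def)

lemma bigrade_D: "bigrade D_alg \<alpha> \<beta> = (if \<alpha> = \<beta> then {\<lambda>u. f * T_shift (- \<beta>) u | f. True} else {\<lambda>u. 0})"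
  by (simp add: D_alg_def)

lemma D_algI: "finite B \<Longrightarrow> d = (\<lambda>u. \<Sum>\<beta>\<in>B. f \<beta> * T_shift \<beta> u) \<Longrightarrow> d \<in> carrier D_alg"
  unfolding D_alg_def by auto

lemma D_algE:
  assumes "d \<in> carrier D_alg"
  obtains B f where "finite B" "d = (\<lambda>u. \<Sum>\<beta>\<in>B. f \<beta> * T_shift \<beta> u)"
  using assms unfolding D_alg_def by auto

lemma D_alg_term: "(\<lambda>u. f * T_shift \<beta> u) \<in> carrier D_alg"
  by (rule D_algI[of "{\<beta>}" _ "\<lambda>_. f"]) simp_all

lemma D_alg_times: "(\<lambda>u. f * u) \<in> carrier D_alg"
  using D_alg_term[of f 0] by simp

lemma D_alg_zero: "(\<lambda>u. 0) \<in> carrier D_alg"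
  by (rule D_algI[of "{}"]) simp_all

lemma D_alg_shift: "T_shift \<beta> \<in> carrier D_alg"
  using D_alg_term[of 1 \<beta>] by simp

lemma D_alg_add:
  assumes "d \<in> carrier D_alg" "e \<in> carrier D_alg"
  shows "(\<lambda>u. d u + e u) \<in> carrier D_alg"
proof -
  obtain B f where B: "finite B" "d = (\<lambda>u. \<Sum>\<beta>\<in>B. f \<beta> * T_shift \<beta> u)" using assms(1) by (rule D_algE)
  obtain C g where C: "finite C" "e = (\<lambda>u. \<Sum>\<beta>\<in>C. g \<beta> * T_shift \<beta> u)" using assms(2) by (rule D_algE)
  define f' where "f' \<beta> = (if \<beta> \<in> B then f \<beta> else 0) + (if \<beta> \<in> C then g \<beta> else 0)" for \<beta>
  have "d u + e u = (\<Sum>\<beta>\<in>B \<union> C. f' \<beta> * T_shift \<beta> u)" for u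
  proof -
    have "d u = (\<Sum>\<beta>\<in>B \<union> C. (if \<beta> \<in> B then f \<beta> else 0) * T_shift \<beta> u)"
      unfolding B(2) using B(1) C(1) by (intro sum.mono_neutral_cong_left) auto
    moreover have "e u = (\<Sum>\<beta>\<in>B \<union> C. (if \<beta> \<in> C then g \<beta> else 0) * T_shift \<beta> u)"
      unfolding C(2) using B(1) C(1) by (intro sum.mono_neutral_cong_left) auto
    ultimately show ?thesis by (simp add: f'_def distrib_right sum.distrib)
  qed
  then show ?thesis using B(1) C(1) by (intro D_algI[of "B \<union> C" _ f']) auto
qed

lemma D_alg_sum: "finite J \<Longrightarrow> (\<And>j. j \<in> J \<Longrightarrow> d j \<in> carrier D_alg) \<Longrightarrow> (\<lambda>u. \<Sum>j\<in>J. d j u) \<in> carrier D_alg"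
  by (induction J rule: finite_induct) (simp_all add: D_alg_zero D_alg_add)

lemma D_alg_comp:
  assumes "d \<in> carrier D_alg" "e \<in> carrier D_alg"
  shows "d \<circ> e \<in> carrier D_alg"
proof -
  obtain B f where B: "finite B" "d = (\<lambda>u. \<Sum>\<beta>\<in>B. f \<beta> * T_shift \<beta> u)" using assms(1) by (rule D_algE)
  obtain C g where C: "finite C" "e = (\<lambda>u. \<Sum>\<gamma>\<in>C. g \<gamma> * T_shift \<gamma> u)" using assms(2) by (rule D_algE)
  have "d \<circ> e = (\<lambda>u. \<Sum>\<beta>\<in>B. \<Sum>\<gamma>\<in>C. f \<beta> * T_shift \<beta> (g \<gamma>) * T_shift (\<beta> + \<gamma>) u)"
    by (auto simp: B C T_shift_sum T_shift_mult sum_distrib_left mult.assoc)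
  \<comment> \<open>Several pairs of indices may give the same shift, so membership comes from
    closure under sums of single terms and not from one family of coefficients.\<close>
  also have "\<dots> \<in> carrier D_alg"
    using B(1) C(1) by (intro D_alg_sum D_alg_term)
  finally show ?thesis .
qed

lemma D_alg_minus:
  assumes "d \<in> carrier D_alg"
  shows "(\<lambda>u. - d u) \<in> carrier D_alg"
proof -
  obtain B f where B: "finite B" "d = (\<lambda>u. \<Sum>\<beta>\<in>B. f \<beta> * T_shift \<beta> u)" using assms by (rule D_algE)
  then show ?thesis by (intro D_algI[of B _ "\<lambda>\<beta>. - f \<beta>"]) (simp_all add: sum_negf)
qed

lemma D_alg_additive: "d \<in> carrier D_alg \<Longrightarrow> d (u + v) = d u + d v"
  by (erule D_algE) (simp add: T_shift_add distrib_left sum.distrib)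

lemma ring_D_alg: "ring (D_alg :: ('n::finite, _) halg)"
proof (rule ringI, rule abelian_groupI)
  show "monoid (D_alg :: ('n, _) halg)"
    using D_alg_times[of 1] by (intro monoidI) (auto simp: D_alg_comp id_def)
  fix x assume "x \<in> carrier (D_alg :: ('n, _) halg)"
  then show "\<exists>y\<in>carrier D_alg. y \<oplus>\<^bsub>D_alg\<^esub> x = \<zero>\<^bsub>D_alg\<^esub>"
    using D_alg_minus by (intro bexI[of _ "\<lambda>u. - x u"]) auto
qed (auto simp: D_alg_add D_alg_zero D_alg_additive add_ac)

interpretation D: ring D_alg
  by (rule ring_D_alg)

lemma D_finsum:
  "finite J \<Longrightarrow> (\<And>j. j \<in> J \<Longrightarrow> d j \<in> carrier D_alg) \<Longrightarrow> (\<Oplus>\<^bsub>D_alg\<^esub>j\<in>J. d j) = (\<lambda>u. \<Sum>j\<in>J. d j u)"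
  by (induction J rule: finite_induct) (simp_all add: Pi_def D.finsum_insert)

lemma bigrade_D_props:
  "(\<lambda>u. 0) \<in> bigrade D_alg \<alpha> \<beta>"
  "d \<in> bigrade D_alg \<alpha> \<beta> \<Longrightarrow> e \<in> bigrade D_alg \<alpha> \<beta> \<Longrightarrow> (\<lambda>u. d u + e u) \<in> bigrade D_alg \<alpha> \<beta>"
  "d \<in> bigrade D_alg \<alpha> \<beta> \<Longrightarrow> (\<lambda>u. f * d u) \<in> bigrade D_alg \<alpha> \<beta>"
  "d \<in> bigrade D_alg \<alpha> \<beta> \<Longrightarrow> e \<in> bigrade D_alg \<gamma> \<delta> \<Longrightarrow> d \<circ> e \<in> bigrade D_alg (\<alpha> + \<gamma>) (\<beta> + \<delta>)"
proof -
  show "(\<lambda>u. 0) \<in> bigrade D_alg \<alpha> \<beta>" by (auto simp: bigrade_D intro!: exI[of _ 0])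
  show "(\<lambda>u. d u + e u) \<in> bigrade D_alg \<alpha> \<beta>" if "d \<in> bigrade D_alg \<alpha> \<beta>" "e \<in> bigrade D_alg \<alpha> \<beta>"
    using that by (auto simp: bigrade_D distrib_right[symmetric] split: if_splits)
  show "(\<lambda>u. f * d u) \<in> bigrade D_alg \<alpha> \<beta>" if "d \<in> bigrade D_alg \<alpha> \<beta>"
    using that by (auto simp: bigrade_D mult.assoc[symmetric] split: if_splits)
  show "d \<circ> e \<in> bigrade D_alg (\<alpha> + \<gamma>) (\<beta> + \<delta>)" if de: "d \<in> bigrade D_alg \<alpha> \<beta>" "e \<in> bigrade D_alg \<gamma> \<delta>"
  proof (cases "\<alpha> = \<beta> \<and> \<gamma> = \<delta>")
    case True
    then obtain f g where "d = (\<lambda>u. f * T_shift (- \<beta>) u)" "e = (\<lambda>u. g * T_shift (- \<delta>) u)"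
      using de by (auto simp: bigrade_D)
    then have "d \<circ> e = (\<lambda>u. f * T_shift (- \<beta>) g * T_shift (- (\<beta> + \<delta>)) u)"
      by (auto simp: T_shift_mult mult.assoc)
    then show ?thesis using True by (auto simp: bigrade_D)
  next
    case False
    then have "d \<circ> e = (\<lambda>u. 0)" using de D_alg_zero by (auto simp: bigrade_D fun_eq_iff split: if_splits)
    moreover have "(\<lambda>u. 0) \<in> bigrade D_alg (\<alpha> + \<gamma>) (\<beta> + \<delta>)"
      by (auto simp: bigrade_D intro!: exI[of _ 0])
    ultimately show ?thesis by simp
  qed
qed

section \<open>The counit of F\<close>

definition counit_gen :: "'n Fgen \<Rightarrow> 'n::{finite,linorder} mero \<Rightarrow> 'n mero" where
  "counit_gen = (\<lambda>y. case y of
       Tgen i j \<Rightarrow> (if i = j then T_shift (- \<omega> i) else (\<lambda>u. 0))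
     | Lgen f \<Rightarrow> (\<lambda>u. f * u)
     | Rgen f \<Rightarrow> (\<lambda>u. f * u))"

lemma counit_gen_simps [simp]:
  "counit_gen (Tgen i j) = (if i = j then T_shift (- \<omega> i) else (\<lambda>u. 0))"
  "counit_gen (Lgen f) = (\<lambda>u. f * u)" "counit_gen (Rgen f) = (\<lambda>u. f * u)"
  by (simp_all add: counit_gen_def)

lemma F_counit_lift: "F_counit = presented_lift D_alg counit_gen"
  by (simp add: F_counit_def counit_gen_def)

lemma D_alg_commute_const: "d \<in> carrier D_alg \<Longrightarrow> d (mero_const c * u) = mero_const c * d u"
  by (auto elim!: D_algE simp: T_shift_mult sum_distrib_left mult_ac)

lemma counit_gen_closed: "counit_gen y \<in> carrier D_alg"
  by (cases y) (simp_all add: D_alg_shift D_alg_zero D_alg_times)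

interpretation counit: free_lift_hom D_alg counit_gen
  by (rule free_lift_hom.intro[OF ring_D_alg counit_gen_closed])
     (simp add: D_alg_times, simp add: mero_const_add distrib_right,
      simp add: mero_const_mult comp_def mult.assoc, simp add: id_def, simp add: comp_def D_alg_commute_const)

text \<open>In RLL the Kronecker deltas leave one term on each side, both with the entry of upper
  indices \<open>b d\<close> and lower indices \<open>a c\<close>, since the two dynamical variables
  are sent to the same one. The operators shift by the weights of \<open>b, d\<close> and of
  \<open>a, c\<close> respectively, and these agree whenever the entry is nonzero.\<close>

lemma counit_rel:
  assumes "s \<in> F_rels lq"
  shows "counit.lift s = \<zero>\<^bsub>D_alg\<^esub>"
proof -
  note lift = counit.lift_mult counit.lift_fgen counit.lift_add counit.lift_fscalar
  have eq: "counit.lift (x - y) = \<zero>\<^bsub>D_alg\<^esub>" if "counit.lift x = counit.lift y" for x y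
    unfolding counit.lift_diff that a_minus_def by (rule D.r_neg) (rule counit.lift_closed)
  from assms show ?thesis
  proof (induction rule: F_rels_cases)
    case (add M f f')
    then show ?case by (intro eq) (auto simp: lift distrib_right)
  next
    case (mult M f f')
    then show ?case by (intro eq) (auto simp: lift mult.assoc)
  next
    case (const M c)
    then show ?case by (intro eq) (auto simp: lift)
  next
    case (commute f f')
    show ?case by (intro eq) (auto simp: lift mult.left_commute)
  next
    case (left f i j)
    show ?case by (intro eq) (auto simp: lift T_shift_mult)
  next
    case (right f i j)
    show ?case by (intro eq) (auto simp: lift T_shift_mult)
  next
    case (RLL a b c d)
    have "counit.lift (\<Sum>x\<in>UNIV. \<Sum>y\<in>UNIV. fgen (Lgen (Rmat lq x y a c)) * fgen (Tgen x b) * fgen (Tgen y d)) =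
       (\<lambda>u. \<Sum>x\<in>UNIV. \<Sum>y\<in>UNIV. counit.lift (fgen (Lgen (Rmat lq x y a c)) * fgen (Tgen x b) * fgen (Tgen y d)) u)"
      by (simp only: counit.lift_sum finite_class.finite_UNIV D_finsum counit.lift_closed D_alg_sum)
    also have "\<dots> = (\<lambda>u. \<Sum>x\<in>UNIV. \<Sum>y\<in>UNIV. if y = d then
        (if x = b then Rmat lq x y a c * T_shift (- (\<omega> b + \<omega> d)) u else 0) else 0)"
      by (intro ext sum.cong refl) (auto simp: lift)
    also have "\<dots> = (\<lambda>u. Rmat lq b d a c * T_shift (- (\<omega> b + \<omega> d)) u)" by simp
    finally have 1: "counit.lift (\<Sum>x\<in>UNIV. \<Sum>y\<in>UNIV. fgen (Lgen (Rmat lq x y a c)) * fgen (Tgen x b) * fgen (Tgen y d)) =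
       (\<lambda>u. Rmat lq b d a c * T_shift (- (\<omega> b + \<omega> d)) u)" .
    have "counit.lift (\<Sum>x\<in>UNIV. \<Sum>y\<in>UNIV. fgen (Rgen (Rmat lq b d x y)) * fgen (Tgen c y) * fgen (Tgen a x)) =
       (\<lambda>u. \<Sum>x\<in>UNIV. \<Sum>y\<in>UNIV. counit.lift (fgen (Rgen (Rmat lq b d x y)) * fgen (Tgen c y) * fgen (Tgen a x)) u)"
      by (simp only: counit.lift_sum finite_class.finite_UNIV D_finsum counit.lift_closed D_alg_sum)
    also have "\<dots> = (\<lambda>u. \<Sum>x\<in>UNIV. \<Sum>y\<in>UNIV. if y = c then
        (if x = a then Rmat lq b d x y * T_shift (- (\<omega> a + \<omega> c)) u else 0) else 0)"
      by (intro ext sum.cong refl) (auto simp: lift add.commute)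
    also have "\<dots> = (\<lambda>u. Rmat lq b d a c * T_shift (- (\<omega> a + \<omega> c)) u)" by simp
    finally have 2: "counit.lift (\<Sum>x\<in>UNIV. \<Sum>y\<in>UNIV. fgen (Rgen (Rmat lq b d x y)) * fgen (Tgen c y) * fgen (Tgen a x)) =
       (\<lambda>u. Rmat lq b d a c * T_shift (- (\<omega> a + \<omega> c)) u)" .
    show ?case
    proof (intro eq, cases "\<omega> b + \<omega> d = \<omega> a + \<omega> c")
      case True
      then show "counit.lift (\<Sum>x\<in>UNIV. \<Sum>y\<in>UNIV. fgen (Lgen (Rmat lq x y a c)) * fgen (Tgen x b) * fgen (Tgen y d)) =
         counit.lift (\<Sum>x\<in>UNIV. \<Sum>y\<in>UNIV. fgen (Rgen (Rmat lq b d x y)) * fgen (Tgen c y) * fgen (Tgen a x))"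
        unfolding 1 2 by (simp only:)
    qed (simp add: 1 2 Rmat_zero)
  qed
qed

lemma F_counit_class: "F_counit (F_cls lq x) = counit.lift x"
  unfolding F_counit_lift by (rule counit.presented_lift_class) (rule counit_rel)

lemma F_counit_add:
  assumes "a \<in> carrier (F_alg lq)" "b \<in> carrier (F_alg lq)"
  shows "F_counit (a \<oplus>\<^bsub>F_alg lq\<^esub> b) = (\<lambda>u. F_counit a u + F_counit b u)"
  using assms by (auto simp: F_pres.carrier_A F_pres.cls_add F_counit_class counit.lift_add)

lemma F_counit_mult:
  assumes "a \<in> carrier (F_alg lq)" "b \<in> carrier (F_alg lq)"
  shows "F_counit (a \<otimes>\<^bsub>F_alg lq\<^esub> b) = F_counit a \<circ> F_counit b"
  using assms by (auto simp: F_pres.carrier_A F_pres.cls_mult F_counit_class counit.lift_mult)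

lemma F_counit_elems:
  "F_counit (t_elt lq i j) = (if i = j then T_shift (- \<omega> i) else (\<lambda>u. 0))"
  "F_counit (mul lq f) = (\<lambda>u. f * u)" "F_counit (mur lq f) = (\<lambda>u. f * u)"
  "F_counit \<one>\<^bsub>F_alg lq\<^esub> = id"
  by (simp_all add: t_elt_class mu_l_F mu_r_F F_pres.cls_one F_counit_class counit.lift_fgen counit.lift_one)

lemma \<omega>_eq_iff [simp]: "\<omega> i = \<omega> j \<longleftrightarrow> i = j"
  by (simp add: \<omega>_def axis_eq_axis)

lemma bigrade_D_elems: "id \<in> bigrade D_alg 0 0" "(\<lambda>u. f * u) \<in> bigrade D_alg 0 0"
  by (auto simp: bigrade_D fun_eq_iff intro: exI[of _ 1])

lemma counit_gen_bigrade: "counit_gen y \<in> bigrade D_alg (fst (F_deg y)) (snd (F_deg y))"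
proof (cases y)
  case (Tgen i j)
  then show ?thesis by (auto simp: bigrade_D intro!: exI[of _ 1])
qed (simp_all add: bigrade_D_elems)

lemma F_counit_bigrade:
  assumes "a \<in> bigrade (F_alg lq) \<alpha> \<beta>"
  shows "F_counit a \<in> bigrade D_alg \<alpha> \<beta>"
proof -
  obtain x where x: "a = F_cls lq x" "x \<in> homogeneous F_deg (\<alpha>, \<beta>)"
    using assms by (auto simp: bigrade_F F.part_def)
  have "counit.lift x \<in> bigrade D_alg (fst (\<alpha>, \<beta>)) (snd (\<alpha>, \<beta>))"
  proof (rule counit.lift_homogeneous[OF x(2)])
  qed (simp_all add: bigrade_D_props bigrade_D_elems counit_gen_bigrade)
  then show ?thesis by (simp add: x F_counit_class)
qed

section \<open>Quadratic relations between the generators \<open>t\<^sub>i\<^sub>j\<close>\<close>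

lemma (in presented_algebra) I_sum: "(\<And>j. j \<in> J \<Longrightarrow> f j \<in> I) \<Longrightarrow> sum f J \<in> I"
  by (induction J rule: infinite_finite_induct) (simp_all add: I_0 I_add)

lemma (in presented_algebra) I_sum_subset:
  assumes "finite J" "K \<subseteq> J" "\<And>j. j \<in> J - K \<Longrightarrow> f j \<in> I"
  shows "sum f J - sum f K \<in> I"
  using I_sum[of "J - K" f] assms by (simp add: sum_diff)

lemma F_I_rel: "x \<in> F_rels lq \<Longrightarrow> x \<in> F_ideal lq"
  using F_pres.S_subset_I by blast

text \<open>Terms with vanishing R-entry lie in the ideal, so each side may be cut down to any index
  set containing the possible nonzero entries. \<open>K\<close> and \<open>K'\<close> are left free
  because the two listed pairs coincide when the indices do.\<close>

lemma RLL_sums: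
  fixes lq :: complex and a b c d :: "'n::{finite,linorder}"
  defines "l \<equiv> \<lambda>(x, y). fgen (Lgen (Rmat lq x y a c)) * fgen (Tgen x b) * fgen (Tgen y d)"
    and "r \<equiv> \<lambda>(x, y). fgen (Rgen (Rmat lq b d x y)) * fgen (Tgen c y) * fgen (Tgen a x)"
  assumes "{(a, c), (c, a)} \<subseteq> K" "{(b, d), (d, b)} \<subseteq> K'"
  shows "sum l K - sum r K' \<in> F_ideal lq"
proof -
  have "l p \<in> F_ideal lq" if "p \<notin> K" for p
  proof (cases p)
    case (Pair x y)
    then have "Rmat lq x y a c = 0" using that assms(3) by (auto simp: Rmat_def)
    then show ?thesis unfolding l_def Pair using F_moment_0[OF insertI1, of lq]
      by (simp only: prod.case) (intro F_pres.I_mult(2))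
  qed
  then have L: "sum l UNIV - sum l K \<in> F_ideal lq"
    by (intro F_pres.I_sum_subset) auto
  have "r p \<in> F_ideal lq" if "p \<notin> K'" for p
  proof (cases p)
    case (Pair x y)
    then have "Rmat lq b d x y = 0" using that assms(4) by (auto simp: Rmat_def)
    then show ?thesis unfolding r_def Pair using F_moment_0[OF insertI2[OF singletonI], of lq]
      by (simp only: prod.case) (intro F_pres.I_mult(2))
  qed
  then have R: "sum r UNIV - sum r K' \<in> F_ideal lq"
    by (intro F_pres.I_sum_subset) auto
  have "sum l UNIV - sum r UNIV \<in> F_ideal lq"
    using F_I_rel[OF F_rels_RLL[of lq a c b d]]
    by (simp add: l_def r_def sum.cartesian_product UNIV_Times_UNIV)
  from F_pres.I_add[OF F_pres.I_diff[OF this L] R] show ?thesis by simp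
qed

text \<open>In the free algebra the generators do not depend linearly on the function, so the
  identity h = q - h0 is only available modulo the ideal, through the relations for sums and
  constants.\<close>

lemma mu_h_mem:
  assumes "M \<in> {Lgen, Rgen :: 'n::{finite,linorder} mero \<Rightarrow> 'n Fgen}"
  shows "fgen (M (h_at lq a b)) - (fscalar (qpow lq 1) - fgen (M (h0_at lq a b))) \<in> F_ideal lq"
proof -
  note rel = F_I_rel[OF F_rels_moment(1)[OF assms]] F_I_rel[OF F_rels_moment(3)[OF assms]]
  have "mero_const (qpow lq 1) = h_at lq a b + h0_at lq a b" by (simp add: h_at_eq)
  then show ?thesis
    using F_pres.I_diff[OF rel(2)[of "qpow lq 1" lq] rel(1)[of "h_at lq a b" "h0_at lq a b" lq]]
    by (simp add: algebra_simps)
qed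

lemma mu_one_mem:
  assumes "M \<in> {Lgen, Rgen :: 'n::{finite,linorder} mero \<Rightarrow> 'n Fgen}"
  shows "fgen (M 1) - 1 \<in> F_ideal lq"
  using F_I_rel[OF F_rels_moment(3)[OF assms, of 1 lq]] by simp

abbreviation tt :: "'n \<Rightarrow> 'n \<Rightarrow> 'n::finite Fgen falg" where
  "tt i j \<equiv> fgen (Tgen i j)"

text \<open>RLL for \<open>a = k\<close>, \<open>c = l\<close>, \<open>b = d = i\<close>. The
  entries on the left are 1 and h0(\<lambda>_l - \<lambda>_k), the only one on the right is q; the
  left generator for the constant function 1 is then replaced by 1.\<close>

lemma RLL_equal:
  assumes "k < l"
  shows "tt k i * tt l i + fgen (Lgen (h0_at lq l k)) * (tt l i * tt k i) -
    fgen (Rgen (mero_const (qpow lq 1))) * (tt l i * tt k i) \<in> F_ideal lq"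
proof -
  have kl: "k < l" "k \<noteq> l" "l \<noteq> k" "\<not> l < k" using assms by auto
  have "fgen (Lgen 1) * tt k i * tt l i + fgen (Lgen (h0_at lq l k)) * tt l i * tt k i -
    fgen (Rgen (mero_const (qpow lq 1))) * tt l i * tt k i \<in> F_ideal lq"
    using RLL_sums[of k l "{(k, l), (l, k)}" i i "{(i, i)}" lq] kl by (simp add: Rmat_def)
  from F_pres.I_diff[OF this F_pres.I_mult(2)[OF F_pres.I_mult(2)[OF mu_one_mem[OF insertI1, of lq], of "tt k i"], of "tt l i"]]
  show ?thesis by (simp add: algebra_simps)
qed

text \<open>RLL for \<open>a = k\<close>, \<open>c = l\<close> and distinct \<open>b = i\<close>,
  \<open>d = j\<close>. Now two entries survive on the right, and the order of \<open>i\<close> and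
  \<open>j\<close> decides whether the diagonal one is 1 or g.\<close>

lemma RLL_distinct:
  assumes "k < l" "i \<noteq> j"
  shows "tt k i * tt l j + fgen (Lgen (h0_at lq l k)) * (tt l i * tt k j) -
    (fgen (Rgen (if i < j then 1 else g_at lq i j)) * (tt l j * tt k i) +
     fgen (Rgen (h0_at lq i j)) * (tt l i * tt k j)) \<in> F_ideal lq"
proof -
  have kl: "k < l" "k \<noteq> l" "l \<noteq> k" "\<not> l < k" using assms by auto
  have "fgen (Lgen 1) * tt k i * tt l j + fgen (Lgen (h0_at lq l k)) * tt l i * tt k j -
    (fgen (Rgen (if i < j then 1 else g_at lq i j)) * tt l j * tt k i +
     fgen (Rgen (h0_at lq i j)) * tt l i * tt k j) \<in> F_ideal lq"
    using RLL_sums[of k l "{(k, l), (l, k)}" i j "{(i, j), (j, i)}" lq] kl assms(2) assms(2)[symmetric] by (simp add: Rmat_def)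
  from F_pres.I_diff[OF this F_pres.I_mult(2)[OF F_pres.I_mult(2)[OF mu_one_mem[OF insertI1, of lq], of "tt k i"], of "tt l j"]]
  show ?thesis by (simp add: algebra_simps)
qed

text \<open>The coefficient of \<open>w\<^sub>k w\<^sub>l\<close>, \<open>k < l\<close>, in the product of the images of \<open>w\<^sub>i\<close> and \<open>w\<^sub>j\<close>.\<close>

definition minor :: "complex \<Rightarrow> 'n \<Rightarrow> 'n \<Rightarrow> 'n \<Rightarrow> 'n \<Rightarrow> 'n::{finite,linorder} Fgen falg" where
  "minor lq k l i j = tt k i * tt l j - fgen (Lgen (h_at lq l k)) * (tt l i * tt k j)"

text \<open>\<open>RLL_equal\<close> reads t_ki t_li = (q - h0) t_li t_ki, and q - h0 = h.\<close>

lemma minor_equal: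
  assumes "k < l"
  shows "minor lq k l i i \<in> F_ideal lq"
proof -
  let ?P = "tt l i * tt k i"
  let ?A = "tt k i * tt l i + fgen (Lgen (h0_at lq l k)) * ?P - fgen (Rgen (mero_const (qpow lq 1))) * ?P"
  let ?e = "fgen (Lgen (h_at lq l k)) - (fscalar (qpow lq 1) - fgen (Lgen (h0_at lq l k)))"
  have "?A + (fgen (Rgen (mero_const (qpow lq 1))) - fscalar (qpow lq 1)) * ?P - ?e * ?P
      \<in> F_ideal lq"
    by (intro F_pres.I_diff F_pres.I_add F_pres.I_mult(2) RLL_equal[OF assms] mu_h_mem[OF insertI1]
          F_I_rel F_rels_moment insertI2 singletonI)
  also have "?A + (fgen (Rgen (mero_const (qpow lq 1))) - fscalar (qpow lq 1)) * ?P - ?e * ?P = minor lq k l i i"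
    by (simp add: minor_def algebra_simps)
  finally show ?thesis .
qed

text \<open>Let A1 and A2 be RLL with column indices \<open>i, j\<close> and \<open>j, i\<close>,
  and form A2 + h(\<mu>_j - \<mu>_i) A1. The coefficient of \<open>?Q\<close> becomes h0(\<lambda>_l
  - \<lambda>_k) - q, because h + h0 = q at \<mu>_j - \<mu>_i. Factoring g as h(\<mu>_j - \<mu>_i)
  h(\<mu>_i - \<mu>_j) turns the coefficient of \<open>?P\<close> into h(\<mu>_j - \<mu>_i) times
  h0(\<lambda>_l - \<lambda>_k) - q in the same way. In both places h0 - q is -h(\<lambda>_l -
  \<lambda>_k), as in the minors.\<close>

lemma minor_swap:
  assumes kl: "k < l" and ij: "i < j" and lq: "lq \<noteq> 0"
  shows "minor lq k l j i + fgen (Rgen (h_at lq j i)) * minor lq k l i j \<in> F_ideal lq"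
proof -
  let ?I = "F_ideal lq"
  let ?P = "tt l i * tt k j" and ?Q = "tt l j * tt k i" and ?X = "tt k i * tt l j" and ?Y = "tt k j * tt l i"
  let ?c = "fscalar (qpow lq 1)"
  let ?Hl = "fgen (Lgen (h_at lq l k))" and ?H0 = "fgen (Lgen (h0_at lq l k))"
  let ?Hr = "fgen (Rgen (h_at lq j i))" and ?G2 = "fgen (Rgen (h0_at lq j i))"
  let ?Hr' = "fgen (Rgen (h_at lq i j))" and ?G1 = "fgen (Rgen (h0_at lq i j))"
  let ?G = "fgen (Rgen (g_at lq j i))"
  have Rgen: "Rgen \<in> {Lgen, Rgen}" by simp
  have A1: "?X + ?H0 * ?P - (?Q + ?G1 * ?P) \<in> ?I"
  proof -
    have "?X + ?H0 * ?P - (fgen (Rgen 1) * ?Q + ?G1 * ?P) \<in> ?I"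
      using RLL_distinct[OF kl, of i j lq] ij by simp
    from F_pres.I_add[OF this F_pres.I_mult(2)[OF mu_one_mem[OF Rgen, of lq], of ?Q]]
    show ?thesis by (simp add: algebra_simps)
  qed
  have A2: "?Y + ?H0 * ?Q - (?G * ?P + ?G2 * ?Q) \<in> ?I"
    using RLL_distinct[OF kl, of j i lq] less_imp_neq[OF ij, symmetric] order_less_not_sym[OF ij] by simp
  have eg: "?G - ?Hr * ?Hr' \<in> ?I"
    using F_I_rel[OF F_rels_moment(2)[OF Rgen, of "h_at lq j i" "h_at lq i j" lq]] g_at_factor[of j i lq] ij lq
    by simp
  note e = mu_h_mem[OF Rgen, of lq] mu_h_mem[OF insertI1, of lq]
  \<comment> \<open>The combination just described, followed by one correction for the factorization
    of g and four for h = q - h0, each multiplied by the monomial where it is applied.\<close>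
  have "(?Y + ?H0 * ?Q - (?G * ?P + ?G2 * ?Q)) + ?Hr * (?X + ?H0 * ?P - (?Q + ?G1 * ?P)) +
      (?G - ?Hr * ?Hr') * ?P + (?Hr - (?c - ?G2)) * ?Q - (?Hl - (?c - ?H0)) * ?Q +
      ?Hr * ((?Hr' - (?c - ?G1)) * ?P) - ?Hr * ((?Hl - (?c - ?H0)) * ?P) \<in> ?I"
    by (intro F_pres.I_diff F_pres.I_add F_pres.I_mult(2)[OF e(1)] F_pres.I_mult(2)[OF e(2)]
        F_pres.I_mult(1)[OF A1] F_pres.I_mult(2)[OF eg] A2 F_pres.I_mult(1)[OF F_pres.I_mult(2)[OF e(1)]]
        F_pres.I_mult(1)[OF F_pres.I_mult(2)[OF e(2)]])
  also have "(?Y + ?H0 * ?Q - (?G * ?P + ?G2 * ?Q)) + ?Hr * (?X + ?H0 * ?P - (?Q + ?G1 * ?P)) +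
      (?G - ?Hr * ?Hr') * ?P + (?Hr - (?c - ?G2)) * ?Q - (?Hl - (?c - ?H0)) * ?Q +
      ?Hr * ((?Hr' - (?c - ?G1)) * ?P) - ?Hr * ((?Hl - (?c - ?H0)) * ?P) =
      minor lq k l j i + ?Hr * minor lq k l i j"
    by (simp add: minor_def algebra_simps)
  finally show ?thesis .
qed

section \<open>Finite sums\<close>

context abelian_monoid
begin

lemma finsum_prod:
  assumes "finite A" "finite B" "\<And>a b. a \<in> A \<Longrightarrow> b \<in> B \<Longrightarrow> f a b \<in> carrier G"
  shows "(\<Oplus>a\<in>A. \<Oplus>b\<in>B. f a b) = (\<Oplus>p\<in>A \<times> B. f (fst p) (snd p))"
  using assms(1,3)
proof (induction A rule: finite_induct)
  case (insert a A)
  have "(\<Oplus>p\<in>insert a A \<times> B. f (fst p) (snd p)) =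
      (\<Oplus>p\<in>Pair a ` B. f (fst p) (snd p)) \<oplus> (\<Oplus>p\<in>A \<times> B. f (fst p) (snd p))"
    unfolding insert_def Sigma_Un_distrib1[symmetric]
    using insert assms(2)
    by (subst finsum_Un_disjoint[symmetric]) (auto intro!: arg_cong2[where f = "finsum G"])
  also have "(\<Oplus>p\<in>Pair a ` B. f (fst p) (snd p)) = (\<Oplus>b\<in>B. f a b)"
    using insert by (subst finsum_reindex) (auto simp: inj_on_def)
  finally show ?case using insert by (simp add: Pi_def)
qed simp

lemma finsum_swap:
  assumes "finite A" "finite B" "\<And>a b. a \<in> A \<Longrightarrow> b \<in> B \<Longrightarrow> f a b \<in> carrier G"
  shows "(\<Oplus>a\<in>A. \<Oplus>b\<in>B. f a b) = (\<Oplus>b\<in>B. \<Oplus>a\<in>A. f a b)"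
  using assms(1,3)
proof (induction A rule: finite_induct)
  case (insert a A)
  have "(\<Oplus>b\<in>B. \<Oplus>a\<in>insert a A. f a b) = (\<Oplus>b\<in>B. f a b \<oplus> (\<Oplus>a\<in>A. f a b))"
    using insert by (intro finsum_cong') auto
  also have "\<dots> = (\<Oplus>b\<in>B. f a b) \<oplus> (\<Oplus>b\<in>B. \<Oplus>a\<in>A. f a b)"
    using insert by (intro finsum_addf) auto
  finally show ?case using insert by (simp add: Pi_def)
qed simp

text \<open>Groups each pair of indices with its reversal, so that the two orders of a product w_k
  w_l can be combined; the diagonal will drop out because w_k squares to zero.\<close>

lemma finsum_triangle:
  fixes f :: "'n::{finite,linorder} \<Rightarrow> 'n \<Rightarrow> 'a"
  assumes "\<And>k l. f k l \<in> carrier G" "\<And>k. f k k = \<zero>"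
  shows "(\<Oplus>k\<in>UNIV. \<Oplus>l\<in>UNIV. f k l) = (\<Oplus>p\<in>{(k, l). k < l}. f (fst p) (snd p) \<oplus> f (snd p) (fst p))"
proof -
  let ?g = "\<lambda>p. f (fst p) (snd p)"
  let ?L = "{(k, l). k < l} :: ('n \<times> 'n) set"
  have "(\<Oplus>k\<in>UNIV. \<Oplus>l\<in>UNIV. f k l) = (\<Oplus>p\<in>UNIV. ?g p)"
    using finsum_prod[of UNIV UNIV f] assms by simp
  also have "\<dots> = (\<Oplus>p\<in>?L \<union> prod.swap ` ?L. ?g p)"
  proof (rule add.finprod_mono_neutral_cong_right)
    show "?g p = \<zero>" if "p \<in> UNIV - (?L \<union> prod.swap ` ?L)" for p
    proof -
      have "\<not> fst p < snd p" using that by (auto simp: case_prod_unfold)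
      moreover have "\<not> snd p < fst p"
      proof
        assume "snd p < fst p"
        then have "p \<in> prod.swap ` ?L" by (intro image_eqI[of _ _ "prod.swap p"]) auto
        then show False using that by blast
      qed
      ultimately show ?thesis using assms(2) by simp
    qed
  qed (use assms in auto)
  also have "\<dots> = (\<Oplus>p\<in>?L. ?g p) \<oplus> (\<Oplus>p\<in>prod.swap ` ?L. ?g p)"
    using assms by (intro finsum_Un_disjoint) auto
  also have "(\<Oplus>p\<in>prod.swap ` ?L. ?g p) = (\<Oplus>p\<in>?L. f (snd p) (fst p))"
    using assms by (subst finsum_reindex) (auto simp: inj_on_def)
  also have "(\<Oplus>p\<in>?L. ?g p) \<oplus> \<dots> = (\<Oplus>p\<in>?L. ?g p \<oplus> f (snd p) (fst p))"
    using assms by (intro finsum_addf[symmetric]) auto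
  finally show ?thesis .
qed

end

section \<open>The coaction on \<open>W\<close>\<close>

lemma ring_cong:
  assumes "ring R" and "carrier S = carrier R" "monoid.mult S = monoid.mult R" "one S = one R"
    "ring.zero S = ring.zero R" "ring.add S = ring.add R"
  shows "ring S"
proof -
  interpret R: ring R by (rule assms(1))
  show ?thesis
  proof (rule ringI, rule abelian_groupI)
    show "monoid S" by (rule monoidI) (simp_all add: assms R.m_assoc)
    show "\<exists>y\<in>carrier S. y \<oplus>\<^bsub>S\<^esub> x = \<zero>\<^bsub>S\<^esub>" if "x \<in> carrier S" for x
      using that R.l_neg[of x] by (intro bexI[of _ "\<ominus>\<^bsub>R\<^esub> x"]) (simp_all add: assms)
  qed (simp_all add: assms R.a_ac R.l_distr R.r_distr)
qed

context tensor_product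
begin

text \<open>Membership of the sum in \<open>Y\<close> is proved along with the formula, because
  additivity of tensors is available only inside one component.\<close>

lemma pure_finsum_right:
  assumes "abelian_monoid W" "(X, Y) \<in> Cs" "v \<in> X" "\<zero>\<^bsub>W\<^esub> \<in> Y" "Y \<subseteq> carrier W" "finite J" "\<And>j. j \<in> J \<Longrightarrow> f j \<in> Y"
  shows "(\<Oplus>\<^bsub>W\<^esub>j\<in>J. f j) \<in> Y \<and> pure v (\<Oplus>\<^bsub>W\<^esub>j\<in>J. f j) = (\<Oplus>j\<in>J. pure v (f j))"
proof -
  interpret W: abelian_monoid W by (rule assms(1))
  from assms(6,7) show ?thesis
  proof (induction J rule: finite_induct)
    case empty
    then show ?case by (simp add: pure_zero_right assms(4))
  next
    case (insert j J)
    then have "f \<in> J \<rightarrow> carrier W" "f j \<in> carrier W" using assms(5) by auto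
    then show ?case using insert by (simp add: pure_add_right[OF assms(2,3)] closed(2)[OF assms(2)] Pi_def)
  qed
qed

lemma pure_finsum_left:
  assumes "abelian_monoid V" "(X, Y) \<in> Cs" "w \<in> Y" "\<zero>\<^bsub>V\<^esub> \<in> X" "X \<subseteq> carrier V" "finite J" "\<And>j. j \<in> J \<Longrightarrow> f j \<in> X"
  shows "(\<Oplus>\<^bsub>V\<^esub>j\<in>J. f j) \<in> X \<and> pure (\<Oplus>\<^bsub>V\<^esub>j\<in>J. f j) w = (\<Oplus>j\<in>J. pure (f j) w)"
proof -
  interpret V: abelian_monoid V by (rule assms(1))
  from assms(6,7) show ?thesis
  proof (induction J rule: finite_induct)
    case empty
    then show ?case by (simp add: pure_zero_left assms(4))
  next
    case (insert j J)
    then have "f \<in> J \<rightarrow> carrier V" "f j \<in> carrier V" using assms(5) by auto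
    then show ?case using insert by (simp add: pure_add_left[OF assms(2) _ _ assms(3)] closed(1)[OF assms(2)] Pi_def)
  qed
qed

end

definition hdeg :: "('n::finite, 'v) hspace \<Rightarrow> ('n, 'a) halg \<Rightarrow> complex^'n \<Rightarrow> ('v \<times> 'a) set" where
  "hdeg V A \<beta> = (\<Union>\<alpha>. grade V \<alpha> \<times> bigrade A \<alpha> \<beta>)"

lemma hdeg_subset: "hdeg V A \<beta> \<subseteq> tpairs (hcomps V A)"
  by (auto simp: hdeg_def tpairs_def hcomps_def)

lemma hdegI: "v \<in> grade V \<alpha> \<Longrightarrow> a \<in> bigrade A \<alpha> \<beta> \<Longrightarrow> (v, a) \<in> hdeg V A \<beta>"
  by (auto simp: hdeg_def)

lemma hdegE:
  assumes "(v, a) \<in> hdeg V A \<beta>"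
  obtains \<alpha> where "v \<in> grade V \<alpha>" "a \<in> bigrade A \<alpha> \<beta>"
  using assms by (auto simp: hdeg_def)

lemma hten_grade: "grade (hten V A) \<beta> = tensor_product.tspan V (l_module A) (hcomps V A) (hdeg V A \<beta>)"
  if "tensor_product V (l_module A) (hcomps V A) (hten V A)"
  unfolding tensor_product.tspan_def[OF that] by (simp add: hten_def Let_def hdeg_def)

lemma hten_W_grade: "grade (WF_ten lq) \<beta> = WF.tspan lq (hdeg (W_alg lq) (F_alg lq) \<beta>)"
  by (rule hten_grade) (rule WF.tensor_product_axioms)

lemma hcomps_pairs: "v \<in> grade V \<alpha> \<Longrightarrow> a \<in> bigrade A \<alpha> \<beta> \<Longrightarrow> (v, a) \<in> tpairs (hcomps V A)"
  by (rule subsetD[OF hdeg_subset hdegI])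

lemma hpure_mult_W:
  assumes "v \<in> grade (W_alg lq) \<alpha>" "a \<in> bigrade (F_alg lq) \<alpha> \<beta>"
    "w \<in> grade (W_alg lq) \<alpha>'" "b \<in> bigrade (F_alg lq) \<alpha>' \<beta>'"
  shows "hpure_W lq v a \<otimes>\<^bsub>WF_ten lq\<^esub> hpure_W lq w b =
    hpure_W lq (v \<otimes>\<^bsub>W_alg lq\<^esub> w) (a \<otimes>\<^bsub>F_alg lq\<^esub> b)"
  using WF.pure_mult[OF hcomps_pairs hcomps_pairs, OF assms] by (simp add: hpure_def)

lemma hpure_closed [simp]: "hpure_W lq v a \<in> carrier (WF_ten lq)"
  by (simp add: hpure_def)

lemma hten_W_smult:
  assumes "X \<in> carrier (WF_ten lq)"
  shows "f \<odot>\<^bsub>WF_ten lq\<^esub> X =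
    hpure_W lq \<one>\<^bsub>W_alg lq\<^esub> (mur lq f) \<otimes>\<^bsub>WF_ten lq\<^esub> X"
  using WF.mult_right_factor[OF hcomps_pairs assms, OF grade_W_elems(2) bigrade_F_elems(2)]
  by (simp add: hpure_def hten_def Let_def)

lemma hpure_moment:
  assumes "v \<in> grade (W_alg lq) \<alpha>" "a \<in> bigrade (F_alg lq) \<alpha> \<beta>"
  shows "f \<odot>\<^bsub>WF_ten lq\<^esub> hpure_W lq v a =
    hpure_W lq v (mur lq f \<otimes>\<^bsub>F_alg lq\<^esub> a)"
  using assms grade_W_closed[OF assms(1)]
  by (simp add: hten_W_smult hpure_mult_W[OF grade_W_elems(2) bigrade_F_elems(2) assms])

lemma hten_W_grade_closed:
  "X \<in> grade (WF_ten lq) \<beta> \<Longrightarrow> X \<in> carrier (WF_ten lq)"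
  unfolding hten_W_grade by (rule WF.tspan_closed[OF hdeg_subset])

lemma hten_W_grade_mult:
  assumes "X \<in> grade (WF_ten lq) \<beta>" "Y \<in> grade (WF_ten lq) \<beta>'"
  shows "X \<otimes>\<^bsub>WF_ten lq\<^esub> Y \<in> grade (WF_ten lq) (\<beta> + \<beta>')"
  unfolding hten_W_grade
  by (rule WF.tspan_mult[OF hdeg_subset hdeg_subset hdeg_subset _ assms[unfolded hten_W_grade]])
     (auto elim!: hdegE intro: hdegI grade_W_props(4) bigrade_F_props(4))

text \<open>On functions the value is forced: the coaction is linear and unital, and a function acts
  on W \<otimes> F as multiplication by its right moment image in the second factor.\<close>

definition coact_gen :: "complex \<Rightarrow> 'n Wgen \<Rightarrow> ('n::{finite,linorder} Wgen falg set, 'n Fgen falg set) ten" where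
  "coact_gen lq y = (case y of
       Vgen i \<Rightarrow> (\<Oplus>\<^bsub>WF_ten lq\<^esub>j\<in>UNIV. hpure_W lq (w_elt lq j) (t_elt lq j i))
     | Mgen f \<Rightarrow> hpure_W lq \<one>\<^bsub>W_alg lq\<^esub> (mur lq f))"

text \<open>The ring \<open>W \<otimes> F\<close> dressed as an \<open>\<hh>\<close>-algebra record, so that \<^const>\<open>free_lift\<close> applies; the
  bigrading is irrelevant.\<close>

definition coact_target :: "complex \<Rightarrow> ('n, ('n::{finite,linorder} Wgen falg set, 'n Fgen falg set) ten) halg" where
  "coact_target lq = (let T = WF_ten lq in
     \<lparr>carrier = carrier T, monoid.mult = monoid.mult T, one = one T, ring.zero = ring.zero T, ring.add = ring.add T,
      bigrade = (\<lambda>\<alpha> \<beta>. {}),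
      mu_l = (\<lambda>f. hpure_W lq \<one>\<^bsub>W_alg lq\<^esub> (mur lq f)),
      mu_r = (\<lambda>f. hpure_W lq \<one>\<^bsub>W_alg lq\<^esub> (mur lq f))\<rparr>)"

lemma coact_target_simps [simp]:
  "carrier (coact_target lq) = carrier (WF_ten lq)"
  "monoid.mult (coact_target lq) = monoid.mult (WF_ten lq)"
  "one (coact_target lq) = one (WF_ten lq)"
  "ring.zero (coact_target lq) = ring.zero (WF_ten lq)"
  "ring.add (coact_target lq) = ring.add (WF_ten lq)"
  "mu_l (coact_target lq) f = hpure_W lq \<one>\<^bsub>W_alg lq\<^esub> (mur lq f)"
  by (simp_all add: coact_target_def Let_def)

lemma ring_coact_target: "ring (coact_target lq)"
  by (rule ring_cong[OF WF.ring_T]) simp_all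

lemma hpure_moment_add:
  "hpure_W lq \<one>\<^bsub>W_alg lq\<^esub> (mur lq (f + f')) =
   hpure_W lq \<one>\<^bsub>W_alg lq\<^esub> (mur lq f) \<oplus>\<^bsub>WF_ten lq\<^esub>
   hpure_W lq \<one>\<^bsub>W_alg lq\<^esub> (mur lq f')"
  using WF.pure_add_right[OF hcompsI grade_W_elems(2) bigrade_F_elems(2) bigrade_F_elems(2)]
  by (simp add: hpure_def mu_F_add)

lemma hpure_moment_mult:
  "hpure_W lq \<one>\<^bsub>W_alg lq\<^esub> (mur lq (f * f')) =
   hpure_W lq \<one>\<^bsub>W_alg lq\<^esub> (mur lq f) \<otimes>\<^bsub>WF_ten lq\<^esub>
   hpure_W lq \<one>\<^bsub>W_alg lq\<^esub> (mur lq f')"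
  by (simp add: hpure_mult_W[OF grade_W_elems(2) bigrade_F_elems(2) grade_W_elems(2) bigrade_F_elems(2)] mu_F_mult)

lemma hpure_one: "hpure_W lq \<one>\<^bsub>W_alg lq\<^esub> \<one>\<^bsub>F_alg lq\<^esub> = \<one>\<^bsub>WF_ten lq\<^esub>"
  by (simp only: hpure_def WF.one_pure l_module_simps)

lemma hpure_scalar_central:
  assumes "X \<in> carrier (WF_ten lq)"
  shows "hpure_W lq \<one>\<^bsub>W_alg lq\<^esub> (mur lq (mero_const c)) \<otimes>\<^bsub>WF_ten lq\<^esub> X =
     X \<otimes>\<^bsub>WF_ten lq\<^esub> hpure_W lq \<one>\<^bsub>W_alg lq\<^esub> (mur lq (mero_const c))"
  using WF.pure_central[OF hcomps_pairs[OF grade_W_elems(2) bigrade_F_elems(2)] _ _ assms, of "mero_const c"]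
  by (simp add: hpure_def mu_F_const F.scalar_commute)

lemma coact_gen_closed: "coact_gen lq y \<in> carrier (WF_ten lq)"
  by (cases y) (auto simp: coact_gen_def intro!: WF.finsum_closed)

interpretation coact: free_lift_hom "coact_target lq" "coact_gen lq" for lq
  by (rule free_lift_hom.intro[OF ring_coact_target], unfold coact_target_simps)
     (rule coact_gen_closed, rule hpure_closed, simp add: mero_const_add hpure_moment_add,
      simp add: mero_const_mult hpure_moment_mult, simp add: mu_F_one hpure_one, erule hpure_scalar_central)

lemma (in tensor_product) pure_cancel:
  assumes "abelian_group V" "(X, Y) \<in> Cs" "v \<in> X" "\<ominus>\<^bsub>V\<^esub> v \<in> X" "w \<in> Y" "X \<subseteq> carrier V"
  shows "pure v w \<oplus> pure (\<ominus>\<^bsub>V\<^esub> v) w = \<zero>"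
proof -
  interpret V: abelian_group V by (rule assms(1))
  have "v \<in> carrier V" using assms by blast
  then show ?thesis using pure_zero_left[of w]
    by (simp add: pure_add_left[OF assms(2-5), symmetric] V.r_neg)
qed

lemma minor_bigrade:
  "F_cls lq (minor lq k l i j) \<in> bigrade (F_alg lq) (\<omega> k + \<omega> l) (\<omega> i + \<omega> j)"
  unfolding bigrade_F minor_def
  by (rule F.cls_in_part) ((rule homogeneous_intros | simp add: add.commute zero_prod_def)+)

lemma ww_grade: "w_elt lq k \<otimes>\<^bsub>W_alg lq\<^esub> w_elt lq l \<in> grade (W_alg lq) (\<omega> k + \<omega> l)"
  by (intro grade_W_props grade_W_elems)

lemma tt_bigrade: "t_elt lq k i \<otimes>\<^bsub>F_alg lq\<^esub> t_elt lq l j \<in> bigrade (F_alg lq) (\<omega> k + \<omega> l) (\<omega> i + \<omega> j)"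
  by (intro bigrade_F_props bigrade_F_elems)

text \<open>The anticommutation relation rewrites w_l w_k as -h(\<lambda>_l - \<lambda>_k) w_k w_l.
  Balancing moves the function across the tensor sign, where it becomes the left moment map in front
  of t_li t_kj. What remains next to w_k w_l is the minor.\<close>

lemma hpure_pair_sum:
  fixes lq :: complex and k l i j :: "'n::{finite,linorder}"
  assumes "k < l"
  shows "hpure_W lq (w_elt lq k \<otimes>\<^bsub>W_alg lq\<^esub> w_elt lq l) (t_elt lq k i \<otimes>\<^bsub>F_alg lq\<^esub> t_elt lq l j)
      \<oplus>\<^bsub>WF_ten lq\<^esub>
    hpure_W lq (w_elt lq l \<otimes>\<^bsub>W_alg lq\<^esub> w_elt lq k) (t_elt lq l i \<otimes>\<^bsub>F_alg lq\<^esub> t_elt lq k j) =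
    hpure_W lq (w_elt lq k \<otimes>\<^bsub>W_alg lq\<^esub> w_elt lq l) (F_cls lq (minor lq k l i j))"
proof -
  let ?T = "WF_ten lq :: ('n, _) hspace"
  let ?p = "hpure_W lq"
  let ?x = "w_elt lq k \<otimes>\<^bsub>W_alg lq\<^esub> w_elt lq l" and ?h = "h_at lq l k"
  let ?b = "t_elt lq l i \<otimes>\<^bsub>F_alg lq\<^esub> t_elt lq k j"
  let ?y = "mul lq ?h \<otimes>\<^bsub>F_alg lq\<^esub> ?b"
  note x = ww_grade[of lq k l]
  have b: "?b \<in> bigrade (F_alg lq) (\<omega> k + \<omega> l) (\<omega> i + \<omega> j)"
    using tt_bigrade[of lq l i k j] by (simp add: add.commute)
  note y = bigrade_F_mu_mult(1)[OF b, of ?h]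
  have hx: "?h \<odot>\<^bsub>W_alg lq\<^esub> ?x \<in> grade (W_alg lq) (\<omega> k + \<omega> l)" by (rule grade_W_smult[OF x])
  have hx': "\<ominus>\<^bsub>W_alg lq\<^esub> (?h \<odot>\<^bsub>W_alg lq\<^esub> ?x) \<in> grade (W_alg lq) (\<omega> k + \<omega> l)"
    using hx unfolding grade_W by (rule W.part_minus)
  \<comment> \<open>The first coefficient is split as minor plus remainder; the remainder then
    cancels against the second tensor.\<close>
  have "t_elt lq k i \<otimes>\<^bsub>F_alg lq\<^esub> t_elt lq l j = F_cls lq (minor lq k l i j) \<oplus>\<^bsub>F_alg lq\<^esub> ?y"
    by (simp add: t_elt_class mu_l_F F_pres.cls_mult F_pres.cls_add minor_def)
  then have "?p ?x (t_elt lq k i \<otimes>\<^bsub>F_alg lq\<^esub> t_elt lq l j) =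
      ?p ?x (F_cls lq (minor lq k l i j)) \<oplus>\<^bsub>?T\<^esub> ?p ?x ?y"
    using WF.pure_add_right[OF hcompsI x minor_bigrade y] by (simp add: hpure_def)
  moreover have "?p ?x ?y = ?p (?h \<odot>\<^bsub>W_alg lq\<^esub> ?x) ?b"
    using WF.pure_balanced[OF hcompsI x b, of ?h] by (simp add: hpure_def)
  moreover have "?p (?h \<odot>\<^bsub>W_alg lq\<^esub> ?x) ?b \<oplus>\<^bsub>?T\<^esub> ?p (w_elt lq l \<otimes>\<^bsub>W_alg lq\<^esub> w_elt lq k) ?b = \<zero>\<^bsub>?T\<^esub>"
    unfolding w_elt_anticommute[OF assms]
    using WF.pure_cancel[OF W_pres.abelian_group_axioms hcompsI hx hx' b grade_W_props(1)] by (simp add: hpure_def)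
  ultimately show ?thesis by (simp add: WF.a_assoc)
qed

lemma coact_gen_mult:
  fixes lq :: complex and i j :: "'n::{finite,linorder}"
  shows "coact_gen lq (Vgen i) \<otimes>\<^bsub>WF_ten lq\<^esub> coact_gen lq (Vgen j) =
    (\<Oplus>\<^bsub>WF_ten lq\<^esub>p\<in>{(k, l). k < l}. hpure_W lq
      (w_elt lq (fst p) \<otimes>\<^bsub>W_alg lq\<^esub> w_elt lq (snd p)) (F_cls lq (minor lq (fst p) (snd p) i j)))"
proof -
  let ?T = "WF_ten lq :: ('n, _) hspace"
  let ?p = "hpure_W lq"
  let ?f = "\<lambda>k l. ?p (w_elt lq k \<otimes>\<^bsub>W_alg lq\<^esub> w_elt lq l) (t_elt lq k i \<otimes>\<^bsub>F_alg lq\<^esub> t_elt lq l j)"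
  have "coact_gen lq (Vgen i) \<otimes>\<^bsub>?T\<^esub> coact_gen lq (Vgen j) =
     (\<Oplus>\<^bsub>?T\<^esub>k\<in>UNIV. ?p (w_elt lq k) (t_elt lq k i) \<otimes>\<^bsub>?T\<^esub> (\<Oplus>\<^bsub>?T\<^esub>l\<in>UNIV. ?p (w_elt lq l) (t_elt lq l j)))"
    unfolding coact_gen_def by (simp add: WF.finsum_ldistr Pi_def)
  also have "\<dots> = (\<Oplus>\<^bsub>?T\<^esub>k\<in>UNIV. \<Oplus>\<^bsub>?T\<^esub>l\<in>UNIV. ?f k l)"
    by (simp add: WF.finsum_rdistr Pi_def hpure_mult_W[OF grade_W_elems(3) bigrade_F_elems(4) grade_W_elems(3) bigrade_F_elems(4)])
  also have "\<dots> = (\<Oplus>\<^bsub>?T\<^esub>p\<in>{(k, l). k < l}. ?f (fst p) (snd p) \<oplus>\<^bsub>?T\<^esub> ?f (snd p) (fst p))"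
    by (rule WF.finsum_triangle) (simp_all add: w_elt_square hpure_def WF.pure_zero_left)
  also have "\<dots> = (\<Oplus>\<^bsub>?T\<^esub>p\<in>{(k, l). k < l}. ?p
      (w_elt lq (fst p) \<otimes>\<^bsub>W_alg lq\<^esub> w_elt lq (snd p)) (F_cls lq (minor lq (fst p) (snd p) i j)))"
    by (rule WF.finsum_cong') (auto simp: hpure_pair_sum)
  finally show ?thesis .
qed

lemma hpure_zero: "hpure_W lq v \<zero>\<^bsub>F_alg lq\<^esub> = \<zero>\<^bsub>WF_ten lq\<^esub>"
  using WF.pure_zero_right[of lq v] by (simp add: hpure_def)

text \<open>The relations among functions hold because the right moment map is a ring homomorphism.
  For squares and anticommutation it suffices to compare the coefficients of the products w_k w_l
  with k < l, and these are governed by \<open>minor_equal\<close> and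
  \<open>minor_swap\<close>.\<close>

lemma coact_rel:
  fixes lq :: complex and s :: "'n::{finite,linorder} Wgen falg"
  assumes "s \<in> W_rels lq" and lq: "lq \<noteq> 0"
  shows "coact.lift lq s = \<zero>\<^bsub>WF_ten lq\<^esub>"
proof -
  let ?T = "WF_ten lq :: ('n, _) hspace"
  let ?p = "hpure_W lq"
  have closed [simp]: "coact.lift lq x \<in> carrier ?T" for x
    using coact.lift_closed[of lq x] by simp
  have minus: "coact.lift lq (x - y) \<oplus>\<^bsub>?T\<^esub> coact.lift lq y = coact.lift lq x" for x y
    using coact.lift_add[of lq "x - y" y] by simp
  have eq: "coact.lift lq (x - y) = \<zero>\<^bsub>?T\<^esub>" if "coact.lift lq x = coact.lift lq y" for x y
    using minus[of x y] that WF.add.r_cancel_one[OF closed closed, of y "x - y"] by simp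
  have lift_mult: "coact.lift lq (x * y) = coact.lift lq x \<otimes>\<^bsub>?T\<^esub> coact.lift lq y" for x y
    using coact.lift_mult[of lq x y] by simp
  have lift_add: "coact.lift lq (x + y) = coact.lift lq x \<oplus>\<^bsub>?T\<^esub> coact.lift lq y" for x y
    using coact.lift_add[of lq x y] by simp
  have lift_fscalar: "coact.lift lq (fscalar c) = ?p \<one>\<^bsub>W_alg lq\<^esub> (mur lq (mero_const c))" for c
    using coact.lift_fscalar[of lq c] by simp
  note lift = lift_mult lift_add lift_fscalar coact.lift_fgen
  have M: "coact_gen lq (Mgen f) = ?p \<one>\<^bsub>W_alg lq\<^esub> (mur lq f)" for f
    by (simp add: coact_gen_def)
  from assms(1) show ?thesis
  proof (induction rule: W_rels_cases)
    case (add f f')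
    show ?case by (intro eq) (simp only: lift M hpure_moment_add)
  next
    case (mult f f')
    show ?case by (intro eq) (simp only: lift M hpure_moment_mult)
  next
    case (const c)
    show ?case by (intro eq) (simp only: lift M)
  next
    case (square i)
    have "?p (w_elt lq k \<otimes>\<^bsub>W_alg lq\<^esub> w_elt lq l) (F_cls lq (minor lq k l i i)) = \<zero>\<^bsub>?T\<^esub>" if "k < l" for k l
      using minor_equal[OF that, of lq i] by (simp add: hpure_zero flip: F_pres.cls_eq_zero)
    then show ?case
      unfolding lift coact_gen_mult by (intro WF.add.finprod_one_eqI) auto
  next
    case (anticommute i j)
    let ?h = "mur lq (h_at lq j i)"
    let ?S = "{(k, l). k < l} :: ('n \<times> 'n) set"
    let ?x = "\<lambda>p. w_elt lq (fst p) \<otimes>\<^bsub>W_alg lq\<^esub> w_elt lq (snd p)"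
    let ?c = "\<lambda>p i j. F_cls lq (minor lq (fst p) (snd p) i j)"
    \<comment> \<open>The coefficient at one pair k < l: h(\<mu>_j - \<mu>_i) reaches it through the
      right moment map, and \<open>minor_swap\<close> makes it vanish.\<close>
    have 1: "?p (?x p) (?c p j i) \<oplus>\<^bsub>?T\<^esub> ?p \<one>\<^bsub>W_alg lq\<^esub> ?h \<otimes>\<^bsub>?T\<^esub> ?p (?x p) (?c p i j) = \<zero>\<^bsub>?T\<^esub>"
      if "p \<in> ?S" for p
    proof -
      have kl: "fst p < snd p" using that by auto
      have c: "?c p j i \<in> bigrade (F_alg lq) (\<omega> (fst p) + \<omega> (snd p)) (\<omega> i + \<omega> j)"
        using minor_bigrade[of lq "fst p" "snd p" j i] by (simp add: add.commute)
      have "?p \<one>\<^bsub>W_alg lq\<^esub> ?h \<otimes>\<^bsub>?T\<^esub> ?p (?x p) (?c p i j) = ?p (?x p) (?h \<otimes>\<^bsub>F_alg lq\<^esub> ?c p i j)"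
        using hpure_mult_W[OF grade_W_elems(2) bigrade_F_elems(2) ww_grade minor_bigrade, of lq "h_at lq j i"] by simp
      then have "?p (?x p) (?c p j i) \<oplus>\<^bsub>?T\<^esub> ?p \<one>\<^bsub>W_alg lq\<^esub> ?h \<otimes>\<^bsub>?T\<^esub> ?p (?x p) (?c p i j) =
          ?p (?x p) (?c p j i \<oplus>\<^bsub>F_alg lq\<^esub> ?h \<otimes>\<^bsub>F_alg lq\<^esub> ?c p i j)"
        using WF.pure_add_right[OF hcompsI ww_grade c bigrade_F_mu_mult(2)[OF minor_bigrade]] by (simp add: hpure_def)
      also have "?c p j i \<oplus>\<^bsub>F_alg lq\<^esub> ?h \<otimes>\<^bsub>F_alg lq\<^esub> ?c p i j = \<zero>\<^bsub>F_alg lq\<^esub>"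
        using minor_swap[OF kl anticommute lq] by (simp add: mu_r_F F_pres.cls_mult F_pres.cls_add F_pres.cls_eq_zero)
      finally show ?thesis by (simp add: hpure_zero)
    qed
    let ?m = "\<lambda>i. coact_gen lq (Vgen i)"
    have "?m j \<otimes>\<^bsub>?T\<^esub> ?m i \<oplus>\<^bsub>?T\<^esub> ?p \<one>\<^bsub>W_alg lq\<^esub> ?h \<otimes>\<^bsub>?T\<^esub> (?m i \<otimes>\<^bsub>?T\<^esub> ?m j) =
       (\<Oplus>\<^bsub>?T\<^esub>p\<in>?S. ?p (?x p) (?c p j i)) \<oplus>\<^bsub>?T\<^esub> (\<Oplus>\<^bsub>?T\<^esub>p\<in>?S. ?p \<one>\<^bsub>W_alg lq\<^esub> ?h \<otimes>\<^bsub>?T\<^esub> ?p (?x p) (?c p i j))"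
      unfolding coact_gen_mult by (subst WF.finsum_rdistr) (auto simp: Pi_def)
    also have "\<dots> = (\<Oplus>\<^bsub>?T\<^esub>p\<in>?S. ?p (?x p) (?c p j i) \<oplus>\<^bsub>?T\<^esub> ?p \<one>\<^bsub>W_alg lq\<^esub> ?h \<otimes>\<^bsub>?T\<^esub> ?p (?x p) (?c p i j))"
      by (rule WF.finsum_addf[symmetric]) (auto simp: Pi_def)
    also have "\<dots> = \<zero>\<^bsub>?T\<^esub>" using 1 by (intro WF.add.finprod_one_eqI) auto
    finally have "coact.lift lq (fgen (Vgen j) * fgen (Vgen i) + fgen (Mgen (h_at lq j i)) * (fgen (Vgen i) * fgen (Vgen j))) = \<zero>\<^bsub>?T\<^esub>"
      by (simp only: lift M)
    then show ?case by (simp add: mult.assoc)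
  next
    case (moment f i)
    \<comment> \<open>All t_ji have right degree \<open>\<omega> i\<close>, whatever
      \<open>j\<close> is, so every summand of the image of w_i shifts \<open>f\<close> by the same
      vector.\<close>
    have "?p \<one>\<^bsub>W_alg lq\<^esub> (mur lq f) \<otimes>\<^bsub>?T\<^esub> ?p (w_elt lq j) (t_elt lq j i) =
        ?p (w_elt lq j) (t_elt lq j i) \<otimes>\<^bsub>?T\<^esub> ?p \<one>\<^bsub>W_alg lq\<^esub> (mur lq (T_shift (\<omega> i) f))" for j
      by (simp add: hpure_mult_W[OF grade_W_elems(2) bigrade_F_elems(2) grade_W_elems(3) bigrade_F_elems(4)]
          hpure_mult_W[OF grade_W_elems(3) bigrade_F_elems(4) grade_W_elems(2) bigrade_F_elems(2)]
          mu_r_F_shift[OF bigrade_F_elems(4)])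
    then show ?case
      by (intro eq) (simp add: lift M coact_gen_def WF.finsum_ldistr WF.finsum_rdistr Pi_def)
  qed
qed

section \<open>The comultiplication\<close>

definition adeg :: "('n::finite, 'a) halg \<Rightarrow> ('n, 'b) halg \<Rightarrow> complex^'n \<Rightarrow> complex^'n \<Rightarrow> ('a \<times> 'b) set" where
  "adeg A B \<alpha> \<beta> = (\<Union>\<gamma>. bigrade A \<alpha> \<gamma> \<times> bigrade B \<gamma> \<beta>)"

lemma adeg_subset: "adeg A B \<alpha> \<beta> \<subseteq> tpairs (acomps A B)"
  by (auto simp: adeg_def tpairs_def acomps_def)

lemma adegI: "a \<in> bigrade A \<alpha> \<gamma> \<Longrightarrow> b \<in> bigrade B \<gamma> \<beta> \<Longrightarrow> (a, b) \<in> adeg A B \<alpha> \<beta>"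
  by (auto simp: adeg_def)

lemma adegE:
  assumes "(a, b) \<in> adeg A B \<alpha> \<beta>"
  obtains \<gamma> where "a \<in> bigrade A \<alpha> \<gamma>" "b \<in> bigrade B \<gamma> \<beta>"
  using assms by (auto simp: adeg_def)

lemma acomps_pairs: "a \<in> bigrade A \<alpha> \<gamma> \<Longrightarrow> b \<in> bigrade B \<gamma> \<beta> \<Longrightarrow> (a, b) \<in> tpairs (acomps A B)"
  by (rule subsetD[OF adeg_subset adegI])

lemma FF_bigrade: "bigrade (FF_ten lq) \<alpha> \<beta> = FF.tspan lq (adeg (F_alg lq) (F_alg lq) \<alpha> \<beta>)"
  by (simp add: FF.tspan_def aten_def Let_def adeg_def)

lemma FF_mu:
  "mu_l (FF_ten lq) f = apure_F lq (mul lq f) \<one>\<^bsub>F_alg lq\<^esub>"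
  "mu_r (FF_ten lq) f = apure_F lq \<one>\<^bsub>F_alg lq\<^esub> (mur lq f)"
  by (simp_all add: aten_def Let_def)

lemma apure_closed [simp]: "apure_F lq a b \<in> carrier (FF_ten lq)"
  by (simp add: apure_def)

lemma apure_mult:
  assumes "a \<in> bigrade (F_alg lq) \<alpha> \<gamma>" "b \<in> bigrade (F_alg lq) \<gamma> \<beta>"
    "a' \<in> bigrade (F_alg lq) \<alpha>' \<gamma>'" "b' \<in> bigrade (F_alg lq) \<gamma>' \<beta>'"
  shows "apure_F lq a b \<otimes>\<^bsub>FF_ten lq\<^esub> apure_F lq a' b' =
    apure_F lq (a \<otimes>\<^bsub>F_alg lq\<^esub> a') (b \<otimes>\<^bsub>F_alg lq\<^esub> b')"
  using FF.pure_mult[OF acomps_pairs acomps_pairs, OF assms] by (simp add: apure_def)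

lemma apure_one: "apure_F lq \<one>\<^bsub>F_alg lq\<^esub> \<one>\<^bsub>F_alg lq\<^esub> = \<one>\<^bsub>FF_ten lq\<^esub>"
  by (simp only: apure_def FF.one_pure l_module_simps r_module_simps)

lemma FF_bigrade_closed:
  "X \<in> bigrade (FF_ten lq) \<alpha> \<beta> \<Longrightarrow> X \<in> carrier (FF_ten lq)"
  unfolding FF_bigrade by (rule FF.tspan_closed[OF adeg_subset])

lemma FF_bigrade_add:
  "X \<in> bigrade (FF_ten lq) \<alpha> \<beta> \<Longrightarrow> Y \<in> bigrade (FF_ten lq) \<alpha> \<beta> \<Longrightarrow>
    X \<oplus>\<^bsub>FF_ten lq\<^esub> Y \<in> bigrade (FF_ten lq) \<alpha> \<beta>"
  unfolding FF_bigrade by (rule FF.tspan_add)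

lemma FF_bigrade_zero: "\<zero>\<^bsub>FF_ten lq\<^esub> \<in> bigrade (FF_ten lq) \<alpha> \<beta>"
  unfolding FF_bigrade by (rule FF.tspan_zero)

lemma apure_bigrade:
  "a \<in> bigrade (F_alg lq) \<alpha> \<gamma> \<Longrightarrow> b \<in> bigrade (F_alg lq) \<gamma> \<beta> \<Longrightarrow>
    apure_F lq a b \<in> bigrade (FF_ten lq) \<alpha> \<beta>"
  unfolding FF_bigrade apure_def by (rule FF.pure_in_tspan[OF adegI adeg_subset])

lemma FF_bigrade_mult:
  assumes "X \<in> bigrade (FF_ten lq) \<alpha> \<beta>" "Y \<in> bigrade (FF_ten lq) \<alpha>' \<beta>'"
  shows "X \<otimes>\<^bsub>FF_ten lq\<^esub> Y \<in> bigrade (FF_ten lq) (\<alpha> + \<alpha>') (\<beta> + \<beta>')"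
  unfolding FF_bigrade
  by (rule FF.tspan_mult[OF adeg_subset adeg_subset adeg_subset _ assms[unfolded FF_bigrade]])
     (auto elim!: adegE intro: adegI bigrade_F_props(4))

lemma FF_moment_add:
  "apure_F lq (mul lq (f + f')) \<one>\<^bsub>F_alg lq\<^esub> =
   apure_F lq (mul lq f) \<one>\<^bsub>F_alg lq\<^esub> \<oplus>\<^bsub>FF_ten lq\<^esub>
   apure_F lq (mul lq f') \<one>\<^bsub>F_alg lq\<^esub>"
  "apure_F lq \<one>\<^bsub>F_alg lq\<^esub> (mur lq (f + f')) =
   apure_F lq \<one>\<^bsub>F_alg lq\<^esub> (mur lq f) \<oplus>\<^bsub>FF_ten lq\<^esub>
   apure_F lq \<one>\<^bsub>F_alg lq\<^esub> (mur lq f')"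
  using FF.pure_add_left[OF acompsI bigrade_F_elems(1) bigrade_F_elems(1) bigrade_F_elems(3), of lq f f']
    FF.pure_add_right[OF acompsI bigrade_F_elems(3) bigrade_F_elems(2) bigrade_F_elems(2), of lq f f']
  by (simp_all add: apure_def mu_F_add)

lemma FF_moment_mult:
  "apure_F lq (mul lq (f * f')) \<one>\<^bsub>F_alg lq\<^esub> =
   apure_F lq (mul lq f) \<one>\<^bsub>F_alg lq\<^esub> \<otimes>\<^bsub>FF_ten lq\<^esub>
   apure_F lq (mul lq f') \<one>\<^bsub>F_alg lq\<^esub>"
  "apure_F lq \<one>\<^bsub>F_alg lq\<^esub> (mur lq (f * f')) =
   apure_F lq \<one>\<^bsub>F_alg lq\<^esub> (mur lq f) \<otimes>\<^bsub>FF_ten lq\<^esub>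
   apure_F lq \<one>\<^bsub>F_alg lq\<^esub> (mur lq f')"
  by (simp_all add: mu_F_mult apure_mult[OF bigrade_F_elems(1) bigrade_F_elems(3) bigrade_F_elems(1) bigrade_F_elems(3)]
      apure_mult[OF bigrade_F_elems(3) bigrade_F_elems(2) bigrade_F_elems(3) bigrade_F_elems(2)])

text \<open>Balancing at the pair of units, together with the agreement of both moment maps of F on
  constants. The complex scalars of the lift enter through the left moment map, and this reconciles
  them with the relations for \<open>Rgen\<close>.\<close>

lemma FF_moment_const:
  "apure_F lq \<one>\<^bsub>F_alg lq\<^esub> (mur lq (mero_const c)) =
   apure_F lq (mul lq (mero_const c)) \<one>\<^bsub>F_alg lq\<^esub>"
proof -
  have "apure_F lq (mur lq (mero_const c) \<otimes>\<^bsub>F_alg lq\<^esub> \<one>\<^bsub>F_alg lq\<^esub>) \<one>\<^bsub>F_alg lq\<^esub> =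
     apure_F lq \<one>\<^bsub>F_alg lq\<^esub> (mul lq (mero_const c) \<otimes>\<^bsub>F_alg lq\<^esub> \<one>\<^bsub>F_alg lq\<^esub>)"
    using FF.pure_balanced[OF acompsI bigrade_F_elems(3) bigrade_F_elems(3), of lq "mero_const c"]
    by (simp add: apure_def)
  from this[symmetric] show ?thesis by (simp add: mu_F_const)
qed

lemma FF_scalar_central:
  assumes "X \<in> carrier (FF_ten lq)"
  shows "apure_F lq (mul lq (mero_const c)) \<one>\<^bsub>F_alg lq\<^esub> \<otimes>\<^bsub>FF_ten lq\<^esub> X =
     X \<otimes>\<^bsub>FF_ten lq\<^esub> apure_F lq (mul lq (mero_const c)) \<one>\<^bsub>F_alg lq\<^esub>"
  using FF.pure_central[OF acomps_pairs[OF bigrade_F_elems(1) bigrade_F_elems(3)] _ _ assms, of "mero_const c"]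
  by (simp add: apure_def mu_F_const F.scalar_commute)

definition comult_gen :: "complex \<Rightarrow> 'n Fgen \<Rightarrow>
    ('n::{finite,linorder} Fgen falg set, 'n Fgen falg set) ten" where
  "comult_gen lq y = (case y of
         Tgen i j \<Rightarrow> (\<Oplus>\<^bsub>FF_ten lq\<^esub>k\<in>UNIV. apure_F lq (t_elt lq i k) (t_elt lq k j))
       | Lgen f \<Rightarrow> apure_F lq (mul lq f) \<one>\<^bsub>F_alg lq\<^esub>
       | Rgen f \<Rightarrow> apure_F lq \<one>\<^bsub>F_alg lq\<^esub> (mur lq f))"

lemma F_comult_lift: "F_comult lq = presented_lift (FF_ten lq) (comult_gen lq)"
  by (simp add: F_comult_def Let_def comult_gen_def[abs_def])

lemma comult_gen_closed: "comult_gen lq y \<in> carrier (FF_ten lq)"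
  by (cases y) (auto simp: comult_gen_def intro!: FF.finsum_closed)

interpretation comult: free_lift_hom "FF_ten lq" "comult_gen lq" for lq
  by (rule free_lift_hom.intro[OF FF.ring_T], unfold FF_mu)
     (rule comult_gen_closed, rule apure_closed, simp add: mero_const_add FF_moment_add,
      simp add: mero_const_mult FF_moment_mult, simp add: mu_F_one apure_one, erule FF_scalar_central)

text \<open>Multiplied by its R-entry, each product lies in a component that does not depend on the
  summation indices \<open>x, y\<close>: for other degrees the entry is zero. This allows the sums
  in RLL to be moved through the tensor sign.\<close>

lemma Rt_bigrade:
  fixes lq :: complex and x y a c k l :: "'n::{finite,linorder}"
  shows "mul lq (Rmat lq x y a c) \<otimes>\<^bsub>F_alg lq\<^esub> (t_elt lq x k \<otimes>\<^bsub>F_alg lq\<^esub> t_elt lq y l)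
      \<in> bigrade (F_alg lq) (\<omega> a + \<omega> c) (\<omega> k + \<omega> l)"
    "mur lq (Rmat lq k l x y) \<otimes>\<^bsub>F_alg lq\<^esub> (t_elt lq c y \<otimes>\<^bsub>F_alg lq\<^esub> t_elt lq a x)
      \<in> bigrade (F_alg lq) (\<omega> a + \<omega> c) (\<omega> k + \<omega> l)"
proof -
  show "mul lq (Rmat lq x y a c) \<otimes>\<^bsub>F_alg lq\<^esub> (t_elt lq x k \<otimes>\<^bsub>F_alg lq\<^esub> t_elt lq y l)
      \<in> bigrade (F_alg lq) (\<omega> a + \<omega> c) (\<omega> k + \<omega> l)"
  proof (cases "\<omega> x + \<omega> y = \<omega> a + \<omega> c")
    case True
    show ?thesis using bigrade_F_mu_mult(1)[OF tt_bigrade[of lq x k y l]] unfolding True .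
  qed (simp add: Rmat_zero mu_F_zero bigrade_F_props(2))
  show "mur lq (Rmat lq k l x y) \<otimes>\<^bsub>F_alg lq\<^esub> (t_elt lq c y \<otimes>\<^bsub>F_alg lq\<^esub> t_elt lq a x)
      \<in> bigrade (F_alg lq) (\<omega> a + \<omega> c) (\<omega> k + \<omega> l)"
  proof (cases "\<omega> k + \<omega> l = \<omega> x + \<omega> y")
    case True
    show ?thesis using bigrade_F_mu_mult(2)[OF tt_bigrade[of lq c y a x]] unfolding True
      by (simp add: add.commute)
  qed (simp add: Rmat_zero mu_F_zero bigrade_F_props(2))
qed

lemma F_RLL:
  fixes lq :: complex and a b c d :: "'n::{finite,linorder}"
  shows "(\<Oplus>\<^bsub>F_alg lq\<^esub>p\<in>UNIV. mul lq (Rmat lq (fst p) (snd p) a c) \<otimes>\<^bsub>F_alg lq\<^esub>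
      (t_elt lq (fst p) b \<otimes>\<^bsub>F_alg lq\<^esub> t_elt lq (snd p) d)) =
    (\<Oplus>\<^bsub>F_alg lq\<^esub>p\<in>UNIV. mur lq (Rmat lq b d (fst p) (snd p)) \<otimes>\<^bsub>F_alg lq\<^esub>
      (t_elt lq c (snd p) \<otimes>\<^bsub>F_alg lq\<^esub> t_elt lq a (fst p)))"
  unfolding mu_l_F mu_r_F t_elt_class F_pres.cls_mult
  using F_rel_eq[OF F_rels_RLL[of lq a c b d]]
  by (simp add: F_pres.cls_sum sum.cartesian_product UNIV_Times_UNIV case_prod_unfold mult.assoc)

lemma comult_TT:
  fixes lq :: complex and x b y d :: "'n::{finite,linorder}"
  shows "comult_gen lq (Tgen x b) \<otimes>\<^bsub>FF_ten lq\<^esub> comult_gen lq (Tgen y d) =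
    (\<Oplus>\<^bsub>FF_ten lq\<^esub>q\<in>UNIV. apure_F lq
      (t_elt lq x (fst q) \<otimes>\<^bsub>F_alg lq\<^esub> t_elt lq y (snd q)) (t_elt lq (fst q) b \<otimes>\<^bsub>F_alg lq\<^esub> t_elt lq (snd q) d))"
    (is "_ = (\<Oplus>\<^bsub>?T\<^esub>q\<in>UNIV. ?f (fst q) (snd q))")
proof -
  have "comult_gen lq (Tgen x b) \<otimes>\<^bsub>?T\<^esub> comult_gen lq (Tgen y d) =
     (\<Oplus>\<^bsub>?T\<^esub>k\<in>UNIV. apure_F lq (t_elt lq x k) (t_elt lq k b) \<otimes>\<^bsub>?T\<^esub>
       (\<Oplus>\<^bsub>?T\<^esub>l\<in>UNIV. apure_F lq (t_elt lq y l) (t_elt lq l d)))"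
    unfolding comult_gen_def by (simp add: FF.finsum_ldistr Pi_def)
  also have "\<dots> = (\<Oplus>\<^bsub>?T\<^esub>k\<in>UNIV. \<Oplus>\<^bsub>?T\<^esub>l\<in>UNIV. ?f k l)"
    by (simp add: FF.finsum_rdistr Pi_def apure_mult[OF bigrade_F_elems(4) bigrade_F_elems(4) bigrade_F_elems(4) bigrade_F_elems(4)])
  also have "\<dots> = (\<Oplus>\<^bsub>?T\<^esub>q\<in>UNIV. ?f (fst q) (snd q))"
    using FF.finsum_prod[of UNIV UNIV ?f lq] by simp
  finally show ?thesis .
qed

text \<open>The middle indices are swapped to meet the reversed order of the factors on the right
  side of RLL.\<close>

lemma comult_TT_swap:
  fixes lq :: complex and x b y d :: "'n::{finite,linorder}"
  shows "comult_gen lq (Tgen x b) \<otimes>\<^bsub>FF_ten lq\<^esub> comult_gen lq (Tgen y d) =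
    (\<Oplus>\<^bsub>FF_ten lq\<^esub>q\<in>UNIV. apure_F lq
      (t_elt lq x (snd q) \<otimes>\<^bsub>F_alg lq\<^esub> t_elt lq y (fst q)) (t_elt lq (snd q) b \<otimes>\<^bsub>F_alg lq\<^esub> t_elt lq (fst q) d))"
proof -
  have "UNIV = prod.swap ` (UNIV :: ('n \<times> 'n) set)" by auto
  then show ?thesis unfolding comult_TT
    by (subst \<open>UNIV = _\<close>, subst FF.finsum_reindex) (auto simp: inj_on_def)
qed

lemma apure_zero: "apure_F lq v \<zero>\<^bsub>F_alg lq\<^esub> = \<zero>\<^bsub>FF_ten lq\<^esub>"
  "apure_F lq \<zero>\<^bsub>F_alg lq\<^esub> v = \<zero>\<^bsub>FF_ten lq\<^esub>"
  using FF.pure_zero_right[of lq v] FF.pure_zero_left[of lq v] by (simp_all add: apure_def)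

lemma abelian_monoid_l_module_F: "abelian_monoid (l_module (F_alg lq))"
  using ring_l_module_F by (rule ring.is_abelian_group[THEN abelian_group.axioms(1)])

lemma abelian_monoid_r_module_F: "abelian_monoid (r_module (F_alg lq))"
  using ring_r_module_F by (rule ring.is_abelian_group[THEN abelian_group.axioms(1)])

lemma finsum_module_F:
  "finsum (l_module (F_alg lq)) f J = finsum (F_alg lq) f J"
  "finsum (r_module (F_alg lq)) f J = finsum (F_alg lq) f J"
  by (simp_all add: finsum_def finprod_def)

lemma apure_finsum_right:
  assumes "a \<in> bigrade (F_alg lq) \<alpha> \<gamma>" "finite J" "\<And>j. j \<in> J \<Longrightarrow> b j \<in> bigrade (F_alg lq) \<gamma> \<beta>"
  shows "apure_F lq a (\<Oplus>\<^bsub>F_alg lq\<^esub>j\<in>J. b j) =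
    (\<Oplus>\<^bsub>FF_ten lq\<^esub>j\<in>J. apure_F lq a (b j))"
  using FF.pure_finsum_right[OF abelian_monoid_l_module_F acompsI assms(1) _ _ assms(2), of \<beta> b]
    assms(3)
  by (simp add: apure_def finsum_module_F bigrade_F_props(1,2))

lemma apure_finsum_left:
  assumes "b \<in> bigrade (F_alg lq) \<gamma> \<beta>" "finite J" "\<And>j. j \<in> J \<Longrightarrow> a j \<in> bigrade (F_alg lq) \<alpha> \<gamma>"
  shows "apure_F lq (\<Oplus>\<^bsub>F_alg lq\<^esub>j\<in>J. a j) b =
    (\<Oplus>\<^bsub>FF_ten lq\<^esub>j\<in>J. apure_F lq (a j) b)"
  using FF.pure_finsum_left[OF abelian_monoid_r_module_F acompsI assms(1) _ _ assms(2), of \<alpha> a]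
    assms(3)
  by (simp add: apure_def finsum_module_F bigrade_F_props(1,2))

text \<open>Balancing requires equal middle degrees, which holds when the weights match; otherwise
  the R-entry vanishes and both sides are zero.\<close>

lemma apure_Rmat_balanced:
  fixes lq :: complex and a b c d :: "'n::{finite,linorder}" and q r :: "'n \<times> 'n"
  shows "apure_F lq
      (mur lq (Rmat lq (fst q) (snd q) (fst r) (snd r)) \<otimes>\<^bsub>F_alg lq\<^esub> (t_elt lq c (snd r) \<otimes>\<^bsub>F_alg lq\<^esub> t_elt lq a (fst r)))
      (t_elt lq (fst q) b \<otimes>\<^bsub>F_alg lq\<^esub> t_elt lq (snd q) d) =
    apure_F lq (t_elt lq c (snd r) \<otimes>\<^bsub>F_alg lq\<^esub> t_elt lq a (fst r))
      (mul lq (Rmat lq (fst q) (snd q) (fst r) (snd r)) \<otimes>\<^bsub>F_alg lq\<^esub> (t_elt lq (fst q) b \<otimes>\<^bsub>F_alg lq\<^esub> t_elt lq (snd q) d))"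
proof (cases "\<omega> (fst q) + \<omega> (snd q) = \<omega> (snd r) + \<omega> (fst r)")
  case True
  show ?thesis
    using FF.pure_balanced[OF acompsI tt_bigrade tt_bigrade[of lq "fst q" b "snd q" d, unfolded True]]
    by (simp add: apure_def)
next
  case False
  then have "Rmat lq (fst q) (snd q) (fst r) (snd r) = 0" by (intro Rmat_zero) (simp add: add.commute)
  then show ?thesis by (simp add: mu_F_zero apure_zero)
qed

text \<open>RLL is applied twice. In the left tensor factor it turns R(\<lambda>) into R of the
  middle dynamical variable, which may cross the tensor sign; in the right factor it then turns this
  into R(\<mu>). The finite sums are interchanged in between so that each application sees the full
  sum over its own indices.\<close>

lemma comult_RLL:
  fixes lq :: complex and a b c d :: "'n::{finite,linorder}"
  defines "T \<equiv> FF_ten lq :: ('n, _) halg" and "ap \<equiv> apure_F lq"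
    and "t \<equiv> t_elt lq :: 'n \<Rightarrow> 'n \<Rightarrow> _" and "D \<equiv> \<lambda>i j. comult_gen lq (Tgen i j)"
    and "L \<equiv> \<lambda>p a c. mul lq (Rmat lq (fst p) (snd p) a c)"
    and "R \<equiv> \<lambda>b d p. mur lq (Rmat lq b d (fst p) (snd p))"
  shows "(\<Oplus>\<^bsub>T\<^esub>p\<in>UNIV. ap (L p a c) \<one>\<^bsub>F_alg lq\<^esub> \<otimes>\<^bsub>T\<^esub> (D (fst p) b \<otimes>\<^bsub>T\<^esub> D (snd p) d)) =
    (\<Oplus>\<^bsub>T\<^esub>p\<in>UNIV. ap \<one>\<^bsub>F_alg lq\<^esub> (R b d p) \<otimes>\<^bsub>T\<^esub> (D c (snd p) \<otimes>\<^bsub>T\<^esub> D a (fst p)))"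
proof -
  have Tc: "ap x y \<in> carrier T" for x y by (simp add: ap_def T_def)
  have tt2: "t_elt lq c (snd r) \<otimes>\<^bsub>F_alg lq\<^esub> t_elt lq a (fst r) \<in>
      bigrade (F_alg lq) (\<omega> c + \<omega> a) (\<omega> (fst r) + \<omega> (snd r))" for r :: "'n \<times> 'n"
    using tt_bigrade[of lq c "snd r" a "fst r"] by (simp add: add.commute)
  let ?tt = "\<lambda>x k y l. t x k \<otimes>\<^bsub>F_alg lq\<^esub> t y l"
  have "(\<Oplus>\<^bsub>T\<^esub>p\<in>UNIV. ap (L p a c) \<one>\<^bsub>F_alg lq\<^esub> \<otimes>\<^bsub>T\<^esub> (D (fst p) b \<otimes>\<^bsub>T\<^esub> D (snd p) d)) =
     (\<Oplus>\<^bsub>T\<^esub>p\<in>UNIV. \<Oplus>\<^bsub>T\<^esub>q\<in>UNIV. ap (L p a c \<otimes>\<^bsub>F_alg lq\<^esub> ?tt (fst p) (fst q) (snd p) (snd q)) (?tt (fst q) b (snd q) d))"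
    unfolding D_def T_def ap_def t_def L_def comult_TT
    by (simp add: FF.finsum_rdistr Pi_def apure_mult[OF bigrade_F_elems(1) bigrade_F_elems(3) tt_bigrade tt_bigrade])
  also have "\<dots> = (\<Oplus>\<^bsub>T\<^esub>q\<in>UNIV. \<Oplus>\<^bsub>T\<^esub>p\<in>UNIV. ap (L p a c \<otimes>\<^bsub>F_alg lq\<^esub> ?tt (fst p) (fst q) (snd p) (snd q)) (?tt (fst q) b (snd q) d))"
    unfolding T_def ap_def by (rule FF.finsum_swap) simp_all
  also have "\<dots> = (\<Oplus>\<^bsub>T\<^esub>q\<in>UNIV. ap (\<Oplus>\<^bsub>F_alg lq\<^esub>p\<in>UNIV. L p a c \<otimes>\<^bsub>F_alg lq\<^esub> ?tt (fst p) (fst q) (snd p) (snd q)) (?tt (fst q) b (snd q) d))"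
    unfolding T_def ap_def t_def L_def
    by (subst apure_finsum_left[OF tt_bigrade _ Rt_bigrade(1)]) simp_all
  \<comment> \<open>RLL in the left factor, for fixed middle indices \<open>q\<close>.\<close>
  also have "\<dots> = (\<Oplus>\<^bsub>T\<^esub>q\<in>UNIV. ap (\<Oplus>\<^bsub>F_alg lq\<^esub>r\<in>UNIV. R (fst q) (snd q) r \<otimes>\<^bsub>F_alg lq\<^esub> ?tt c (snd r) a (fst r)) (?tt (fst q) b (snd q) d))"
    unfolding L_def R_def t_def F_RLL ..
  also have "\<dots> = (\<Oplus>\<^bsub>T\<^esub>q\<in>UNIV. \<Oplus>\<^bsub>T\<^esub>r\<in>UNIV. ap (R (fst q) (snd q) r \<otimes>\<^bsub>F_alg lq\<^esub> ?tt c (snd r) a (fst r)) (?tt (fst q) b (snd q) d))"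
    unfolding T_def ap_def t_def R_def
    by (subst apure_finsum_left[OF tt_bigrade _ Rt_bigrade(2)]) simp_all
  \<comment> \<open>The entry now sits in the right moment map of the left factor, which balancing
    identifies with the left moment map of the right factor.\<close>
  also have "\<dots> = (\<Oplus>\<^bsub>T\<^esub>q\<in>UNIV. \<Oplus>\<^bsub>T\<^esub>r\<in>UNIV. ap (?tt c (snd r) a (fst r)) (L q (fst r) (snd r) \<otimes>\<^bsub>F_alg lq\<^esub> ?tt (fst q) b (snd q) d))"
    unfolding T_def ap_def t_def R_def L_def apure_Rmat_balanced ..
  also have "\<dots> = (\<Oplus>\<^bsub>T\<^esub>r\<in>UNIV. \<Oplus>\<^bsub>T\<^esub>q\<in>UNIV. ap (?tt c (snd r) a (fst r)) (L q (fst r) (snd r) \<otimes>\<^bsub>F_alg lq\<^esub> ?tt (fst q) b (snd q) d))"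
    unfolding T_def ap_def by (rule FF.finsum_swap) simp_all
  also have "\<dots> = (\<Oplus>\<^bsub>T\<^esub>r\<in>UNIV. ap (?tt c (snd r) a (fst r)) (\<Oplus>\<^bsub>F_alg lq\<^esub>q\<in>UNIV. L q (fst r) (snd r) \<otimes>\<^bsub>F_alg lq\<^esub> ?tt (fst q) b (snd q) d))"
    unfolding T_def ap_def t_def L_def
    by (subst apure_finsum_right[OF tt2 _ Rt_bigrade(1)]) simp_all
  \<comment> \<open>RLL in the right factor, for fixed middle indices \<open>r\<close>.\<close>
  also have "\<dots> = (\<Oplus>\<^bsub>T\<^esub>r\<in>UNIV. ap (?tt c (snd r) a (fst r)) (\<Oplus>\<^bsub>F_alg lq\<^esub>p\<in>UNIV. R b d p \<otimes>\<^bsub>F_alg lq\<^esub> ?tt (snd r) (snd p) (fst r) (fst p)))"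
    unfolding L_def R_def t_def F_RLL ..
  also have "\<dots> = (\<Oplus>\<^bsub>T\<^esub>r\<in>UNIV. \<Oplus>\<^bsub>T\<^esub>p\<in>UNIV. ap (?tt c (snd r) a (fst r)) (R b d p \<otimes>\<^bsub>F_alg lq\<^esub> ?tt (snd r) (snd p) (fst r) (fst p)))"
    unfolding T_def ap_def t_def R_def
    by (subst apure_finsum_right[OF tt2 _ Rt_bigrade(2)]) simp_all
  also have "\<dots> = (\<Oplus>\<^bsub>T\<^esub>p\<in>UNIV. \<Oplus>\<^bsub>T\<^esub>r\<in>UNIV. ap (?tt c (snd r) a (fst r)) (R b d p \<otimes>\<^bsub>F_alg lq\<^esub> ?tt (snd r) (snd p) (fst r) (fst p)))"
    unfolding T_def ap_def by (rule FF.finsum_swap) simp_all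
  also have "\<dots> = (\<Oplus>\<^bsub>T\<^esub>p\<in>UNIV. ap \<one>\<^bsub>F_alg lq\<^esub> (R b d p) \<otimes>\<^bsub>T\<^esub> (D c (snd p) \<otimes>\<^bsub>T\<^esub> D a (fst p)))"
    unfolding D_def T_def ap_def t_def R_def comult_TT_swap
    by (simp add: FF.finsum_rdistr Pi_def apure_mult[OF bigrade_F_elems(3) bigrade_F_elems(2) tt_bigrade tt_bigrade])
  finally show ?thesis .
qed

lemma comult_rel:
  fixes lq :: complex and s :: "'n::{finite,linorder} Fgen falg"
  assumes "s \<in> F_rels lq"
  shows "comult.lift lq s = \<zero>\<^bsub>FF_ten lq\<^esub>"
proof -
  let ?T = "FF_ten lq :: ('n, _) halg"
  let ?p = "apure_F lq"
  have minus: "comult.lift lq (x - y) \<oplus>\<^bsub>?T\<^esub> comult.lift lq y = comult.lift lq x" for x y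
    using comult.lift_add[of lq "x - y" y] by simp
  have eq: "comult.lift lq (x - y) = \<zero>\<^bsub>?T\<^esub>" if "comult.lift lq x = comult.lift lq y" for x y
    using minus[of x y] that FF.add.r_cancel_one[OF comult.lift_closed comult.lift_closed, of lq y "x - y"] by simp
  have M: "comult_gen lq (Lgen f) = ?p (mul lq f) \<one>\<^bsub>F_alg lq\<^esub>"
    "comult_gen lq (Rgen f) = ?p \<one>\<^bsub>F_alg lq\<^esub> (mur lq f)" for f
    by (simp_all add: comult_gen_def)
  note lift = comult.lift_mult comult.lift_add comult.lift_fscalar comult.lift_fgen
  from assms show ?thesis
  proof (induction rule: F_rels_cases)
    case (add M f f')
    show ?case by (rule eq) (use add in \<open>auto simp only: lift M FF_moment_add\<close>)
  next
    case (mult M f f')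
    show ?case by (rule eq) (use mult in \<open>auto simp only: lift M FF_moment_mult\<close>)
  next
    case (const M c)
    show ?case by (rule eq) (use const in \<open>auto simp only: lift M FF_mu FF_moment_const\<close>)
  next
    case (commute f f')
    show ?case
      by (rule eq) (simp add: lift M apure_mult[OF bigrade_F_elems(1) bigrade_F_elems(3) bigrade_F_elems(3) bigrade_F_elems(2)]
         apure_mult[OF bigrade_F_elems(3) bigrade_F_elems(2) bigrade_F_elems(1) bigrade_F_elems(3)])
  next
    case (left f i j)
    have "?p (mul lq f) \<one>\<^bsub>F_alg lq\<^esub> \<otimes>\<^bsub>?T\<^esub> ?p (t_elt lq i k) (t_elt lq k j) =
        ?p (t_elt lq i k) (t_elt lq k j) \<otimes>\<^bsub>?T\<^esub> ?p (mul lq (T_shift (\<omega> i) f)) \<one>\<^bsub>F_alg lq\<^esub>" for k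
      by (simp add: apure_mult[OF bigrade_F_elems(1) bigrade_F_elems(3) bigrade_F_elems(4) bigrade_F_elems(4)]
          apure_mult[OF bigrade_F_elems(4) bigrade_F_elems(4) bigrade_F_elems(1) bigrade_F_elems(3)]
          mu_l_F_shift[OF bigrade_F_elems(4)])
    then show ?case
      by (intro eq) (simp add: lift M comult_gen_def FF.finsum_ldistr FF.finsum_rdistr Pi_def)
  next
    case (right f i j)
    have "?p \<one>\<^bsub>F_alg lq\<^esub> (mur lq f) \<otimes>\<^bsub>?T\<^esub> ?p (t_elt lq i k) (t_elt lq k j) =
        ?p (t_elt lq i k) (t_elt lq k j) \<otimes>\<^bsub>?T\<^esub> ?p \<one>\<^bsub>F_alg lq\<^esub> (mur lq (T_shift (\<omega> j) f))" for k
      by (simp add: apure_mult[OF bigrade_F_elems(3) bigrade_F_elems(2) bigrade_F_elems(4) bigrade_F_elems(4)]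
          apure_mult[OF bigrade_F_elems(4) bigrade_F_elems(4) bigrade_F_elems(3) bigrade_F_elems(2)]
          mu_r_F_shift[OF bigrade_F_elems(4)])
    then show ?case
      by (intro eq) (simp add: lift M comult_gen_def FF.finsum_ldistr FF.finsum_rdistr Pi_def)
  next
    case (RLL a b c d)
    have "comult.lift lq (\<Sum>p\<in>UNIV. fgen (Lgen (Rmat lq (fst p) (snd p) a c)) * (fgen (Tgen (fst p) b) * fgen (Tgen (snd p) d))) =
      comult.lift lq (\<Sum>p\<in>UNIV. fgen (Rgen (Rmat lq b d (fst p) (snd p))) * (fgen (Tgen c (snd p)) * fgen (Tgen a (fst p))))"
      by (simp only: comult.lift_sum[OF finite_class.finite_UNIV] lift M comult_RLL)
    then show ?case
      by (intro eq) (simp add: sum.cartesian_product case_prod_unfold mult.assoc)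
  qed
qed

section \<open>The comultiplication as a graded homomorphism\<close>

lemma F_comult_class: "F_comult lq (F_cls lq x) = comult.lift lq x"
  unfolding F_comult_lift by (rule comult.presented_lift_class) (rule comult_rel)

lemma F_comult_add:
  assumes "a \<in> carrier (F_alg lq)" "b \<in> carrier (F_alg lq)"
  shows "F_comult lq (a \<oplus>\<^bsub>F_alg lq\<^esub> b) = F_comult lq a \<oplus>\<^bsub>FF_ten lq\<^esub> F_comult lq b"
  using assms by (auto simp: F_pres.carrier_A F_pres.cls_add F_comult_class comult.lift_add)

lemma F_comult_mult:
  assumes "a \<in> carrier (F_alg lq)" "b \<in> carrier (F_alg lq)"
  shows "F_comult lq (a \<otimes>\<^bsub>F_alg lq\<^esub> b) = F_comult lq a \<otimes>\<^bsub>FF_ten lq\<^esub> F_comult lq b"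
  using assms by (auto simp: F_pres.carrier_A F_pres.cls_mult F_comult_class comult.lift_mult)

lemma F_comult_elems:
  "F_comult lq (t_elt lq i j) = (\<Oplus>\<^bsub>FF_ten lq\<^esub>k\<in>UNIV. apure_F lq (t_elt lq i k) (t_elt lq k j))"
  "F_comult lq (mul lq f) = mu_l (FF_ten lq) f"
  "F_comult lq (mur lq f) = mu_r (FF_ten lq) f"
  "F_comult lq \<one>\<^bsub>F_alg lq\<^esub> = \<one>\<^bsub>FF_ten lq\<^esub>"
  unfolding FF_mu
  by (simp add: t_elt_class F_comult_class comult.lift_fgen comult_gen_def)
     (simp_all add: mu_l_F mu_r_F F_pres.cls_one F_comult_class comult.lift_fgen comult.lift_one comult_gen_def)

lemma FF_bigrade_finsum:
  "finite J \<Longrightarrow> (\<And>j. j \<in> J \<Longrightarrow> f j \<in> bigrade (FF_ten lq) \<alpha> \<beta>) \<Longrightarrow>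
    (\<Oplus>\<^bsub>FF_ten lq\<^esub>j\<in>J. f j) \<in> bigrade (FF_ten lq) \<alpha> \<beta>"
proof (induction J rule: finite_induct)
  case (insert j J)
  have "f i \<in> carrier (FF_ten lq)" if "i \<in> insert j J" for i
    by (rule FF_bigrade_closed[OF insert.prems[OF that]])
  then show ?case using insert by (simp add: Pi_def FF_bigrade_add)
qed (simp add: FF_bigrade_zero)

lemma hten_W_grade_add:
  "X \<in> grade (WF_ten lq) \<beta> \<Longrightarrow> Y \<in> grade (WF_ten lq) \<beta> \<Longrightarrow>
    X \<oplus>\<^bsub>WF_ten lq\<^esub> Y \<in> grade (WF_ten lq) \<beta>"
  unfolding hten_W_grade by (rule WF.tspan_add)

lemma hten_W_grade_zero: "\<zero>\<^bsub>WF_ten lq\<^esub> \<in> grade (WF_ten lq) \<beta>"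
  unfolding hten_W_grade by (rule WF.tspan_zero)

lemma hpure_grade:
  "v \<in> grade (W_alg lq) \<alpha> \<Longrightarrow> a \<in> bigrade (F_alg lq) \<alpha> \<beta> \<Longrightarrow>
    hpure_W lq v a \<in> grade (WF_ten lq) \<beta>"
  unfolding hten_W_grade hpure_def by (rule WF.pure_in_tspan[OF hdegI hdeg_subset])

lemma hten_W_grade_finsum:
  "finite J \<Longrightarrow> (\<And>j. j \<in> J \<Longrightarrow> f j \<in> grade (WF_ten lq) \<beta>) \<Longrightarrow>
    (\<Oplus>\<^bsub>WF_ten lq\<^esub>j\<in>J. f j) \<in> grade (WF_ten lq) \<beta>"
proof (induction J rule: finite_induct)
  case (insert j J)
  have "f i \<in> carrier (WF_ten lq)" if "i \<in> insert j J" for i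
    by (rule hten_W_grade_closed[OF insert.prems[OF that]])
  then show ?case using insert by (simp add: Pi_def hten_W_grade_add)
qed (simp add: hten_W_grade_zero)

lemma comult_gen_bigrade:
  "comult_gen lq y \<in> bigrade (FF_ten lq) (fst (F_deg y)) (snd (F_deg y))"
  by (cases y) (auto simp: comult_gen_def intro!: FF_bigrade_finsum apure_bigrade bigrade_F_elems)

lemma F_comult_bigrade:
  assumes "a \<in> bigrade (F_alg lq) \<alpha> \<beta>"
  shows "F_comult lq a \<in> bigrade (FF_ten lq) \<alpha> \<beta>"
proof -
  obtain x where x: "a = F_cls lq x" "x \<in> homogeneous F_deg (\<alpha>, \<beta>)"
    using assms by (auto simp: bigrade_F F.part_def)
  have "comult.lift lq x \<in> bigrade (FF_ten lq) (fst (\<alpha>, \<beta>)) (snd (\<alpha>, \<beta>))"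
    by (rule comult.lift_homogeneous[OF x(2)])
       (simp_all add: FF_bigrade_zero FF_bigrade_add FF_bigrade_mult comult_gen_bigrade FF_mu
          apure_bigrade[OF bigrade_F_elems(1) bigrade_F_elems(3)]
          apure_bigrade[OF bigrade_F_elems(3) bigrade_F_elems(3)] flip: apure_one)
  then show ?thesis by (simp add: x F_comult_class)
qed

text \<open>Restricted to the carrier, so that uniqueness can be claimed as equality of
  functions.\<close>

definition coact :: "complex \<Rightarrow> 'n Wgen falg set \<Rightarrow> ('n::{finite,linorder} Wgen falg set, 'n Fgen falg set) ten" where
  "coact lq = restrict (presented_lift (coact_target lq) (coact_gen lq)) (carrier (W_alg lq))"

lemma coact_class: "lq \<noteq> 0 \<Longrightarrow> coact lq (W_cls lq x) = coact.lift lq x"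
  unfolding coact_def
  by (simp, rule coact.presented_lift_class) (simp add: coact_rel)

section \<open>Compatibility of the coaction with sums, products, functions and degrees\<close>

lemma coact_closed:
  assumes "lq \<noteq> 0" "v \<in> carrier (W_alg lq)"
  shows "coact lq v \<in> carrier (WF_ten lq)"
proof -
  obtain x where "v = W_cls lq x" using assms(2) by (auto simp: W_pres.carrier_A)
  then show ?thesis using coact.lift_closed[of lq x] by (simp add: coact_class assms(1))
qed

lemma coact_add:
  assumes "lq \<noteq> 0" "v \<in> carrier (W_alg lq)" "w \<in> carrier (W_alg lq)"
  shows "coact lq (v \<oplus>\<^bsub>W_alg lq\<^esub> w) = coact lq v \<oplus>\<^bsub>WF_ten lq\<^esub> coact lq w"
proof -
  obtain x y where "v = W_cls lq x" "w = W_cls lq y" using assms by (auto simp: W_pres.carrier_A)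
  then show ?thesis using coact.lift_add[of lq x y] by (simp add: coact_class assms(1) W_pres.cls_add)
qed

lemma coact_mult:
  assumes "lq \<noteq> 0" "v \<in> carrier (W_alg lq)" "w \<in> carrier (W_alg lq)"
  shows "coact lq (v \<otimes>\<^bsub>W_alg lq\<^esub> w) = coact lq v \<otimes>\<^bsub>WF_ten lq\<^esub> coact lq w"
proof -
  obtain x y where "v = W_cls lq x" "w = W_cls lq y" using assms by (auto simp: W_pres.carrier_A)
  then show ?thesis using coact.lift_mult[of lq x y] by (simp add: coact_class assms(1) W_pres.cls_mult)
qed

lemma coact_gens:
  assumes "lq \<noteq> 0"
  shows "coact lq (W_gen lq y) = coact_gen lq y" "coact lq \<one>\<^bsub>W_alg lq\<^esub> = \<one>\<^bsub>WF_ten lq\<^esub>"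
proof -
  show "coact lq (W_gen lq y) = coact_gen lq y"
    by (simp add: W_gen_def coact_class assms coact.lift_fgen)
  show "coact lq \<one>\<^bsub>W_alg lq\<^esub> = \<one>\<^bsub>WF_ten lq\<^esub>"
    using coact.lift_one[of lq] by (simp add: W_pres.cls_one coact_class assms)
qed

lemma coact_w:
  assumes "lq \<noteq> 0"
  shows "coact lq (w_elt lq i) =
    (\<Oplus>\<^bsub>WF_ten lq\<^esub>j\<in>UNIV. hpure_W lq (w_elt lq j) (t_elt lq j i))"
  unfolding w_elt_def[of lq i] by (simp add: coact_gens assms coact_gen_def)

lemma coact_smult:
  assumes "lq \<noteq> 0" "v \<in> carrier (W_alg lq)"
  shows "coact lq (f \<odot>\<^bsub>W_alg lq\<^esub> v) = f \<odot>\<^bsub>WF_ten lq\<^esub> coact lq v"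
  by (simp add: smult_W coact_mult assms coact_gens hten_W_smult coact_closed) (simp add: coact_gen_def)

lemma coact_gen_grade: "coact_gen lq y \<in> grade (WF_ten lq) (W_deg y)"
  by (cases y) (auto simp: coact_gen_def intro!: hten_W_grade_finsum hpure_grade grade_W_elems bigrade_F_elems)

lemma coact_grade:
  assumes "lq \<noteq> 0" "v \<in> grade (W_alg lq) \<alpha>"
  shows "coact lq v \<in> grade (WF_ten lq) \<alpha>"
proof -
  obtain x where x: "v = W_cls lq x" "x \<in> homogeneous W_deg \<alpha>"
    using assms(2) by (auto simp: grade_W W.part_def)
  have "coact.lift lq x \<in> grade (WF_ten lq) \<alpha>"
    by (rule coact.lift_homogeneous[OF x(2)])
       (simp_all add: hten_W_grade_zero hten_W_grade_add hten_W_grade_mult coact_gen_grade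
          hpure_grade[OF grade_W_elems(2) bigrade_F_elems(2)]
          hpure_grade[OF grade_W_elems(2) bigrade_F_elems(3)] flip: hpure_one)
  then show ?thesis by (simp add: x coact_class assms(1))
qed

section \<open>Words in the generators\<close>

definition wordsum :: "'n::finite list \<Rightarrow> complex^'n" where
  "wordsum I = sum_list (map \<omega> I)"

lemma wordsum_simps [simp]: "wordsum [] = 0" "wordsum (i # I) = \<omega> i + wordsum I"
  by (simp_all add: wordsum_def)

fun wword :: "complex \<Rightarrow> 'n list \<Rightarrow> 'n::{finite,linorder} Wgen falg set" where
  "wword lq [] = \<one>\<^bsub>W_alg lq\<^esub>"
| "wword lq (i # I) = w_elt lq i \<otimes>\<^bsub>W_alg lq\<^esub> wword lq I"

text \<open>The matrix coefficients of the coaction on words. The catch-all clause supplies the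
  empty product; the sums over words only involve words of equal length.\<close>

fun tword :: "complex \<Rightarrow> 'n list \<Rightarrow> 'n list \<Rightarrow> 'n::{finite,linorder} Fgen falg set" where
  "tword lq (j # J) (i # I) = t_elt lq j i \<otimes>\<^bsub>F_alg lq\<^esub> tword lq J I"
| "tword lq _ _ = \<one>\<^bsub>F_alg lq\<^esub>"

lemma wword_grade: "wword lq I \<in> grade (W_alg lq) (wordsum I)"
  by (induction I) (simp_all add: grade_W_elems grade_W_props)

lemma wword_closed [simp]: "wword lq I \<in> carrier (W_alg lq)"
  using wword_grade by (rule grade_W_closed)

lemma tword_closed [simp]: "tword lq J I \<in> carrier (F_alg lq)"
  by (induction lq J I rule: tword.induct) simp_all

lemma tword_bigrade: "length J = length I \<Longrightarrow> tword lq J I \<in> bigrade (F_alg lq) (wordsum J) (wordsum I)"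
  by (induction J I rule: list_induct2) (simp_all add: bigrade_F_elems bigrade_F_props)

lemma finite_words: "finite {J :: 'n::finite list. length J = n}"
  using finite_lists_length_eq[of "UNIV :: 'n set" n] by simp

lemma (in abelian_monoid) finsum_words_Suc:
  fixes f :: "'n::finite list \<Rightarrow> 'a"
  assumes "\<And>J. length J = Suc n \<Longrightarrow> f J \<in> carrier G"
  shows "(\<Oplus>J\<in>{J. length J = Suc n}. f J) = (\<Oplus>j\<in>UNIV. \<Oplus>J\<in>{J. length J = n}. f (j # J))"
proof -
  have eq: "{J :: 'n list. length J = Suc n} = (\<lambda>p. fst p # snd p) ` (UNIV \<times> {J. length J = n})"
    by (auto simp: length_Suc_conv image_iff)
  have "(\<Oplus>J\<in>{J. length J = Suc n}. f J) = (\<Oplus>p\<in>UNIV \<times> {J. length J = n}. f (fst p # snd p))"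
    unfolding eq using assms by (subst finsum_reindex) (auto simp: inj_on_def)
  also have "\<dots> = (\<Oplus>j\<in>UNIV. \<Oplus>J\<in>{J. length J = n}. f (j # J))"
    using assms finite_words by (subst finsum_prod) auto
  finally show ?thesis .
qed

text \<open>No normal form is chosen: \<open>J\<close> runs over all words of the given length, also
  those whose product in W is zero or proportional to that of another. This keeps the formula a
  plain expansion of a product of sums, and the later comparisons of double sums mere
  interchanges.\<close>

lemma coact_wword:
  assumes "lq \<noteq> 0"
  shows "coact lq (wword lq I) = (\<Oplus>\<^bsub>WF_ten lq\<^esub>J\<in>{J. length J = length I}.
    hpure_W lq (wword lq J) (tword lq J I))"
proof (induction I)
  case Nil
  show ?case by (simp add: coact_gens assms hpure_one)
next
  case (Cons i I)
  let ?T = "WF_ten lq" and ?p = "hpure_W lq"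
  have "coact lq (wword lq (i # I)) =
      (\<Oplus>\<^bsub>?T\<^esub>j\<in>UNIV. ?p (w_elt lq j) (t_elt lq j i) \<otimes>\<^bsub>?T\<^esub> (\<Oplus>\<^bsub>?T\<^esub>J\<in>{J. length J = length I}. ?p (wword lq J) (tword lq J I)))"
    by (simp add: coact_mult assms coact_w Cons.IH WF.finsum_ldistr Pi_def)
  also have "\<dots> = (\<Oplus>\<^bsub>?T\<^esub>j\<in>UNIV. \<Oplus>\<^bsub>?T\<^esub>J\<in>{J. length J = length I}. ?p (w_elt lq j) (t_elt lq j i) \<otimes>\<^bsub>?T\<^esub> ?p (wword lq J) (tword lq J I))"
    by (simp add: WF.finsum_rdistr Pi_def finite_words)
  also have "\<dots> = (\<Oplus>\<^bsub>?T\<^esub>j\<in>UNIV. \<Oplus>\<^bsub>?T\<^esub>J\<in>{J. length J = length I}. ?p (wword lq (j # J)) (tword lq (j # J) (i # I)))"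
    by (intro WF.finsum_cong' refl)
       (auto simp: Pi_def hpure_mult_W[OF grade_W_elems(3) bigrade_F_elems(4) wword_grade tword_bigrade])
  also have "\<dots> = (\<Oplus>\<^bsub>?T\<^esub>J\<in>{J. length J = length (i # I)}. ?p (wword lq J) (tword lq J (i # I)))"
    unfolding list.size(4) add_0_right add_Suc_right One_nat_def
    by (subst WF.finsum_words_Suc) (simp_all del: wword.simps tword.simps)
  finally show ?case .
qed

lemma comult_tword:
  "length J = length I \<Longrightarrow> F_comult lq (tword lq J I) =
    (\<Oplus>\<^bsub>FF_ten lq\<^esub>K\<in>{K. length K = length I}. apure_F lq (tword lq J K) (tword lq K I))"
proof (induction J I rule: list_induct2)
  case Nil
  show ?case by (simp add: F_comult_elems apure_one)
next
  case (Cons j J i I)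
  let ?T = "FF_ten lq" and ?p = "apure_F lq"
  have "F_comult lq (tword lq (j # J) (i # I)) =
      (\<Oplus>\<^bsub>?T\<^esub>k\<in>UNIV. ?p (t_elt lq j k) (t_elt lq k i) \<otimes>\<^bsub>?T\<^esub> (\<Oplus>\<^bsub>?T\<^esub>K\<in>{K. length K = length I}. ?p (tword lq J K) (tword lq K I)))"
    by (simp add: F_comult_mult F_comult_elems Cons.IH FF.finsum_ldistr Pi_def)
  also have "\<dots> = (\<Oplus>\<^bsub>?T\<^esub>k\<in>UNIV. \<Oplus>\<^bsub>?T\<^esub>K\<in>{K. length K = length I}. ?p (t_elt lq j k) (t_elt lq k i) \<otimes>\<^bsub>?T\<^esub> ?p (tword lq J K) (tword lq K I))"
    by (simp add: FF.finsum_rdistr Pi_def finite_words)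
  also have "\<dots> = (\<Oplus>\<^bsub>?T\<^esub>k\<in>UNIV. \<Oplus>\<^bsub>?T\<^esub>K\<in>{K. length K = length I}. ?p (tword lq (j # J) (k # K)) (tword lq (k # K) (i # I)))"
    using Cons.hyps by (intro FF.finsum_cong' refl)
       (auto simp: Pi_def apure_mult[OF bigrade_F_elems(4) bigrade_F_elems(4) tword_bigrade tword_bigrade])
  also have "\<dots> = (\<Oplus>\<^bsub>?T\<^esub>K\<in>{K. length K = length (i # I)}. ?p (tword lq (j # J) K) (tword lq K (i # I)))"
    unfolding list.size(4) add_0_right add_Suc_right One_nat_def
    by (subst FF.finsum_words_Suc) (simp_all del: tword.simps)
  finally show ?case .
qed

lemma counit_tword:
  "length J = length I \<Longrightarrow> F_counit (tword lq J I) = (if J = I then T_shift (- wordsum I) else (\<lambda>u. 0))"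
  by (induction J I rule: list_induct2)
     (auto simp: F_counit_elems F_counit_mult fun_eq_iff)

text \<open>Functions are collected on the left: passing a letter w_i costs a shift by
  \<open>- \<omega> i\<close>, and functions that meet are multiplied. Spanning is all that is
  claimed, so dependent words do no harm.\<close>

lemma W_span_monomial: "\<exists>f I. W_cls lq (Poly_Mapping.single (FMon ys) c) = f \<odot>\<^bsub>W_alg lq\<^esub> wword lq I"
proof (induction ys)
  case Nil
  have "W_cls lq (Poly_Mapping.single (FMon []) c) = mero_const c \<odot>\<^bsub>W_alg lq\<^esub> wword lq []"
    by (simp add: single_Nil smult_W W_moment_const)
  then show ?case by blast
next
  case (Cons y ys)
  then obtain f I where IH: "W_cls lq (Poly_Mapping.single (FMon ys) c) = f \<odot>\<^bsub>W_alg lq\<^esub> wword lq I" by blast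
  have *: "W_cls lq (Poly_Mapping.single (FMon (y # ys)) c) = W_gen lq y \<otimes>\<^bsub>W_alg lq\<^esub> (f \<odot>\<^bsub>W_alg lq\<^esub> wword lq I)"
    by (simp only: single_Cons W_gen_def flip: W_pres.cls_mult IH)
  show ?case
  proof (cases y)
    case (Vgen i)
    then have "W_cls lq (Poly_Mapping.single (FMon (y # ys)) c) = T_shift (- \<omega> i) f \<odot>\<^bsub>W_alg lq\<^esub> wword lq (i # I)"
      unfolding * using W_mult_smult[OF grade_W_elems(3) wword_closed, of lq i f I] by (simp add: w_elt_def)
    then show ?thesis by blast
  next
    case (Mgen g)
    then have "W_cls lq (Poly_Mapping.single (FMon (y # ys)) c) = (g * f) \<odot>\<^bsub>W_alg lq\<^esub> wword lq I"
      unfolding * by (simp add: smult_W W_moment_mult W_pres.m_assoc)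
    then show ?thesis by blast
  qed
qed

lemma W_span_induct [consumes 1, case_names add word]:
  assumes "v \<in> carrier (W_alg lq)"
    and "\<And>v w. v \<in> carrier (W_alg lq) \<Longrightarrow> w \<in> carrier (W_alg lq) \<Longrightarrow> Q v \<Longrightarrow> Q w \<Longrightarrow> Q (v \<oplus>\<^bsub>W_alg lq\<^esub> w)"
    and "\<And>f I. Q (f \<odot>\<^bsub>W_alg lq\<^esub> wword lq I)"
  shows "Q v"
proof -
  have mono: "Q (W_cls lq (Poly_Mapping.single m c))" for m c
    using W_span_monomial[of lq "letters m" c] assms(3) by auto
  obtain x where "v = W_cls lq x" using assms(1) by (auto simp: W_pres.carrier_A)
  moreover have "Q (W_cls lq x)"
  proof (induction x rule: falg_induct)
    case zero
    show ?case using mono[of 0 0] by simp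
  next
    case (single_add x m c)
    then show ?case using assms(2)[OF _ _ single_add mono[of m c]] by (simp add: W_pres.cls_add)
  qed
  ultimately show ?thesis by simp
qed

section \<open>The corepresentation axioms\<close>

lemma mu_l_FF_bigrade:
  assumes "X \<in> bigrade (FF_ten lq) \<alpha> \<beta>"
  shows "mu_l (FF_ten lq) f \<otimes>\<^bsub>FF_ten lq\<^esub> X \<in> bigrade (FF_ten lq) \<alpha> \<beta>"
  using FF_bigrade_mult[OF apure_bigrade[OF bigrade_F_elems(1) bigrade_F_elems(3)] assms] by (simp add: FF_mu)

lemma hten_W_grade_smult:
  assumes "X \<in> grade (WF_ten lq) \<beta>"
  shows "f \<odot>\<^bsub>WF_ten lq\<^esub> X \<in> grade (WF_ten lq) \<beta>"
  using hten_W_grade_mult[OF hpure_grade[OF grade_W_elems(2) bigrade_F_elems(2)] assms] hten_W_grade_closed[OF assms]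
  by (simp add: hten_W_smult)

interpretation WFF: tensor_product "W_alg lq" "l_module (FF_ten lq)"
    "hcomps (W_alg lq) (FF_ten lq)" "W_FF_ten lq" for lq
  by (rule tensor_product_hten) (erule (1) grade_W_props, erule grade_W_smult, erule (1) FF_bigrade_add, erule mu_l_FF_bigrade)

interpretation WF_F: tensor_product "WF_ten lq" "l_module (F_alg lq)"
    "hcomps (WF_ten lq) (F_alg lq)" "WF_F_ten lq" for lq
  by (rule tensor_product_hten)
     (erule (1) hten_W_grade_add, erule hten_W_grade_smult, erule (1) bigrade_F_props, erule bigrade_F_mu_mult)

interpretation WD: tensor_product "W_alg lq" "l_module D_alg" "hcomps (W_alg lq) D_alg" "hten (W_alg lq) D_alg" for lq
  by (rule tensor_product_hten)
     (erule (1) grade_W_props, erule grade_W_smult, simp_all add: bigrade_D_props comp_def)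

lemma apure_add_left:
  "a \<in> bigrade (F_alg lq) \<alpha> \<gamma> \<Longrightarrow> a' \<in> bigrade (F_alg lq) \<alpha> \<gamma> \<Longrightarrow> b \<in> bigrade (F_alg lq) \<gamma> \<beta> \<Longrightarrow>
    apure_F lq (a \<oplus>\<^bsub>F_alg lq\<^esub> a') b =
    apure_F lq a b \<oplus>\<^bsub>FF_ten lq\<^esub> apure_F lq a' b"
  using FF.pure_add_left[OF acompsI] by (simp add: apure_def)

lemma apure_add_right:
  "a \<in> bigrade (F_alg lq) \<alpha> \<gamma> \<Longrightarrow> b \<in> bigrade (F_alg lq) \<gamma> \<beta> \<Longrightarrow> b' \<in> bigrade (F_alg lq) \<gamma> \<beta> \<Longrightarrow>
    apure_F lq a (b \<oplus>\<^bsub>F_alg lq\<^esub> b') =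
    apure_F lq a b \<oplus>\<^bsub>FF_ten lq\<^esub> apure_F lq a b'"
  using FF.pure_add_right[OF acompsI] by (simp add: apure_def)

lemma apure_balanced:
  "a \<in> bigrade (F_alg lq) \<alpha> \<gamma> \<Longrightarrow> b \<in> bigrade (F_alg lq) \<gamma> \<beta> \<Longrightarrow>
    apure_F lq (mur lq f \<otimes>\<^bsub>F_alg lq\<^esub> a) b =
    apure_F lq a (mul lq f \<otimes>\<^bsub>F_alg lq\<^esub> b)"
  using FF.pure_balanced[OF acompsI] by (simp add: apure_def)

lemma apure_mu_l:
  "a \<in> bigrade (F_alg lq) \<alpha> \<gamma> \<Longrightarrow> b \<in> bigrade (F_alg lq) \<gamma> \<beta> \<Longrightarrow>
    mu_l (FF_ten lq) f \<otimes>\<^bsub>FF_ten lq\<^esub> apure_F lq a b =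
    apure_F lq (mul lq f \<otimes>\<^bsub>F_alg lq\<^esub> a) b"
  using apure_mult[OF bigrade_F_elems(1) bigrade_F_elems(3), of a lq \<alpha> \<gamma> b \<beta> f] bigrade_F_closed[of b lq \<gamma> \<beta>]
  by (simp add: FF_mu)

lemma apure_mu_r:
  "a \<in> bigrade (F_alg lq) \<alpha> \<gamma> \<Longrightarrow> b \<in> bigrade (F_alg lq) \<gamma> \<beta> \<Longrightarrow>
    mu_r (FF_ten lq) f \<otimes>\<^bsub>FF_ten lq\<^esub> apure_F lq a b =
    apure_F lq a (mur lq f \<otimes>\<^bsub>F_alg lq\<^esub> b)"
  using apure_mult[OF bigrade_F_elems(3) bigrade_F_elems(2), of a lq \<alpha> \<gamma> b \<beta> f] bigrade_F_closed[of a lq \<alpha> \<gamma>]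
  by (simp add: FF_mu)

text \<open>The pair may still lie in some other matching product of components, but then one of its
  entries belongs to two different components and is zero. Otherwise the tensor is zero by
  convention.\<close>

lemma apure_mismatch:
  assumes a: "a \<in> bigrade (F_alg lq) \<alpha> \<gamma>" and b: "b \<in> bigrade (F_alg lq) \<gamma>' \<beta>" and "\<gamma> \<noteq> \<gamma>'"
  shows "apure_F lq a b = \<zero>\<^bsub>FF_ten lq\<^esub>"
proof (cases "(a, b) \<in> tpairs (acomps (F_alg lq) (F_alg lq))")
  case True
  then obtain \<delta> \<epsilon> \<zeta> where *: "a \<in> bigrade (F_alg lq) \<delta> \<epsilon>" "b \<in> bigrade (F_alg lq) \<epsilon> \<zeta>"
    by (auto simp: tpairs_def acomps_def)
  have "a = \<zero>\<^bsub>F_alg lq\<^esub> \<or> b = \<zero>\<^bsub>F_alg lq\<^esub>"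
    using bigrade_F_disjoint[OF a *(1)] bigrade_F_disjoint[OF b *(2)] assms(3) by auto
  then show ?thesis by (auto simp: apure_zero)
next
  case False
  then show ?thesis unfolding apure_def by (rule FF.pure_unmatched)
qed

lemma hpure_FF_zero:
  "hpure_W_FF lq v \<zero>\<^bsub>FF_ten lq\<^esub> = \<zero>\<^bsub>W_FF_ten lq\<^esub>"
  using WFF.pure_zero_right[of lq v] by (simp add: hpure_def)

text \<open>Functoriality of the tensor product in degree-preserving maps. It is applied to the
  identity with the comultiplication, to the coaction with the identity, and to the identity with
  the counit.\<close>

lemma tensor_lift_map:
  fixes V :: "('n::finite, 'v) hspace" and A :: "('n, 'a) halg" and V' :: "('n, 'w) hspace" and A' :: "('n, 'b) halg"
  assumes T: "tensor_product V (l_module A) (hcomps V A) (hten V A)"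
    and T': "tensor_product V' (l_module A') (hcomps V' A') (hten V' A')"
    and r: "\<And>\<alpha> v. v \<in> grade V \<alpha> \<Longrightarrow> r v \<in> grade V' \<alpha>"
      "\<And>\<alpha> v w. v \<in> grade V \<alpha> \<Longrightarrow> w \<in> grade V \<alpha> \<Longrightarrow> r (v \<oplus>\<^bsub>V\<^esub> w) = r v \<oplus>\<^bsub>V'\<^esub> r w"
      "\<And>\<alpha> f v. v \<in> grade V \<alpha> \<Longrightarrow> r (f \<odot>\<^bsub>V\<^esub> v) = f \<odot>\<^bsub>V'\<^esub> r v"
    and s: "\<And>\<alpha> \<beta> a. a \<in> bigrade A \<alpha> \<beta> \<Longrightarrow> s a \<in> bigrade A' \<alpha> \<beta>"
      "\<And>\<alpha> \<beta> a b. a \<in> bigrade A \<alpha> \<beta> \<Longrightarrow> b \<in> bigrade A \<alpha> \<beta> \<Longrightarrow> s (a \<oplus>\<^bsub>A\<^esub> b) = s a \<oplus>\<^bsub>A'\<^esub> s b"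
      "\<And>\<alpha> \<beta> f a. a \<in> bigrade A \<alpha> \<beta> \<Longrightarrow> s (mu_l A f \<otimes>\<^bsub>A\<^esub> a) = mu_l A' f \<otimes>\<^bsub>A'\<^esub> s a"
  shows "tensor_lift V (l_module A) (hcomps V A) (hten V A) (hten V' A') (\<lambda>v a. hpure V' A' (r v) (s a))"
proof -
  interpret T': tensor_product V' "l_module A'" "hcomps V' A'" "hten V' A'" by (rule T')
  show ?thesis
  proof (intro tensor_lift.intro T T'.abelian_group_T tensor_lift_axioms.intro; erule hcompsE; hypsubst)
    fix \<alpha> \<beta> v w a b f
    assume v: "v \<in> grade V \<alpha>" and a: "a \<in> bigrade A \<alpha> \<beta>"
    note v' = r(1)[OF v] and a' = s(1)[OF a]
    show "hpure V' A' (r v) (s a) \<in> carrier (hten V' A')" by (simp add: hpure_def)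
    show "hpure V' A' (r (f \<odot>\<^bsub>V\<^esub> v)) (s a) = hpure V' A' (r v) (s (f \<odot>\<^bsub>l_module A\<^esub> a))"
      using T'.pure_balanced[OF hcompsI v' a', of f] by (simp add: hpure_def r(3)[OF v] s(3)[OF a])
    show "hpure V' A' (r (v \<oplus>\<^bsub>V\<^esub> w)) (s a) = hpure V' A' (r v) (s a) \<oplus>\<^bsub>hten V' A'\<^esub> hpure V' A' (r w) (s a)"
      if "w \<in> grade V \<alpha>"
      using T'.pure_add_left[OF hcompsI v' r(1)[OF that] a'] by (simp add: hpure_def r(2)[OF v that])
    show "hpure V' A' (r v) (s (a \<oplus>\<^bsub>l_module A\<^esub> b)) = hpure V' A' (r v) (s a) \<oplus>\<^bsub>hten V' A'\<^esub> hpure V' A' (r v) (s b)"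
      if "b \<in> bigrade A \<alpha> \<beta>"
      using T'.pure_add_right[OF hcompsI v' a' s(1)[OF that]] by (simp add: hpure_def s(2)[OF a that])
  qed
qed

lemma tensor_lift_id_comult:
  "tensor_lift (W_alg lq) (l_module (F_alg lq)) (hcomps (W_alg lq) (F_alg lq)) (WF_ten lq)
     (W_FF_ten lq) (\<lambda>w a. hpure_W_FF lq w (F_comult lq a))"
  by (rule tensor_lift_map[OF WF.tensor_product_axioms WFF.tensor_product_axioms])
     (assumption | rule refl | erule F_comult_bigrade | (rule F_comult_add; erule bigrade_F_closed) |
      (drule bigrade_F_closed, simp add: F_comult_mult F_comult_elems))+

lemma tensor_lift_coact_id:
  assumes "lq \<noteq> 0"
  shows "tensor_lift (W_alg lq) (l_module (F_alg lq)) (hcomps (W_alg lq) (F_alg lq)) (WF_ten lq)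
     (WF_F_ten lq) (\<lambda>w a. hpure (WF_ten lq) (F_alg lq) (coact lq w) a)"
  by (rule tensor_lift_map[OF WF.tensor_product_axioms WF_F.tensor_product_axioms])
     (assumption | rule refl | erule coact_grade[OF assms] | (rule coact_add[OF assms]; erule grade_W_closed) |
      (rule coact_smult[OF assms], erule grade_W_closed))+

lemma tensor_lift_id_counit:
  "tensor_lift (W_alg lq) (l_module (F_alg lq)) (hcomps (W_alg lq) (F_alg lq)) (WF_ten lq)
     (hten (W_alg lq) D_alg) (\<lambda>w a. hpure (W_alg lq) D_alg w (F_counit a))"
proof (rule tensor_lift_map[OF WF.tensor_product_axioms WD.tensor_product_axioms])
  fix \<alpha> \<beta> and a b :: "'a Fgen falg set" and f
  assume "a \<in> bigrade (F_alg lq) \<alpha> \<beta>"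
  then have a: "a \<in> carrier (F_alg lq)" by (rule bigrade_F_closed)
  then show "F_counit (mul lq f \<otimes>\<^bsub>F_alg lq\<^esub> a) = mu_l D_alg f \<otimes>\<^bsub>D_alg\<^esub> F_counit a"
    by (simp add: F_counit_mult F_counit_elems)
  assume "b \<in> bigrade (F_alg lq) \<alpha> \<beta>"
  then have "b \<in> carrier (F_alg lq)" by (rule bigrade_F_closed)
  with a show "F_counit (a \<oplus>\<^bsub>F_alg lq\<^esub> b) = F_counit a \<oplus>\<^bsub>D_alg\<^esub> F_counit b"
    by (simp add: F_counit_add[OF a])
qed (auto intro: F_counit_bigrade)

text \<open>\<open>hassoc\<close> builds its inner map on all of W \<otimes> F, while
  \<open>b\<close> has one fixed left degree. Tensors whose right degree differs from it are sent to
  zero by \<open>apure_mismatch\<close>, so each verification splits into a matching case and a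
  trivial one.\<close>

lemma tensor_lift_inner:
  fixes lq :: complex and b :: "'n::{finite,linorder} Fgen falg set"
  assumes b: "b \<in> bigrade (F_alg lq) \<beta> \<gamma>"
  shows "tensor_lift (W_alg lq) (l_module (F_alg lq)) (hcomps (W_alg lq) (F_alg lq)) (WF_ten lq)
     (W_FF_ten lq)
     (\<lambda>v a. hpure_W_FF lq v (apure_F lq a b))"
proof (intro tensor_lift.intro WF.tensor_product_axioms WFF.abelian_group_T tensor_lift_axioms.intro; erule hcompsE; hypsubst)
  let ?h = "hpure (W_alg lq) (aten (F_alg lq) (F_alg lq :: ('n, _) halg))"
    and ?p = "apure (F_alg lq) (F_alg lq :: ('n, _) halg)"
  fix \<alpha> \<beta>' and v w :: "'n Wgen falg set" and a a' :: "'n Fgen falg set" and f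
  assume v: "v \<in> grade (W_alg lq) \<alpha>"
  show "?h v (?p a b) \<in> carrier (W_FF_ten lq)"
    by (simp add: hpure_def)
  assume a: "a \<in> bigrade (F_alg lq) \<alpha> \<beta>'"
  have zero: "?h u (?p x b) = \<zero>\<^bsub>W_FF_ten lq\<^esub>"
    if "x \<in> bigrade (F_alg lq) \<alpha> \<beta>'" "\<beta>' \<noteq> \<beta>" for u x
    using apure_mismatch[OF that(1) b that(2)] by (simp add: hpure_FF_zero)
  show "?h (f \<odot>\<^bsub>W_alg lq\<^esub> v) (?p a b) = ?h v (?p (f \<odot>\<^bsub>l_module (F_alg lq)\<^esub> a) b)"
  proof (cases "\<beta>' = \<beta>")
    case True
    show ?thesis using WFF.pure_balanced[OF hcompsI v apure_bigrade[OF a b[folded True]], of f] apure_mu_l[OF a b[folded True]]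
      by (simp add: hpure_def)
  next
    case False
    show ?thesis using zero[OF a False] zero[OF bigrade_F_mu_mult(1)[OF a] False] by simp
  qed
  show "?h (v \<oplus>\<^bsub>W_alg lq\<^esub> w) (?p a b) = ?h v (?p a b) \<oplus>\<^bsub>W_FF_ten lq\<^esub> ?h w (?p a b)"
    if w: "w \<in> grade (W_alg lq) \<alpha>"
  proof (cases "\<beta>' = \<beta>")
    case True
    show ?thesis using WFF.pure_add_left[OF hcompsI v w apure_bigrade[OF a b[folded True]]] by (simp add: hpure_def)
  next
    case False
    show ?thesis using zero[OF a False] by simp
  qed
  show "?h v (?p (a \<oplus>\<^bsub>l_module (F_alg lq)\<^esub> a') b) =
      ?h v (?p a b) \<oplus>\<^bsub>W_FF_ten lq\<^esub> ?h v (?p a' b)"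
    if a': "a' \<in> bigrade (F_alg lq) \<alpha> \<beta>'"
  proof (cases "\<beta>' = \<beta>")
    case True
    show ?thesis
      using WFF.pure_add_right[OF hcompsI v apure_bigrade[OF a b[folded True]] apure_bigrade[OF a' b[folded True]]]
        apure_add_left[OF a a' b[folded True]]
      by (simp add: hpure_def)
  next
    case False
    show ?thesis using zero[OF a False] zero[OF a' False] zero[OF bigrade_F_props(3)[OF a a'] False] by simp
  qed
qed

section \<open>Reassociation of the triple tensor product\<close>

abbreviation assoc_inner where
  "assoc_inner lq b \<equiv> tlift (W_FF_ten lq)
     (\<lambda>v a. hpure_W_FF lq v (apure_F lq a b))"

lemma assoc_inner_pure:
  assumes "b \<in> bigrade (F_alg lq) \<beta> \<gamma>" "v \<in> grade (W_alg lq) \<alpha>" "a \<in> bigrade (F_alg lq) \<alpha> \<beta>'"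
  shows "assoc_inner lq b (hpure_W lq v a) =
    hpure_W_FF lq v (apure_F lq a b)"
  using tensor_lift.tlift_pure[OF tensor_lift_inner[OF assms(1)] hcomps_pairs[OF assms(2,3)]] by (simp add: hpure_def)

text \<open>Additivity in \<open>X\<close> belongs to the universal property of the inner map;
  additivity in \<open>b\<close> compares three such maps and needs an induction over tensors.
  Restricting \<open>X\<close> to degree \<open>\<beta>\<close> makes the middle degrees
  match.\<close>

lemma assoc_inner_add_right:
  assumes b: "b \<in> bigrade (F_alg lq) \<beta> \<gamma>" "b' \<in> bigrade (F_alg lq) \<beta> \<gamma>"
    and X: "X \<in> grade (WF_ten lq) \<beta>"
  shows "assoc_inner lq (b \<oplus>\<^bsub>F_alg lq\<^esub> b') X =
    assoc_inner lq b X \<oplus>\<^bsub>W_FF_ten lq\<^esub> assoc_inner lq b' X"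
proof -
  interpret L: tensor_lift "W_alg lq" "l_module (F_alg lq)" "hcomps (W_alg lq) (F_alg lq)" "WF_ten lq"
     "W_FF_ten lq"
     "\<lambda>v a. hpure_W_FF lq v (apure_F lq a b)"
    by (rule tensor_lift_inner[OF b(1)])
  interpret L': tensor_lift "W_alg lq" "l_module (F_alg lq)" "hcomps (W_alg lq) (F_alg lq)" "WF_ten lq"
     "W_FF_ten lq"
     "\<lambda>v a. hpure_W_FF lq v (apure_F lq a b')"
    by (rule tensor_lift_inner[OF b(2)])
  interpret L'': tensor_lift "W_alg lq" "l_module (F_alg lq)" "hcomps (W_alg lq) (F_alg lq)" "WF_ten lq"
     "W_FF_ten lq"
     "\<lambda>v a. hpure_W_FF lq v (apure_F lq a (b \<oplus>\<^bsub>F_alg lq\<^esub> b'))"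
    by (rule tensor_lift_inner[OF bigrade_F_props(3)[OF b]])
  show ?thesis
    using X[unfolded hten_W_grade] hdeg_subset
  proof (induction X rule: WF.tspan_induct)
    case zero
    show ?case by (simp add: L.tlift_zero L'.tlift_zero L''.tlift_zero)
  next
    case (pure v a)
    then obtain \<alpha> where va: "v \<in> grade (W_alg lq) \<alpha>" "a \<in> bigrade (F_alg lq) \<alpha> \<beta>" by (rule hdegE)
    show ?case
      using assoc_inner_pure[OF b(1) va] assoc_inner_pure[OF b(2) va] assoc_inner_pure[OF bigrade_F_props(3)[OF b] va]
        WFF.pure_add_right[OF hcompsI va(1) apure_bigrade[OF va(2) b(1)] apure_bigrade[OF va(2) b(2)]]
        apure_add_right[OF va(2) b]
      by (simp add: hpure_def)
  next
    case (minus X)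
    note c = WF.tspan_closed[OF hdeg_subset minus(1)]
    show ?case using minus(2) L.tlift_closed[OF c] L'.tlift_closed[OF c]
      by (simp add: L.tlift_minus[OF c] L'.tlift_minus[OF c] L''.tlift_minus[OF c] WFF.minus_add)
  next
    case (add X Y)
    note c = WF.tspan_closed[OF hdeg_subset add(1)] WF.tspan_closed[OF hdeg_subset add(2)]
    show ?case using add(3,4) L.tlift_closed[OF c(1)] L'.tlift_closed[OF c(1)] L.tlift_closed[OF c(2)] L'.tlift_closed[OF c(2)]
      by (simp add: L.tlift_add[OF c] L'.tlift_add[OF c] L''.tlift_add[OF c] WFF.a_ac)
  qed
qed

text \<open>On a pure tensor the function acts on \<open>a\<close> through the right moment map and
  then crosses to \<open>b\<close>; sums and negatives follow by induction over the degree
  \<open>\<beta>\<close> component.\<close>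

lemma assoc_inner_balanced:
  assumes b: "b \<in> bigrade (F_alg lq) \<beta> \<gamma>"
    and X: "X \<in> grade (WF_ten lq) \<beta>"
  shows "assoc_inner lq b (f \<odot>\<^bsub>WF_ten lq\<^esub> X) = assoc_inner lq (mul lq f \<otimes>\<^bsub>F_alg lq\<^esub> b) X"
proof -
  interpret L: tensor_lift "W_alg lq" "l_module (F_alg lq)" "hcomps (W_alg lq) (F_alg lq)" "WF_ten lq"
     "W_FF_ten lq"
     "\<lambda>v a. hpure_W_FF lq v (apure_F lq a b)"
    by (rule tensor_lift_inner[OF b])
  interpret L': tensor_lift "W_alg lq" "l_module (F_alg lq)" "hcomps (W_alg lq) (F_alg lq)" "WF_ten lq"
     "W_FF_ten lq"
     "\<lambda>v a. hpure_W_FF lq v (apure_F lq a (mul lq f \<otimes>\<^bsub>F_alg lq\<^esub> b))"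
    by (rule tensor_lift_inner[OF bigrade_F_mu_mult(1)[OF b]])
  show ?thesis
    using X[unfolded hten_W_grade] hdeg_subset
  proof (induction X rule: WF.tspan_induct)
    case zero
    show ?case by (simp add: hten_W_smult L.tlift_zero L'.tlift_zero)
  next
    case (pure v a)
    then obtain \<alpha> where va: "v \<in> grade (W_alg lq) \<alpha>" "a \<in> bigrade (F_alg lq) \<alpha> \<beta>" by (rule hdegE)
    show ?case
      using assoc_inner_pure[OF b va(1) bigrade_F_mu_mult(2)[OF va(2)], of f]
        assoc_inner_pure[OF bigrade_F_mu_mult(1)[OF b] va, of f] hpure_moment[OF va, of f] apure_balanced[OF va(2) b, of f]
      by (simp add: hpure_def)
  next
    case (minus X)
    note c = WF.tspan_closed[OF hdeg_subset minus(1)]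
    have "f \<odot>\<^bsub>WF_ten lq\<^esub> (\<ominus>\<^bsub>WF_ten lq\<^esub> X) =
        \<ominus>\<^bsub>WF_ten lq\<^esub> (f \<odot>\<^bsub>WF_ten lq\<^esub> X)"
      using c by (simp add: hten_W_smult WF.r_minus)
    moreover have "f \<odot>\<^bsub>WF_ten lq\<^esub> X \<in> carrier (WF_ten lq)"
      using c by (simp add: hten_W_smult)
    ultimately show ?case using minus(2) c by (simp add: L.tlift_minus L'.tlift_minus)
  next
    case (add X Y)
    note c = WF.tspan_closed[OF hdeg_subset add(1)] WF.tspan_closed[OF hdeg_subset add(2)]
    have "f \<odot>\<^bsub>WF_ten lq\<^esub> (X \<oplus>\<^bsub>WF_ten lq\<^esub> Y) =
        f \<odot>\<^bsub>WF_ten lq\<^esub> X \<oplus>\<^bsub>WF_ten lq\<^esub> f \<odot>\<^bsub>WF_ten lq\<^esub> Y"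
      using c by (simp add: hten_W_smult WF.r_distr)
    moreover have "f \<odot>\<^bsub>WF_ten lq\<^esub> X \<in> carrier (WF_ten lq)"
        "f \<odot>\<^bsub>WF_ten lq\<^esub> Y \<in> carrier (WF_ten lq)"
      using c by (simp_all add: hten_W_smult)
    ultimately show ?case using add(3,4) c by (simp add: L.tlift_add L'.tlift_add)
  qed
qed

lemma tensor_lift_outer:
  "tensor_lift (WF_ten lq) (l_module (F_alg lq)) (hcomps (WF_ten lq) (F_alg lq))
     (WF_F_ten lq) (W_FF_ten lq)
     (\<lambda>X b. assoc_inner lq b X)"
proof (intro tensor_lift.intro WF_F.tensor_product_axioms WFF.abelian_group_T tensor_lift_axioms.intro; erule hcompsE; hypsubst)
  fix \<beta> \<gamma> X Y b b' f
  assume X: "X \<in> grade (WF_ten lq) \<beta>" and b: "b \<in> bigrade (F_alg lq) \<beta> \<gamma>"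
  show "assoc_inner lq b X \<in> carrier (W_FF_ten lq)"
    by (rule tensor_lift.tlift_closed[OF tensor_lift_inner[OF b] hten_W_grade_closed[OF X]])
  show "assoc_inner lq b (f \<odot>\<^bsub>WF_ten lq\<^esub> X) = assoc_inner lq (f \<odot>\<^bsub>l_module (F_alg lq)\<^esub> b) X"
    using assoc_inner_balanced[OF b X] by simp
  show "assoc_inner lq b (X \<oplus>\<^bsub>WF_ten lq\<^esub> Y) =
      assoc_inner lq b X \<oplus>\<^bsub>W_FF_ten lq\<^esub> assoc_inner lq b Y"
    if "Y \<in> grade (WF_ten lq) \<beta>"
    by (rule tensor_lift.tlift_add[OF tensor_lift_inner[OF b] hten_W_grade_closed[OF X] hten_W_grade_closed[OF that]])
  show "assoc_inner lq (b \<oplus>\<^bsub>l_module (F_alg lq)\<^esub> b') X =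
      assoc_inner lq b X \<oplus>\<^bsub>W_FF_ten lq\<^esub> assoc_inner lq b' X"
    if "b' \<in> bigrade (F_alg lq) \<beta> \<gamma>"
    using assoc_inner_add_right[OF b that X] by simp
qed

text \<open>Evaluating an operator at 1 is linear over functions, so balancing comes down to
  commutativity of the function field.\<close>

lemma tensor_lift_hunit:
  "tensor_lift (W_alg lq :: ('n::{finite,linorder}, _) hspace) (l_module D_alg) (hcomps (W_alg lq) D_alg) (hten (W_alg lq) D_alg) (W_alg lq)
     (\<lambda>v d. d 1 \<odot>\<^bsub>W_alg lq\<^esub> v)"
proof (intro tensor_lift.intro WD.tensor_product_axioms W_pres.abelian_group_axioms tensor_lift_axioms.intro; erule hcompsE; hypsubst)
  fix \<alpha> \<beta> and v w :: "'n Wgen falg set" and d e :: "'n mero \<Rightarrow> 'n mero" and f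
  assume v: "v \<in> grade (W_alg lq) \<alpha>"
  have vc: "v \<in> carrier (W_alg lq)" using v by (rule grade_W_closed)
  then show "d 1 \<odot>\<^bsub>W_alg lq\<^esub> v \<in> carrier (W_alg lq)" by simp
  show "d 1 \<odot>\<^bsub>W_alg lq\<^esub> (f \<odot>\<^bsub>W_alg lq\<^esub> v) = (f \<odot>\<^bsub>l_module D_alg\<^esub> d) 1 \<odot>\<^bsub>W_alg lq\<^esub> v"
    using vc by (simp add: smult_W flip: W_pres.m_assoc W_moment_mult) (simp add: mult.commute)
  show "d 1 \<odot>\<^bsub>W_alg lq\<^esub> (v \<oplus>\<^bsub>W_alg lq\<^esub> w) = d 1 \<odot>\<^bsub>W_alg lq\<^esub> v \<oplus>\<^bsub>W_alg lq\<^esub> d 1 \<odot>\<^bsub>W_alg lq\<^esub> w"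
    if "w \<in> grade (W_alg lq) \<alpha>"
    using vc grade_W_closed[OF that] by (simp add: smult_W W_pres.r_distr)
  show "(d \<oplus>\<^bsub>l_module D_alg\<^esub> e) 1 \<odot>\<^bsub>W_alg lq\<^esub> v = d 1 \<odot>\<^bsub>W_alg lq\<^esub> v \<oplus>\<^bsub>W_alg lq\<^esub> e 1 \<odot>\<^bsub>W_alg lq\<^esub> v"
    using vc by (simp add: smult_W W_moment_add W_pres.l_distr)
qed

section \<open>The two coaction identities\<close>

lemma W_moment_zero: "W_gen lq (Mgen 0) = \<zero>\<^bsub>W_alg lq\<^esub>"
  using W_moment_const[of lq 0] by (simp add: fscalar_def W_pres.cls_zero)

lemma coact_smult_wword:
  assumes "lq \<noteq> 0"
  shows "coact lq (f \<odot>\<^bsub>W_alg lq\<^esub> wword lq I) = (\<Oplus>\<^bsub>WF_ten lq\<^esub>J\<in>{J. length J = length I}.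
    hpure_W lq (wword lq J) (mur lq f \<otimes>\<^bsub>F_alg lq\<^esub> tword lq J I))"
proof -
  let ?T = "WF_ten lq" and ?p = "hpure_W lq"
  have "coact lq (f \<odot>\<^bsub>W_alg lq\<^esub> wword lq I) =
      (\<Oplus>\<^bsub>?T\<^esub>J\<in>{J. length J = length I}. ?p \<one>\<^bsub>W_alg lq\<^esub> (mur lq f) \<otimes>\<^bsub>?T\<^esub> ?p (wword lq J) (tword lq J I))"
    by (simp add: coact_smult coact_wword assms hten_W_smult WF.finsum_rdistr Pi_def finite_words)
  also have "\<dots> = (\<Oplus>\<^bsub>?T\<^esub>J\<in>{J. length J = length I}. ?p (wword lq J) (mur lq f \<otimes>\<^bsub>F_alg lq\<^esub> tword lq J I))"
    by (intro WF.finsum_cong' refl)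
       (auto simp: hpure_mult_W[OF grade_W_elems(2) bigrade_F_elems(2) wword_grade tword_bigrade])
  finally show ?thesis .
qed

lemma mu_tword_bigrade:
  "length J = length I \<Longrightarrow> mur lq f \<otimes>\<^bsub>F_alg lq\<^esub> tword lq J I \<in> bigrade (F_alg lq) (wordsum J) (wordsum I)"
  by (intro bigrade_F_mu_mult tword_bigrade)

lemma hpure_FF_finsum:
  assumes "v \<in> grade (W_alg lq) \<alpha>" "finite J" "\<And>j. j \<in> J \<Longrightarrow> b j \<in> bigrade (FF_ten lq) \<alpha> \<beta>"
  shows "hpure_W_FF lq v (\<Oplus>\<^bsub>FF_ten lq\<^esub>j\<in>J. b j) =
    (\<Oplus>\<^bsub>W_FF_ten lq\<^esub>j\<in>J. hpure_W_FF lq v (b j))"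
proof -
  let ?A = "FF_ten lq"
  have sum: "finsum (l_module ?A) b J = finsum ?A b J" by (simp add: finsum_def finprod_def)
  have "ring (l_module ?A)" by (rule ring_cong[OF FF.ring_T]) simp_all
  then have mon: "abelian_monoid (l_module ?A)" by (rule ring.is_abelian_group[THEN abelian_group.axioms(1)])
  have sub: "bigrade ?A \<alpha> \<beta> \<subseteq> carrier (l_module ?A)" using FF_bigrade_closed by auto
  show ?thesis
    using WFF.pure_finsum_right[OF mon hcompsI assms(1) _ sub assms(2), where f = b] assms(3)
    by (simp add: sum hpure_def FF_bigrade_zero)
qed

text \<open>On f w_I both sides become the double sum of w_J \<otimes> (t_JK \<otimes> f(\<mu>)
  t_KI) over words J and K of the length of I. On one side K comes from the comultiplication of
  t_JI, on the other J comes from the coaction on w_K. The function stays with the last factor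
  throughout.\<close>

lemma coact_coassociative:
  fixes lq :: complex and v :: "'n::{finite,linorder} Wgen falg set"
  assumes lq: "lq \<noteq> 0" and v: "v \<in> carrier (W_alg lq)"
  shows "tlift (W_FF_ten lq)
      (\<lambda>w a. hpure_W_FF lq w (F_comult lq a)) (coact lq v) =
    hassoc (W_alg lq) (F_alg lq) (tlift (WF_F_ten lq)
      (\<lambda>w a. hpure (WF_ten lq) (F_alg lq) (coact lq w) a) (coact lq v))"
proof -
  let ?W = "W_alg lq :: ('n, _) hspace" and ?F = "F_alg lq :: ('n, _) halg"
  let ?FF = "aten ?F ?F"
  let ?T = "hten ?W ?F" and ?U = "hten ?W ?FF"
  let ?p = "apure ?F ?F" and ?h = "hpure ?W ?FF"
  interpret D: tensor_lift ?W "l_module ?F" "hcomps ?W ?F" ?T ?U "\<lambda>w a. ?h w (F_comult lq a)"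
    by (rule tensor_lift_id_comult)
  interpret R: tensor_lift ?W "l_module ?F" "hcomps ?W ?F" ?T "hten ?T ?F" "\<lambda>w a. hpure ?T ?F (coact lq w) a"
    by (rule tensor_lift_coact_id[OF lq])
  interpret A: tensor_lift ?T "l_module ?F" "hcomps ?T ?F" "hten ?T ?F" ?U "\<lambda>X b. assoc_inner lq b X"
    by (rule tensor_lift_outer)
  have hassoc: "hassoc ?W ?F = tlift ?U (\<lambda>X b. assoc_inner lq b X)"
    by (simp add: hassoc_def Let_def)
  show ?thesis
    using v unfolding hassoc
  proof (induction v rule: W_span_induct)
    case (add v w)
    then show ?case
      by (simp add: coact_add lq coact_closed D.tlift_add R.tlift_add A.tlift_add R.tlift_closed)
  next
    case (word f I)
    let ?S = "{J. length J = length I}"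
    let ?b = "\<lambda>J. mu_r ?F f \<otimes>\<^bsub>?F\<^esub> tword lq J I"
    have hcl: "?h x y \<in> carrier ?U" for x y by (simp add: hpure_def)
    have "tlift ?U (\<lambda>w a. ?h w (F_comult lq a)) (coact lq (f \<odot>\<^bsub>?W\<^esub> wword lq I)) =
        (\<Oplus>\<^bsub>?U\<^esub>J\<in>?S. tlift ?U (\<lambda>w a. ?h w (F_comult lq a)) (hpure ?W ?F (wword lq J) (?b J)))"
      unfolding coact_smult_wword[OF lq] by (rule D.tlift_finsum[OF finite_words]) simp
    also have "\<dots> = (\<Oplus>\<^bsub>?U\<^esub>J\<in>?S. \<Oplus>\<^bsub>?U\<^esub>K\<in>?S. ?h (wword lq J) (?p (tword lq J K) (?b K)))"
    proof (intro WFF.finsum_cong' refl)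
      show "(\<lambda>J. \<Oplus>\<^bsub>?U\<^esub>K\<in>?S. ?h (wword lq J) (?p (tword lq J K) (?b K))) \<in> ?S \<rightarrow> carrier ?U"
        by (auto intro!: WFF.finsum_closed hcl)
      fix J :: "'n list" assume "J \<in> ?S"
      then have J: "length J = length I" by simp
      have "F_comult lq (?b J) = mu_r ?FF f \<otimes>\<^bsub>?FF\<^esub> (\<Oplus>\<^bsub>?FF\<^esub>K\<in>?S. ?p (tword lq J K) (tword lq K I))"
        by (simp add: F_comult_mult F_comult_elems comult_tword[OF J])
      also have "\<dots> = (\<Oplus>\<^bsub>?FF\<^esub>K\<in>?S. mu_r ?FF f \<otimes>\<^bsub>?FF\<^esub> ?p (tword lq J K) (tword lq K I))"
        by (rule FF.finsum_rdistr) (auto simp: finite_words FF_mu)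
      also have "\<dots> = (\<Oplus>\<^bsub>?FF\<^esub>K\<in>?S. ?p (tword lq J K) (?b K))"
        by (intro FF.finsum_cong' refl) (auto simp: J apure_mu_r[OF tword_bigrade tword_bigrade])
      finally have "F_comult lq (?b J) = (\<Oplus>\<^bsub>?FF\<^esub>K\<in>?S. ?p (tword lq J K) (?b K))" .
      moreover have "?h (wword lq J) (\<Oplus>\<^bsub>?FF\<^esub>K\<in>?S. ?p (tword lq J K) (?b K)) =
          (\<Oplus>\<^bsub>?U\<^esub>K\<in>?S. ?h (wword lq J) (?p (tword lq J K) (?b K)))"
        by (rule hpure_FF_finsum[OF wword_grade finite_words])
           (use J in \<open>auto intro!: apure_bigrade[OF tword_bigrade mu_tword_bigrade]\<close>)
      moreover have "tlift ?U (\<lambda>w a. ?h w (F_comult lq a)) (hpure ?W ?F (wword lq J) (?b J)) = ?h (wword lq J) (F_comult lq (?b J))"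
        using D.tlift_pure[OF hcomps_pairs[OF wword_grade mu_tword_bigrade[OF J]]] by (simp add: hpure_def)
      ultimately show "tlift ?U (\<lambda>w a. ?h w (F_comult lq a)) (hpure ?W ?F (wword lq J) (?b J)) =
          (\<Oplus>\<^bsub>?U\<^esub>K\<in>?S. ?h (wword lq J) (?p (tword lq J K) (?b K)))" by simp
    qed
    \<comment> \<open>\<open>K\<close> becomes the outer index, as it is when the coaction is
      applied a second time.\<close>
    also have "\<dots> = (\<Oplus>\<^bsub>?U\<^esub>K\<in>?S. \<Oplus>\<^bsub>?U\<^esub>J\<in>?S. ?h (wword lq J) (?p (tword lq J K) (?b K)))"
      by (rule WFF.finsum_swap[OF finite_words finite_words hcl])
    also have "\<dots> = (\<Oplus>\<^bsub>?U\<^esub>K\<in>?S. tlift ?U (\<lambda>X b. assoc_inner lq b X) (hpure ?T ?F (coact lq (wword lq K)) (?b K)))"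
    proof (intro WFF.finsum_cong' refl)
      show "(\<lambda>K. tlift ?U (\<lambda>X b. assoc_inner lq b X) (hpure ?T ?F (coact lq (wword lq K)) (?b K))) \<in> ?S \<rightarrow> carrier ?U"
        by (intro funcsetI A.tlift_closed) (simp add: hpure_def)
      fix K :: "'n list" assume "K \<in> ?S"
      then have K: "length K = length I" by simp
      interpret L: tensor_lift ?W "l_module ?F" "hcomps ?W ?F" ?T ?U "\<lambda>v a. ?h v (?p a (?b K))"
        by (rule tensor_lift_inner[OF mu_tword_bigrade[OF K]])
      have "tlift ?U (\<lambda>X b. assoc_inner lq b X) (hpure ?T ?F (coact lq (wword lq K)) (?b K)) = assoc_inner lq (?b K) (coact lq (wword lq K))"
        using A.tlift_pure[OF hcomps_pairs[OF coact_grade[OF lq wword_grade] mu_tword_bigrade[OF K]]]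
        by (simp add: hpure_def)
      also have "\<dots> = (\<Oplus>\<^bsub>?U\<^esub>J\<in>{J. length J = length K}. assoc_inner lq (?b K) (hpure ?W ?F (wword lq J) (tword lq J K)))"
        unfolding coact_wword[OF lq] by (rule L.tlift_finsum[OF finite_words]) simp
      also have "\<dots> = (\<Oplus>\<^bsub>?U\<^esub>J\<in>?S. ?h (wword lq J) (?p (tword lq J K) (?b K)))"
        by (intro WFF.finsum_cong')
           (auto simp: K hcl assoc_inner_pure[OF mu_tword_bigrade[OF K] wword_grade tword_bigrade])
      finally show "(\<Oplus>\<^bsub>?U\<^esub>J\<in>?S. ?h (wword lq J) (?p (tword lq J K) (?b K))) =
        tlift ?U (\<lambda>X b. assoc_inner lq b X) (hpure ?T ?F (coact lq (wword lq K)) (?b K))" by simp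
    qed
    also have "\<dots> = tlift ?U (\<lambda>X b. assoc_inner lq b X)
        (\<Oplus>\<^bsub>hten ?T ?F\<^esub>K\<in>?S. hpure ?T ?F (coact lq (wword lq K)) (?b K))"
      by (rule A.tlift_finsum[OF finite_words, symmetric]) (simp add: hpure_def)
    also have "(\<Oplus>\<^bsub>hten ?T ?F\<^esub>K\<in>?S. hpure ?T ?F (coact lq (wword lq K)) (?b K)) =
        (\<Oplus>\<^bsub>hten ?T ?F\<^esub>K\<in>?S. tlift (hten ?T ?F) (\<lambda>w a. hpure ?T ?F (coact lq w) a) (hpure ?W ?F (wword lq K) (?b K)))"
    proof (intro WF_F.finsum_cong' refl)
      show "(\<lambda>K. tlift (hten ?T ?F) (\<lambda>w a. hpure ?T ?F (coact lq w) a) (hpure ?W ?F (wword lq K) (?b K))) \<in> ?S \<rightarrow> carrier (hten ?T ?F)"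
        by (intro funcsetI R.tlift_closed) simp
      fix K :: "'n list" assume "K \<in> ?S"
      then have K: "length K = length I" by simp
      show "hpure ?T ?F (coact lq (wword lq K)) (?b K) =
          tlift (hten ?T ?F) (\<lambda>w a. hpure ?T ?F (coact lq w) a) (hpure ?W ?F (wword lq K) (?b K))"
        using R.tlift_pure[OF hcomps_pairs[OF wword_grade mu_tword_bigrade[OF K]]] by (simp add: hpure_def)
    qed
    also have "\<dots> = tlift (hten ?T ?F) (\<lambda>w a. hpure ?T ?F (coact lq w) a) (coact lq (f \<odot>\<^bsub>?W\<^esub> wword lq I))"
      unfolding coact_smult_wword[OF lq] by (rule R.tlift_finsum[OF finite_words, symmetric]) simp
    finally show ?case .
  qed
qed

lemma coact_counital:
  fixes lq :: complex and v :: "'n::{finite,linorder} Wgen falg set"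
  assumes lq: "lq \<noteq> 0" and v: "v \<in> carrier (W_alg lq)"
  shows "hunit (W_alg lq) (tlift (hten (W_alg lq) D_alg) (\<lambda>w a. hpure (W_alg lq) D_alg w (F_counit a)) (coact lq v)) = v"
proof -
  let ?W = "W_alg lq :: ('n, _) hspace" and ?F = "F_alg lq :: ('n, _) halg"
  interpret E: tensor_lift ?W "l_module ?F" "hcomps ?W ?F" "hten ?W ?F" "hten ?W D_alg" "\<lambda>w a. hpure ?W D_alg w (F_counit a)"
    by (rule tensor_lift_id_counit)
  interpret H: tensor_lift ?W "l_module D_alg" "hcomps ?W D_alg" "hten ?W D_alg" ?W "\<lambda>v d. d 1 \<odot>\<^bsub>?W\<^esub> v"
    by (rule tensor_lift_hunit)
  show ?thesis
    using v unfolding hunit_def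
  proof (induction v rule: W_span_induct)
    case (add v w)
    then show ?case by (simp add: coact_add lq coact_closed E.tlift_add H.tlift_add E.tlift_closed)
  next
    case (word f I)
    let ?S = "{J. length J = length I}"
    let ?b = "\<lambda>J. mu_r ?F f \<otimes>\<^bsub>?F\<^esub> tword lq J I"
    let ?H = "tlift ?W (\<lambda>v d. d 1 \<odot>\<^bsub>?W\<^esub> v)" and ?E = "tlift (hten ?W D_alg) (\<lambda>w a. hpure ?W D_alg w (F_counit a))"
    have "?H (?E (coact lq (f \<odot>\<^bsub>?W\<^esub> wword lq I))) = ?H (\<Oplus>\<^bsub>hten ?W D_alg\<^esub>J\<in>?S. ?E (hpure ?W ?F (wword lq J) (?b J)))"
      unfolding coact_smult_wword[OF lq] by (subst E.tlift_finsum[OF finite_words]) simp_all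
    also have "\<dots> = (\<Oplus>\<^bsub>?W\<^esub>J\<in>?S. ?H (?E (hpure ?W ?F (wword lq J) (?b J))))"
      by (rule H.tlift_finsum[OF finite_words]) (simp add: E.tlift_closed)
    also have "\<dots> = (\<Oplus>\<^bsub>?W\<^esub>J\<in>?S. if I = J then f \<odot>\<^bsub>?W\<^esub> wword lq J else \<zero>\<^bsub>?W\<^esub>)"
    proof (intro W_pres.finsum_cong' refl)
      fix J :: "'n list" assume "J \<in> ?S"
      then have J: "length J = length I" by simp
      have "?E (hpure ?W ?F (wword lq J) (?b J)) = hpure ?W D_alg (wword lq J) (F_counit (?b J))"
        using E.tlift_pure[OF hcomps_pairs[OF wword_grade mu_tword_bigrade[OF J]]] by (simp add: hpure_def)
      moreover have "?H (hpure ?W D_alg (wword lq J) (F_counit (?b J))) = F_counit (?b J) 1 \<odot>\<^bsub>?W\<^esub> wword lq J"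
        using H.tlift_pure[OF hcomps_pairs[OF wword_grade F_counit_bigrade[OF mu_tword_bigrade[OF J]]]] by (simp add: hpure_def)
      \<comment> \<open>For \<open>J = I\<close> the operator is \<open>f\<close> times a shift, and
        a shift fixes the constant function 1; otherwise the operator is zero.\<close>
      moreover have "F_counit (?b J) 1 = (if I = J then f else 0)"
        by (auto simp: F_counit_mult F_counit_elems counit_tword[OF J])
      moreover have "0 \<odot>\<^bsub>?W\<^esub> wword lq J = \<zero>\<^bsub>?W\<^esub>"
        by (simp add: smult_W W_moment_zero)
      ultimately show "?H (?E (hpure ?W ?F (wword lq J) (?b J))) = (if I = J then f \<odot>\<^bsub>?W\<^esub> wword lq J else \<zero>\<^bsub>?W\<^esub>)" by simp
    qed auto
    also have "\<dots> = f \<odot>\<^bsub>?W\<^esub> wword lq I"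
      by (subst W_pres.add.finprod_singleton) (auto simp: finite_words)
    finally show ?case .
  qed
qed

lemma coact_comodule_algebra:
  fixes lq :: complex
  assumes lq: "lq \<noteq> 0"
  shows "right_comodule_algebra (F_alg lq) (F_comult lq) F_counit (W_alg lq :: ('n::{finite,linorder}, _) hspace) (coact lq)"
proof -
  let ?W = "W_alg lq :: ('n, _) hspace" and ?F = "F_alg lq :: ('n, _) halg"
  have "coact lq ` grade ?W \<alpha> \<subseteq> grade (hten ?W ?F) \<alpha>" for \<alpha>
    using coact_grade[OF lq] by (rule image_subsetI)
  then have "coact lq \<in> hspace_hom ?W (hten ?W ?F)"
    unfolding hspace_hom_def by (simp add: coact_closed lq coact_add coact_smult)
  moreover have "coact lq \<in> ring_hom ?W (hten ?W ?F)"
    by (rule ring_hom_memI) (simp_all add: coact_closed lq coact_add coact_mult coact_gens)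
  moreover have "f \<odot>\<^bsub>?W\<^esub> (v \<otimes>\<^bsub>?W\<^esub> w) = (f \<odot>\<^bsub>?W\<^esub> v) \<otimes>\<^bsub>?W\<^esub> w \<and>
      (f \<odot>\<^bsub>?W\<^esub> v) \<otimes>\<^bsub>?W\<^esub> w = v \<otimes>\<^bsub>?W\<^esub> (T_shift \<alpha> f \<odot>\<^bsub>?W\<^esub> w)"
    if vw: "v \<in> grade ?W \<alpha>" "w \<in> carrier ?W" for f \<alpha> v w
  proof -
    have v: "v \<in> carrier ?W" by (rule grade_W_closed[OF vw(1)])
    have "f \<odot>\<^bsub>?W\<^esub> (v \<otimes>\<^bsub>?W\<^esub> w) = (f \<odot>\<^bsub>?W\<^esub> v) \<otimes>\<^bsub>?W\<^esub> w"
      using v vw(2) by (simp add: smult_W W_pres.m_assoc)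
    moreover have "(f \<odot>\<^bsub>?W\<^esub> v) \<otimes>\<^bsub>?W\<^esub> w = v \<otimes>\<^bsub>?W\<^esub> (T_shift \<alpha> f \<odot>\<^bsub>?W\<^esub> w)"
      using v vw(2) by (simp add: smult_W W_moment_shift[OF vw(1)] W_pres.m_assoc)
    ultimately show ?thesis by simp
  qed
  ultimately show ?thesis
    unfolding right_comodule_algebra_def right_corepresentation_def
    by (simp add: h_space_W coact_coassociative[OF lq] coact_counital[OF lq] W_pres.ring_A grade_W_props(4))
qed

text \<open>Multiplicativity and the unit determine \<open>R\<close> on words in the w_i, and
  linearity over functions extends this to the additive generators f w_I.\<close>

lemma coact_unique:
  assumes lq: "lq \<noteq> 0"
    and R: "\<And>i. R (w_elt lq i) = (\<Oplus>\<^bsub>WF_ten lq\<^esub>j\<in>UNIV. hpure_W lq (w_elt lq j) (t_elt lq j i))"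
    and hom: "R \<in> hspace_hom (W_alg lq) (WF_ten lq)" "R \<in> ring_hom (W_alg lq) (WF_ten lq)"
    and v: "v \<in> carrier (W_alg lq)"
  shows "R v = coact lq v"
proof -
  have word: "R (wword lq I) = coact lq (wword lq I)" for I
    by (induction I) (simp_all add: ring_hom_one[OF hom(2)] ring_hom_mult[OF hom(2)] coact_gens lq coact_mult coact_w R)
  have smult: "R (f \<odot>\<^bsub>W_alg lq\<^esub> v) = f \<odot>\<^bsub>WF_ten lq\<^esub> R v" if "v \<in> carrier (W_alg lq)" for f v
    using hom(1) that unfolding hspace_hom_def by blast
  show ?thesis
    using v by (induction v rule: W_span_induct) (simp_all add: ring_hom_add[OF hom(2)] coact_add lq coact_smult word smult)
qed

theorem proposition3p7:
  fixes q lq :: complex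
  assumes "q \<noteq> 0" and "exp lq = q" and "\<forall>m::nat. m > 0 \<longrightarrow> q ^ m \<noteq> 1"
  shows "let W = (W_alg lq :: ('n::{finite,linorder}, 'n Wgen falg set) hspace);
             F = (F_alg lq :: ('n, 'n Fgen falg set) halg)
         in \<exists>!R. R \<in> carrier W \<rightarrow>\<^sub>E carrier (hten W F) \<and>
              R \<one>\<^bsub>W\<^esub> = hpure W F \<one>\<^bsub>W\<^esub> \<one>\<^bsub>F\<^esub> \<and>
              (\<forall>i. R (w_elt lq i) =
                 (\<Oplus>\<^bsub>hten W F\<^esub>j\<in>UNIV. hpure W F (w_elt lq j) (t_elt lq j i))) \<and>
              right_comodule_algebra F (F_comult lq) F_counit W R"
proof -
  \<comment> \<open>The case \<open>m = 1\<close> says that q differs from 1, hence its logarithm is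
    nonzero; this keeps the denominators of g and h from vanishing identically.\<close>
  have lq: "lq \<noteq> 0" using assms(2) assms(3)[rule_format, of 1] by auto
  let ?W = "W_alg lq :: ('n, 'n Wgen falg set) hspace" and ?F = "F_alg lq :: ('n, 'n Fgen falg set) halg"
  let ?P = "\<lambda>R. R \<in> carrier ?W \<rightarrow>\<^sub>E carrier (hten ?W ?F) \<and>
              R \<one>\<^bsub>?W\<^esub> = hpure ?W ?F \<one>\<^bsub>?W\<^esub> \<one>\<^bsub>?F\<^esub> \<and>
              (\<forall>i. R (w_elt lq i) =
                 (\<Oplus>\<^bsub>hten ?W ?F\<^esub>j\<in>UNIV. hpure ?W ?F (w_elt lq j) (t_elt lq j i))) \<and>
              right_comodule_algebra ?F (F_comult lq) F_counit ?W R"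
  have "?P (coact lq)"
  proof (intro conjI allI)
    show "coact lq \<in> carrier ?W \<rightarrow>\<^sub>E carrier (hten ?W ?F)"
    proof (rule PiE_I)
      show "coact lq v \<in> carrier (hten ?W ?F)" if "v \<in> carrier ?W" for v
        by (rule coact_closed[OF lq that])
      show "coact lq v = undefined" if "v \<notin> carrier ?W" for v
        using that by (simp add: coact_def)
    qed
  qed (simp_all add: coact_gens coact_w lq hpure_one coact_comodule_algebra)
  moreover have "R = coact lq" if R: "?P R" for R
  proof (rule PiE_ext)
    show "R \<in> carrier ?W \<rightarrow>\<^sub>E carrier (hten ?W ?F)" using R by blast
    show "coact lq \<in> carrier ?W \<rightarrow>\<^sub>E carrier (hten ?W ?F)" using \<open>?P (coact lq)\<close> by blast
    fix v assume v: "v \<in> carrier ?W"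
    show "R v = coact lq v"
    proof (rule coact_unique[OF lq _ _ _ v])
      show "R (w_elt lq i) = (\<Oplus>\<^bsub>hten ?W ?F\<^esub>j\<in>UNIV. hpure ?W ?F (w_elt lq j) (t_elt lq j i))" for i
        using R by blast
    qed (use R in \<open>auto simp: right_comodule_algebra_def right_corepresentation_def\<close>)
  qed
  ultimately have "\<exists>!R. ?P R" by (rule ex1I)
  then show ?thesis by (simp only: Let_def)
qed

end
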